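(* Let $R=K[x_1,\dots,x_n]$ be a polynomial ring over a field $K$, and let $I\subset R$ be a symmetric strongly shifted ideal with exactly one partition Borel generator. Then the toric ideal of $I$ is generated by quadratic polynomials, namely by the symmetric exchange relations. Moreover, the toric ring of $I$ is a Cohen–Macaulay normal domain, which has rational singularities if $K$ has characteristic zero and is $F$-rational if $K$ has positive characteristic.
   Context: $\mathfrak S_n$ acts on $R$ by permuting variables. $P_n=\{\lambda\in\mathbb Z^n: 0\le\lambda_1\le\cdots\le\lambda_n\}$, $x^\lambda=x_1^{\lambda_1}\cdots x_n^{\lambda_n}$. For an $\mathfrak S_n$-fixed monomial ideal $I$ put $P(I)=\{\lambda\in P_n: x^\lambda\in I\}$. An $\mathfrak S_n$-fixed monomial ideal $I$ is symmetric strongly shifted if for every $\lambda\in P(I)$ and $1\le i<j\le n$ with $\lambda_i<\lambda_j$ one has $x^\lambda x_i/x_j\in I$. For $B\subseteq P_n$, $\mathrm{Sss}(B)$ is the smallest symmetric strongly shifted ideal containing $\{x^\lambda:\lambda\in B\}$; the set of partition Borel generators of $I$ is the smallest $B\subseteq P_n$ with $I=\mathrm{Sss}(B)$. So the hypothesis says $I=\mathrm{Sss}(\{\lambda\})$ for some $\lambda\in P_n$ (such $I$ is generated in a single degree). All ideals considered are proper. $G(I)$ denotes the set of minimal monomial generators of $I$. The toric ring of $I$ is the subring $K[G(I)]=K[m: m\in G(I)]\subseteq R$, and the toric ideal of $I$ is the kernel of the surjective $K$-algebra map $K[T_m: m\in G(I)]\to K[G(I)]$, $T_m\mapsto m$.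 Writing $\deg_i(m)$ for the exponent of $x_i$ in a monomial $m$, the symmetric exchange relations are the binomials $T_rT_s-T_tT_w$ with $r,s,t,w\in G(I)$ for which there are indices $i,j$ with $\deg_i(r)>\deg_i(s)$, $\deg_j(r)<\deg_j(s)$, $t=rx_j/x_i$ and $w=sx_i/x_j$. *)

theory Defs
  imports
    "HOL-Algebra.Algebra"
    "HOL-Algebra.Algebraic_Closure_Type"
    "HOL-Computational_Algebra.Computational_Algebra"
    "HOL-Library.Poly_Mapping"
    "HOL-Library.Extended_Nat"
begin

section \<open>Commutative algebra\<close>

subsection \<open>Local rings\<close>

definition local_ring :: "('a, 'b) ring_scheme \<Rightarrow> bool" where
  "local_ring R \<longleftrightarrow> cring R \<and> (\<exists>!M. maximalideal M R)"

text \<open>For a local ring this is its maximal ideal.\<close>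

definition nonunits :: "('a, 'b) ring_scheme \<Rightarrow> 'a set" where
  "nonunits R = carrier R - Units R"

definition krull_dim :: "('a, 'b) ring_scheme \<Rightarrow> enat" where
  "krull_dim R = Sup {enat n | n. \<exists>P :: nat \<Rightarrow> 'a set.
     (\<forall>i\<le>n. primeideal (P i) R) \<and> (\<forall>i<n. P i \<subset> P (Suc i))}"

definition regular_sequence :: "('a, 'b) ring_scheme \<Rightarrow> 'a list \<Rightarrow> bool" where
  "regular_sequence R xs \<longleftrightarrow>
     set xs \<subseteq> carrier R \<and> Idl\<^bsub>R\<^esub> (set xs) \<noteq> carrier R \<and>
     (\<forall>i<length xs. \<forall>a\<in>carrier R.
        (xs ! i) \<otimes>\<^bsub>R\<^esub> a \<in> Idl\<^bsub>R\<^esub> (set (take i xs)) \<longrightarrow> a \<in> Idl\<^bsub>R\<^esub> (set (take i xs)))"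

definition local_depth :: "('a, 'b) ring_scheme \<Rightarrow> enat" where
  "local_depth R = Sup {enat (length xs) | xs. set xs \<subseteq> nonunits R \<and> regular_sequence R xs}"

definition cohen_macaulay_local :: "('a, 'b) ring_scheme \<Rightarrow> bool" where
  "cohen_macaulay_local R \<longleftrightarrow>
     local_ring R \<and> noetherian_ring R \<and> local_depth R = krull_dim R"

definition regular_local :: "('a, 'b) ring_scheme \<Rightarrow> bool" where
  "regular_local R \<longleftrightarrow> local_ring R \<and> noetherian_ring R \<and>
     (\<exists>S \<subseteq> carrier R. finite S \<and> Idl\<^bsub>R\<^esub> S = nonunits R \<and> enat (card S) = krull_dim R)"

text \<open>In a Noetherian local ring, a sequence of length the dimension generates an ideal primary
  to the maximal ideal iff the maximal ideal is the only prime ideal containing it.\<close>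

definition system_of_parameters :: "('a, 'b) ring_scheme \<Rightarrow> 'a list \<Rightarrow> bool" where
  "system_of_parameters R xs \<longleftrightarrow>
     set xs \<subseteq> nonunits R \<and> enat (length xs) = krull_dim R \<and>
     (\<forall>P. primeideal P R \<and> set xs \<subseteq> P \<longrightarrow> P = nonunits R)"


subsection \<open>Domains as subrings of a field\<close>

text \<open>Domains are given as subrings \<open>A\<close> of an ambient field (a type of class
  \<^class>\<open>field\<close>), so that the fraction field of \<open>A\<close>, its localizations, and all rings between
  \<open>A\<close> and its fraction field are again subsets of this type.\<close>

definition ring_on :: "'a :: comm_ring_1 set \<Rightarrow> 'a ring" where
  "ring_on A = ring_of_type_algebra\<lparr>carrier := A\<rparr>"

definition adjoin :: "'a :: comm_ring_1 set \<Rightarrow> 'a set \<Rightarrow> 'a set" where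
  "adjoin A S = generate_ring ring_of_type_algebra (A \<union> S)"

definition frac_field :: "'f :: field set \<Rightarrow> 'f set" where
  "frac_field A = {a / b | a b. a \<in> A \<and> b \<in> A \<and> b \<noteq> 0}"

definition localize :: "'f :: field set \<Rightarrow> 'f set \<Rightarrow> 'f set" where
  "localize A P = {a / b | a b. a \<in> A \<and> b \<in> A - P}"

definition cohen_macaulay :: "'f :: field set \<Rightarrow> bool" where
  "cohen_macaulay A \<longleftrightarrow> noetherian_ring (ring_on A) \<and>
     (\<forall>M. maximalideal M (ring_on A) \<longrightarrow> cohen_macaulay_local (ring_on (localize A M)))"

definition integral_over :: "'f :: field set \<Rightarrow> 'f \<Rightarrow> bool" where
  "integral_over A z \<longleftrightarrow>
     (\<exists>p :: 'f poly. lead_coeff p = 1 \<and> (\<forall>i. coeff p i \<in> A) \<and> poly p z = 0)"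

definition normal_domain :: "'f :: field set \<Rightarrow> bool" where
  "normal_domain A \<longleftrightarrow> domain (ring_on A) \<and> (\<forall>z\<in>frac_field A. integral_over A z \<longrightarrow> z \<in> A)"


subsection \<open>F-rational domains\<close>

definition frobenius_power :: "'f :: field set \<Rightarrow> 'f set \<Rightarrow> nat \<Rightarrow> 'f set" where
  "frobenius_power A J q = Idl\<^bsub>ring_on A\<^esub> ((\<lambda>a. a ^ q) ` J)"

text \<open>The multiplier \<open>c\<close> ranges over the complement of the minimal primes, that is, over the
  nonzero elements of the domain \<open>A\<close>.\<close>

definition tight_closure :: "'f :: field set \<Rightarrow> 'f set \<Rightarrow> 'f set" where
  "tight_closure A J = {a \<in> A. \<exists>c\<in>A. c \<noteq> 0 \<and>
     (\<exists>N. \<forall>e\<ge>N. c * a ^ (CHAR('f) ^ e) \<in> frobenius_power A J (CHAR('f) ^ e))}"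

text \<open>Elements of \<open>A\<close> are parameters if they form part of a system of parameters in the
  localization at each prime ideal containing them.\<close>

definition parameters :: "'f :: field set \<Rightarrow> 'f list \<Rightarrow> bool" where
  "parameters A xs \<longleftrightarrow> set xs \<subseteq> A \<and>
     (\<forall>P. primeideal P (ring_on A) \<and> set xs \<subseteq> P \<longrightarrow>
        (\<exists>ys. system_of_parameters (ring_on (localize A P)) (xs @ ys)))"

definition F_rational :: "'f :: field set \<Rightarrow> bool" where
  "F_rational A \<longleftrightarrow> domain (ring_on A) \<and> noetherian_ring (ring_on A) \<and>
     (\<forall>xs. parameters A xs \<longrightarrow>
        tight_closure A (Idl\<^bsub>ring_on A\<^esub> (set xs)) = Idl\<^bsub>ring_on A\<^esub> (set xs))"


subsection \<open>Rational singularities\<close>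

text \<open>An integral scheme \<open>Y\<close> with a proper birational morphism to the spectrum of a Noetherian
  domain \<open>A\<close> is a complete model in the sense of Zariski. It is given by finitely many affine
  charts, whose coordinate rings \<open>B 0, \<dots>, B (r - 1)\<close> are finitely generated extensions of
  \<open>A\<close> inside the fraction field. The points of \<open>Y\<close> are the local rings of the charts. By the
  valuative criteria, \<open>Y\<close> is separated and proper over \<open>A\<close> iff every valuation ring of the
  fraction field that contains \<open>A\<close> dominates exactly one of these local rings.\<close>

definition valuation_ring_of :: "'f :: field set \<Rightarrow> 'f set \<Rightarrow> bool" where
  "valuation_ring_of F V \<longleftrightarrow>
     subring V ring_of_type_algebra \<and> V \<subseteq> F \<and> (\<forall>x\<in>F. x \<in> V \<or> inverse x \<in> V)"

definition dominates :: "'f :: field set \<Rightarrow> 'f set \<Rightarrow> bool" where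
  "dominates V Q \<longleftrightarrow> Q \<subseteq> V \<and> nonunits (ring_on Q) \<subseteq> nonunits (ring_on V)"

definition local_rings :: "'f :: field set \<Rightarrow> 'f set set" where
  "local_rings B = {localize B P | P. primeideal P (ring_on B)}"

definition proper_birational_model :: "'f :: field set \<Rightarrow> nat \<Rightarrow> (nat \<Rightarrow> 'f set) \<Rightarrow> bool" where
  "proper_birational_model A r B \<longleftrightarrow>
     (\<forall>i<r. B i \<subseteq> frac_field A \<and> (\<exists>S. finite S \<and> B i = adjoin A S)) \<and>
     (\<forall>V. valuation_ring_of (frac_field A) V \<and> A \<subseteq> V \<longrightarrow>
        (\<exists>!Q. Q \<in> (\<Union>i<r. local_rings (B i)) \<and> dominates V Q))"

definition regular_model :: "nat \<Rightarrow> (nat \<Rightarrow> 'f :: field set) \<Rightarrow> bool" where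
  "regular_model r B \<longleftrightarrow> (\<forall>i<r. \<forall>Q\<in>local_rings (B i). regular_local (ring_on Q))"

text \<open>Cohomology of the structure sheaf of \<open>Y\<close> is computed by the Cech complex of the affine
  charts. As \<open>Y\<close> is separated, the intersection of the charts with indices in a nonempty set
  \<open>\<sigma>\<close> is affine, and its coordinate ring is generated by the rings \<open>B i\<close> with \<open>i \<in> \<sigma>\<close>.
  All these rings lie in one field, so the restriction maps are inclusions.\<close>

definition cech_simplices :: "nat \<Rightarrow> nat \<Rightarrow> nat set set" where
  "cech_simplices r p = {\<sigma>. \<sigma> \<subseteq> {..<r} \<and> card \<sigma> = Suc p}"

definition cech_cochain :: "nat \<Rightarrow> (nat \<Rightarrow> 'f :: field set) \<Rightarrow> nat \<Rightarrow> (nat set \<Rightarrow> 'f) \<Rightarrow> bool" where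
  "cech_cochain r B p c \<longleftrightarrow>
     (\<forall>\<sigma>\<in>cech_simplices r p. c \<sigma> \<in> generate_ring ring_of_type_algebra (\<Union>i\<in>\<sigma>. B i))"

definition cech_coboundary :: "(nat set \<Rightarrow> 'f :: field) \<Rightarrow> nat set \<Rightarrow> 'f" where
  "cech_coboundary c \<sigma> = (\<Sum>i\<in>\<sigma>. (-1) ^ card {j\<in>\<sigma>. j < i} * c (\<sigma> - {i}))"

definition cech_cocycle :: "nat \<Rightarrow> (nat \<Rightarrow> 'f :: field set) \<Rightarrow> nat \<Rightarrow> (nat set \<Rightarrow> 'f) \<Rightarrow> bool" where
  "cech_cocycle r B p c \<longleftrightarrow> cech_cochain r B p c \<and>
     (\<forall>\<sigma>\<in>cech_simplices r (Suc p). cech_coboundary c \<sigma> = 0)"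

definition higher_cohomology_vanishes :: "nat \<Rightarrow> (nat \<Rightarrow> 'f :: field set) \<Rightarrow> bool" where
  "higher_cohomology_vanishes r B \<longleftrightarrow>
     (\<forall>p c. cech_cocycle r B (Suc p) c \<longrightarrow>
        (\<exists>b. cech_cochain r B p b \<and> (\<forall>\<sigma>\<in>cech_simplices r (Suc p). c \<sigma> = cech_coboundary b \<sigma>)))"

text \<open>Some resolution \<open>f : Y \<rightarrow> Spec A\<close> has \<open>f\<^sub>* O\<^sub>Y = O\<close> and vanishing higher direct images.
  Since the target is affine, this is a condition on the cohomology of the structure sheaf of
  \<open>Y\<close>; its global sections are the intersection of the rings \<open>B i\<close>. The notion is meant for
  algebras of finite type over a field of characteristic zero.\<close>

definition rational_singularities :: "'f :: field set \<Rightarrow> bool" where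
  "rational_singularities A \<longleftrightarrow>
     domain (ring_on A) \<and> noetherian_ring (ring_on A) \<and>
     (\<exists>r B. proper_birational_model A r B \<and> regular_model r B \<and>
        (\<Inter>i<r. B i) = A \<and> higher_cohomology_vanishes r B)"


section \<open>Symmetric strongly shifted ideals\<close>

text \<open>The polynomial ring over \<open>'k\<close> in variables indexed by \<open>'v\<close>; monomials are represented by
  their exponents. For a finite linearly ordered type \<open>'n\<close> with \<open>n\<close> elements, \<open>'n\<close> plays the
  role of \<open>{1, \<dots>, n}\<close>.\<close>

type_synonym ('v, 'k) mpoly = "('v \<Rightarrow>\<^sub>0 nat) \<Rightarrow>\<^sub>0 'k"

definition monom_of :: "('v \<Rightarrow>\<^sub>0 nat) \<Rightarrow> ('v, 'k :: comm_ring_1) mpoly" where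
  "monom_of \<mu> = Poly_Mapping.single \<mu> 1"

definition const_of :: "'k \<Rightarrow> ('v, 'k :: comm_ring_1) mpoly" where
  "const_of c = Poly_Mapping.single 0 c"

abbreviation unit_exp :: "'v \<Rightarrow> ('v \<Rightarrow>\<^sub>0 nat)" where
  "unit_exp i \<equiv> Poly_Mapping.single i 1"

text \<open>For a permutation \<open>\<pi>\<close>, this is the substitution \<open>x\<^sub>i \<mapsto> x\<^bsub>\<pi> i\<^esub>\<close>: the coefficient of \<open>x\<^sup>\<mu>\<close> in
  the result is that of \<open>x\<^bsup>\<mu> \<circ> \<pi>\<^esup>\<close> in \<open>f\<close>.\<close>

definition permute_vars :: "('v \<Rightarrow> 'v) \<Rightarrow> ('v, 'k :: comm_ring_1) mpoly \<Rightarrow> ('v, 'k) mpoly" where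
  "permute_vars \<pi> f = Poly_Mapping.map_key (Poly_Mapping.map_key \<pi>) f"

definition monomial_ideal :: "('v, 'k :: comm_ring_1) mpoly set \<Rightarrow> bool" where
  "monomial_ideal I \<longleftrightarrow> (\<exists>S. I = Idl\<^bsub>ring_of_type_algebra\<^esub> (monom_of ` S))"

definition symmetric_fixed :: "('v, 'k :: comm_ring_1) mpoly set \<Rightarrow> bool" where
  "symmetric_fixed I \<longleftrightarrow> (\<forall>\<pi>. bij \<pi> \<longrightarrow> permute_vars \<pi> ` I = I)"

definition partitions :: "('n :: linorder \<Rightarrow>\<^sub>0 nat) set" where
  "partitions = {\<mu>. mono (Poly_Mapping.lookup \<mu>)}"

definition ideal_partitions :: "('n :: linorder, 'k :: comm_ring_1) mpoly set \<Rightarrow> ('n \<Rightarrow>\<^sub>0 nat) set" where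
  "ideal_partitions I = {\<mu> \<in> partitions. monom_of \<mu> \<in> I}"

definition symmetric_strongly_shifted ::
    "('n :: {finite, linorder}, 'k :: comm_ring_1) mpoly set \<Rightarrow> bool" where
  "symmetric_strongly_shifted I \<longleftrightarrow> monomial_ideal I \<and> symmetric_fixed I \<and>
     (\<forall>\<mu>\<in>ideal_partitions I. \<forall>i j. i < j \<and> Poly_Mapping.lookup \<mu> i < Poly_Mapping.lookup \<mu> j \<longrightarrow>
        monom_of (\<mu> + unit_exp i - unit_exp j) \<in> I)"

definition Sss ::
    "('n :: {finite, linorder} \<Rightarrow>\<^sub>0 nat) set \<Rightarrow> ('n, 'k :: comm_ring_1) mpoly set" where
  "Sss B = \<Inter>{J. symmetric_strongly_shifted J \<and> monom_of ` B \<subseteq> J}"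

definition is_partition_Borel_generators ::
    "('n :: {finite, linorder}, 'k :: comm_ring_1) mpoly set \<Rightarrow> ('n \<Rightarrow>\<^sub>0 nat) set \<Rightarrow> bool" where
  "is_partition_Borel_generators I B \<longleftrightarrow> B \<subseteq> partitions \<and> I = Sss B \<and>
     (\<forall>B'. B' \<subseteq> partitions \<and> I = Sss B' \<longrightarrow> B \<subseteq> B')"


section \<open>Toric rings and toric ideals\<close>

definition min_gens :: "('v, 'k :: comm_ring_1) mpoly set \<Rightarrow> ('v \<Rightarrow>\<^sub>0 nat) set" where
  "min_gens I = {\<mu>. monom_of \<mu> \<in> I \<and>
     (\<forall>\<nu>. monom_of \<nu> \<in> I \<and> (monom_of \<nu> :: ('v, 'k) mpoly) dvd monom_of \<mu> \<longrightarrow> \<nu> = \<mu>)}"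

definition toric_ring :: "('v, 'k :: comm_ring_1) mpoly set \<Rightarrow> ('v, 'k) mpoly set" where
  "toric_ring I = adjoin (range const_of) (monom_of ` min_gens I)"

text \<open>\<open>T_var m\<close> is the variable indexed by the minimal generator with exponent \<open>m\<close>.\<close>

definition T_var :: "('v \<Rightarrow>\<^sub>0 nat) \<Rightarrow> ('v \<Rightarrow>\<^sub>0 nat, 'k :: comm_ring_1) mpoly" where
  "T_var m = monom_of (unit_exp m)"

definition toric_poly_ring ::
    "('v, 'k :: comm_ring_1) mpoly set \<Rightarrow> ('v \<Rightarrow>\<^sub>0 nat, 'k) mpoly ring" where
  "toric_poly_ring I = ring_on (adjoin (range const_of) (T_var ` min_gens I))"

definition toric_map :: "('v \<Rightarrow>\<^sub>0 nat, 'k :: comm_ring_1) mpoly \<Rightarrow> ('v, 'k) mpoly" where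
  "toric_map f = (\<Sum>t\<in>Poly_Mapping.keys f. const_of (Poly_Mapping.lookup f t) *
     (\<Prod>m\<in>Poly_Mapping.keys t. monom_of m ^ Poly_Mapping.lookup t m))"

definition toric_ideal ::
    "('v, 'k :: comm_ring_1) mpoly set \<Rightarrow> ('v \<Rightarrow>\<^sub>0 nat, 'k) mpoly set" where
  "toric_ideal I = {f \<in> carrier (toric_poly_ring I). toric_map f = 0}"

definition symmetric_exchange_relations ::
    "('v, 'k :: comm_ring_1) mpoly set \<Rightarrow> ('v \<Rightarrow>\<^sub>0 nat, 'k) mpoly set" where
  "symmetric_exchange_relations I = {T_var r * T_var s - T_var t * T_var w | r s t w.
     {r, s, t, w} \<subseteq> min_gens I \<and>
     (\<exists>i j. Poly_Mapping.lookup r i > Poly_Mapping.lookup s i \<and>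
            Poly_Mapping.lookup r j < Poly_Mapping.lookup s j \<and>
            t + unit_exp i = r + unit_exp j \<and> w + unit_exp j = s + unit_exp i)}"

definition quadratic_form :: "('v, 'k :: comm_ring_1) mpoly \<Rightarrow> bool" where
  "quadratic_form f \<longleftrightarrow> (\<forall>t\<in>Poly_Mapping.keys f.
     (\<Sum>v\<in>Poly_Mapping.keys t. Poly_Mapping.lookup t v) = 2)"

text \<open>The toric ring as a subring of the field of rational functions.\<close>

definition toric_domain ::
    "('n :: {finite, linorder}, 'k :: field) mpoly set \<Rightarrow> ('n, 'k) mpoly fract set" where
  "toric_domain I = to_fract ` toric_ring I"

end

(*
The minimal generators of I are the integer points of the base polytope of lam: the exponents of
total degree |lam| whose partial sums over every k-element set of variables are bounded by the sum
of the k largest parts of lam. Multiples of this polytope have the integer decomposition property,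
so the toric ring is the ring of the saturated monoid S cut out by the corresponding facet
inequalities. Leading exponents thus that the ring is normal.

In characteristic p the coefficient maps at exponents of S congruent to a fixed one modulo p^e split
the Frobenius, so all ideals are tightly closed and the ring is F-rational. Sums of monomials over
the faces of equal height are parameters, and colon capturing with the splitting shows that the ring
is free over the polynomial ring in them. A basis of monomials over the field with two elements is
also a basis in characteristic zero, and freeness gives the Cohen-Macaulay property.

For the toric ideal, every factorization of a monomial into generators is moved by symmetric
exchanges, which decrease a quadratic energy, to a canonical sorted one.

For rational singularities in characteristic zero, the n! orders of the variables give smooth charts
of a toric resolution. A valuation ring of the fraction field contains the chart of an order sorted by
the valuation. In each degree the Cech complex is a relative cochain complex, contractible because
the excess of u is supermodular.
*)
theory Submission imports Defs "HOL-Library.Z2" "HOL-Library.Cardinality" begin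

text \<open>Dimensions are counted by \<open>indep\<close>, algebraic independence over a field
  modulo a prime: every step of a chain of primes yields one more independent element, and counting
  monomials in boxes bounds how many there can be. Colon capturing needs a Frobenius, so freeness
  over the parameters is first found in positive characteristic. The parameters have integer
  coefficients; independence of the products \<open>basis_elem\<close> is injectivity of an integer
  matrix, and this passes from two elements to characteristic zero, while spanning is recovered by
  comparing dimensions degree by degree. Geometrically, for nonconstant \<open>lam\<close> the
  resolution is the total space of a line bundle on the permutohedral variety: ratios of
  neighbouring variables are coordinates on the base, and the rearranged monomial of
  \<open>lam\<close> is the fibre coordinate. For constant \<open>lam\<close> the fraction field of
  the toric ring does not contain these ratios; the ring is then a polynomial ring in one variable
  and is its own resolution.\<close>

type_synonym 'v mon = "'v \<Rightarrow>\<^sub>0 nat"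
type_synonym ('v, 'k) mfrac = "('v, 'k) mpoly fract"

abbreviation (input) "lookup \<equiv> Poly_Mapping.lookup"
abbreviation (input) "keys \<equiv> Poly_Mapping.keys"
abbreviation (input) "single \<equiv> Poly_Mapping.single"

section \<open>Subrings and their ideals inside one ambient ring\<close>

definition is_subring :: "'a::comm_ring_1 set => bool" where
 "is_subring A \<longleftrightarrow> 1 : A & (ALL x:A. ALL y:A. x - y : A & x * y : A)"

text \<open>Ideals are sets relative to an explicit subring \<open>A\<close>, so that ideals of a
  ring, of its localizations and of its polynomial extensions can be intersected and compared inside
  one type.\<close>

definition is_ideal :: "'a::comm_ring_1 set => 'a set => bool" where
 "is_ideal A J \<longleftrightarrow> J <= A & 0 : J & (ALL x:J. ALL y:J. x + y : J) & (ALL a:A. ALL x:J. a * x : J)"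

definition is_prime :: "'a::comm_ring_1 set => 'a set => bool" where
 "is_prime A P \<longleftrightarrow> is_ideal A P & 1 ~: P & (ALL a:A. ALL b:A. a * b : P --> a : P | b : P)"

definition ideal_gen :: "'a::comm_ring_1 set => 'a set => 'a set" where
 "ideal_gen A S = \<Inter>{J. is_ideal A J & S <= J}"

lemma subring_1: "is_subring A ==> 1 : A" and subring_diff: "is_subring A ==> x : A ==> y : A ==> x - y : A"
 and subring_mult: "is_subring A ==> x : A ==> y : A ==> x * y : A" by(auto simp: is_subring_def)

lemma subring_0: "is_subring A ==> 0 : A" using subring_diff[of A 1 1] subring_1[of A] by simp

lemma subring_uminus: "is_subring A ==> x : A ==> - x : A" using subring_diff[of A 0 x] subring_0[of A] by simp

lemma subring_add: "is_subring A ==> x : A ==> y : A ==> x + y : A" using subring_diff[of A x "- y"] subring_uminus[of A y] by simp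

lemma subring_sum: "is_subring A ==> (!!x. x : S ==> f x : A) ==> sum f S : A"
 by(induction S rule: infinite_finite_induct) (auto intro: subring_0 subring_add)

lemma subring_prod: "is_subring A ==> (!!x. x : S ==> f x : A) ==> prod f S : A"
 by(induction S rule: infinite_finite_induct) (auto intro: subring_1 subring_mult)

lemma subring_power: "is_subring A ==> x : A ==> x ^ n : A" by(induction n) (auto intro: subring_1 subring_mult)

lemma subring_poly:
 "is_subring A ==> (!!i. coeff p i : A) ==> y : A ==> poly p y : A" unfolding poly_altdef by(intro subring_sum subring_mult subring_power)

lemma subring_UNIV: "is_subring UNIV" by(auto simp: is_subring_def)

lemmas subring_intros = subring_0 subring_1 subring_diff subring_mult subring_uminus subring_add
 subring_sum subring_prod subring_power

lemma ideal_subset: "is_ideal A J ==> x : J ==> x : A" and ideal_0: "is_ideal A J ==> 0 : J"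
 and ideal_add: "is_ideal A J ==> x : J ==> y : J ==> x + y : J" and ideal_mult: "is_ideal A J ==> a : A ==> x : J ==> a * x : J"
 by(auto simp: is_ideal_def)

lemma ideal_mult_right: "is_ideal A J ==> a : A ==> x : J ==> x * a : J" by(metis ideal_mult mult.commute)

lemma ideal_uminus: "is_subring A ==> is_ideal A J ==> x : J ==> - x : J"
 using ideal_mult[of A J "-1" x] subring_uminus[of A 1] subring_1[of A] by simp

lemma ideal_diff: "is_subring A ==> is_ideal A J ==> x : J ==> y : J ==> x - y : J" using ideal_add[of A J x "- y"] ideal_uminus[of A J y] by simp

lemma ideal_sum: "is_ideal A J ==> (!!x. x : S ==> f x : J) ==> sum f S : J"
 by(induction S rule: infinite_finite_induct) (auto intro: ideal_0 ideal_add)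

lemma ideal_one_iff: "is_ideal A J ==> is_subring A ==> 1 : J \<longleftrightarrow> J = A"
 by(auto simp: is_ideal_def intro: subring_1) (metis mult.right_neutral)

lemma ideal_self: "is_subring A ==> is_ideal A A" by(auto simp: is_ideal_def intro: subring_intros)

lemma ideal_zero: "is_subring A ==> is_ideal A {0}" by(auto simp: is_ideal_def intro: subring_intros)

lemma ideal_Inter: "\<F> ~= {} ==> (!!J. J : \<F> ==> is_ideal A J) ==> is_ideal A (\<Inter>\<F>)"
 by(simp add: is_ideal_def subset_iff Ball_def) blast

lemma ideal_gen_ideal: "is_subring A ==> S <= A ==> is_ideal A (ideal_gen A S)" unfolding ideal_gen_def
 by(rule ideal_Inter) (use ideal_self[of A] in auto)

lemma ideal_gen_superset: "S <= ideal_gen A S" unfolding ideal_gen_def by blast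

lemma ideal_gen_minimal: "is_ideal A J ==> S <= J ==> ideal_gen A S <= J" unfolding ideal_gen_def by blast

lemma ideal_gen_mono: "S <= Y ==> ideal_gen A S <= ideal_gen A Y" unfolding ideal_gen_def by blast

lemma ideal_gen_eq_combinations: assumes A: "is_subring A" and S: "S <= A"
 shows "ideal_gen A S = {z. EX Y c. finite Y & Y <= S & (ALL y. c y : A) & z = (SUM y:Y. c y * y)}"
  (is "_ = ?R")
proof
 have "is_ideal A ?R" unfolding is_ideal_def
 proof(intro conjI ballI)
  show "?R <= A" using A S by(auto intro!: subring_sum subring_mult)
  show "0 : ?R" by(simp, rule exI[of _ "{}"], use A in \<open>auto intro: subring_0 exI[of _ "%_. 0"]\<close>)
  fix x y assume "x : ?R" "y : ?R"
  then obtain Y c Z d where h: "finite Y" "Y <= S" "ALL y. c y : A" "x = (SUM y:Y. c y * y)"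
   "finite Z" "Z <= S" "ALL y. d y : A" "y = (SUM y:Z. d y * y)" by blast
  let ?e = "%y. (if y : Y then c y else 0) + (if y : Z then d y else 0)"
  have "x + y = (SUM y:Y Un Z. ?e y * y)" using h by(simp add: distrib_right sum.distrib if_distrib[of "%t. t * _"] sum.If_cases Int_absorb1
     cong: if_cong)
  moreover have "ALL y. ?e y : A" using h A by(auto intro: subring_intros)
  ultimately show "x + y : ?R" using h(1,2,5,6) by(intro CollectI exI[of _ "Y Un Z"] exI[of _ ?e]) auto
 next
  fix a x assume a: "a : A" and "x : ?R"
  then obtain Y c where h: "finite Y" "Y <= S" "ALL y. c y : A" "x = (SUM y:Y. c y * y)" by blast
  hence "a * x = (SUM y:Y. (a * c y) * y)" by(simp add: sum_distrib_left mult.assoc)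
  thus "a * x : ?R" using h a A by(intro CollectI exI[of _ Y] exI[of _ "%y. a * c y"]) (auto intro: subring_mult)
 qed
 moreover have "S <= ?R"
 proof
  fix x assume "x : S"
  thus "x : ?R" using A by(intro CollectI exI[of _ "{x}"] exI[of _ "%_. 1"]) (auto intro: subring_1)
 qed
 ultimately show "ideal_gen A S <= ?R" by(rule ideal_gen_minimal)
 have I: "is_ideal A (ideal_gen A S)" using A S by(rule ideal_gen_ideal)
 show "?R <= ideal_gen A S" using I ideal_gen_superset[of S A] by(auto intro!: ideal_sum ideal_mult)
qed

lemma ideal_gen_finite: assumes A: "is_subring A" and S: "S <= A" and "finite S"
 shows "z : ideal_gen A S \<longleftrightarrow> (EX c. (ALL y. c y : A) & z = (SUM y:S. c y * y))"
proof
 assume "z : ideal_gen A S"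
 then obtain Y c where h: "finite Y" "Y <= S" "ALL y. c y : A" "z = (SUM y:Y. c y * y)" unfolding ideal_gen_eq_combinations[OF A S] by blast
 have "z = (SUM y:S. (if y : Y then c y else 0) * y)" using h \<open>finite S\<close>
  by(simp add: if_distrib[of "%t. t * _"] sum.If_cases Int_absorb1 cong: if_cong)
 thus "EX c. (ALL y. c y : A) & z = (SUM y:S. c y * y)" using h(3) A by(intro exI[of _ "%y. if y : Y then c y else 0"]) (auto intro: subring_0)
next
 assume "EX c. (ALL y. c y : A) & z = (SUM y:S. c y * y)"
 thus "z : ideal_gen A S" unfolding ideal_gen_eq_combinations[OF A S] using assms(3) by blast
qed

lemma ideal_gen_insert: assumes A: "is_subring A" and S: "S <= A" "x : A"
 shows "z : ideal_gen A (insert x S) \<longleftrightarrow> (EX a:A. z - a * x : ideal_gen A S)"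
proof
 let ?J = "{z\<in>A. EX a:A. z - a * x : ideal_gen A S}"
 have I: "is_ideal A (ideal_gen A S)" using A S by(intro ideal_gen_ideal)
 have "is_ideal A ?J" unfolding is_ideal_def
 proof(intro conjI ballI)
  show "0 : ?J" using subring_0[OF A] ideal_0[OF I] by(auto intro!: bexI[of _ 0])
  fix u v assume "u : ?J" "v : ?J"
  then obtain a b where h: "u : A" "v : A" "a : A" "b : A" "u - a * x : ideal_gen A S" "v - b * x : ideal_gen A S" by auto
  have "u + v - (a + b) * x = (u - a * x) + (v - b * x)" by(simp add: algebra_simps)
  hence "u + v - (a + b) * x : ideal_gen A S" using ideal_add[OF I h(5,6)] by(simp only:)
  thus "u + v : ?J" using h A by(auto intro: subring_add)
 next
  fix c u assume c: "c : A" and "u : ?J"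
  then obtain a where h: "u : A" "a : A" "u - a * x : ideal_gen A S" by auto
  have "c * u - (c * a) * x = c * (u - a * x)" by(simp add: algebra_simps)
  hence "c * u - (c * a) * x : ideal_gen A S" using ideal_mult[OF I c h(3)] by(simp only:)
  thus "c * u : ?J" using h c A by(auto intro: subring_mult)
 qed auto
 moreover have "x : ?J" using S(2) subring_1[OF A] ideal_0[OF I] by(auto intro!: bexI[of _ 1])
 moreover have "S <= ?J" using S subring_0[OF A] ideal_gen_superset[of S A] by(auto intro!: bexI[of _ 0])
 ultimately have "ideal_gen A (insert x S) <= ?J" by(intro ideal_gen_minimal) auto
 thus "z : ideal_gen A (insert x S) ==> EX a:A. z - a * x : ideal_gen A S" by auto
 have I': "is_ideal A (ideal_gen A (insert x S))" using A S by(intro ideal_gen_ideal) auto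
 show "EX a:A. z - a * x : ideal_gen A S ==> z : ideal_gen A (insert x S)"
 proof -
  assume "EX a:A. z - a * x : ideal_gen A S"
  then obtain a where a: "a : A" "z - a * x : ideal_gen A S" by blast
  have "x : ideal_gen A (insert x S)" using ideal_gen_superset[of "insert x S" A] by auto
  hence "(z - a * x) + a * x : ideal_gen A (insert x S)" using a ideal_gen_mono[of S "insert x S" A] I' by(intro ideal_add ideal_mult) auto
  thus ?thesis by simp
 qed
qed

lemma ideal_gen_empty: "is_subring A ==> ideal_gen A {} = {0}"
 using ideal_gen_minimal[OF ideal_zero, of A "{}"] ideal_0[OF ideal_gen_ideal[of A "{}"]] by auto

lemma ideal_gen_ideal_eq: "is_ideal A J ==> ideal_gen A J = J" using ideal_gen_minimal[of A J J] ideal_gen_superset[of J A] by auto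

lemma prime_ideal: "is_prime A P ==> is_ideal A P" by(simp add: is_prime_def)

lemma prime_power:
 "is_prime A P ==> is_subring A ==> a : A ==> a ^ k : P ==> a : P" by(induction k) (auto simp: is_prime_def intro: subring_power)



lemma prime_contract: assumes "is_prime A P" "is_subring B" "B <= A" shows "is_prime B (P Int B)"
 using assms subring_0[OF assms(2)] subring_add[OF assms(2)] subring_mult[OF assms(2)] unfolding is_prime_def is_ideal_def by(auto simp: subset_iff)

subsection \<open>Translation to HOL-Algebra\<close>

lemma ring_on_sel [simp]:
 "carrier (ring_on A) = A" "monoid.mult (ring_on A) = (*)" "monoid.one (ring_on A) = 1"
 "ring.zero (ring_on A) = 0" "ring.add (ring_on A) = (+)" by(simp_all add: ring_on_def ring_of_type_algebra_def)

lemma cring_ring_on: assumes A: "is_subring A" shows "cring (ring_on A)"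
proof(intro cringI abelian_groupI comm_monoidI)
 fix x assume "x : carrier (ring_on A)"
 thus "EX y:carrier (ring_on A). y \<oplus>\<^bsub>ring_on A\<^esub> x = \<zero>\<^bsub>ring_on A\<^esub>"
  using A by(auto intro!: bexI[of _ "- x"] subring_uminus)
qed (use A in \<open>auto simp: algebra_simps intro: subring_intros\<close>)

lemma domain_ring_on: assumes A: "is_subring (A :: 'a::idom set)" shows "domain (ring_on A)" using cring_ring_on[OF A] by(intro domainI) auto

lemma ideal_ring_on: assumes A: "is_subring A" shows "ideal J (ring_on A) \<longleftrightarrow> is_ideal A J"
proof
 interpret cring "ring_on A" using A by(rule cring_ring_on)
 {
  assume "ideal J (ring_on A)"
  then interpret J: ideal J "ring_on A" .
  show "is_ideal A J" unfolding is_ideal_def using J.a_subset J.I_l_closed J.zero_closed J.a_closed by(auto simp: subset_iff)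
 }
 assume J: "is_ideal A J"
 show "ideal J (ring_on A)"
 proof(rule idealI)
  show "ring (ring_on A)" by(rule ring_axioms)
  show "subgroup J (add_monoid (ring_on A))"
  proof(rule group.subgroupI)
   show "group (add_monoid (ring_on A))" using add.is_group .
   fix a assume a: "a : J"
   hence aA: "a : A" using J by(auto simp: is_ideal_def)
   have "\<ominus>\<^bsub>ring_on A\<^esub> a = - a" using aA A by(intro minus_equality) (auto intro: subring_uminus)
   thus "inv\<^bsub>add_monoid (ring_on A)\<^esub> a : J" using ideal_uminus[OF A J a] by(simp add: a_inv_def)
  qed (use J in \<open>auto simp: is_ideal_def\<close>)
 next
  fix a x assume "a : J" "x : carrier (ring_on A)"
  thus "x \<otimes>\<^bsub>ring_on A\<^esub> a : J" "a \<otimes>\<^bsub>ring_on A\<^esub> x : J" using ideal_mult[OF J] ideal_mult_right[OF J] by auto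
 qed
qed

lemma genideal_ring_on: assumes A: "is_subring A" shows "Idl\<^bsub>ring_on A\<^esub> S = ideal_gen A S"
 unfolding genideal_def ideal_gen_def ideal_ring_on[OF A] by simp

lemma primeideal_ring_on: assumes A: "is_subring A" shows "primeideal P (ring_on A) \<longleftrightarrow> is_prime A P"
proof
 assume "primeideal P (ring_on A)"
 then interpret P: primeideal P "ring_on A" .
 have I: "is_ideal A P" using P.is_ideal ideal_ring_on[OF A] by simp
 hence "1 ~: P" using P.I_notcarr ideal_one_iff[OF I A] by auto
 thus "is_prime A P" using I P.I_prime by(auto simp: is_prime_def)
next
 assume P: "is_prime A P"
 hence I: "is_ideal A P" and "P ~= A" using ideal_one_iff[OF _ A] by(auto simp: is_prime_def)
 thus "primeideal P (ring_on A)" using P cring_ring_on[OF A] ideal_ring_on[OF A]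
  by(intro primeideal.intro primeideal_axioms.intro) (auto simp: is_prime_def)
qed

lemma maximalideal_ring_on: assumes A: "is_subring A" shows "maximalideal M (ring_on A) \<longleftrightarrow>
  is_ideal A M & M ~= A & (ALL J. is_ideal A J & M <= J --> J = M | J = A)"
proof -
 have "is_ideal A J ==> J <= A" for J by(simp add: is_ideal_def)
 thus ?thesis unfolding maximalideal_def maximalideal_axioms_def ideal_ring_on[OF A] ring_on_sel by blast
qed

lemma maximal_is_prime: assumes A: "is_subring A" and "maximalideal M (ring_on A)" shows "is_prime A M"
 using cring.maximalideal_prime[OF cring_ring_on[OF A] assms(2)] primeideal_ring_on[OF A] by simp

lemma Units_ring_on: "is_subring A ==> Units (ring_on A) = {x\<in>A. EX y:A. x * y = 1}" by(auto simp: Units_def mult.commute)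

lemma noetherian_ring_on: assumes A: "is_subring A" shows "noetherian_ring (ring_on A) \<longleftrightarrow>
  (ALL J. is_ideal A J --> (EX S<=A. finite S & J = ideal_gen A S))"
 using cring.axioms(1)[OF cring_ring_on[OF A]] ideal_ring_on[OF A] genideal_ring_on[OF A]
 by(auto simp: noetherian_ring_def noetherian_ring_axioms_def)

section \<open>Localization\<close>

text \<open>With \<open>J = A\<close> this is the localization at \<open>P\<close>, with an ideal
  \<open>J\<close> of \<open>A\<close> its extension to the localization. Asking for a multiplier
  \<open>s\<close> instead of writing fractions reduces most proofs to clearing
  denominators.\<close>

definition sat :: "'a::comm_ring_1 set => 'a set => 'a set => 'a set" where
 "sat A P J = {z. EX s:A - P. s * z : J}"

lemma prime_mult_notin: "is_prime A P ==> is_subring A ==> s : A - P ==> t : A - P ==> s * t : A - P" by(auto simp: is_prime_def intro: subring_mult)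

lemma prime_one_notin: "is_prime A P ==> is_subring A ==> 1 : A - P" by(auto simp: is_prime_def intro: subring_1)

lemma prime_zero_in: "is_prime A P ==> 0 : P" by(auto simp: is_prime_def is_ideal_def)

lemma localize_eq_sat:
 fixes A :: "'a::field set" assumes A: "is_subring A" and P: "is_prime A P" shows "localize A P = sat A P A"
proof
 show "localize A P <= sat A P A"
 proof
  fix z assume "z : localize A P"
  then obtain a b where h: "z = a / b" "a : A" "b : A - P" by(auto simp: localize_def)
  hence "b ~= 0" using prime_zero_in[OF P] by auto
  hence "b * z = a" using h by simp
  hence "b * z : A" using h(2) by(simp only:)
  thus "z : sat A P A" using h(3) unfolding sat_def by blast
 qed
 show "sat A P A <= localize A P"
 proof
  fix z assume "z : sat A P A"
  then obtain s where h: "s : A - P" "s * z : A" by(auto simp: sat_def)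
  hence "s ~= 0" using prime_zero_in[OF P] by auto
  hence "z = (s * z) / s" by simp
  thus "z : localize A P" using h unfolding localize_def by blast
 qed
qed

lemma sat_superset:
 "is_subring A ==> is_prime A P ==> J <= sat A P J" using prime_one_notin[of A P] by(auto simp: sat_def intro!: bexI[of _ 1])

lemma sat_mono: "J <= J' ==> sat A P J <= sat A P J'" by(auto simp: sat_def)

lemma sat_subring: assumes A: "is_subring A" and P: "is_prime A P" shows "is_subring (sat A P A)" unfolding is_subring_def
proof(intro conjI ballI)
 show "1 : sat A P A" using sat_superset[OF A P, of A] subring_1[OF A] by auto
 fix x y assume "x : sat A P A" "y : sat A P A"
 then obtain s t where h: "s : A - P" "s * x : A" "t : A - P" "t * y : A" by(auto simp: sat_def)
 have st: "s * t : A - P" using prime_mult_notin[OF P A] h by blast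
 have "s * t * (x - y) = t * (s * x) - s * (t * y)" by(simp add: algebra_simps)
 moreover have "t * (s * x) - s * (t * y) : A" using h A by(auto intro!: subring_diff subring_mult)
 ultimately have "s * t * (x - y) : A" by(simp only:)
 thus "x - y : sat A P A" using st by(auto simp only: sat_def)
 have "s * t * (x * y) = (s * x) * (t * y)" by(simp add: algebra_simps)
 moreover have "(s * x) * (t * y) : A" using h A by(auto intro!: subring_mult)
 ultimately have "s * t * (x * y) : A" by(simp only:)
 thus "x * y : sat A P A" using st by(auto simp only: sat_def)
qed

lemma sat_ideal: assumes A: "is_subring A" and P: "is_prime A P" and J: "is_ideal A J" shows "is_ideal (sat A P A) (sat A P J)" unfolding is_ideal_def
proof(intro conjI ballI)
 show "sat A P J <= sat A P A" using J by(auto intro!: sat_mono simp: is_ideal_def)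
 show "0 : sat A P J" using sat_superset[OF A P, of J] ideal_0[OF J] by auto
 fix x y assume "x : sat A P J" "y : sat A P J"
 then obtain s t where h: "s : A - P" "s * x : J" "t : A - P" "t * y : J" by(auto simp: sat_def)
 have st: "s * t : A - P" using prime_mult_notin[OF P A] h by blast
 have "s * t * (x + y) = t * (s * x) + s * (t * y)" by(simp add: algebra_simps)
 moreover have "t * (s * x) + s * (t * y) : J" using h J by(auto intro!: ideal_add ideal_mult)
 ultimately have "s * t * (x + y) : J" by(simp only:)
 thus "x + y : sat A P J" using st by(auto simp only: sat_def)
next
 fix x y assume "x : sat A P A" "y : sat A P J"
 then obtain s t where h: "s : A - P" "s * x : A" "t : A - P" "t * y : J" by(auto simp: sat_def)
 have st: "s * t : A - P" using prime_mult_notin[OF P A] h by blast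
 have "s * t * (x * y) = (s * x) * (t * y)" by(simp add: algebra_simps)
 moreover have "(s * x) * (t * y) : J" by(rule ideal_mult[OF J h(2) h(4)])
 ultimately have "s * t * (x * y) : J" by(simp only:)
 thus "x * y : sat A P J" using st by(auto simp only: sat_def)
qed

lemma ideal_contract: assumes "is_ideal B I" "is_subring A" "A <= B" shows "is_ideal A (I Int A)"
 using assms subring_0[OF assms(2)] subring_add[OF assms(2)] subring_mult[OF assms(2)] unfolding is_ideal_def by(auto simp: subset_iff)

lemma sat_unit:
 fixes A :: "'a::field set" assumes A: "is_subring A" and P: "is_prime A P" and s: "s : A - P" shows "inverse s : sat A P A"
proof -
 have "s ~= 0" using s prime_zero_in[OF P] by auto
 hence "s * inverse s : A" using subring_1[OF A] by simp
 thus ?thesis using s by(auto simp only: sat_def)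
qed

text \<open>One multiplier outside \<open>P\<close> moves an element of \<open>I\<close> into
  \<open>A\<close>, and that multiplier is a unit of the localization. Hence ideals of the
  localization are determined by their contractions, and chains of primes and finite generation can
  be compared in \<open>A\<close>.\<close>

lemma sat_contract:
 fixes A :: "'a::field set" assumes A: "is_subring A" and P: "is_prime A P" and I: "is_ideal (sat A P A) I" shows "sat A P (I Int A) = I"
proof
 show "sat A P (I Int A) <= I"
 proof
  fix z assume "z : sat A P (I Int A)"
  then obtain s where h: "s : A - P" "s * z : I" by(auto simp: sat_def)
  hence "s ~= 0" using prime_zero_in[OF P] by auto
  hence "inverse s * (s * z) = z" by simp
  thus "z : I" using ideal_mult[OF I sat_unit[OF A P h(1)] h(2)] by(simp only:)
 qed
 show "I <= sat A P (I Int A)"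
 proof
  fix z assume z: "z : I"
  hence "z : sat A P A" using I by(auto simp: is_ideal_def)
  then obtain s where h: "s : A - P" "s * z : A" by(auto simp: sat_def)
  have "s : sat A P A" using h sat_superset[OF A P, of A] by auto
  hence "s * z : I" using ideal_mult[OF I _ z] by blast
  thus "z : sat A P (I Int A)" using h by(auto simp: sat_def)
 qed
qed

lemma sat_ideal_gen:
 fixes A :: "'a::field set" assumes A: "is_subring A" and P: "is_prime A P" and S: "S <= A" shows "ideal_gen (sat A P A) S = sat A P (ideal_gen A S)"
proof
 have I: "is_ideal A (ideal_gen A S)" using A S by(rule ideal_gen_ideal)
 have SQ: "S <= sat A P A" using S sat_superset[OF A P, of A] by auto
 show "ideal_gen (sat A P A) S <= sat A P (ideal_gen A S)" using sat_superset[OF A P, of "ideal_gen A S"] ideal_gen_superset[of S A]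
  by(intro ideal_gen_minimal sat_ideal[OF A P I]) auto
 have I': "is_ideal (sat A P A) (ideal_gen (sat A P A) S)" using sat_subring[OF A P] SQ by(rule ideal_gen_ideal)
 have "is_ideal A (ideal_gen (sat A P A) S Int A)" using I' A sat_superset[OF A P, of A] by(rule ideal_contract)
 hence "ideal_gen A S <= ideal_gen (sat A P A) S Int A" using S ideal_gen_superset[of S "sat A P A"] by(intro ideal_gen_minimal) auto
 hence "sat A P (ideal_gen A S) <= sat A P (ideal_gen (sat A P A) S Int A)" by(rule sat_mono)
 thus "sat A P (ideal_gen A S) <= ideal_gen (sat A P A) S" using sat_contract[OF A P I'] by simp
qed

lemma nonunits_sat:
 fixes A :: "'a::field set" assumes A: "is_subring A" and P: "is_prime A P" shows "nonunits (ring_on (sat A P A)) = sat A P P"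
proof -
 let ?Q = "sat A P A"
 have Q: "is_subring ?Q" by(rule sat_subring[OF A P])
 have PI: "is_ideal A P" using P by(rule prime_ideal)
 have "x : sat A P P \<longleftrightarrow> ~ (EX y:?Q. x * y = 1)" if x: "x : ?Q" for x
 proof
  assume h: "x : sat A P P"
  show "~ (EX y:?Q. x * y = 1)"
  proof
   assume "EX y:?Q. x * y = 1"
   then obtain y where y: "y : ?Q" "y * x = 1" by(auto simp: mult.commute)
   hence "1 : sat A P P" using ideal_mult[OF sat_ideal[OF A P PI] y(1) h] by simp
   thus False by(auto simp: sat_def)
  qed
 next
  assume h: "~ (EX y:?Q. x * y = 1)"
  obtain s where s: "s : A - P" "s * x : A" using x by(auto simp: sat_def)
  have "s * x : P"
  proof(rule ccontr)
   assume "s * x ~: P"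
   hence n: "s * x : A - P" using s by auto
   hence "inverse (s * x) * s : ?Q" using sat_unit[OF A P n] s sat_superset[OF A P, of A] by(auto intro: subring_mult[OF Q])
   moreover have "s * x ~= 0" using n prime_zero_in[OF P] by auto
   hence "x * (inverse (s * x) * s) = 1" by(simp add: field_simps)
   ultimately show False using h by blast
  qed
  thus "x : sat A P P" using s by(auto simp: sat_def)
 qed
 moreover have "sat A P P <= ?Q" using sat_ideal[OF A P PI] by(simp add: is_ideal_def)
 ultimately show ?thesis by(auto simp: nonunits_def Units_ring_on[OF Q])
qed

lemma local_ring_if_nonunits_ideal: assumes Q: "is_subring Q" and m: "is_ideal Q (nonunits (ring_on Q))" shows "local_ring (ring_on Q)"
 unfolding local_ring_def
proof(intro conjI ex1I[of _ "nonunits (ring_on Q)"])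
 show "cring (ring_on Q)" by(rule cring_ring_on[OF Q])
 have 1: "1 ~: nonunits (ring_on Q)" using subring_1[OF Q] by(auto simp: nonunits_def Units_ring_on[OF Q])
 have sub: "J <= nonunits (ring_on Q)" if J: "is_ideal Q J" "J ~= Q" for J
 proof
  fix x assume x: "x : J"
  have "x * y ~= 1" if "y : Q" for y using ideal_mult[OF J(1) that x] ideal_one_iff[OF J(1) Q] J(2) by(auto simp: mult.commute)
  thus "x : nonunits (ring_on Q)" using x J by(auto simp: nonunits_def Units_ring_on[OF Q] is_ideal_def)
 qed
 have neq: "nonunits (ring_on Q) ~= Q" using 1 subring_1[OF Q] by auto
 show "maximalideal (nonunits (ring_on Q)) (ring_on Q)" unfolding maximalideal_ring_on[OF Q] using m neq sub by blast
 fix M assume "maximalideal M (ring_on Q)"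
 thus "M = nonunits (ring_on Q)" unfolding maximalideal_ring_on[OF Q] using m neq sub by blast
qed

lemma sat_prime:
 fixes A :: "'a::field set" assumes A: "is_subring A" and P: "is_prime A P" shows "is_prime (sat A P A) (sat A P P)" unfolding is_prime_def
proof(intro conjI ballI impI)
 show I: "is_ideal (sat A P A) (sat A P P)" by(rule sat_ideal[OF A P prime_ideal[OF P]])
 show "1 ~: sat A P P" by(auto simp: sat_def)
 fix a b assume ab: "a : sat A P A" "b : sat A P A" "a * b : sat A P P"
 then obtain s t u where h: "s : A - P" "s * a : A" "t : A - P" "t * b : A" "u : A - P" "u * (a * b) : P" by(auto simp: sat_def)
 have "u * ((s * a) * (t * b)) = (s * t) * (u * (a * b))" by(simp add: algebra_simps)
 moreover have "(s * t) * (u * (a * b)) : P" by(rule ideal_mult[OF prime_ideal[OF P] _ h(6)]) (use h subring_mult[OF A] in auto)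
 ultimately have "u * ((s * a) * (t * b)) : P" by(simp only:)
 hence "s * a : P | t * b : P" using h P subring_mult[OF A] unfolding is_prime_def by blast
 thus "a : sat A P P | b : sat A P P" using h by(auto simp: sat_def)
qed

lemma local_ring_sat:
 fixes A :: "'a::field set" assumes "is_subring A" "is_prime A P" shows "local_ring (ring_on (sat A P A))"
 using assms nonunits_sat[OF assms] sat_ideal[OF assms prime_ideal] by(intro local_ring_if_nonunits_ideal sat_subring) auto

definition noetherian :: "'a::comm_ring_1 set => bool" where
 "noetherian A \<longleftrightarrow> is_subring A & (ALL J. is_ideal A J --> (EX S<=A. finite S & J = ideal_gen A S))"

lemma noetherian_imp: "noetherian A ==> noetherian_ring (ring_on A)" by(simp add: noetherian_def noetherian_ring_on)

lemma noetherian_sat: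
 fixes A :: "'a::field set" assumes N: "noetherian A" and P: "is_prime A P" shows "noetherian (sat A P A)"
proof -
 have A: "is_subring A" using N by(simp add: noetherian_def)
 have "EX S<=sat A P A. finite S & I = ideal_gen (sat A P A) S"
  if I: "is_ideal (sat A P A) I" for I
 proof -
  have "is_ideal A (I Int A)" using I A sat_superset[OF A P, of A] by(rule ideal_contract)
  then obtain S where S: "S <= A" "finite S" "I Int A = ideal_gen A S" using N by(auto simp: noetherian_def)
  have "I = ideal_gen (sat A P A) S" using sat_contract[OF A P I] sat_ideal_gen[OF A P S(1)] S(3) by simp
  moreover have "S <= sat A P A" using S(1) sat_superset[OF A P, of A] by auto
  ultimately show ?thesis using S(2) by blast
 qed
 thus ?thesis using sat_subring[OF A P] by(simp add: noetherian_def)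
qed

section \<open>Chains of prime ideals\<close>

definition prime_chain :: "'a::comm_ring_1 set => nat => (nat => 'a set) => bool" where
 "prime_chain A n P \<longleftrightarrow> (ALL i<=n. is_prime A (P i)) & (ALL i<n. P i \<subset> P (Suc i))"

lemma krull_dim_ring_on:
 "is_subring A ==> krull_dim (ring_on A) = Sup {enat n | n. EX P. prime_chain A n P}" by(simp add: krull_dim_def prime_chain_def primeideal_ring_on)

lemma prime_chain_contract:
 fixes A :: "'a::field set" assumes A: "is_subring A" and P: "is_prime A P" and C: "prime_chain (sat A P A) n C"
 shows "prime_chain A n (%i. C i Int A)" "!!i. i <= n ==> C i Int A <= P"
proof -
 have sup: "A <= sat A P A" by(rule sat_superset[OF A P])
 have Ci: "is_prime (sat A P A) (C i)" if "i <= n" for i using C that by(auto simp: prime_chain_def)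
 have "C i Int A \<subset> C (Suc i) Int A" if i: "i < n" for i
 proof -
  have "C i \<subset> C (Suc i)" using C i by(auto simp: prime_chain_def)
  moreover have e1: "sat A P (C i Int A) = C i" by(rule sat_contract[OF A P prime_ideal[OF Ci]]) (use i in simp)
  moreover have e2: "sat A P (C (Suc i) Int A) = C (Suc i)" by(rule sat_contract[OF A P prime_ideal[OF Ci]]) (use i in simp)
  moreover have "C i Int A ~= C (Suc i) Int A" using e1 e2 \<open>C i \<subset> C (Suc i)\<close> by(metis psubset_eq)
  ultimately show ?thesis by blast
 qed
 thus "prime_chain A n (%i. C i Int A)" using prime_contract[OF Ci A sup] by(auto simp: prime_chain_def)
 show "C i Int A <= P" if "i <= n" for i
 proof
  fix x assume x: "x : C i Int A"
  show "x : P"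
  proof(rule ccontr)
   assume "x ~: P"
   hence xs: "x : A - P" using x by auto
   hence "inverse x * x : C i" using x by(intro ideal_mult[OF prime_ideal[OF Ci[OF that]]] sat_unit[OF A P]) auto
   moreover have "x ~= 0" using xs prime_zero_in[OF P] by auto
   ultimately show False using Ci[OF that] by(simp add: is_prime_def)
  qed
 qed
qed

text \<open>Zorn's lemma gives an ideal \<open>P\<close> over \<open>J\<close> that is maximal among
  those missing the multiplicative set \<open>M\<close>. If neither \<open>a\<close> nor
  \<open>b\<close> were in \<open>P\<close>, both enlarged ideals would meet \<open>M\<close>; the
  product of the two witnesses would lie in \<open>P\<close> as soon as \<open>a * b\<close>
  does.\<close>

lemma prime_avoiding: assumes R: "is_subring R" and J: "is_ideal R J" and M: "1 : M" "!!x y. x : M ==> y : M ==> x * y : M" and JM: "J Int M = {}"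
 obtains P where "is_prime R P" "J <= P" "P Int M = {}"
proof -
 let ?F = "{I. is_ideal R I & J <= I & I Int M = {}}"
 have "EX I:?F. ALL I':?F. I <= I' --> I' = I"
 proof(rule subset_Zorn_nonempty)
  show "?F ~= {}" using J JM by blast
  fix \<C> assume ne: "\<C> ~= {}" and ch: "subset.chain ?F \<C>"
  hence CF: "\<C> <= ?F" and lin: "!!x y. x : \<C> ==> y : \<C> ==> x <= y | y <= x" by(auto simp: subset_chain_def)
  have "is_ideal R (\<Union>\<C>)" unfolding is_ideal_def
  proof(intro conjI ballI)
   show "\<Union>\<C> <= R" using CF by(auto simp: is_ideal_def)
   show "0 : \<Union>\<C>" using CF ne by(auto simp: is_ideal_def)
   fix x y assume "x : \<Union>\<C>" "y : \<Union>\<C>"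
   then obtain U V where "U : \<C>" "V : \<C>" "x : U" "y : V" by blast
   moreover hence "U <= V | V <= U" using lin by blast
   ultimately obtain W where "W : \<C>" "x : W" "y : W" by blast
   moreover hence "is_ideal R W" using CF by blast
   ultimately show "x + y : \<Union>\<C>" using ideal_add by blast
  next
   fix a x assume a: "a : R" "x : \<Union>\<C>"
   then obtain W where W: "W : \<C>" "x : W" by blast
   hence "is_ideal R W" using CF by blast
   thus "a * x : \<Union>\<C>" using W a ideal_mult by blast
  qed
  thus "\<Union>\<C> : ?F" using CF ne by blast
 qed
 then obtain P where P: "is_ideal R P" "J <= P" "P Int M = {}" and max: "!!I. is_ideal R I ==> P <= I ==> I Int M = {} ==> I = P"
  by(smt (verit) mem_Collect_eq order_trans)
 have ins: "EX m:M. EX r:R. m - r * a : P" if a: "a : R" "a ~: P" for a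
 proof -
  have PR: "P <= R" using P(1) by(simp add: is_ideal_def)
  let ?I = "ideal_gen R (insert a P)"
  have "is_ideal R ?I" using R a PR by(intro ideal_gen_ideal) auto
  moreover have "P <= ?I" "a : ?I" using ideal_gen_superset[of "insert a P" R] by auto
  ultimately have "?I Int M ~= {}" using max[of ?I] a(2) by blast
  then obtain m where m: "m : M" "m : ?I" by blast
  thus ?thesis using ideal_gen_insert[OF R PR a(1), of m] ideal_gen_ideal_eq[OF P(1)] by auto
 qed
 have "is_prime R P" unfolding is_prime_def
 proof(intro conjI ballI impI)
  show "is_ideal R P" by fact
  show "1 ~: P" using P(3) M(1) by auto
  fix a b assume ab: "a : R" "b : R" "a * b : P"
  show "a : P | b : P"
  proof(rule ccontr)
   assume "~ ?thesis"
   then obtain m r n s where h: "m : M" "r : R" "m - r * a : P" "n : M" "s : R" "n - s * b : P" using ins[OF ab(1)] ins[OF ab(2)] by blast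
   have nR: "s * b : R" "r * a : R" using h ab R by(auto intro: subring_mult)
   have "n - s * b : R" using h P(1) by(auto simp: is_ideal_def)
   hence "(n - s * b) + s * b : R" using nR by(intro subring_add[OF R])
   hence n: "n : R" by simp
   have "n * (m - r * a) + (r * a) * (n - s * b) + (r * s) * (a * b) : P"
    by(intro ideal_add[OF P(1)] ideal_mult[OF P(1) n h(3)] ideal_mult[OF P(1) nR(2) h(6)]
      ideal_mult[OF P(1) _ ab(3)] subring_mult[OF R] h)
   moreover have "n * (m - r * a) + (r * a) * (n - s * b) + (r * s) * (a * b) = m * n" by(simp add: algebra_simps)
   ultimately have "m * n : P" by simp
   thus False using P(3) M(2)[OF h(1,4)] by blast
  qed
 qed
 thus ?thesis using that P by blast
qed

text \<open>The products of elements outside \<open>P\<close> with powers of \<open>x\<close> form a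
  multiplicative set that misses \<open>J\<close>, because \<open>x\<close> can be cancelled modulo
  \<open>J\<close>. A prime over \<open>J\<close> missing this set is contained in \<open>P\<close>
  and does not contain \<open>x\<close>.\<close>

lemma prime_below_nonzerodivisor: assumes R: "is_subring R" and J: "is_ideal R J" and P: "is_prime R P" "J <= P" and x: "x : P"
  and reg: "!!a. a : R ==> x * a : J ==> a : J"
 obtains P' where "is_prime R P'" "J <= P'" "P' \<subset> P"
proof -
 let ?M = "{s * x ^ k | s k. s : R - P}"
 have xR: "x : R" using x P by(auto simp: is_prime_def is_ideal_def)
 have pw: "a : J" if "a : R" "a * x ^ k : J" for a k using that
 proof(induction k)
  case (Suc k)
  have "x * (a * x ^ k) : J" using Suc.prems by(simp add: mult_ac)
  hence "a * x ^ k : J" using reg Suc.prems xR R by(auto intro: subring_mult subring_power)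
  thus ?case using Suc by auto
 qed auto
 have "J Int ?M = {}" using pw P by blast
 moreover have "1 : ?M"
 proof -
  have "1 = 1 * x ^ 0" "1 : R - P" using prime_one_notin[OF P(1) R] by auto
  thus ?thesis by blast
 qed
 moreover have "u * v : ?M" if "u : ?M" "v : ?M" for u v
 proof -
  obtain s k t l where h: "u = s * x ^ k" "v = t * x ^ l" "s : R - P" "t : R - P" using \<open>u : ?M\<close> \<open>v : ?M\<close> by blast
  hence "u * v = (s * t) * x ^ (k + l)" by(simp add: power_add mult_ac)
  thus ?thesis using prime_mult_notin[OF P(1) R h(3,4)] by blast
 qed
 ultimately obtain P' where P': "is_prime R P'" "J <= P'" "P' Int ?M = {}" using prime_avoiding[OF R J, of ?M] by blast
 have "P' <= P"
 proof
  fix y assume y: "y : P'"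
  hence "y : R" using P' by(auto simp: is_prime_def is_ideal_def)
  show "y : P"
  proof(rule ccontr)
   assume "y ~: P"
   hence "y * x ^ 0 : ?M" using \<open>y : R\<close> by blast
   thus False using y P' by auto
  qed
 qed
 moreover have "1 * x ^ 1 : ?M" using prime_one_notin[OF P(1) R] by blast
 hence "x ~: P'" using P'(3) by auto
 ultimately show ?thesis using that P' x by blast
qed

text \<open>Each member of a regular sequence, taken from the end of the list, costs one strict step
  down from \<open>P\<close>; this is the inequality between depth and dimension.\<close>

lemma regular_sequence_chain: assumes R: "is_subring R" and xs: "set xs <= R" and P: "is_prime R P" "set xs <= P"
  and reg: "!!i a. i < length xs ==> a : R ==> xs ! i * a : ideal_gen R (set (take i xs)) ==>
   a : ideal_gen R (set (take i xs))" shows "EX C. prime_chain R (length xs) C & C (length xs) = P" using assms(2-5)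
proof(induction xs arbitrary: P rule: rev_induct)
 case Nil
 thus ?case by(auto simp: prime_chain_def intro!: exI[of _ "%_. P"])
next
 case (snoc x xs)
 have I: "is_ideal R (ideal_gen R (set xs))" using R snoc.prems by(intro ideal_gen_ideal) auto
 have "ideal_gen R (set xs) <= P" using snoc.prems by(intro ideal_gen_minimal prime_ideal) auto
 moreover have "a : ideal_gen R (set xs)" if "a : R" "x * a : ideal_gen R (set xs)" for a using snoc.prems(4)[of "length xs" a] that by simp
 ultimately obtain P' where P': "is_prime R P'" "ideal_gen R (set xs) <= P'" "P' \<subset> P"
  using prime_below_nonzerodivisor[OF R I snoc.prems(2), of x] snoc.prems by auto
 have "EX C. prime_chain R (length xs) C & C (length xs) = P'"
 proof(rule snoc.IH)
  show "set xs <= P'" using P' ideal_gen_superset[of "set xs" R] by auto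
  show "a : ideal_gen R (set (take i xs))" if "i < length xs" "a : R"
   "xs ! i * a : ideal_gen R (set (take i xs))" for i a using snoc.prems(4)[of i a] that by(simp add: nth_append)
 qed (use snoc.prems P' in auto)
 then obtain C where C: "prime_chain R (length xs) C" "C (length xs) = P'" by blast
 let ?C = "%i. if i <= length xs then C i else P"
 have "prime_chain R (length (xs @ [x])) ?C" using C P' snoc.prems(2) unfolding prime_chain_def by(auto simp: less_Suc_eq le_Suc_eq)
 thus ?case by(auto intro!: exI[of _ ?C])
qed

lemma depth_le_dim: assumes R: "is_subring R" and m: "is_prime R (nonunits (ring_on R))" shows "local_depth (ring_on R) <= krull_dim (ring_on R)"
 unfolding local_depth_def
proof(rule Sup_least)
 fix e assume "e : {enat (length xs) |xs. set xs <= nonunits (ring_on R) & regular_sequence (ring_on R) xs}"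
 then obtain xs where xs: "e = enat (length xs)" "set xs <= nonunits (ring_on R)" "regular_sequence (ring_on R) xs" by blast
 have "EX C. prime_chain R (length xs) C & C (length xs) = nonunits (ring_on R)" by(rule regular_sequence_chain[OF R _ m xs(2)])
   (use xs(3) in \<open>auto simp: regular_sequence_def genideal_ring_on[OF R]\<close>)
 thus "e <= krull_dim (ring_on R)" unfolding krull_dim_ring_on[OF R] xs(1) by(intro Sup_upper) blast
qed

lemma krull_dim_le: assumes R: "is_subring R" and "!!n C. prime_chain R n C ==> n <= N" shows "krull_dim (ring_on R) <= enat N"
 unfolding krull_dim_ring_on[OF R] using assms(2) by(intro Sup_least) auto

section \<open>Polynomial extensions of subrings\<close>

definition polys_over :: "'a::comm_ring_1 set => 'a poly set" where
 "polys_over R = {p. ALL i. coeff p i : R}"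

definition adjoin1 :: "'a::comm_ring_1 set => 'a => 'a set" where
 "adjoin1 R y = (%p. poly p y) ` polys_over R"

definition transcendental :: "'a::comm_ring_1 set => 'a => bool" where
 "transcendental R y \<longleftrightarrow> (ALL p:polys_over R. poly p y = 0 --> p = 0)"

lemma polys_over_coeff: "p : polys_over R ==> coeff p i : R" by(simp add: polys_over_def)

lemma polys_over_diff: "is_subring R ==> p : polys_over R ==> q : polys_over R ==> p - q : polys_over R"
 by(auto simp: polys_over_def intro: subring_diff)

lemma polys_over_mult: "is_subring R ==> p : polys_over R ==> q : polys_over R ==> p * q : polys_over R"
 by(auto simp: polys_over_def coeff_mult intro!: subring_sum subring_mult)

lemma polys_over_ideal_mult:
 "is_ideal R J ==> p : polys_over R ==> q : polys_over J ==> p * q : polys_over J"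
 by(auto simp: polys_over_def coeff_mult intro!: ideal_sum ideal_mult)

lemma polys_over_monom: "0 : R ==> a : R ==> Polynomial.monom a n : polys_over R" by(auto simp: polys_over_def)

lemma polys_over_const: "0 : R ==> a : R ==> [:a:] : polys_over R" using polys_over_monom[of R a 0] by(simp add: monom_0)

lemma polys_over_1: "is_subring R ==> 1 : polys_over R" using polys_over_const[of R 1] subring_0[of R] subring_1[of R] by(simp add: one_pCons)

lemma polys_over_mono: "R <= S ==> polys_over R <= polys_over S" by(auto simp: polys_over_def)

lemma adjoin1_I: "p : polys_over R ==> poly p y : adjoin1 R y" by(auto simp: adjoin1_def)

lemma adjoin1_subring: "is_subring R ==> is_subring (adjoin1 R y)" unfolding is_subring_def
proof(intro conjI ballI)
 assume R: "1 : R & (ALL x:R. ALL y:R. x - y : R & x * y : R)"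
 hence R': "is_subring R" by(simp add: is_subring_def)
 show "1 : adjoin1 R y" using adjoin1_I[OF polys_over_1[OF R'], of y] by simp
 fix u v assume "u : adjoin1 R y" "v : adjoin1 R y"
 then obtain p q where h: "p : polys_over R" "q : polys_over R" "u = poly p y" "v = poly q y" by(auto simp: adjoin1_def)
 show "u - v : adjoin1 R y" using adjoin1_I[OF polys_over_diff[OF R' h(1,2)], of y] h by simp
 show "u * v : adjoin1 R y" using adjoin1_I[OF polys_over_mult[OF R' h(1,2)], of y] h by simp
qed

lemma adjoin1_superset: "is_subring R ==> R <= adjoin1 R y" using adjoin1_I[OF polys_over_const[of R], of _ y] subring_0[of R] by auto

lemma adjoin1_generator: "is_subring R ==> y : adjoin1 R y" using adjoin1_I[OF polys_over_monom[of R 1 1], of y] subring_0[of R] subring_1[of R]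
 by(simp add: poly_monom)

lemma adjoin1_least:
 "is_subring S ==> R <= S ==> y : S ==> adjoin1 R y <= S" by(auto simp: adjoin1_def polys_over_def intro!: subring_poly)

lemma transcendental_eq: assumes R: "is_subring R" and "transcendental R y" and "p : polys_over R" "q : polys_over R" "poly p y = poly q y"
 shows "p = q" using assms polys_over_diff[OF R assms(3,4)] unfolding transcendental_def by force

lemma ideal_extend: assumes R: "is_subring R" and J: "is_ideal R J" shows "is_ideal (adjoin1 R y) ((%p. poly p y) ` polys_over J)"
 unfolding is_ideal_def
proof(intro conjI ballI)
 show "(%p. poly p y) ` polys_over J <= adjoin1 R y" using polys_over_mono[of J R] J by(auto simp: adjoin1_def is_ideal_def)
 show "0 : (%p. poly p y) ` polys_over J" using ideal_0[OF J] by(auto simp: polys_over_def intro!: image_eqI[of _ _ 0])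
 fix u v assume "u : (%p. poly p y) ` polys_over J" "v : (%p. poly p y) ` polys_over J"
 then obtain p q where h: "p : polys_over J" "q : polys_over J" "u = poly p y" "v = poly q y" by auto
 hence "p + q : polys_over J" using ideal_add[OF J] by(auto simp: polys_over_def)
 thus "u + v : (%p. poly p y) ` polys_over J" using h by(auto intro!: image_eqI[of _ _ "p + q"])
next
 fix u v assume "u : adjoin1 R y" "v : (%p. poly p y) ` polys_over J"
 then obtain p q where h: "p : polys_over R" "q : polys_over J" "u = poly p y" "v = poly q y" by(auto simp: adjoin1_def)
 thus "u * v : (%p. poly p y) ` polys_over J" using polys_over_ideal_mult[OF J h(1,2)] by(auto intro!: image_eqI[of _ _ "p * q"])
qed

text \<open>Reduces, for transcendental \<open>y\<close>, membership and colon conditions in the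
  polynomial ring to conditions on coefficients in \<open>R\<close>.\<close>

lemma ideal_gen_extend: assumes R: "is_subring R" and S: "S <= R" shows "ideal_gen (adjoin1 R y) S = (%p. poly p y) ` polys_over (ideal_gen R S)"
proof
 have I: "is_ideal R (ideal_gen R S)" using R S by(rule ideal_gen_ideal)
 have "S <= (%p. poly p y) ` polys_over (ideal_gen R S)"
 proof
  fix s assume "s : S"
  hence "[:s:] : polys_over (ideal_gen R S)" using ideal_gen_superset[of S R] ideal_0[OF I] by(intro polys_over_const) auto
  thus "s : (%p. poly p y) ` polys_over (ideal_gen R S)" by(auto intro!: image_eqI[of _ _ "[:s:]"])
 qed
 thus "ideal_gen (adjoin1 R y) S <= (%p. poly p y) ` polys_over (ideal_gen R S)" by(intro ideal_gen_minimal ideal_extend[OF R I])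
 have B: "is_subring (adjoin1 R y)" using R by(rule adjoin1_subring)
 have SB: "S <= adjoin1 R y" using S adjoin1_superset[OF R] by blast
 have I': "is_ideal (adjoin1 R y) (ideal_gen (adjoin1 R y) S)" using B SB by(rule ideal_gen_ideal)
 have sub: "ideal_gen R S <= ideal_gen (adjoin1 R y) S" using ideal_contract[OF I' R adjoin1_superset[OF R]] S ideal_gen_superset[of S "adjoin1 R y"]
   ideal_gen_minimal[of R "ideal_gen (adjoin1 R y) S Int R" S] by blast
 show "(%p. poly p y) ` polys_over (ideal_gen R S) <= ideal_gen (adjoin1 R y) S"
 proof
  fix u assume "u : (%p. poly p y) ` polys_over (ideal_gen R S)"
  then obtain p where p: "p : polys_over (ideal_gen R S)" "u = poly p y" by auto
  show "u : ideal_gen (adjoin1 R y) S" unfolding p(2) poly_altdef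
  proof(rule ideal_sum[OF I'])
   fix i
   have "coeff p i : ideal_gen (adjoin1 R y) S" using p(1) sub by(auto simp: polys_over_def)
   thus "coeff p i * y ^ i : ideal_gen (adjoin1 R y) S" using subring_power[OF B adjoin1_generator[OF R]] by(intro ideal_mult_right[OF I'])
  qed
 qed
qed

subsection \<open>Hilbert's basis theorem\<close>

text \<open>The ascending chain condition in terms of elements: finitely many generators of the
  ideal of all terms are combinations of finitely many terms, so the terms after these depend on
  them.\<close>

lemma noetherian_sequence: assumes N: "noetherian R" and a: "!!n. a n : R" shows "EX m. a m : ideal_gen R (a ` {..<m :: nat})"
proof -
 have R: "is_subring R" using N by(simp add: noetherian_def)
 let ?I = "%n. ideal_gen R (a ` {..<n})"
 have I: "is_ideal R (?I n)" for n using a by(intro ideal_gen_ideal[OF R]) auto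
 have "is_ideal R (ideal_gen R (range a))" using a by(intro ideal_gen_ideal[OF R]) auto
 then obtain S where S: "finite S" "ideal_gen R (range a) = ideal_gen R S" using N unfolding noetherian_def by blast
 have "EX m. s : ?I m" if "s : S" for s
 proof -
  have "s : ideal_gen R (range a)" using that S(2) ideal_gen_superset[of S R] by blast
  then obtain Y c where Y: "finite Y" "Y <= range a" "ALL y. c y : R" "s = (SUM y:Y. c y * y)"
   using ideal_gen_eq_combinations[OF R, of "range a"] a by blast
  then obtain F where F: "finite F" "Y = a ` F" using finite_subset_image by metis
  have "Y <= ?I (Suc (Max F))" using F ideal_gen_superset[of "a ` {..<Suc (Max F)}" R] by(auto simp: less_Suc_eq_le)
  thus ?thesis unfolding Y(4) using Y(3) by(intro exI[of _ "Suc (Max F)"] ideal_sum[OF I] ideal_mult[OF I]) auto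
 qed
 then obtain m where m: "!!s. s : S ==> s : ?I (m s)" by metis
 let ?m = "Max (insert 0 (m ` S))"
 have "?I (m s) <= ?I ?m" if "s : S" for s using that S(1) by(intro ideal_gen_mono image_mono) auto
 hence "ideal_gen R S <= ?I ?m" using m by(intro ideal_gen_minimal[OF I]) blast
 thus ?thesis using S(2) ideal_gen_superset[of "range a" R] by blast
qed

text \<open>In an ideal that is not finitely generated, pick polynomials of minimal degree outside the ideal
 generated by the earlier ones; the leading coefficients then violate the ascending chain condition.\<close>

lemma noetherian_adjoin1: assumes N: "noetherian R" shows "noetherian (adjoin1 R y)"
proof -
 have R: "is_subring R" using N by(simp add: noetherian_def)
 let ?B = "adjoin1 R y"
 have B: "is_subring ?B" by(rule adjoin1_subring[OF R])
 have "EX S<=?B. finite S & J = ideal_gen ?B S" if J: "is_ideal ?B J" for J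
 proof(rule ccontr)
  assume nf: "~ ?thesis"
  let ?I = "%f n. ideal_gen ?B ((%j. poly (f j) y) ` {..<n})"
  define Q where "Q f n p \<longleftrightarrow> p : polys_over R & poly p y : J - ?I f n" for f and n :: nat and p
  have "EX f. ALL n. Q f n (f n) & (ALL p. Q f n p --> degree (f n) <= degree p)"
  proof(rule dependent_wellorder_choice)
   fix n and f :: "nat => 'a poly" assume h: "!!j. j < n ==> Q f j (f j) & (ALL p. Q f j p --> degree (f j) <= degree p)"
   hence sub: "(%j. poly (f j) y) ` {..<n} <= J" by(auto simp: Q_def)
   hence "?I f n <= J" by(rule ideal_gen_minimal[OF J])
   moreover have "?I f n ~= J"
   proof
    assume "?I f n = J"
    moreover have "(%j. poly (f j) y) ` {..<n} <= ?B" using sub ideal_subset[OF J] by(rule_tac subset_trans) auto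
    ultimately show False using nf by(elim notE) (intro exI[of _ "(%j. poly (f j) y) ` {..<n}"], simp)
   qed
   ultimately obtain u where u: "u : J - ?I f n" by blast
   hence "u : ?B" using ideal_subset[OF J] by blast
   then obtain p where p: "p : polys_over R" "u = poly p y" by(auto simp: adjoin1_def)
   hence "Q f n p" using u by(simp add: Q_def)
   thus "EX p. Q f n p & (ALL q. Q f n q --> degree p <= degree q)" by(rule ex_has_least_nat)
  next
   fix r n and f g :: "nat => 'a poly" assume "!!j. j < n ==> f j = g j"
   hence "?I f n = ?I g n" by(intro arg_cong[where f = "ideal_gen ?B"] image_cong) auto
   thus "(Q f n r & (ALL p. Q f n p --> degree r <= degree p)) = (Q g n r & (ALL p. Q g n p --> degree r <= degree p))" by(simp add: Q_def)
  qed
  then obtain f where "ALL n. Q f n (f n) & (ALL p. Q f n p --> degree (f n) <= degree p)" by(rule exE)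
  hence f: "Q f n (f n)" "Q f n p ==> degree (f n) <= degree p" for n p by blast+
  have fB: "f n : polys_over R" "poly (f n) y : J" "poly (f n) y ~: ?I f n" for n using f(1)[of n] by(auto simp: Q_def)
  let ?a = "%n. lead_coeff (f n)" let ?d = "%n. degree (f n)"
  have a: "?a n : R" for n using fB(1) by(simp add: polys_over_def)
  obtain m where "?a m : ideal_gen R (?a ` {..<m})" using noetherian_sequence[of R ?a, OF N a] by blast
  then obtain c where c: "!!s. c s : R" "?a m = (SUM s:?a ` {..<m}. c s * s)" using ideal_gen_finite[OF R, of "?a ` {..<m}"] a by blast
  have "ALL s:?a ` {..<m}. EX j<m. ?a j = s" by auto
  then obtain g where g: "!!s. s : ?a ` {..<m} ==> g s < m & ?a (g s) = s" by metis
  have mono: "?I f j <= ?I f m" if "j < m" for j using that by(intro ideal_gen_mono image_mono) auto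
  have dm: "?d j <= ?d m" if "j < m" for j using mono[OF that] fB[of m] by(intro f(2)) (auto simp: Q_def)
  \<comment> \<open>The combination of earlier polynomials that has the leading term of
    \<open>f m\<close>; their degrees do not exceed \<open>?d m\<close>, so multiplying by powers of
    the variable is enough. The difference \<open>f m - h\<close> stays outside the ideal, yet
    minimality of \<open>?d m\<close> forces it to be zero.\<close>
  define h where "h = (SUM s:?a ` {..<m}. Polynomial.smult (c s) (Polynomial.monom 1 (?d m - ?d (g s)) * f (g s)))"
  have IS: "is_ideal ?B (?I f m)" using fB(1) by(intro ideal_gen_ideal[OF B]) (auto intro: adjoin1_I)
  have hR: "h : polys_over R" unfolding polys_over_def
   using fB(1) a c(1) by(auto simp: h_def coeff_sum coeff_monom_mult polys_over_def intro!: subring_sum[OF R] subring_mult[OF R] subring_0[OF R])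
  have hI: "poly h y : ?I f m" unfolding h_def poly_sum
  proof(rule ideal_sum[OF IS])
   fix s assume "s : ?a ` {..<m}"
   hence "poly (f (g s)) y : ?I f m" using g[of s] ideal_gen_superset[of "(%j. poly (f j) y) ` {..<m}" ?B] by blast
   hence "(c s * y ^ (?d m - ?d (g s))) * poly (f (g s)) y : ?I f m" using c(1)[of s] adjoin1_superset[OF R, of y] adjoin1_generator[OF R, of y]
    by(intro ideal_mult[OF IS] subring_mult[OF B] subring_power[OF B]) auto
   thus "poly (Polynomial.smult (c s) (Polynomial.monom 1 (?d m - ?d (g s)) * f (g s))) y : ?I f m" by(simp add: poly_monom mult_ac)
  qed
  have co: "coeff (f m - h) i = 0" if i: "?d m <= i" for i
  proof(cases "i = ?d m")
   case True
   have "coeff h i = (SUM s:?a ` {..<m}. c s * s)" unfolding h_def coeff_sum using g dm by(intro sum.cong) (auto simp: coeff_monom_mult True)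
   thus ?thesis using c(2) True by simp
  next
   case False
   have "coeff h i = 0" unfolding h_def coeff_sum
   proof(intro sum.neutral ballI)
    fix s assume "s : ?a ` {..<m}"
    hence "?d (g s) <= ?d m" using g dm by blast
    thus "coeff (Polynomial.smult (c s) (Polynomial.monom 1 (?d m - ?d (g s)) * f (g s))) i = 0"
     using i False by(simp add: coeff_monom_mult coeff_eq_0)
   qed
   thus ?thesis using i False by(simp add: coeff_eq_0)
  qed
  have notin: "poly (f m - h) y ~: ?I f m" using ideal_add[OF IS _ hI, of "poly (f m - h) y"] fB(3)[of m] by auto
  have "poly h y : J" using hI ideal_gen_minimal[OF J, of "(%j. poly (f j) y) ` {..<m}"] fB(2) by blast
  hence "Q f m (f m - h)" using notin fB hR polys_over_diff[OF R] ideal_diff[OF B J] by(simp add: Q_def)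
  hence "coeff (f m - h) (degree (f m - h)) = 0" by(intro co f(2))
  hence "f m - h = 0" by(simp only: leading_coeff_0_iff)
  thus False using notin ideal_0[OF IS] by simp
 qed
 thus ?thesis using B by(simp add: noetherian_def)
qed

subsection \<open>Finitely generated algebras over a subfield\<close>

definition is_subfield :: "'a::field set => bool" where
 "is_subfield K \<longleftrightarrow> is_subring K & (ALL x:K. inverse x : K)"

lemma noetherian_subfield: assumes "is_subfield K" shows "noetherian K"
proof -
 have K: "is_subring K" using assms by(simp add: is_subfield_def)
 have "EX S<=K. finite S & J = ideal_gen K S" if J: "is_ideal K J" for J
 proof(cases "J = {0}")
  case True
  thus ?thesis using ideal_gen_empty[OF K] by(intro exI[of _ "{}"]) auto
 next
  case False
  then obtain x where x: "x : J" "x ~= 0" using ideal_0[OF J] by blast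
  hence "inverse x * x : J" using assms J by(intro ideal_mult[OF J]) (auto simp: is_subfield_def is_ideal_def)
  hence "J = K" using x ideal_one_iff[OF J K] by simp
  moreover have "1 : ideal_gen K {1}" using ideal_gen_superset[of "{1}" K] by auto
  hence "ideal_gen K {1} = K" using ideal_one_iff[OF ideal_gen_ideal[OF K, of "{1}"] K] subring_1[OF K] by auto
  ultimately show ?thesis using subring_1[OF K] by(intro exI[of _ "{1}"]) auto
 qed
 thus ?thesis using K by(simp add: noetherian_def)
qed

text \<open>The head of the list is adjoined last, so induction over the list peels off the
  outermost variable; hence the reversed list in \<open>regular_on_powers\<close>.\<close>

fun adjoins :: "'a::comm_ring_1 set => 'a list => 'a set" where
 "adjoins R [] = R"
| "adjoins R (y # ys) = adjoin1 (adjoins R ys) y"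

lemma adjoins_subring: "is_subring R ==> is_subring (adjoins R ys)" by(induction ys) (auto intro: adjoin1_subring)

lemma adjoins_superset: "is_subring R ==> R <= adjoins R ys"
proof(induction ys)
 case (Cons y ys)
 thus ?case using adjoin1_superset[OF adjoins_subring[of R ys], of y] by auto
qed simp

lemma adjoins_generators: "is_subring R ==> set ys <= adjoins R ys"
proof(induction ys)
 case (Cons y ys)
 thus ?case using adjoin1_superset[of "adjoins R ys" y] adjoin1_generator[of "adjoins R ys" y]
  adjoins_subring[of R ys] by auto
qed simp

lemma adjoins_least: "is_subring S ==> R <= S ==> set ys <= S ==> adjoins R ys <= S"
proof(induction ys)
 case (Cons y ys)
 thus ?case using adjoin1_least[of S "adjoins R ys" y] by simp
qed simp

lemma noetherian_adjoins: "noetherian R ==> noetherian (adjoins R ys)" by(induction ys) (auto intro: noetherian_adjoin1)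

section \<open>Algebraic independence\<close>

fun mono_eval :: "'a::comm_monoid_mult list => nat list => 'a" where
 "mono_eval (a # as) (k # ks) = a ^ k * mono_eval as ks"
| "mono_eval _ _ = 1"

text \<open>Bounding each exponent separately rather than the total degree makes the number of
  monomials a plain power and lets sums split off the first exponent.\<close>

definition box :: "nat => nat => nat list set" where
 "box n E = {ks. set ks <= {..E} & length ks = n}"

abbreviation (input) "lincomb c as E \<equiv> SUM ks:box (length as) E. c ks * mono_eval as ks"

lemma finite_box [simp]: "finite (box n E)" unfolding box_def by(rule finite_lists_length_eq) simp

lemma card_box: "card (box n E) = (E + 1) ^ n" unfolding box_def by(subst card_lists_length_eq) simp_all

lemma box_0 [simp]: "box 0 E = {[]}" by(auto simp: box_def)

lemma box_mono: "E <= E' ==> box n E <= box n E'" by(auto simp: box_def)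

lemma box_Suc: "box (Suc n) E = (%(k, ks). k # ks) ` ({..E} \<times> box n E)"
proof
 show "box (Suc n) E <= (%(k, ks). k # ks) ` ({..E} \<times> box n E)"
 proof
  fix ks assume "ks : box (Suc n) E"
  then obtain k l where "ks = k # l" "k <= E" "l : box n E" by(cases ks) (auto simp: box_def)
  thus "ks : (%(k, ks). k # ks) ` ({..E} \<times> box n E)" by force
 qed
qed (auto simp: box_def)

lemma sum_box_Suc: "(SUM ks:box (Suc n) E. f ks) = (SUM k<=E. SUM ks:box n E. f (k # ks))"
proof -
 have "inj_on (%(k, ks). k # ks) ({..E} \<times> box n E)" by(auto simp: inj_on_def)
 thus ?thesis unfolding box_Suc by(subst sum.reindex) (auto simp: sum.cartesian_product case_prod_unfold)
qed

lemma mono_eval_in: "is_subring A ==> set as <= A ==> mono_eval as ks : A"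
 by(induction as ks rule: mono_eval.induct) (auto intro: subring_1 subring_mult subring_power)

text \<open>Algebraic independence over \<open>K\<close> of the residues modulo \<open>P\<close>;
  \<open>P = {0}\<close> is ordinary independence. The lengths of such lists play the part of the
  transcendence degree of the residue ring.\<close>

definition indep :: "'a::comm_ring_1 set => 'a set => 'a list => bool" where
 "indep K P as \<longleftrightarrow> (ALL E c. (ALL ks. c ks : K) & lincomb c as E : P -->
   (ALL ks:box (length as) E. c ks = 0))"

lemma indepD:
 "indep K P as ==> (!!ks. c ks : K) ==> lincomb c as E : P ==>
  ks : box (length as) E ==> c ks = 0" unfolding indep_def by blast

lemma indep_antimono: "indep K P as ==> P' <= P ==> indep K P' as" unfolding indep_def by blast

lemma indep_Nil: assumes K: "is_subfield K" and A: "is_subring A" "K <= A" and P: "is_prime A P" shows "indep K P []" unfolding indep_def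
proof(intro allI impI ballI)
 fix E c ks assume h: "(ALL ks. c ks : K) & (SUM ks:box (length []) E. c ks * mono_eval [] ks) : P" and "ks : box (length []) E"
 hence ks: "ks = []" and "c [] : P" by auto
 have "c [] = 0"
 proof(rule ccontr)
  assume "c [] ~= 0"
  moreover have "inverse (c []) * c [] : P"
   using K h A \<open>c [] : P\<close> by(intro ideal_mult[OF prime_ideal[OF P]]) (auto simp: is_subfield_def)
  ultimately show False using P by(simp add: is_prime_def)
 qed
 thus "c ks = 0" using ks by simp
qed

text \<open>A polynomial relation modulo the smaller prime yields, after cancelling the largest
 possible power of \<open>b\<close>, a relation for \<open>as\<close> modulo the larger one.\<close>

lemma indep_Cons_chain: assumes A: "is_subring A" and K: "K <= A" and P: "is_prime A P" and Q: "is_prime A Q" "P <= Q"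
  and b: "b : Q" "b ~: P" and as: "set as <= A" "indep K Q as" shows "indep K P (b # as)" unfolding indep_def
proof(intro allI impI ballI)
 fix E c ks assume h: "(ALL ks. c ks : K) & lincomb c (b # as) E : P" and ks: "ks : box (length (b # as)) E"
 have bA: "b : A" using b Q by(auto simp: is_prime_def is_ideal_def)
 define G where "G k = (SUM l:box (length as) E. c (k # l) * mono_eval as l)" for k
 have GA: "G k : A" for k unfolding G_def using h K as A by(auto intro!: subring_sum subring_mult mono_eval_in)
 have "lincomb c (b # as) E = (SUM k<=E. b ^ k * G k)" unfolding G_def by(simp add: sum_box_Suc sum_distrib_left mult_ac)
 hence rel: "(SUM k<=E. b ^ k * G k) : P" using h by simp
 have "c (k # l) = 0" if "k <= E" "l : box (length as) E" for k l using that
 proof(induction k arbitrary: l rule: less_induct)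
  case (less k)
  have G0: "G j = 0" if "j < k" for j unfolding G_def using less.IH[OF that] that less.prems by(auto intro!: sum.neutral)
  \<comment> \<open>The terms above \<open>k\<close> divided by \<open>b ^ Suc k\<close>; after
    cancelling \<open>b ^ k\<close> modulo \<open>P\<close> they contribute a multiple of
    \<open>b\<close>, which vanishes modulo \<open>Q\<close>.\<close>
  define H where "H = (SUM j:{Suc k..E}. b ^ (j - k - 1) * G j)"
  have HA: "H : A" unfolding H_def using GA bA A by(auto intro!: subring_sum subring_mult subring_power)
  have "{..E} = {..<k} Un {k..E}" using less.prems by auto
  hence "(SUM j<=E. b ^ j * G j) = (SUM j:{..<k}. b ^ j * G j) + (SUM j:{k..E}. b ^ j * G j)" by(subst sum.union_disjoint[symmetric]) auto
  also have "(SUM j:{..<k}. b ^ j * G j) = 0" using G0 by(auto intro!: sum.neutral)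
  also have "(SUM j:{k..E}. b ^ j * G j) = b ^ k * G k + (SUM j:{Suc k..E}. b ^ j * G j)" using less.prems by(simp add: sum.atLeast_Suc_atMost)
  also have "(SUM j:{Suc k..E}. b ^ j * G j) = b ^ k * (b * H)"
  proof -
   have "b ^ j = b ^ k * (b * b ^ (j - k - 1))" if "Suc k <= j" for j
    using that by(metis Suc_diff_Suc Suc_le_eq diff_Suc_1 le_add_diff_inverse less_imp_le power_Suc power_add diff_diff_left add.commute plus_1_eq_Suc)
   thus ?thesis unfolding H_def sum_distrib_left by(intro sum.cong) (auto simp: mult_ac)
  qed
  finally have "b ^ k * (G k + b * H) : P" using rel by(simp add: algebra_simps)
  moreover have "b ^ k ~: P" using prime_power[OF P A bA] b(2) by blast
  ultimately have "G k + b * H : Q" using P Q(2) GA HA bA A unfolding is_prime_def by(blast intro: subring_power subring_add subring_mult)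
  moreover have "H * b : Q" by(rule ideal_mult[OF prime_ideal[OF Q(1)] HA b(1)])
  ultimately have "(G k + b * H) - H * b : Q" by(rule ideal_diff[OF A prime_ideal[OF Q(1)]])
  hence "G k : Q" by(simp add: algebra_simps)
  thus ?case unfolding G_def using h less.prems by(intro indepD[OF as(2), of "%l. c (k # l)"]) auto
 qed
 thus "c ks = 0" using ks by(auto simp: box_Suc)
qed

text \<open>At each inclusion some element of the larger prime lies outside the smaller one and can
  be put in front of the list. A chain of length \<open>m\<close> thus forces \<open>m\<close>
  further independent elements.\<close>

lemma indep_chain: assumes A: "is_subring A" and K: "K <= A" and as: "set as <= A" shows "prime_chain A m C ==> indep K (C m) as ==>
  EX bs. length bs = m & set bs <= A & indep K (C 0) (bs @ as)"
proof(induction m arbitrary: C)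
 case (Suc m)
 have "prime_chain A m (%i. C (Suc i))" using Suc.prems(1) by(auto simp: prime_chain_def)
 then obtain bs where bs: "length bs = m" "set bs <= A" "indep K (C (Suc 0)) (bs @ as)" using Suc.IH[of "%i. C (Suc i)"] Suc.prems(2) by auto
 have C: "is_prime A (C 0)" "is_prime A (C (Suc 0))" "C 0 \<subset> C (Suc 0)" using Suc.prems(1) by(auto simp: prime_chain_def)
 then obtain b where b: "b : C (Suc 0)" "b ~: C 0" by blast
 hence "b : A" using C by(auto simp: is_prime_def is_ideal_def)
 moreover have "indep K (C 0) (b # (bs @ as))" using C b bs as by(intro indep_Cons_chain[OF A K C(1,2)]) auto
 ultimately show ?case using bs by(intro exI[of _ "b # bs"]) auto
qed auto

definition spanned :: "'a::comm_ring_1 set => 'a list => nat => 'a set" where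
 "spanned K as E = {SUM ks:box (length as) E. c ks * mono_eval as ks | c. ALL ks. c ks : K}"

lemma spannedI:
 "(!!ks. c ks : K) ==> lincomb c as E : spanned K as E" unfolding spanned_def by blast

lemma spanned_mono: assumes K: "is_subring K" and "E <= E'" shows "spanned K as E <= spanned K as E'"
proof
 fix z assume "z : spanned K as E"
 then obtain c where c: "ALL ks. c ks : K" "z = lincomb c as E" by(auto simp: spanned_def)
 let ?c = "%ks. if ks : box (length as) E then c ks else 0"
 have "z = (SUM ks:box (length as) E'. ?c ks * mono_eval as ks)" unfolding c(2) using box_mono[OF assms(2)] by(intro sum.mono_neutral_cong_left) auto
 thus "z : spanned K as E'" using c(1) subring_0[OF K] by(auto intro!: spannedI)
qed

lemma poly_eq_sum_box:
 fixes a :: "'a::comm_ring_1" assumes dE: "degree p <= E"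
  and c: "!!i. i <= degree p ==> coeff p i = (SUM ks:box (length as) E. c i ks * mono_eval as ks)" shows "poly p a = (SUM ks:box (length (a # as)) E.
  (case ks of [] => 0 | k # l => (if k <= degree p then c k l else 0)) * mono_eval (a # as) ks)"
proof -
 have "poly p a = (SUM i<=E. coeff p i * a ^ i)" unfolding poly_altdef
 proof(rule sum.mono_neutral_left)
  show "ALL i:{..E} - {..degree p}. coeff p i * a ^ i = 0" by(auto simp: coeff_eq_0)
 qed (use dE in auto)
 also have "... = (SUM i<=E. SUM ks:box (length as) E. (if i <= degree p then c i ks else 0) * (a ^ i * mono_eval as ks))"
 proof(intro sum.cong refl)
  fix i
  show "coeff p i * a ^ i = (SUM ks:box (length as) E. (if i <= degree p then c i ks else 0) * (a ^ i * mono_eval as ks))"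
  proof(cases "i <= degree p")
   case True
   thus ?thesis unfolding c[OF True] sum_distrib_right by(simp add: mult_ac)
  qed (simp add: coeff_eq_0)
 qed
 finally show ?thesis by(simp add: sum_box_Suc)
qed

lemma adjoins_eq_spanned: assumes K: "is_subring K" shows "adjoins K as = (\<Union>E. spanned K as E)"
proof
 show "(\<Union>E. spanned K as E) <= adjoins K as" using adjoins_subring[OF K, of as] adjoins_superset[OF K, of as] adjoins_generators[OF K, of as]
  by(auto simp: spanned_def intro!: subring_sum subring_mult mono_eval_in)
 show "adjoins K as <= (\<Union>E. spanned K as E)"
 proof(induction as)
  case Nil
  have "z : spanned K [] 0" if "z : K" for z using that unfolding spanned_def by(auto intro!: exI[of _ "%_. z"])
  thus ?case by auto
 next
  case (Cons a as)
  show ?case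
  proof
   fix z assume "z : adjoins K (a # as)"
   then obtain p where p: "!!i. coeff p i : adjoins K as" "z = poly p a" by(auto simp: adjoin1_def polys_over_def)
   hence "ALL i. EX E. coeff p i : spanned K as E" using Cons by blast
   then obtain e where e: "!!i. coeff p i : spanned K as (e i)" by metis
   define E where "E = Max (insert (degree p) (e ` {..degree p}))"
   have eE: "e i <= E" if "i <= degree p" for i unfolding E_def using that by(intro Max_ge) auto
   have dE: "degree p <= E" unfolding E_def by(intro Max_ge) auto
   have "coeff p i : spanned K as E" if "i <= degree p" for i using e[of i] spanned_mono[OF K eE[OF that], of as] by blast
   hence "ALL i. EX c. i <= degree p --> (ALL ks. c ks : K) &
     coeff p i = lincomb c as E" unfolding spanned_def by blast
   then obtain c where c: "!!i ks. i <= degree p ==> c i ks : K"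
    "!!i. i <= degree p ==> coeff p i = (SUM ks:box (length as) E. c i ks * mono_eval as ks)" by metis
   let ?d = "%ks. case ks of [] => 0 | k # l => (if k <= degree p then c k l else 0)"
   have "z = (SUM ks:box (length (a # as)) E. ?d ks * mono_eval (a # as) ks)" unfolding p(2) by(rule poly_eq_sum_box[OF dE c(2)])
   moreover have "?d ks : K" for ks using c(1) subring_0[OF K] by(auto split: list.split)
   ultimately show "z : (\<Union>E. spanned K (a # as) E)" unfolding spanned_def by blast
  qed
 qed
qed

lemma adjoins_uniform_spanned: assumes K: "is_subring K" and "finite S" and "!!x. x : S ==> f x : adjoins K as"
 shows "EX E. ALL E'>=E. ALL x:S. f x : spanned K as E'"
proof -
 have "ALL x. EX E. x : S --> f x : spanned K as E" using assms(3) adjoins_eq_spanned[OF K] by blast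
 then obtain e where e: "!!x. x : S ==> f x : spanned K as (e x)" by metis
 have "f x : spanned K as E'" if "Max (insert 0 (e ` S)) <= E'" "x : S" for x E'
 proof -
  have "e x <= Max (insert 0 (e ` S))" using assms(2) that by(intro Max_ge) auto
  thus ?thesis using e[OF that(2)] spanned_mono[OF K, of "e x" E' as] that(1) by auto
 qed
 thus ?thesis by blast
qed

lemma indep_Cons: assumes K: "is_subring K" and as: "indep K {0} (a # as)" shows "indep K {0} as" "transcendental (adjoins K as) a"
proof -
 show "indep K {0} as" unfolding indep_def
 proof(intro allI impI ballI)
  fix E c ks assume h: "(ALL ks. c ks : K) & lincomb c as E : {0}" and ks: "ks : box (length as) E"
  let ?d = "%ks. case ks of [] => 0 | k # l => (if k = 0 then c l else 0)"
  have "(SUM ks:box (length (a # as)) E. ?d ks * mono_eval (a # as) ks)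
    = (SUM k<=E. if k = 0 then lincomb c as E else 0)" unfolding list.size add_Suc_right add_0_right sum_box_Suc
  proof(rule sum.cong[OF refl])
   fix k
   show "(SUM ks:box (length as) E. ?d (k # ks) * mono_eval (a # as) (k # ks))
     = (if k = 0 then lincomb c as E else 0)" by(cases "k = 0") simp_all
  qed
  also have "... = 0" using h by simp
  finally have "?d (0 # ks) = 0" using h ks subring_0[OF K] by(intro indepD[OF as, of ?d E]) (auto split: list.split simp: box_Suc)
  thus "c ks = 0" by simp
 qed
 show "transcendental (adjoins K as) a" unfolding transcendental_def
 proof(intro ballI impI)
  fix p assume p: "p : polys_over (adjoins K as)" "poly p a = 0"
  obtain E0 where E0: "!!E i. E0 <= E ==> i <= degree p ==> coeff p i : spanned K as E"
   using adjoins_uniform_spanned[OF K, of "{..degree p}" "coeff p" as] p(1) by(auto simp: polys_over_def)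
  define E where "E = max E0 (degree p)"
  have "ALL i. EX c. i <= degree p --> (ALL ks. c ks : K) &
    coeff p i = lincomb c as E" using E0[of E] unfolding spanned_def E_def by fastforce
  then obtain c where c: "!!i ks. i <= degree p ==> c i ks : K"
   "!!i. i <= degree p ==> coeff p i = (SUM ks:box (length as) E. c i ks * mono_eval as ks)" by metis
  let ?d = "%ks. case ks of [] => 0 | k # l => (if k <= degree p then c k l else 0)"
  have z: "(SUM ks:box (length (a # as)) E. ?d ks * mono_eval (a # as) ks) = 0" using poly_eq_sum_box[of p E c as a] c(2) p(2) by(simp add: E_def)
  have dK: "?d ks : K" for ks using c(1) subring_0[OF K] by(auto split: list.split)
  have "c i ks = 0" if "i <= degree p" "ks : box (length as) E" for i ks
  proof -
   have "?d (i # ks) = 0" using z that dK by(intro indepD[OF as, of ?d E]) (auto simp: box_Suc E_def)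
   thus ?thesis using that by simp
  qed
  hence "coeff p i = 0" if "i <= degree p" for i using c(2)[OF that] that by(simp add: sum.neutral)
  thus "p = 0" by(meson le_refl leading_coeff_0_iff)
 qed
qed

text \<open>Elimination of one unknown together with one equation. Entries and solution stay in the
  set \<open>K\<close>, which is a subfield and not a type.\<close>

lemma linear_system: assumes K: "is_subfield (K :: 'a::field set)" and "finite Y" and "finite S" "card Y < card S" and "!!x y. N x y : K"
 shows "EX c. (ALL x. c x : K) & (EX x:S. c x ~= 0) & (ALL y:Y. (SUM x:S. c x * N x y) = 0)" using assms(2-5)
proof(induction Y arbitrary: S N rule: finite_induct)
 case empty
 then obtain x where "x : S" by fastforce
 moreover have "1 : K" using K by(auto simp: is_subfield_def intro: subring_1)
 ultimately show ?case by(intro exI[of _ "%_. 1"]) auto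
next
 case (insert y0 Y)
 have KS: "is_subring K" using K by(simp add: is_subfield_def)
 show ?case
 proof(cases "EX x0:S. N x0 y0 ~= 0")
  case False
  obtain c where "(ALL x. c x : K)" "(EX x:S. c x ~= 0)" "(ALL y:Y. (SUM x:S. c x * N x y) = 0)"
   using insert.IH[of S N] insert.prems insert.hyps by auto
  moreover have "(SUM x:S. c x * N x y0) = 0" using False by(intro sum.neutral) auto
  ultimately show ?thesis by(intro exI[of _ c]) auto
 next
  case True
  then obtain x0 where x0: "x0 : S" "N x0 y0 ~= 0" by blast
  \<comment> \<open>The system left after the pivot \<open>N x0 y0\<close> has cleared the equation
    \<open>y0\<close>.\<close>
  define N' where "N' x y = N x y - N x y0 * inverse (N x0 y0) * N x0 y" for x y
  have "EX c. (ALL x. c x : K) & (EX x:S - {x0}. c x ~= 0) & (ALL y:Y. (SUM x:S - {x0}. c x * N' x y) = 0)"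
  proof(rule insert.IH)
   show "card Y < card (S - {x0})" using insert.prems insert.hyps x0 by simp
   show "N' x y : K" for x y unfolding N'_def using K insert.prems(3) by(intro subring_diff subring_mult KS) (auto simp: is_subfield_def)
  qed (use insert.prems in auto)
  then obtain c where c: "!!x. c x : K" "EX x:S - {x0}. c x ~= 0" "!!y. y : Y ==> (SUM x:S - {x0}. c x * N' x y) = 0" by blast
  define s where "s = (SUM x:S - {x0}. c x * N x y0)"
  \<comment> \<open>The equation \<open>y0\<close> determines the value at the pivot unknown
    \<open>x0\<close>.\<close>
  define d where "d x = (if x = x0 then - (s * inverse (N x0 y0)) else c x)" for x
  have sumd: "(SUM x:S. d x * N x y) = (SUM x:S - {x0}. c x * N x y) - s * inverse (N x0 y0) * N x0 y" for y
  proof -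
   have "(SUM x:S. d x * N x y) = d x0 * N x0 y + (SUM x:S - {x0}. d x * N x y)" using x0(1) insert.prems(1) by(rule sum.remove[rotated])
   also have "(SUM x:S - {x0}. d x * N x y) = (SUM x:S - {x0}. c x * N x y)" by(intro sum.cong) (auto simp: d_def)
   finally show ?thesis by(simp add: d_def)
  qed
  have "(SUM x:S. d x * N x y) = 0" if "y : insert y0 Y" for y
  proof(cases "y = y0")
   case True
   thus ?thesis unfolding sumd using x0(2) by(simp add: s_def)
  next
   case False
   hence "(SUM x:S - {x0}. c x * N' x y) = 0" using c(3) that by simp
   moreover have "(SUM x:S - {x0}. c x * N' x y) = (SUM x:S - {x0}. c x * N x y) - s * inverse (N x0 y0) * N x0 y"
    unfolding s_def N'_def by(simp add: algebra_simps sum_subtractf sum_distrib_left sum_distrib_right)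
   ultimately show ?thesis unfolding sumd by simp
  qed
  moreover have "d x : K" for x
   using K KS c(1) insert.prems(3) by(auto simp: d_def s_def is_subfield_def intro!: subring_uminus subring_mult subring_sum)
  moreover have "EX x:S. d x ~= 0" using c(2) by(auto simp: d_def)
  ultimately show ?thesis by blast
 qed
qed

lemma spanned_sum: assumes K: "is_subring K" and "!!x. x : S ==> f x : spanned K as E" shows "sum f S : spanned K as E"
proof -
 have "ALL x. EX c. x : S --> (ALL ks. c ks : K) & f x = lincomb c as E" using assms(2) unfolding spanned_def by blast
 then obtain c where c: "!!x ks. x : S ==> c x ks : K"
  "!!x. x : S ==> f x = (SUM ks:box (length as) E. c x ks * mono_eval as ks)" by metis
 have "sum f S = (SUM ks:box (length as) E. (SUM x:S. c x ks) * mono_eval as ks)" using c(2) by(simp add: sum_distrib_right sum.swap[of _ S])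
 thus ?thesis using c(1) K by(auto intro!: spannedI subring_sum)
qed

lemma mono_eval_add:
 "length ks = length as ==> length ls = length as ==>
  mono_eval as ks * mono_eval as ls = mono_eval (as :: 'a::comm_ring_1 list) (map2 (+) ks ls)"
proof(induction as arbitrary: ks ls)
 case (Cons a as)
 then obtain k ks' l ls' where "ks = k # ks'" "ls = l # ls'" by(metis length_Suc_conv)
 thus ?case using Cons.IH[of ks' ls', symmetric] Cons.prems by(simp add: power_add mult_ac)
qed simp

lemma box_add: "ks : box n E ==> ls : box n E' ==> map2 (+) ks ls : box n (E + E')"
 by(fastforce simp: box_def dest: set_zip_leftD set_zip_rightD intro: add_mono)

lemma spanned_mult: assumes K: "is_subring K" and "x : spanned K as E" "y : spanned K as E'" shows "x * y : spanned K as (E + E')"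
proof -
 obtain c d where c: "ALL ks. c ks : K" "x = lincomb c as E" and d: "ALL ks. d ks : K" "y = lincomb d as E'"
  using assms(2,3) by(auto simp: spanned_def)
 have "x * y = (SUM ks:box (length as) E. SUM ls:box (length as) E'. (c ks * d ls) * (mono_eval as ks * mono_eval as ls))"
  unfolding c(2) d(2) sum_product by(intro sum.cong refl) (simp add: mult_ac)
 moreover have "(c ks * d ls) * (mono_eval as ks * mono_eval as ls) : spanned K as (E + E')"
  if h: "ks : box (length as) E" "ls : box (length as) E'" for ks ls
 proof -
  let ?m = "map2 (+) ks ls"
  have "(c ks * d ls) * (mono_eval as ks * mono_eval as ls)
   = (SUM ms:box (length as) (E + E'). (if ms = ?m then c ks * d ls else 0) * mono_eval as ms)"
  proof -
   have "length ks = length as" "length ls = length as" using h by(auto simp: box_def)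
   thus ?thesis using box_add[OF h] by(simp add: mono_eval_add if_distrib[of "%t. t * _"] cong: if_cong)
  qed
  thus ?thesis using c(1) d(1) K by(auto intro!: spannedI subring_mult subring_0)
 qed
 ultimately show ?thesis by(auto intro!: spanned_sum[OF K])
qed

text \<open>Comparison of the number of monomials of bounded degree in \<open>as\<close> with the dimension of
 the space they lie in.\<close>

lemma indep_length_le: assumes K: "is_subfield (K :: 'a::field set)" and A: "is_subring A" "K <= A" and W: "finite W" "W <= A"
  and span: "!!a. a : A ==> EX c. (ALL w. c w : adjoins K ths) & a = (SUM w:W. c w * w)" and as: "set as <= A" "indep K {0} as"
 shows "length as <= length ths"
proof(rule ccontr)
 have KS: "is_subring K" using K by(simp add: is_subfield_def)
 \<comment> \<open>A filtration of \<open>A\<close> by the degree of the coefficients: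
   \<open>V E\<close> is spanned by \<open>card W * (E + 1) ^ length ths\<close> products.\<close>
 define V where "V E = {SUM w:W. c w * w | c. ALL w. c w : spanned K ths E}" for E
 have VI: "(SUM w:W. c w * w) : V E" if "!!w. c w : spanned K ths E" for c E unfolding V_def using that by blast
 have V_ex: "EX E. ALL E'>=E. a : V E'" if a: "a : A" for a
 proof -
  obtain c where c: "ALL w. c w : adjoins K ths" "a = (SUM w:W. c w * w)" using span[OF a] by blast
  obtain E where E: "ALL E'>=E. ALL w:W. c w : spanned K ths E'" using adjoins_uniform_spanned[OF KS W(1), of c ths] c(1) by blast
  have "0 : spanned K ths E'" for E' using spanned_sum[OF KS, of "{}" "%_. 0" ths E'] by simp
  hence "a : V E'" if "E <= E'" for E' using E that c(2) unfolding V_def by(intro CollectI exI[of _ "%w. if w : W then c w else 0"]) auto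
  thus ?thesis by blast
 qed
 have "EX e. ALL x:S. x : V e" if "finite S" "S <= A" for S
 proof -
  have "ALL x. EX E. x : S --> (ALL E'>=E. x : V E')" using V_ex that(2) by blast
  then obtain f where f: "!!x E'. x : S ==> f x <= E' ==> x : V E'" by metis
  have "x : V (Max (f ` S))" if "x : S" for x using f[OF that] Max_ge[of "f ` S" "f x"] that \<open>finite S\<close> by auto
  thus ?thesis by blast
 qed
 note * = this
 have "finite (insert 1 ((%(a, w). a * w) ` (set as \<times> W)))" using W by auto
 moreover have "insert 1 ((%(a, w). a * w) ` (set as \<times> W)) <= A" using A as W by(auto intro!: subring_mult subring_1)
 \<comment> \<open>A single \<open>e\<close> bounds how far multiplication by any member of
   \<open>as\<close> raises the filtration, so monomials with exponents up to \<open>E\<close> land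
   in a piece whose index grows linearly in \<open>E\<close>.\<close>
 ultimately obtain e where e: "1 : V e" "!!a w. a : set as ==> w : W ==> a * w : V e"
  using *[of "insert 1 ((%(a, w). a * w) ` (set as \<times> W))"] by auto
 have Vsum: "sum f S : V E" if "!!x. x : S ==> f x : V E" for f and S :: "'a set" and E
 proof -
  have "ALL x. EX c. x : S --> (ALL w. c w : spanned K ths E) & f x = (SUM w:W. c w * w)" using that unfolding V_def by blast
  then obtain c where c: "!!x w. x : S ==> c x w : spanned K ths E" "!!x. x : S ==> f x = (SUM w:W. c x w * w)" by metis
  have "sum f S = (SUM w:W. (SUM x:S. c x w) * w)" using c(2) by(simp add: sum_distrib_right sum.swap[of _ S])
  moreover have "(SUM x:S. c x w) : spanned K ths E" for w by(rule spanned_sum[OF KS c(1)])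
  ultimately show ?thesis using VI[of "%w. SUM x:S. c x w" E] by simp
 qed
 have Vmult: "a * v : V (E + e)" if a: "a : set as" and v: "v : V E" for a v E
 proof -
  obtain c where c: "ALL w. c w : spanned K ths E" "v = (SUM w:W. c w * w)" using v by(auto simp: V_def)
  have "c w * (a * w) : V (E + e)" if w: "w : W" for w
  proof -
   obtain d where d: "ALL x. d x : spanned K ths e" "a * w = (SUM x:W. d x * x)" using e(2)[OF a w] by(auto simp: V_def)
   have "c w * (a * w) = (SUM x:W. (c w * d x) * x)" unfolding d(2) by(simp add: sum_distrib_left mult_ac)
   moreover have "c w * d x : spanned K ths (E + e)" for x using c(1) d(1) by(intro spanned_mult[OF KS]) auto
   ultimately show ?thesis using VI[of "%x. c w * d x" "E + e"] by simp
  qed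
  hence "(SUM w:W. c w * (a * w)) : V (E + e)" by(rule Vsum)
  thus ?thesis unfolding c(2) by(simp add: sum_distrib_left mult_ac)
 qed
 have Vpow: "a ^ k * v : V (E + e * k)" if "a : set as" "v : V E" for a v E k
 proof(induction k)
  case (Suc k)
  thus ?case using Vmult[OF that(1) Suc] by(simp add: mult_ac add_ac)
 qed (use that in simp)
 have Vmono: "mono_eval bs ks : V (e + e * sum_list ks)" if "set bs <= set as" "length ks = length bs" for bs ks using that
 proof(induction bs ks rule: mono_eval.induct)
  case (1 b bs k ks)
  thus ?case using Vpow[of b "mono_eval bs ks" "e + e * sum_list ks" k] by(simp add: algebra_simps)
 qed (use e(1) in auto)
 have Vle: "V E <= V E'" if "E <= E'" for E E' using spanned_mono[OF KS that, of ths] unfolding V_def by blast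
 let ?n = "length ths" and ?m = "length as"
 assume "~ ?m <= ?n"
 hence nm: "Suc ?n <= ?m" by simp
 \<comment> \<open>\<open>F\<close> will be the index reached by all monomials with exponents up to
   \<open>E\<close>. The choice gives \<open>F + 1 <= C * (E + 1)\<close> and
   \<open>card W * C ^ ?n < E + 1\<close>, so that the \<open>(E + 1) ^ ?m\<close> monomials
   outnumber the coordinates, which are indexed by \<open>W \<times> box ?n F\<close>.\<close>
 define C where "C = e * ?m + e + 1"
 define E where "E = (card W + 1) * C ^ ?n"
 define F where "F = e + e * (?m * E)"
 have mV: "mono_eval as ks : V F" if "ks : box ?m E" for ks
 proof -
  have "sum_list ls <= length ls * E" if "set ls <= {..E}" for ls using that by(induction ls) auto
  from this[of ks] have "sum_list ks <= ?m * E" using that by(simp add: box_def)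
  hence "e + e * sum_list ks <= F" by(simp add: F_def)
  thus ?thesis using Vmono[of as ks] Vle that by(auto simp: box_def)
 qed
 have "ALL ks. EX d. ks : box ?m E --> (ALL w ls. d w ls : K) &
   mono_eval as ks = (SUM w:W. SUM ls:box ?n F. d w ls * mono_eval ths ls * w)"
 proof(intro allI)
  fix ks
  show "EX d. ks : box ?m E --> (ALL w ls. d w ls : K) &
   mono_eval as ks = (SUM w:W. SUM ls:box ?n F. d w ls * mono_eval ths ls * w)"
  proof(cases "ks : box ?m E")
   case True
   then obtain c where c: "ALL w. c w : spanned K ths F" "mono_eval as ks = (SUM w:W. c w * w)" using mV by(auto simp: V_def)
   hence "ALL w. EX d. (ALL ls. d ls : K) & c w = (SUM ls:box ?n F. d ls * mono_eval ths ls)" unfolding spanned_def by blast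
   then obtain d where "!!w ls. d w ls : K" "!!w. c w = (SUM ls:box ?n F. d w ls * mono_eval ths ls)" by metis
   thus ?thesis using c(2) by(intro exI[of _ d]) (simp add: sum_distrib_right)
  qed simp
 qed
 from choice[OF this] obtain d where d0: "ALL ks. ks : box ?m E --> (ALL w ls. d ks w ls : K) &
   mono_eval as ks = (SUM w:W. SUM ls:box ?n F. d ks w ls * mono_eval ths ls * w)" ..
 hence d: "!!ks w ls. ks : box ?m E ==> d ks w ls : K"
  "!!ks. ks : box ?m E ==> mono_eval as ks = (SUM w:W. SUM ls:box ?n F. d ks w ls * mono_eval ths ls * w)" by simp_all
 define N where "N ks y = (if ks : box ?m E then d ks (fst y) (snd y) else 0)" for ks y
 have "card (W \<times> box ?n F) < card (box ?m E)"
 proof -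
  have "F + 1 <= C * (E + 1)" by(simp add: F_def C_def algebra_simps)
  hence "(F + 1) ^ ?n <= C ^ ?n * (E + 1) ^ ?n" by(metis power_mono zero_le power_mult_distrib)
  hence "card W * (F + 1) ^ ?n <= card W * C ^ ?n * (E + 1) ^ ?n" by(simp add: mult.assoc mult_left_mono)
  also have "... < (E + 1) * (E + 1) ^ ?n" by(intro mult_strict_right_mono) (auto simp: E_def)
  also have "... <= (E + 1) ^ ?m" using power_increasing[OF nm, of "E + 1"] by simp
  finally show ?thesis using W(1) by(simp add: card_cartesian_product card_box)
 qed
 moreover have "N x y : K" for x y using d(1) subring_0[OF KS] by(simp add: N_def)
 ultimately obtain c where c: "ALL x. c x : K" "EX x:box ?m E. c x ~= 0"
  "ALL y:W \<times> box ?n F. (SUM x:box ?m E. c x * N x y) = 0" using linear_system[OF K, of "W \<times> box ?n F" "box ?m E" N] W(1) by auto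
 have "(SUM ks:box ?m E. c ks * mono_eval as ks)
   = (SUM ks:box ?m E. SUM y:W \<times> box ?n F. c ks * N ks y * (mono_eval ths (snd y) * fst y))"
  using d(2) by(intro sum.cong refl) (simp add: N_def sum.cartesian_product case_prod_unfold sum_distrib_left mult_ac)
 also have "... = (SUM y:W \<times> box ?n F. (SUM ks:box ?m E. c ks * N ks y) * (mono_eval ths (snd y) * fst y))"
  by(subst sum.swap) (simp add: sum_distrib_right)
 also have "... = 0" using c(3) by(intro sum.neutral) auto
 finally have "(SUM ks:box ?m E. c ks * mono_eval as ks) : {0}" by simp
 hence "ALL ks:box ?m E. c ks = 0" using indepD[OF as(2), of c E] c(1) by blast
 thus False using c(2) by blast
qed

section \<open>Local rings of polynomial rings\<close>

text \<open>As in Gauss's lemma: if the first coefficients outside \<open>p\<close> of two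
  polynomials stand at positions \<open>i\<close> and \<open>j\<close>, then the coefficient of
  their product at \<open>i + j\<close> is the product of these two modulo \<open>p\<close>.\<close>

lemma extended_prime:
 fixes R :: "'a::field set" assumes R: "is_subring R" and y: "transcendental R y" and p: "is_prime R p"
 shows "is_prime (adjoin1 R y) ((%q. poly q y) ` polys_over p)" unfolding is_prime_def
proof(intro conjI ballI impI)
 let ?P = "(%q. poly q y) ` polys_over p"
 have pR: "polys_over p <= polys_over R" using p by(intro polys_over_mono) (auto simp: is_prime_def is_ideal_def)
 show I: "is_ideal (adjoin1 R y) ?P" by(rule ideal_extend[OF R prime_ideal[OF p]])
 have mem: "poly q y : ?P \<longleftrightarrow> q : polys_over p" if "q : polys_over R" for q using transcendental_eq[OF R y that] pR by auto
 show "1 ~: ?P" using mem[OF polys_over_1[OF R]] p by(auto simp: polys_over_def is_prime_def)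
 fix a b assume "a : adjoin1 R y" "b : adjoin1 R y" and ab: "a * b : ?P"
 then obtain f g where f: "f : polys_over R" "a = poly f y" and g: "g : polys_over R" "b = poly g y" by(auto simp: adjoin1_def)
 have fg: "f * g : polys_over p" using ab mem[OF polys_over_mult[OF R f(1) g(1)]] f g by simp
 show "a : ?P | b : ?P"
 proof(rule ccontr)
  assume "~ (a : ?P | b : ?P)"
  hence "EX i. coeff f i ~: p" "EX i. coeff g i ~: p" using mem f g by(auto simp: polys_over_def)
  then obtain i j where i: "coeff f i ~: p" "!!k. k < i ==> coeff f k : p" and j: "coeff g j ~: p" "!!k. k < j ==> coeff g k : p"
   using exists_least_iff[of "%i. coeff f i ~: p"] exists_least_iff[of "%i. coeff g i ~: p"] by blast
  note pI = prime_ideal[OF p]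
  have cR: "coeff f k : R" "coeff g k : R" for k using f g by(auto simp: polys_over_def)
  have "coeff (f * g) (i + j) = (SUM k<=i + j. coeff f k * coeff g (i + j - k))" by(rule coeff_mult)
  also have "... = coeff f i * coeff g j
    + (SUM k:{..i + j} - {i}. coeff f k * coeff g (i + j - k))" by(subst sum.remove[of _ i]) auto
  finally have eq: "coeff f i * coeff g j = coeff (f * g) (i + j)
    - (SUM k:{..i + j} - {i}. coeff f k * coeff g (i + j - k))" by simp
  have "(SUM k:{..i + j} - {i}. coeff f k * coeff g (i + j - k)) : p"
  proof(rule ideal_sum[OF pI])
   fix k assume k: "k : {..i + j} - {i}"
   show "coeff f k * coeff g (i + j - k) : p"
   proof(cases "k < i")
    case True
    thus ?thesis using i(2) cR by(intro ideal_mult_right[OF pI]) auto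
   next
    case False
    hence "i + j - k < j" using k by auto
    thus ?thesis using j(2) cR by(intro ideal_mult[OF pI]) auto
   qed
  qed
  hence "coeff f i * coeff g j : p" unfolding eq using fg by(intro ideal_diff[OF R pI]) (auto simp: polys_over_def)
  thus False using p i(1) j(1) cR unfolding is_prime_def by blast
 qed
qed

lemma sat_sat: assumes A: "is_subring A" and P: "is_prime A P" and s: "s : A - P" and "s * z : sat A P J" shows "z : sat A P J"
proof -
 obtain t where t: "t : A - P" "t * (s * z) : J" using assms(4) by(auto simp: sat_def)
 hence "t * s : A - P" "t * s * z : J" using prime_mult_notin[OF P A] s by(auto simp: mult.assoc)
 thus ?thesis unfolding sat_def by blast
qed

lemma sat_ideal_inter: assumes A: "is_subring A" and P: "is_prime A P" and J: "is_ideal A J" shows "is_ideal A (sat A P J Int A)"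
 by(rule ideal_contract[OF sat_ideal[OF A P J] A sat_superset[OF A P]])

text \<open>The coefficients of \<open>q\<close> come with separate multipliers. They are treated
  one at a time, since \<open>sat\<close> cut down to the ring is an ideal.\<close>

lemma sat_extend:
 fixes R :: "'a::field set" assumes R: "is_subring R" and P: "is_prime (adjoin1 R y) P" and S: "S <= R"
  and q: "q : polys_over (sat R (P Int R) (ideal_gen R S) Int R)" shows "poly q y : sat (adjoin1 R y) P (ideal_gen (adjoin1 R y) S)"
proof -
 let ?B = "adjoin1 R y" let ?T = "sat ?B P (ideal_gen ?B S)"
 have B: "is_subring ?B" by(rule adjoin1_subring[OF R])
 have SB: "S <= ?B" using S adjoin1_superset[OF R] by blast
 have T: "is_ideal ?B (?T Int ?B)" by(intro sat_ideal_inter[OF B P] ideal_gen_ideal[OF B SB])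
 have sub: "ideal_gen R S <= ideal_gen ?B S" using ideal_contract[OF ideal_gen_ideal[OF B SB] R adjoin1_superset[OF R]] S ideal_gen_superset[of S ?B]
   ideal_gen_minimal[of R "ideal_gen ?B S Int R" S] by blast
 have "poly q y : ?T Int ?B" unfolding poly_altdef
 proof(rule ideal_sum[OF T])
  fix i
  have "coeff q i : sat R (P Int R) (ideal_gen R S) Int R" using q by(simp add: polys_over_def)
  then obtain s where s: "s : R - (P Int R)" "s * coeff q i : ideal_gen R S" "coeff q i : R" by(auto simp: sat_def)
  hence "s : ?B - P" "s * coeff q i : ideal_gen ?B S" "coeff q i : ?B" using adjoin1_superset[OF R] sub by auto
  hence "coeff q i : ?T Int ?B" by(auto simp: sat_def)
  thus "coeff q i * y ^ i : ?T Int ?B" by(rule ideal_mult_right[OF T subring_power[OF B adjoin1_generator[OF R]]])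
 qed
 thus ?thesis by simp
qed

text \<open>A prime ideal of a polynomial ring is built up one variable at a time: each variable either
 stays transcendental modulo the prime, or contributes one generator of minimal degree.\<close>

definition regular_prime :: "'a::comm_ring_1 set => 'a set => 'a set => 'a list => 'a list => bool" where
 "regular_prime K A P gs as \<longleftrightarrow> set gs <= P & set as <= A & indep K P as &
   P <= sat A P (ideal_gen A (set gs)) &
   (ALL j<length gs. ALL c:A. gs ! j * c : ideal_gen A (set (take j gs)) -->
    c : sat A P (ideal_gen A (set (take j gs))))"

text \<open>Let \<open>E\<close> be the extension of the contracted prime. If \<open>P = E\<close>,
  the new variable is independent modulo \<open>P\<close> and joins \<open>as\<close>. Otherwise a
  polynomial of least degree in \<open>P\<close> outside \<open>E\<close> joins \<open>gs\<close>;
  its leading coefficient becomes a unit after localization, so division by it reduces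
  \<open>P\<close> to \<open>E\<close>.\<close>

lemma regular_prime_step:
 fixes R :: "'a::field set" assumes K: "K <= R" and R: "is_subring R" and y: "transcendental R y" and P: "is_prime (adjoin1 R y) P"
  and reg: "regular_prime K R (P Int R) gs as"
 shows "EX gs' as'. length gs' + length as' = Suc (length gs + length as) & regular_prime K (adjoin1 R y) P gs' as'"
proof -
 let ?B = "adjoin1 R y" let ?p = "P Int R"
 define E where "E = (%q. poly q y) ` polys_over ?p"
 have B: "is_subring ?B" by(rule adjoin1_subring[OF R])
 have RB: "R <= ?B" by(rule adjoin1_superset[OF R])
 have yB: "y : ?B" by(rule adjoin1_generator[OF R])
 have p: "is_prime R ?p" by(rule prime_contract[OF P R RB])
 have PI: "is_ideal ?B P" by(rule prime_ideal[OF P])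
 have Epr: "is_prime ?B E" unfolding E_def by(rule extended_prime[OF R y p])
 have pR: "polys_over ?p <= polys_over R" by(rule polys_over_mono) auto
 have memE: "poly q y : E \<longleftrightarrow> q : polys_over ?p" if "q : polys_over R" for q
  using transcendental_eq[OF R y that] pR by(auto simp: E_def)
 have g: "set gs <= ?p" "set as <= R" "indep K ?p as" "?p <= sat R ?p (ideal_gen R (set gs))"
  "!!j c. j < length gs ==> c : R ==> gs ! j * c : ideal_gen R (set (take j gs)) ==>
    c : sat R ?p (ideal_gen R (set (take j gs)))" using reg by(auto simp: regular_prime_def)
 have gsR: "set gs <= R" using g(1) by auto
 have EP: "E <= P"
 proof
  fix u assume "u : E"
  then obtain q where q: "q : polys_over ?p" "u = poly q y" by(auto simp: E_def)
  show "u : P" unfolding q(2) poly_altdef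
   using q(1) subring_power[OF B yB] by(intro ideal_sum[OF PI] ideal_mult_right[OF PI]) (auto simp: polys_over_def)
 qed
 have Esat: "E <= sat ?B P (ideal_gen ?B (set gs))"
 proof
  fix u assume "u : E"
  then obtain q where q: "q : polys_over ?p" "u = poly q y" by(auto simp: E_def)
  hence "q : polys_over (sat R ?p (ideal_gen R (set gs)) Int R)" using g(4) by(auto simp: polys_over_def)
  thus "u : sat ?B P (ideal_gen ?B (set gs))" unfolding q(2) by(rule sat_extend[OF R P gsR])
 qed
 have gsE: "set gs <= E"
 proof
  fix x assume "x : set gs"
  hence "x : ?p" using g(1) by blast
  hence "[:x:] : polys_over ?p" using prime_zero_in[OF p] by(intro polys_over_const)
  thus "x : E" unfolding E_def by(auto intro!: image_eqI[of _ _ "[:x:]"])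
 qed
 have regB: "c : sat ?B P (ideal_gen ?B (set (take j gs)))"
  if j: "j < length gs" and c: "c : ?B" "gs ! j * c : ideal_gen ?B (set (take j gs))" for j c
 proof -
  have tR: "set (take j gs) <= R" using gsR set_take_subset[of j gs] by blast
  obtain q where q: "q : polys_over R" "c = poly q y" using c(1) by(auto simp: adjoin1_def)
  obtain r where r: "r : polys_over (ideal_gen R (set (take j gs)))" "gs ! j * c = poly r y" using c(2) ideal_gen_extend[OF R tR] by auto
  have I: "is_ideal R (ideal_gen R (set (take j gs)))" using R tR by(rule ideal_gen_ideal)
  have gj: "gs ! j : R" using gsR j by auto
  have "r : polys_over R" using r(1) polys_over_mono[of "ideal_gen R (set (take j gs))" R] I by(auto simp: is_ideal_def)
  moreover have "Polynomial.smult (gs ! j) q : polys_over R" using q(1) gj by(auto simp: polys_over_def intro: subring_mult[OF R])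
  ultimately have "Polynomial.smult (gs ! j) q = r" using r(2) q(2) by(intro transcendental_eq[OF R y]) auto
  hence "gs ! j * coeff q i : ideal_gen R (set (take j gs))" for i using r(1) by(auto simp: polys_over_def)
  hence "q : polys_over (sat R ?p (ideal_gen R (set (take j gs))) Int R)" using g(5)[OF j] q(1) by(auto simp: polys_over_def)
  thus ?thesis unfolding q(2) by(rule sat_extend[OF R P tR])
 qed
 have gsP: "set gs <= P" using g(1) by auto
 have asB: "set as <= ?B" using g(2) RB by blast
 show ?thesis
 proof(cases "P = E")
  case True
  have "indep K P (y # as)" unfolding indep_def
  proof(intro allI impI ballI)
   fix M c ks assume h: "(ALL ks. c ks : K) & lincomb c (y # as) M : P" and ks: "ks : box (length (y # as)) M"
   define G where "G k = (SUM l:box (length as) M. c (k # l) * mono_eval as l)" for k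
   have GR: "G k : R" for k unfolding G_def using h K g(2) R by(auto intro!: subring_sum subring_mult mono_eval_in)
   define q where "q = (SUM k<=M. Polynomial.monom (G k) k)"
   have qc: "coeff q i = (if i <= M then G i else 0)" for i unfolding q_def by(simp add: coeff_sum)
   hence qR: "q : polys_over R" using GR subring_0[OF R] by(auto simp: polys_over_def)
   have "poly q y = lincomb c (y # as) M"
    unfolding q_def G_def by(simp add: sum_box_Suc poly_sum poly_monom sum_distrib_left sum_distrib_right mult_ac)
   hence "q : polys_over ?p" using h True memE[OF qR] by simp
   hence "G k : ?p" if "k <= M" for k using qc[of k] that by(metis polys_over_coeff)
   hence "c (k # l) = 0" if "k <= M" "l : box (length as) M" for k l using that h unfolding G_def by(intro indepD[OF g(3), of "%l. c (k # l)"]) auto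
   thus "c ks = 0" using ks by(auto simp: box_Suc)
  qed
  hence "regular_prime K ?B P gs (y # as)" unfolding regular_prime_def using gsP asB yB Esat regB True by auto
  thus ?thesis by(intro exI[of _ gs] exI[of _ "y # as"]) simp
 next
  case False
  define D where "D q \<longleftrightarrow> q : polys_over R & poly q y : P & q ~: polys_over ?p" for q
  obtain u where u: "u : P" "u ~: E" using False EP by blast
  hence "u : ?B" using ideal_subset[OF PI] by blast
  hence "EX q. D q" using u memE by(auto simp: adjoin1_def D_def)
  then obtain q where q: "D q" "!!q'. D q' ==> degree q <= degree q'" using ex_has_least_nat[of D _ degree] by metis
  define h where "h = poly q y"
  define l where "l = lead_coeff q"
  have qR: "q : polys_over R" and hP: "h : P" using q(1) by(auto simp: D_def h_def)
  \<comment> \<open>Otherwise dropping the leading term would give a polynomial of smaller degree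
    with the same properties.\<close>
  have l: "l ~: ?p"
  proof
   assume lp: "l : ?p"
   let ?m = "Polynomial.monom l (degree q)"
   have m: "?m : polys_over ?p" using lp prime_zero_in[OF p] by(intro polys_over_monom) auto
   have "q - ?m : polys_over R" using qR m pR by(intro polys_over_diff[OF R]) auto
   moreover have "poly ?m y : P" using m EP memE pR by blast
   hence "poly (q - ?m) y : P" using hP ideal_diff[OF B PI] by(simp add: h_def)
   moreover have n: "q - ?m ~: polys_over ?p"
   proof
    assume "q - ?m : polys_over ?p"
    hence "coeff (q - ?m) i + coeff ?m i : ?p" for i using polys_over_coeff[OF m] polys_over_coeff by(intro ideal_add[OF prime_ideal[OF p]])
    hence "q : polys_over ?p" unfolding polys_over_def by simp
    thus False using q(1) by(simp add: D_def)
   qed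
   ultimately have "degree q <= degree (q - ?m)" using q(2) by(simp add: D_def)
   moreover have "coeff (q - ?m) i = 0" if "i >= degree q" for i using that by(cases "i = degree q") (auto simp: coeff_eq_0 l_def)
   ultimately have "q - ?m = 0" by(metis leading_coeff_0_iff)
   thus False using n prime_zero_in[OF p] by(simp add: polys_over_def)
  qed
  have lR: "l : R" using qR by(simp add: l_def polys_over_def)
  have hE: "h ~: E" using memE[OF qR] q(1) by(simp add: h_def D_def)
  let ?T = "sat ?B P (ideal_gen ?B (set (gs @ [h])))"
  have gB: "set (gs @ [h]) <= ?B" using gsP hP PI by(auto simp: is_ideal_def)
  have TI: "is_ideal ?B (?T Int ?B)" by(intro sat_ideal_inter[OF B P] ideal_gen_ideal[OF B gB])
  have ET: "E <= ?T" using Esat sat_mono[OF ideal_gen_mono[of "set gs" "set (gs @ [h])" ?B], of ?B P] by auto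
  have hT: "h : ?T Int ?B" using sat_superset[OF B P, of "ideal_gen ?B (set (gs @ [h]))"] ideal_gen_superset[of "set (gs @ [h])" ?B] gB by auto
  have "poly r y : ?T" if "r : polys_over R" "poly r y : P" for r using that
  proof(induction "degree r" arbitrary: r rule: less_induct)
   case less
   show ?case
   proof(cases "r : polys_over ?p")
    case True
    thus ?thesis using ET by(auto simp: E_def)
   next
    case False
    hence dq: "degree q <= degree r" using less.prems q(2) by(simp add: D_def)
    let ?d = "degree r" let ?k = "degree r - degree q"
    define m where "m = Polynomial.monom (lead_coeff r) ?k"
    \<comment> \<open>Pseudo-division: only \<open>l * r\<close> is reduced, which suffices because
      \<open>l\<close> lies outside \<open>P\<close>.\<close>
    define r' where "r' = Polynomial.smult l r - m * q"
    have mR: "m : polys_over R" unfolding m_def using less.prems(1) subring_0[OF R] by(intro polys_over_monom) (auto simp: polys_over_def)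
    have "Polynomial.smult l r : polys_over R" using less.prems(1) lR by(auto simp: polys_over_def intro: subring_mult[OF R])
    hence r'R: "r' : polys_over R" unfolding r'_def by(intro polys_over_diff[OF R] polys_over_mult[OF R] mR qR)
    have mB: "poly m y : ?B" using mR by(rule adjoin1_I)
    have r'y: "poly r' y = l * poly r y - poly m y * h" by(simp add: r'_def h_def)
    have lB: "l : ?B" using lR RB by blast
    have "poly r' y : P" unfolding r'y by(intro ideal_diff[OF B PI] ideal_mult[OF PI lB] ideal_mult[OF PI mB] less.prems hP)
    have coe: "coeff r' i = 0" if "i >= ?d" for i
    proof(cases "i = ?d")
     case True
     thus ?thesis using dq by(simp add: r'_def m_def coeff_monom_mult l_def)
    next
     case False
     hence "?d < i" "degree q < i - ?k" using that dq by auto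
     thus ?thesis by(simp add: r'_def m_def coeff_monom_mult coeff_eq_0)
    qed
    have "poly r' y : ?T"
    proof(cases "r' = 0")
     case True
     thus ?thesis using ideal_0[OF TI] by simp
    next
     case False
     hence "degree r' < ?d" using coe by(metis leading_coeff_0_iff not_less)
     thus ?thesis using less.hyps[OF _ r'R] \<open>poly r' y : P\<close> by blast
    qed
    hence "poly r' y : ?T Int ?B" using adjoin1_I[OF r'R] by blast
    hence "poly r' y + poly m y * h : ?T Int ?B" by(rule ideal_add[OF TI _ ideal_mult[OF TI mB hT]])
    hence "l * poly r y : ?T" by(simp add: r'y)
    moreover have "l : ?B - P" using l lR lB by auto
    ultimately show ?thesis using sat_sat[OF B P] by blast
   qed
  qed
  hence PT: "P <= ?T" using PI by(force simp: is_ideal_def adjoin1_def)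
  \<comment> \<open>Locally, \<open>h\<close> is a nonzerodivisor modulo \<open>gs\<close>: the
    ideal \<open>E\<close> is prime, omits \<open>h\<close>, and agrees with the ideal of
    \<open>gs\<close> up to multipliers outside \<open>P\<close>.\<close>
  have regh: "c : sat ?B P (ideal_gen ?B (set gs))" if c: "c : ?B" "h * c : ideal_gen ?B (set gs)" for c
  proof -
   have "ideal_gen ?B (set gs) <= E" by(rule ideal_gen_minimal[OF prime_ideal[OF Epr] gsE])
   hence "h * c : E" using c(2) by blast
   moreover have "h : ?B" using hP PI by(auto simp: is_ideal_def)
   ultimately have "c : E" using c(1) hE Epr by(auto simp: is_prime_def)
   thus ?thesis using Esat by blast
  qed
  have "c : sat ?B P (ideal_gen ?B (set (take j (gs @ [h]))))"
   if "j < length (gs @ [h])" "c : ?B" "(gs @ [h]) ! j * c : ideal_gen ?B (set (take j (gs @ [h])))" for j c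
   using that regB[of j c] regh[of c] by(cases "j < length gs") (auto simp: nth_append not_less)
  moreover have "indep K P as" unfolding indep_def
  proof(intro allI impI ballI)
   fix M c ks assume hh: "(ALL ks. c ks : K) & lincomb c as M : P" and ks: "ks : box (length as) M"
   have "lincomb c as M : R" using hh K g(2) R by(auto intro!: subring_sum subring_mult mono_eval_in)
   thus "c ks = 0" using hh ks by(intro indepD[OF g(3), of c M]) auto
  qed
  ultimately have "regular_prime K ?B P (gs @ [h]) as" unfolding regular_prime_def using gsP hP asB PT by auto
  thus ?thesis by(intro exI[of _ "gs @ [h]"] exI[of _ as]) simp
 qed
qed

text \<open>Each variable contributes exactly one entry, either to \<open>gs\<close> or to
  \<open>as\<close>: height plus dimension of the residue ring equals the number of
  variables.\<close>

lemma regular_prime_exists: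
 fixes K :: "'a::field set" assumes K: "is_subfield K" shows "indep K {0} ys ==> is_prime (adjoins K ys) P ==>
  EX gs as. length gs + length as = length ys & regular_prime K (adjoins K ys) P gs as"
proof(induction ys arbitrary: P)
 case Nil
 have KS: "is_subring K" using K by(simp add: is_subfield_def)
 have P: "is_prime K P" using Nil by simp
 have "P <= {0}"
 proof
  fix x assume x: "x : P"
  show "x : {0}"
  proof(rule ccontr)
   assume "x ~: {0}"
   moreover have "inverse x * x : P" using x P K by(intro ideal_mult[OF prime_ideal[OF P]]) (auto simp: is_subfield_def is_prime_def is_ideal_def)
   ultimately show False using P by(simp add: is_prime_def)
  qed
 qed
 hence "P <= sat K P (ideal_gen K {})" using sat_superset[OF KS P, of "ideal_gen K {}"] ideal_gen_empty[OF KS] by auto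
 thus ?case using indep_Nil[OF K KS _ P] by(intro exI[of _ "[]"]) (simp add: regular_prime_def)
next
 case (Cons y ys)
 have KS: "is_subring K" using K by(simp add: is_subfield_def)
 have R: "is_subring (adjoins K ys)" by(rule adjoins_subring[OF KS])
 have KR: "K <= adjoins K ys" by(rule adjoins_superset[OF KS])
 have P: "is_prime (adjoin1 (adjoins K ys) y) P" using Cons.prems by simp
 note ind = indep_Cons[OF KS Cons.prems(1)]
 obtain gs as where "length gs + length as = length ys" "regular_prime K (adjoins K ys) (P Int adjoins K ys) gs as"
  using Cons.IH[OF ind(1) prime_contract[OF P R adjoin1_superset[OF R]]] by blast
 thus ?case using regular_prime_step[OF KR R ind(2) P] by fastforce
qed

text \<open>A squeeze. The sequence \<open>gs\<close>, regular after localization, bounds the depth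
  from below, and depth is at most dimension. A chain of \<open>n\<close> steps in the localization
  contracts to primes inside \<open>P\<close>, modulo which \<open>as\<close> stays independent, so
  \<open>n + length as\<close> is at most \<open>N\<close>. A repeated entry of \<open>gs\<close>
  would put 1 into the localized ideal of the earlier entries.\<close>

lemma localization_dim_depth:
 fixes A :: "'a::field set" assumes A: "is_subring A" and K: "K <= A" and P: "is_prime A P" and gs: "set gs <= P" and as: "set as <= A" "indep K P as"
  and reg: "!!j c. j < length gs ==> c : A ==> gs ! j * c : ideal_gen A (set (take j gs)) ==>
    c : sat A P (ideal_gen A (set (take j gs)))" and bound: "!!bs. set bs <= A ==> indep K {0} bs ==> length bs <= N"
  and len: "length gs + length as = N" shows "krull_dim (ring_on (sat A P A)) = enat (length gs)"
  and "local_depth (ring_on (sat A P A)) = enat (length gs)" and "j < i ==> i < length gs ==> gs ! i ~= gs ! j"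
proof -
 let ?Q = "sat A P A"
 have Q: "is_subring ?Q" by(rule sat_subring[OF A P])
 have AQ: "A <= ?Q" by(rule sat_superset[OF A P])
 have gA: "set gs <= A" using gs P by(auto simp: is_prime_def is_ideal_def)
 have gen: "ideal_gen ?Q (set (take i gs)) = sat A P (ideal_gen A (set (take i gs)))" for i
  using gA set_take_subset[of i gs] by(intro sat_ideal_gen[OF A P]) auto
 have genP: "ideal_gen A (set (take i gs)) <= P" for i using gs set_take_subset[of i gs] by(intro ideal_gen_minimal prime_ideal[OF P]) auto
 have one: "1 ~: sat A P P" by(auto simp: sat_def)
 have regQ: "c : ideal_gen ?Q (set (take j gs))"
  if j: "j < length gs" and c: "c : ?Q" "gs ! j * c : ideal_gen ?Q (set (take j gs))" for j c
 proof -
  obtain s where s: "s : A - P" "s * c : A" using c(1) by(auto simp: sat_def)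
  obtain t where t: "t : A - P" "t * (gs ! j * c) : ideal_gen A (set (take j gs))" using c(2) unfolding gen by(auto simp: sat_def)
  have I: "is_ideal A (ideal_gen A (set (take j gs)))" using gA set_take_subset[of j gs] by(intro ideal_gen_ideal[OF A]) auto
  have "s * (t * (gs ! j * c)) : ideal_gen A (set (take j gs))" using s(1) by(intro ideal_mult[OF I _ t(2)]) auto
  hence "gs ! j * (t * (s * c)) : ideal_gen A (set (take j gs))" by(simp add: mult_ac)
  moreover have "t * (s * c) : A" using t(1) by(intro subring_mult[OF A _ s(2)]) auto
  ultimately have "t * (s * c) : sat A P (ideal_gen A (set (take j gs)))" using reg[OF j] by blast
  hence "s * c : sat A P (ideal_gen A (set (take j gs)))" by(rule sat_sat[OF A P t(1)])
  thus ?thesis unfolding gen by(rule sat_sat[OF A P s(1)])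
 qed
 have "regular_sequence (ring_on ?Q) gs" unfolding regular_sequence_def genideal_ring_on[OF Q]
 proof(intro conjI allI impI ballI)
  show "set gs <= carrier (ring_on ?Q)" using gA AQ by auto
  have "ideal_gen ?Q (set gs) <= sat A P P" using gen[of "length gs"] sat_mono[OF genP[of "length gs"], of A P] by simp
  thus "ideal_gen ?Q (set gs) ~= carrier (ring_on ?Q)" using one subring_1[OF Q] by auto
 qed (use regQ in simp)
 moreover have "set gs <= nonunits (ring_on ?Q)" using gs sat_superset[OF A P, of P] by(auto simp: nonunits_sat[OF A P])
 ultimately have ge: "enat (length gs) <= local_depth (ring_on ?Q)" unfolding local_depth_def by(intro Sup_upper) blast
 have m: "is_prime ?Q (nonunits (ring_on ?Q))" unfolding nonunits_sat[OF A P] by(rule sat_prime[OF A P])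
 have le: "local_depth (ring_on ?Q) <= krull_dim (ring_on ?Q)" by(rule depth_le_dim[OF Q m])
 have "n <= length gs" if C: "prime_chain ?Q n C" for n C
 proof -
  note C' = prime_chain_contract[OF A P C]
  have "indep K (C n Int A) as" using C'(2)[of n] by(intro indep_antimono[OF as(2)]) simp
  then obtain bs where bs: "length bs = n" "set bs <= A" "indep K (C 0 Int A) (bs @ as)" using indep_chain[OF A K as(1) C'(1)] by blast
  have "is_prime A (C 0 Int A)" using C'(1) by(simp add: prime_chain_def)
  hence "indep K {0} (bs @ as)" by(intro indep_antimono[OF bs(3)]) (use prime_zero_in in blast)
  hence "length (bs @ as) <= N" using bs(2) as(1) by(intro bound) auto
  thus ?thesis using len bs(1) by simp
 qed
 hence "krull_dim (ring_on ?Q) <= enat (length gs)" by(intro krull_dim_le[OF Q])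
 thus "krull_dim (ring_on ?Q) = enat (length gs)" "local_depth (ring_on ?Q) = enat (length gs)" using ge le by auto
 show "gs ! i ~= gs ! j" if ji: "j < i" "i < length gs"
 proof
  assume eq: "gs ! i = gs ! j"
  have "gs ! j : set (take i gs)" using ji by(auto simp: in_set_conv_nth intro!: exI[of _ j])
  hence "gs ! i * 1 : ideal_gen A (set (take i gs))" using ideal_gen_superset[of "set (take i gs)" A] eq by auto
  hence "1 : sat A P (ideal_gen A (set (take i gs)))" using reg[OF ji(2) subring_1[OF A]] by simp
  thus False using one sat_mono[OF genP[of i], of A P] by blast
 qed
qed

lemma adjoins_indep_bound: assumes K: "is_subfield (K :: 'a::field set)" and "set bs <= adjoins K ys" "indep K {0} bs" shows "length bs <= length ys"
proof -
 have KS: "is_subring K" using K by(simp add: is_subfield_def)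
 have R: "is_subring (adjoins K ys)" by(rule adjoins_subring[OF KS])
 show ?thesis
 proof(rule indep_length_le[OF K R adjoins_superset[OF KS] _ _ _ assms(2,3)])
  show "{1} <= adjoins K ys" using subring_1[OF R] by simp
  show "EX c. (ALL w. c w : adjoins K ys) & a = (SUM w:{1}. c w * w)" if "a : adjoins K ys" for a using that by(intro exI[of _ "%_. a"]) simp
 qed simp
qed

lemma regular_local_polynomial: assumes K: "is_subfield (K :: 'a::field set)" and ys: "indep K {0} ys" and P: "is_prime (adjoins K ys) P"
 shows "regular_local (ring_on (sat (adjoins K ys) P (adjoins K ys)))"
proof -
 let ?A = "adjoins K ys" let ?Q = "sat ?A P ?A"
 have KS: "is_subring K" using K by(simp add: is_subfield_def)
 have A: "is_subring ?A" by(rule adjoins_subring[OF KS])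
 obtain gs as where len: "length gs + length as = length ys" and reg: "regular_prime K ?A P gs as" using regular_prime_exists[OF K ys P] by blast
 note dim = localization_dim_depth[OF A adjoins_superset[OF KS] P _ _ _ _ adjoins_indep_bound[OF K] len]
 have r: "set gs <= P" "set as <= ?A" "indep K P as" "P <= sat ?A P (ideal_gen ?A (set gs))"
  "!!j c. j < length gs ==> c : ?A ==> gs ! j * c : ideal_gen ?A (set (take j gs)) ==>
    c : sat ?A P (ideal_gen ?A (set (take j gs)))" using reg by(auto simp: regular_prime_def)
 have gA: "set gs <= ?A" using r(1) P by(auto simp: is_prime_def is_ideal_def)
 have "gs ! i ~= gs ! j" if "i < length gs" "j < length gs" "i ~= j" for i j
  using dim(3)[OF r(1,2,3,5), of i j] dim(3)[OF r(1,2,3,5), of j i] that by(cases "i < j") auto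
 hence "distinct gs" unfolding distinct_conv_nth by blast
 hence card: "card (set gs) = length gs" by(rule distinct_card)
 have Q: "is_subring ?Q" by(rule sat_subring[OF A P])
 have "ideal_gen ?Q (set gs) = sat ?A P (ideal_gen ?A (set gs))" by(rule sat_ideal_gen[OF A P gA])
 also have "... = sat ?A P P"
 proof
  show "sat ?A P (ideal_gen ?A (set gs)) <= sat ?A P P" by(intro sat_mono ideal_gen_minimal prime_ideal[OF P] r)
  show "sat ?A P P <= sat ?A P (ideal_gen ?A (set gs))"
  proof
   fix z assume "z : sat ?A P P"
   then obtain s where s: "s : ?A - P" "s * z : P" by(auto simp: sat_def)
   hence "s * z : sat ?A P (ideal_gen ?A (set gs))" using r(4) by blast
   thus "z : sat ?A P (ideal_gen ?A (set gs))" by(rule sat_sat[OF A P s(1)])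
  qed
 qed
 finally have gen: "Idl\<^bsub>ring_on ?Q\<^esub> (set gs) = nonunits (ring_on ?Q)" by(simp add: genideal_ring_on[OF Q] nonunits_sat[OF A P])
 have "noetherian ?Q" by(intro noetherian_sat[OF _ P] noetherian_adjoins noetherian_subfield K)
 thus ?thesis unfolding regular_local_def using local_ring_sat[OF A P] gen card dim(1)[OF r(1,2,3,5)] gA sat_superset[OF A P, of ?A]
  by(intro conjI noetherian_imp exI[of _ "set gs"]) auto
qed

text \<open>Regular sequences of the polynomial ring stay regular in a free module over it.\<close>

lemma cohen_macaulay_free: assumes K: "is_subfield (K :: 'a::field set)" and ths: "indep K {0} ths"
  and A: "noetherian A" "adjoins K ths <= A" and W: "finite W" "W <= A"
  and span: "!!a. a : A ==> EX c. (ALL w. c w : adjoins K ths) & a = (SUM w:W. c w * w)"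
  and free: "!!c. (!!w. c w : adjoins K ths) ==> (SUM w:W. c w * w) = 0 ==> ALL w:W. c w = 0" shows "cohen_macaulay A" unfolding cohen_macaulay_def
proof(intro conjI allI impI)
 show "noetherian_ring (ring_on A)" using A(1) by(rule noetherian_imp)
 fix M assume "maximalideal M (ring_on A)"
 have AS: "is_subring A" using A(1) by(simp add: noetherian_def)
 have M: "is_prime A M" by(rule maximal_is_prime[OF AS \<open>maximalideal M (ring_on A)\<close>])
 let ?C = "adjoins K ths"
 have KS: "is_subring K" using K by(simp add: is_subfield_def)
 have C: "is_subring ?C" by(rule adjoins_subring[OF KS])
 have KA: "K <= A" using adjoins_superset[OF KS, of ths] A(2) by blast
 have N: "is_prime ?C (M Int ?C)" by(rule prime_contract[OF M C A(2)])
 obtain gs as where len: "length gs + length as = length ths" and reg: "regular_prime K ?C (M Int ?C) gs as"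
  using regular_prime_exists[OF K ths N] by blast
 have r: "set gs <= M Int ?C" "set as <= ?C" "indep K (M Int ?C) as"
  "!!j c. j < length gs ==> c : ?C ==> gs ! j * c : ideal_gen ?C (set (take j gs)) ==>
    c : sat ?C (M Int ?C) (ideal_gen ?C (set (take j gs)))" using reg by(auto simp: regular_prime_def)
 have indM: "indep K M as" unfolding indep_def
 proof(intro allI impI ballI)
  fix E c ks assume hh: "(ALL ks. c ks : K) & lincomb c as E : M" and ks: "ks : box (length as) E"
  have "lincomb c as E : ?C" using hh adjoins_superset[OF KS, of ths] r(2) C by(auto intro!: subring_sum subring_mult mono_eval_in)
  thus "c ks = 0" using hh ks by(intro indepD[OF r(3), of c E]) auto
 qed
 have unique: "ALL w:W. c w = d w" if "!!w. c w : ?C" "!!w. d w : ?C" "(SUM w:W. c w * w) = (SUM w:W. d w * w)" for c d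
  using free[of "%w. c w - d w"] that subring_diff[OF C] by(simp add: left_diff_distrib sum_subtractf)
 have regA: "a : sat A M (ideal_gen A (set (take j gs)))"
  if j: "j < length gs" and a: "a : A" "gs ! j * a : ideal_gen A (set (take j gs))" for j a
 proof -
  let ?T = "set (take j gs)"
  have TC: "?T <= ?C" using r(1) set_take_subset[of j gs] by blast
  have TA: "?T <= A" using TC A(2) by blast
  obtain b where b: "!!t. b t : A" "gs ! j * a = (SUM t:?T. b t * t)" using a(2) ideal_gen_finite[OF AS TA, of "gs ! j * a"] by auto
  have gj: "gs ! j : ?C" using r(1) j by auto
  obtain c where c: "!!w. c w : ?C" "a = (SUM w:W. c w * w)" using span[OF a(1)] by blast
  have "ALL t. EX d. (ALL w. d w : ?C) & b t = (SUM w:W. d w * w)" using span b(1) by blast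
  then obtain d where d: "!!t w. d t w : ?C" "!!t. b t = (SUM w:W. d t w * w)" by metis
  have "(SUM w:W. (gs ! j * c w) * w) = gs ! j * a" unfolding c(2) by(simp add: sum_distrib_left mult_ac)
  also have "... = (SUM w:W. (SUM t:?T. d t w * t) * w)"
  proof -
   have "(SUM t:?T. b t * t) = (SUM t:?T. SUM w:W. d t w * t * w)" by(simp only: d(2) sum_distrib_right) (intro sum.cong refl, simp add: mult_ac)
   thus ?thesis unfolding b(2) by(subst (asm) sum.swap) (simp add: sum_distrib_right)
  qed
  finally have eq: "ALL w:W. gs ! j * c w = (SUM t:?T. d t w * t)"
   using c(1) d(1) gj TC by(intro unique) (auto intro!: subring_mult[OF C] subring_sum[OF C])
  have IA: "is_ideal A (ideal_gen A ?T)" by(rule ideal_gen_ideal[OF AS TA])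
  have sub: "ideal_gen ?C ?T <= ideal_gen A ?T" using ideal_contract[OF IA C A(2)] TC ideal_gen_superset[of ?T A]
    ideal_gen_minimal[of ?C "ideal_gen A ?T Int ?C" ?T] by blast
  have T: "is_ideal A (sat A M (ideal_gen A ?T) Int A)" by(rule sat_ideal_inter[OF AS M IA])
  have "a : sat A M (ideal_gen A ?T) Int A" unfolding c(2)
  proof(rule ideal_sum[OF T])
   fix w assume w: "w : W"
   have "gs ! j * c w : ideal_gen ?C ?T" using eq w d(1) ideal_gen_finite[OF C TC, of "gs ! j * c w"] by(metis List.finite_set)
   hence "c w : sat ?C (M Int ?C) (ideal_gen ?C ?T)" by(rule r(4)[OF j c(1)])
   then obtain s where "s : ?C - (M Int ?C)" "s * c w : ideal_gen ?C ?T" by(auto simp: sat_def)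
   hence "s : A - M" "s * c w : ideal_gen A ?T" "c w : A" using sub A(2) c(1) by auto
   hence "c w : sat A M (ideal_gen A ?T) Int A" by(auto simp: sat_def)
   thus "c w * w : sat A M (ideal_gen A ?T) Int A" using w W(2) by(intro ideal_mult_right[OF T]) auto
  qed
  thus ?thesis by blast
 qed
 have bound: "length bs <= length ths" if "set bs <= A" "indep K {0} bs" for bs by(rule indep_length_le[OF K AS KA W span that])
 have "set gs <= M" "set as <= A" using r(1,2) A(2) by auto
 note dim = localization_dim_depth[OF AS KA M this indM regA bound len]
 have "local_depth (ring_on (sat A M A)) = krull_dim (ring_on (sat A M A))" by(simp only: dim(1,2))
 thus "cohen_macaulay_local (ring_on (localize A M))" unfolding localize_eq_sat[OF AS M] cohen_macaulay_local_def
  by(intro conjI local_ring_sat[OF AS M] noetherian_imp[OF noetherian_sat[OF A(1) M]])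
qed

section \<open>Semigroup rings of normal affine monoids\<close>

subsection \<open>Polynomials as linear combinations of monomials\<close>

lemma sum_single_lookup: "(SUM t:keys f. single t (lookup f t)) = f"
 by(rule poly_mapping_eqI) (auto simp: lookup_sum lookup_single when_def in_keys_iff)

text \<open>Term-by-term extension of \<open>h\<close>, additive as soon as every \<open>h t\<close>
  is. Graded projections, change of coefficients, the toric map, Frobenius splittings and the
  evaluation of Laurent polynomials all have this form.\<close>

definition lin_ext :: "('a => 'b => 'c) => ('a \<Rightarrow>\<^sub>0 'b::zero) => 'c::comm_monoid_add" where
 "lin_ext h f = (SUM t:keys f. h t (lookup f t))"

lemma lin_ext_add:
 "(!!t. h t 0 = 0) ==> (!!t a b. h t (a + b) = h t a + h t b) ==> lin_ext h (f + g) = lin_ext h f + lin_ext h g"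
 unfolding lin_ext_def by(rule setsum_keys_plus_distrib)

lemma lin_ext_single: "h t 0 = 0 ==> lin_ext h (single t a) = h t a" by(simp add: lin_ext_def)

lemma additive_0: "(!!x y. F (x + y) = F x + F y) ==> F (0::'a::monoid_add) = (0::'b::group_add)" by(metis add.right_neutral add_left_cancel)

lemma additive_sum:
 "(!!x y. F (x + y) = F x + F y) ==> F (sum f S) = (SUM x:S. F (f x) :: 'b::ab_group_add)"
 by(induction S rule: infinite_finite_induct) (auto simp: additive_0[of F])

lemma lookup_times:
 fixes f g :: "'a::comm_monoid_add \<Rightarrow>\<^sub>0 'b::comm_ring_1" shows "lookup (f * g) u = (SUM s:keys f. SUM t:keys g.
  if s + t = u then lookup f s * lookup g t else 0)"
proof -
 have "f * g = (SUM s:keys f. SUM t:keys g.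
   single (s + t) (lookup f s * lookup g t))" by(subst (1) sum_single_lookup[of f, symmetric], subst (1) sum_single_lookup[of g, symmetric])
   (simp add: sum_product mult_single)
 thus ?thesis by(simp add: lookup_sum lookup_single when_def)
qed

lemma CHAR_poly_mapping: "CHAR('a::comm_monoid_add \<Rightarrow>\<^sub>0 'b::comm_ring_1) = CHAR('b)"
proof(rule CHAR_eqI)
 show "of_nat CHAR('b) = (0 :: 'a \<Rightarrow>\<^sub>0 'b)" by(simp flip: single_of_nat)
 fix n assume "of_nat n = (0 :: 'a \<Rightarrow>\<^sub>0 'b)"
 hence "lookup (of_nat n :: 'a \<Rightarrow>\<^sub>0 'b) 0 = 0" by simp
 hence "of_nat n = (0 :: 'b)" by(simp add: lookup_of_nat)
 thus "CHAR('b) dvd n" by(simp add: of_nat_eq_0_iff_char_dvd)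
qed

lemma to_fract_of_nat: "to_fract (of_nat n) = of_nat n" by(induction n) auto

lemma to_fract_power: "to_fract (x ^ n) = to_fract x ^ n" by(induction n) auto

lemma CHAR_fract: "CHAR('a::idom fract) = CHAR('a)"
proof(rule CHAR_eqI)
 show "of_nat CHAR('a) = (0 :: 'a fract)" by(simp flip: to_fract_of_nat)
 fix n assume "of_nat n = (0 :: 'a fract)"
 hence "of_nat n = (0 :: 'a)" by(simp flip: to_fract_of_nat)
 thus "CHAR('a) dvd n" by(simp add: of_nat_eq_0_iff_char_dvd)
qed

subsection \<open>A well-founded monomial order\<close>

definition esize :: "('n::finite mon) => nat" where
 "esize w = (SUM i:UNIV. lookup w i)"

lemma esize_add: "esize (v + w) = esize v + esize w" by(simp add: esize_def lookup_add sum.distrib)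

lemma esize_0 [simp]: "esize 0 = 0" by(simp add: esize_def)

lemma esize_eq_0_iff: "esize w = 0 \<longleftrightarrow> w = 0"
proof
 assume "esize w = 0"
 thus "w = 0" by(intro poly_mapping_eqI) (simp add: esize_def)
qed simp

lemma lookup_le_esize: "lookup w i <= esize w" unfolding esize_def by(rule member_le_sum) auto

lemma finite_esize_le: "finite {w :: 'n::finite mon. esize w <= N}"
proof -
 have "finite (PiE UNIV (%_ :: 'n. {..N}))" by(intro finite_PiE) auto
 moreover have "lookup ` {w :: 'n mon. esize w <= N} <= PiE UNIV (%_. {..N})" using lookup_le_esize order_trans by fastforce
 ultimately have "finite (lookup ` {w :: 'n mon. esize w <= N})" by(rule finite_subset[rotated])
 thus ?thesis by(rule finite_imageD) (auto simp: inj_on_def)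
qed

text \<open>The total degree comes first so that only finitely many exponents lie below a given one;
  the termination of division by leading terms rests on this.\<close>

definition grlex :: "('n::{finite, linorder} mon) => 'n mon => bool" where
 "grlex v w \<longleftrightarrow> esize v < esize w | esize v = esize w & v < w"

lemma grlex_total: "grlex v w | v = w | grlex w v" unfolding grlex_def by auto

lemma grlex_trans: "grlex u v ==> grlex v w ==> grlex u w" unfolding grlex_def by auto

lemma grlex_irrefl: "~ grlex v v" unfolding grlex_def by auto

lemma grlex_add_mono: "grlex u v ==> grlex (u + w) (v + w)" unfolding grlex_def by(auto simp: esize_add add_strict_right_mono)

lemma finite_grlex: "finite {v. grlex v w}" by(rule finite_subset[OF _ finite_esize_le[of "esize w"]]) (auto simp: grlex_def)

definition is_lead :: "('n::{finite, linorder} mon) => ('n, 'k::comm_ring_1) mpoly => bool" where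
 "is_lead m f \<longleftrightarrow> m : keys f & (ALL t:keys f. t = m | grlex t m)"

lemma lead_exists: assumes "f ~= 0" obtains m where "is_lead m f"
proof -
 have "EX m:A. ALL t:A. t = m | grlex t m" if "finite A" "A ~= {}" for A :: "('n::{finite, linorder} mon) set" using that
 proof(induction A rule: finite_ne_induct)
  case (insert x A)
  then obtain m where m: "m : A" "ALL t:A. t = m | grlex t m" by blast
  show ?case
  proof(cases "grlex x m")
   case True
   thus ?thesis using m by blast
  next
   case False
   hence "x = m | grlex m x" using grlex_total by blast
   thus ?thesis using m grlex_trans[of _ m x] by(intro bexI[of _ x]) auto
  qed
 qed auto
 thus ?thesis using that assms unfolding is_lead_def by(metis finite_keys keys_eq_empty poly_mapping_eqI lookup_zero not_in_keys_iff_lookup_eq_zero empty_iff)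
qed

lemma is_lead_unique: "is_lead m f ==> is_lead m' f ==> m = m'" unfolding is_lead_def using grlex_trans[of m m' m] grlex_irrefl[of m] by metis

lemma is_lead_times:
 fixes f g :: "('n::{finite, linorder}, 'k::field) mpoly" assumes f: "is_lead m f" and g: "is_lead n g" shows "is_lead (m + n) (f * g)"
proof -
 have lt: "grlex (s + t) (m + n)" if "s : keys f" "t : keys g" "(s, t) ~= (m, n)" for s t
 proof -
  have s: "s = m | grlex s m" and t: "t = n | grlex t n" using f g that by(auto simp: is_lead_def)
  have a: "grlex s m ==> grlex (s + t) (m + t)" "grlex t n ==> grlex (m + t) (m + n)"
   using grlex_add_mono[of s m t] grlex_add_mono[of t n m] by(auto simp: add.commute)
  show ?thesis using s t a that(3) grlex_trans by blast
 qed
 have "lookup (f * g) (m + n) = (SUM s:keys f. SUM t:keys g.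
  if s = m then (if t = n then lookup f m * lookup g n else 0) else 0)" unfolding lookup_times
 proof(intro sum.cong refl)
  fix s t assume "s : keys f" "t : keys g"
  thus "(if s + t = m + n then lookup f s * lookup g t else 0)
   = (if s = m then (if t = n then lookup f m * lookup g n else 0) else 0)" using lt[of s t] grlex_irrefl[of "m + n"] by(auto split: if_splits)
 qed
 also have "... = lookup f m * lookup g n"
 proof -
  have "(SUM t:keys g. if s = m then (if t = n then c else 0) else 0) = (if s = m then c else 0)" for s and c :: 'k using g by(auto simp: is_lead_def)
  thus ?thesis using f by(simp add: is_lead_def)
 qed
 also have "... ~= 0" using f g by(auto simp: is_lead_def in_keys_iff)
 finally have "m + n : keys (f * g)" by(simp add: in_keys_iff)
 moreover have "t = m + n | grlex t (m + n)" if "t : keys (f * g)" for t using subsetD[OF keys_mult that] lt by blast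
 ultimately show ?thesis by(auto simp: is_lead_def)
qed

definition nscale :: "nat => 'n mon => 'n mon" where
 "nscale q t = Poly_Mapping.map ((*) q) t"

lemma lookup_nscale [simp]: "lookup (nscale q t) i = q * lookup t i" by(simp add: nscale_def Poly_Mapping.map.rep_eq when_def)

lemma nscale_0 [simp]: "nscale 0 t = 0" by(rule poly_mapping_eqI) simp

lemma nscale_Suc: "nscale (Suc q) t = nscale q t + t" by(rule poly_mapping_eqI) (simp add: lookup_add)

lemma nscale_add: "nscale q (s + t) = nscale q s + nscale q t" by(rule poly_mapping_eqI) (simp add: lookup_add distrib_left)

lemma nscale_inject: "q > 0 ==> nscale q s = nscale q t ==> s = t"
proof(rule poly_mapping_eqI)
 assume q: "q > 0" "nscale q s = nscale q t"
 fix i show "lookup s i = lookup t i" using q lookup_nscale[of q s i] lookup_nscale[of q t i] by simp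
qed

lemma esize_nscale: "esize (nscale q t) = q * esize t" by(simp add: esize_def sum_distrib_left)

lemma single_power: "(single t x :: ('v, 'k::comm_ring_1) mpoly) ^ q = single (nscale q t) (x ^ q)"
 by(induction q) (auto simp: nscale_Suc mult_single add.commute)

lemma is_lead_power:
 fixes f :: "('n::{finite, linorder}, 'k::field) mpoly" shows "is_lead m f ==> is_lead (nscale k m) (f ^ k)"
proof(induction k)
 case 0
 thus ?case by(simp add: is_lead_def)
next
 case (Suc k)
 thus ?case using is_lead_times[of m f "nscale k m" "f ^ k"] by(simp add: nscale_Suc add.commute)
qed

subsection \<open>Integral elements\<close>

text \<open>Every power of \<open>z\<close> is a combination of the powers below the degree of the
  monic equation, so a power of the denominator of \<open>z\<close> is a common denominator for all
  of them.\<close>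

lemma integral_almost_integral:
 fixes A :: "'f::field set" assumes A: "is_subring A" and z: "z : frac_field A" "integral_over A z"
 obtains c where "c : A" "c ~= 0" "!!k. c * z ^ k : A"
proof -
 obtain a b where ab: "a : A" "b : A" "b ~= 0" "z = a / b" using z(1) by(auto simp: frac_field_def)
 obtain p where p: "lead_coeff p = 1" "!!i. coeff p i : A" "poly p z = 0" using z(2) by(auto simp: integral_over_def)
 let ?n = "degree p"
 have "(SUM i<=?n. coeff p i * z ^ i) = 0" using p(3) by(simp add: poly_altdef)
 hence zn: "z ^ ?n = - (SUM i<?n. coeff p i * z ^ i)" using p(1) by(simp add: lessThan_Suc_atMost[symmetric] add_eq_0_iff2)
 have "EX c. (ALL i. c i : A) & z ^ k = (SUM i<?n. c i * z ^ i)" for k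
 proof(induction k)
  case 0
  have "?n ~= 0"
  proof
   assume "?n = 0"
   hence "p = [:1:]" using p(1) by(metis degree_0_id)
   thus False using p(3) by simp
  qed
  hence "(SUM i<?n. (if i = 0 then 1 else 0) * z ^ i) = 1" by(subst sum.remove[of _ 0]) auto
  thus ?case using subring_0[OF A] subring_1[OF A] by(intro exI[of _ "%i. if i = 0 then 1 else 0"]) simp
 next
  case (Suc k)
  then obtain c where c: "!!i. c i : A" "z ^ k = (SUM i<?n. c i * z ^ i)" by blast
  define d where "d i = (case i of 0 => 0 | Suc j => c j)" for i
  have "z ^ Suc k = (SUM i<?n. c i * z ^ Suc i)" unfolding power_Suc c(2) sum_distrib_left by(simp add: mult_ac)
  also have "... = (SUM i<Suc ?n. d i * z ^ i)" by(subst sum.lessThan_Suc_shift) (simp add: d_def)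
  also have "... = (SUM i<?n. d i * z ^ i) + d ?n * z ^ ?n" by simp
  also have "... = (SUM i<?n. (d i - d ?n * coeff p i) * z ^ i)" unfolding zn left_diff_distrib sum_subtractf by(simp add: sum_distrib_left mult_ac)
  finally have "z ^ Suc k = (SUM i<?n. (d i - d ?n * coeff p i) * z ^ i)" .
  moreover have "d i : A" for i using c(1) subring_0[OF A] by(auto simp: d_def split: nat.split)
  ultimately show ?case using A p(2) by(intro exI[of _ "%i. d i - d ?n * coeff p i"]) (auto intro!: subring_diff subring_mult)
 qed
 note pw = this
 have "b ^ ?n * z ^ k : A" for k
 proof -
  obtain c where c: "!!i. c i : A" "z ^ k = (SUM i<?n. c i * z ^ i)" using pw[of k] by blast
  have "b ^ ?n * z ^ i = b ^ (?n - i) * a ^ i" if "i < ?n" for i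
  proof -
   have "b ^ ?n = b ^ (?n - i) * b ^ i" using that by(simp flip: power_add)
   thus ?thesis using ab by(simp add: power_divide)
  qed
  hence "b ^ ?n * z ^ k = (SUM i<?n. c i * (b ^ (?n - i) * a ^ i))" unfolding c(2) sum_distrib_left by(intro sum.cong) (auto simp: mult_ac)
  thus ?thesis using c(1) ab A by(auto intro!: subring_sum subring_mult subring_power)
 qed
 thus ?thesis using that[of "b ^ ?n"] ab A by(auto intro: subring_power)
qed

subsection \<open>Tight closure and Frobenius splittings\<close>

text \<open>Let the scalars of the field act on it through their \<open>q\<close>-th powers. The
  nonzero vector \<open>c\<close> is independent, so some linear functional has value 1 at
  \<open>c\<close>; for a perfect field it is the \<open>q\<close>-th root of
  \<open>y / c\<close>.\<close>

lemma frobenius_functional: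
 fixes c :: "'k::field" assumes p: "CHAR('k) > 0" and c: "c ~= 0"
 obtains ka :: "'k => 'k" where "!!x y. ka (x + y) = ka x + ka y" "!!x y. ka (x ^ (CHAR('k) ^ e) * y) = x * ka y" "ka c = 1"
proof -
 let ?q = "CHAR('k) ^ e"
 have pr: "Factorial_Ring.prime CHAR('k)" using p prime_CHAR_semidom by blast
 interpret V: vector_space "%x y::'k. x ^ ?q * y" by unfold_locales (auto simp: algebra_simps power_mult_distrib freshmans_dream'[OF pr refl])
 interpret W: vector_space "%x y::'k. x * y" by unfold_locales (auto simp: algebra_simps)
 interpret VW: vector_space_pair "%x y::'k. x ^ ?q * y" "%x y::'k. x * y" ..
 have "V.independent {c}" using c by simp
 then obtain g where g: "Vector_Spaces.linear (%x y::'k. x ^ ?q * y) (*) g" "ALL x:{c}. g x = 1"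
  using VW.linear_independent_extend[of "{c}" "%_. 1"] by blast
 interpret g: Vector_Spaces.linear "%x y::'k. x ^ ?q * y" "(*)" g by(rule g(1))
 show ?thesis using that[of g] g.add g.scale g(2) by simp
qed

text \<open>Such a \<open>Ph\<close> is an \<open>A\<close>-linear map to \<open>A\<close> from the
  \<open>e\<close>-th Frobenius pushforward of \<open>A\<close>, sending \<open>c\<close> to
  1.\<close>

definition splits :: "'f::comm_ring_1 set => nat => 'f => ('f => 'f) => bool" where
 "splits A e c Ph \<longleftrightarrow> (ALL f:A. ALL g:A. Ph (f + g) = Ph f + Ph g) &
   (ALL f:A. Ph f : A) & (ALL f:A. ALL g:A. Ph (g ^ (CHAR('f) ^ e) * f) = g * Ph f) & Ph c = 1"

text \<open>Strong F-regularity, asked for all large \<open>e\<close> so that it can be combined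
  with the bound \<open>N\<close> in the definition of tight closure.\<close>

definition frobenius_split :: "'f::comm_ring_1 set => bool" where
 "frobenius_split A \<longleftrightarrow> (ALL c:A. c ~= 0 --> (EX N. ALL e>=N. EX Ph. splits A e c Ph))"

lemma additive_on_sum: assumes A: "is_subring A" and Ph: "ALL f:A. ALL g:A. Ph (f + g) = Ph f + (Ph g :: 'b::ab_group_add)"
  and "!!x. x : S ==> f x : A" shows "Ph (sum f S) = (SUM x:S. Ph (f x))"
proof -
 have "Ph (0 + 0) = Ph 0 + Ph 0" using Ph subring_0[OF A] by blast
 hence 0: "Ph 0 = 0" by simp
 show ?thesis using assms(3) by(induction S rule: infinite_finite_induct) (auto simp: 0 Ph subring_sum[OF A])
qed

text \<open>If \<open>c * a ^ q\<close> is a combination of \<open>q\<close>-th powers of elements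
  of \<open>J\<close>, a splitting that sends \<open>c\<close> to 1 turns this into an expression of
  \<open>a\<close> as a combination of those elements.\<close>

lemma tight_closure_eq:
 fixes A :: "'f::field set" assumes A: "is_subring A" and split: "frobenius_split A" and J: "is_ideal A J" and p: "CHAR('f) > 0"
 shows "tight_closure A J = J"
proof
 have JA: "J <= A" using J by(simp add: is_ideal_def)
 have pr: "Factorial_Ring.prime CHAR('f)" using p prime_CHAR_semidom by blast
 show "J <= tight_closure A J"
 proof
  fix a assume a: "a : J"
  have "1 * a ^ q : frobenius_power A J q" for q
   using a ideal_gen_superset[of "(%a. a ^ q) ` J" A] by(auto simp: frobenius_power_def genideal_ring_on[OF A])
  thus "a : tight_closure A J" using a JA subring_1[OF A] by(auto simp: tight_closure_def intro!: bexI[of _ 1])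
 qed
 show "tight_closure A J <= J"
 proof
  fix a assume "a : tight_closure A J"
  then obtain c N where a: "a : A" and c: "c : A" "c ~= 0" and N: "!!e. e >= N ==> c * a ^ (CHAR('f) ^ e) : frobenius_power A J (CHAR('f) ^ e)"
   by(auto simp: tight_closure_def)
  obtain M where M: "!!e. e >= M ==> EX Ph. splits A e c Ph" using split c unfolding frobenius_split_def by blast
  define e where "e = max M N"
  let ?q = "CHAR('f) ^ e"
  obtain Ph where Ph: "ALL f:A. ALL g:A. Ph (f + g) = Ph f + Ph g" "!!f. f : A ==> Ph f : A"
   "!!f g. f : A ==> g : A ==> Ph (g ^ ?q * f) = g * Ph f" "Ph c = 1" using M[of e] unfolding e_def splits_def by auto
  have sub: "(%a. a ^ ?q) ` J <= A" using JA A by(auto intro: subring_power)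
  have "c * a ^ ?q : ideal_gen A ((%a. a ^ ?q) ` J)" using N[of e] by(simp add: e_def frobenius_power_def genideal_ring_on[OF A])
  then obtain Y b where Y: "finite Y" "Y <= (%a. a ^ ?q) ` J" "!!y. b y : A" "c * a ^ ?q = (SUM y:Y. b y * y)"
   unfolding ideal_gen_eq_combinations[OF A sub] by blast
  have "ALL y. EX r. y : Y --> r : J & y = r ^ ?q" using Y(2) by blast
  then obtain r where r: "!!y. y : Y ==> r y : J & y = r y ^ ?q" by metis
  have "a = Ph (a ^ ?q * c)" using Ph(3)[OF c(1) a] Ph(4) by simp
  also have "a ^ ?q * c = (SUM y:Y. b y * y)" using Y(4) by(simp add: mult.commute)
  also have "Ph (SUM y:Y. b y * y) = (SUM y:Y. Ph (b y * y))" using Y sub by(intro additive_on_sum[OF A Ph(1)] subring_mult[OF A]) auto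
  also have "... = (SUM y:Y. r y * Ph (b y))"
  proof(rule sum.cong[OF refl])
   fix y assume y: "y : Y"
   have "Ph (b y * y) = Ph (r y ^ ?q * b y)" using r[OF y] by(metis mult.commute)
   also have "... = r y * Ph (b y)" using r[OF y] JA by(intro Ph(3) Y(3)) auto
   finally show "Ph (b y * y) = r y * Ph (b y)" .
  qed
  also have "... : J" using r Ph(2) Y(3) by(intro ideal_sum[OF J] ideal_mult_right[OF J]) auto
  finally show "a : J" .
 qed
qed

lemma F_rational_if_split:
 fixes A :: "'f::field set" assumes A: "noetherian A" and split: "frobenius_split A" and p: "CHAR('f) > 0" shows "F_rational A"
proof -
 have AS: "is_subring A" using A by(simp add: noetherian_def)
 have "tight_closure A (ideal_gen A (set xs)) = ideal_gen A (set xs)" if "parameters A xs" for xs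
  using that by(intro tight_closure_eq[OF AS split ideal_gen_ideal[OF AS] p]) (auto simp: parameters_def)
 thus ?thesis using noetherian_imp[OF A] domain_ring_on[OF AS] by(simp add: F_rational_def genideal_ring_on[OF AS])
qed

subsection \<open>Normal affine monoids\<close>

definition monoid_ring :: "('v \<Rightarrow>\<^sub>0 nat) set => ('v, 'k::comm_ring_1) mpoly set" where
 "monoid_ring S = {f. keys f <= S}"

lemma single_in_monoid_ring: "s : S ==> single s a : monoid_ring S" by(auto simp: monoid_ring_def)

lemma monoid_ring_subring: assumes "0 : S" "!!s t. s : S ==> t : S ==> s + t : S"
 shows "is_subring (monoid_ring S :: ('v, 'k::comm_ring_1) mpoly set)" unfolding is_subring_def
proof(intro conjI ballI)
 show "1 : (monoid_ring S :: ('v, 'k) mpoly set)" using assms(1) by(auto simp: monoid_ring_def)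
 fix f g :: "('v, 'k) mpoly" assume h: "f : monoid_ring S" "g : monoid_ring S"
 have "keys (f - g) <= keys f Un keys g" by(auto simp: in_keys_iff lookup_minus)
 thus "f - g : monoid_ring S" using h by(auto simp: monoid_ring_def)
 have "t : S" if "t : keys (f * g)" for t using subsetD[OF keys_mult that] h assms(2) by(auto simp: monoid_ring_def)
 thus "f * g : monoid_ring S" by(auto simp: monoid_ring_def)
qed

lemma frobenius_split_to_fract: assumes A: "is_subring (A :: 'a::idom set)" and "frobenius_split A" shows "frobenius_split (to_fract ` A)"
 unfolding frobenius_split_def
proof(intro ballI impI)
 fix z assume "z : to_fract ` A" "z ~= 0"
 then obtain c where c: "c : A" "z = to_fract c" "c ~= 0" by auto
 then obtain N where N: "!!e. e >= N ==> EX Ph. splits A e c Ph" using assms(2) unfolding frobenius_split_def by blast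
 have inj: "inj (to_fract :: 'a => 'a fract)" by(auto simp: inj_on_def)
 have "EX Ph. splits (to_fract ` A) e z Ph"
  if "e >= N" for e
 proof -
  obtain Ph where Ph: "ALL f:A. ALL g:A. Ph (f + g) = Ph f + Ph g" "ALL f:A. Ph f : A"
   "ALL f:A. ALL g:A. Ph (g ^ (CHAR('a) ^ e) * f) = g * Ph f" "Ph c = 1" using N[OF \<open>e >= N\<close>] unfolding splits_def by blast
  define \<Psi> where "\<Psi> z = to_fract (Ph (inv_into UNIV to_fract z))" for z
  have \<Psi>: "\<Psi> (to_fract f) = to_fract (Ph f)" for f using inv_f_f[OF inj] by(simp add: \<Psi>_def)
  have "\<Psi> (to_fract f + to_fract g) = \<Psi> (to_fract f) + \<Psi> (to_fract g)" if "f : A" "g : A" for f g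
   using Ph(1) that by(simp add: \<Psi> flip: to_fract_add)
  moreover have "\<Psi> (to_fract g ^ (CHAR('a fract) ^ e) * to_fract f) = to_fract g * \<Psi> (to_fract f)"
   if "f : A" "g : A" for f g using Ph(3) that by(simp add: \<Psi> CHAR_fract flip: to_fract_power to_fract_mult)
  ultimately show ?thesis using Ph(2,4) c(2) by(intro exI[of _ \<Psi>]) (auto simp: splits_def \<Psi>)
 qed
 thus "EX N. ALL e>=N. EX Ph. splits (to_fract ` A) e z Ph" by blast
qed

lemma to_fract_subring: "is_subring A ==> is_subring (to_fract ` A)" by(auto simp: is_subring_def simp flip: to_fract_diff to_fract_mult to_fract_1)

text \<open>The functionals in \<open>L\<close> stand for the facet inequalities of a cone: where
  they all say that \<open>a\<close> dominates \<open>b\<close>, the difference is again in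
  \<open>S\<close>, which is normality of the monoid. The coordinates are included so that only the
  zero exponent is killed by all of \<open>L\<close>.\<close>

locale normal_monoid =
 fixes S :: "('n::{finite, linorder} mon) set" and L :: "('n mon => int) set" assumes finite_L: "finite L"
  and L_add: "ph : L ==> ph (a + b) = ph a + ph b" and L_nonneg: "ph : L ==> s : S ==> ph s >= 0" and L_coord: "(%w. int (lookup w i)) : L"
  and S_0: "0 : S" and S_add: "s : S ==> t : S ==> s + t : S"
  and saturated: "a : S ==> b : S ==> (!!ph. ph : L ==> ph b <= ph a) ==> EX c:S. a = b + c"
begin

lemma L_0: "ph : L ==> ph 0 = 0" using L_add[of ph 0 0] by simp

lemma L_nscale: "ph : L ==> ph (nscale q t) = int q * ph t" by(induction q) (auto simp: L_0 nscale_Suc L_add algebra_simps)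

lemma S_nscale: "s : S ==> nscale q s : S" by(induction q) (auto simp: S_0 nscale_Suc S_add)

lemma S_sum: "(!!x. x : Y ==> f x : S) ==> sum f Y : S" by(induction Y rule: infinite_finite_induct) (auto intro: S_0 S_add)

lemma ring_subring: "is_subring (monoid_ring S)" using S_0 S_add by(rule monoid_ring_subring)

text \<open>Division by leading terms. Comparing leading exponents in
  \<open>c * a ^ k = g * b ^ k\<close> for large \<open>k\<close> shows that the leading exponent of
  \<open>a\<close> dominates that of \<open>b\<close> under all functionals, so by saturation the
  leading term of \<open>b\<close> can be divided out. The remainder satisfies the same hypotheses
  and is zero or has a smaller leading exponent.\<close>

lemma almost_integral_in_ring:
 fixes a b c :: "('n, 'k::field) mpoly" assumes b: "b : monoid_ring S" "b ~= 0" and c: "c : monoid_ring S" "c ~= 0" and a: "a : monoid_ring S"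
  and g: "!!k. EX g:monoid_ring S. c * a ^ k = g * b ^ k" shows "EX r:monoid_ring S. a = r * b"
proof -
 obtain n where n: "is_lead n b" using lead_exists[OF b(2)] by blast
 obtain l where l: "is_lead l c" using lead_exists[OF c(2)] by blast
 have lS: "n : S" "l : S" using n l b c by(auto simp: is_lead_def monoid_ring_def)
 have "EX r:monoid_ring S. a = r * b"
  if "a : monoid_ring S" "!!k. EX g:monoid_ring S. c * a ^ k = g * b ^ k"
   "a = 0 | (EX m. is_lead m a & card {v. grlex v m} = N)" for a N using that
 proof(induction N arbitrary: a rule: less_induct)
  case (less N)
  show ?case
  proof(cases "a = 0")
   case True
   thus ?thesis using subring_0[OF ring_subring] by(intro bexI[of _ 0]) auto
  next
   case False
   then obtain m where m: "is_lead m a" "card {v. grlex v m} = N" using less.prems(3) by blast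
   have mS: "m : S" using m less.prems(1) by(auto simp: is_lead_def monoid_ring_def)
   have "ph n <= ph m" if ph: "ph : L" for ph
   proof(rule ccontr)
    assume "~ ph n <= ph m"
    \<comment> \<open>With \<open>k\<close> larger than \<open>ph l\<close>, a deficit of at least 1
      per factor exceeds what \<open>c\<close> can make up for.\<close>
    define k where "k = nat (ph l) + 1"
    obtain g where g: "g : monoid_ring S" "c * a ^ k = g * b ^ k" using less.prems(2) by blast
    have lead: "is_lead (l + nscale k m) (c * a ^ k)" by(intro is_lead_times is_lead_power l m)
    hence "g ~= 0" using g(2) by(auto simp: is_lead_def)
    then obtain t where t: "is_lead t g" using lead_exists by blast
    hence tS: "t : S" using g by(auto simp: is_lead_def monoid_ring_def)
    have "is_lead (t + nscale k n) (c * a ^ k)" unfolding g(2) by(intro is_lead_times is_lead_power t n)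
    hence "l + nscale k m = t + nscale k n" using lead is_lead_unique by blast
    hence "ph (l + nscale k m) = ph (t + nscale k n)" by simp
    hence "ph l + int k * ph m = ph t + int k * ph n" by(simp add: L_add[OF ph] L_nscale[OF ph])
    hence "int k * (ph n - ph m) <= ph l" using L_nonneg[OF ph tS] by(simp add: algebra_simps)
    moreover have "int k * 1 <= int k * (ph n - ph m)" using \<open>~ ph n <= ph m\<close> by(intro mult_left_mono) auto
    moreover have "ph l < int k" using L_nonneg[OF ph lS(2)] by(simp add: k_def)
    ultimately show False by simp
   qed
   then obtain s where s: "s : S" "m = n + s" using saturated[OF mS lS(1)] by blast
   define h where "h = single s (lookup a m / lookup b n)"
   have hS: "h : monoid_ring S" unfolding h_def using s(1) by(rule single_in_monoid_ring)
   define a' where "a' = a - h * b"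
   have a'S: "a' : monoid_ring S" unfolding a'_def by(intro subring_diff[OF ring_subring] subring_mult[OF ring_subring] less.prems(1) hS b(1))
   have "EX g:monoid_ring S. c * a' ^ k = g * b ^ k" for k
   proof -
    obtain g where g: "!!i. g i : monoid_ring S" "!!i. c * a ^ i = g i * b ^ i" using less.prems(2) by metis
    \<comment> \<open>In the binomial expansion each \<open>c * a ^ i\<close> is a multiple of
      \<open>b ^ i\<close>, and the other factor supplies \<open>b ^ (k - i)\<close>.\<close>
    have "c * a' ^ k = (SUM i<=k. of_nat (k choose i) * (c * a ^ i) * (- (h * b)) ^ (k - i))"
     unfolding a'_def diff_conv_add_uminus binomial_ring by(simp add: sum_distrib_left mult_ac)
    also have "... = (SUM i<=k. of_nat (k choose i) * g i * (- h) ^ (k - i)) * b ^ k" unfolding sum_distrib_right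
    proof(intro sum.cong refl)
     fix i assume "i : {..k}"
     hence "b ^ k = b ^ i * b ^ (k - i)" by(simp flip: power_add)
     moreover have "(- (h * b)) ^ (k - i) = (- h) ^ (k - i) * b ^ (k - i)" by(simp flip: power_mult_distrib)
     ultimately show "of_nat (k choose i) * (c * a ^ i) * (- (h * b)) ^ (k - i)
      = of_nat (k choose i) * g i * (- h) ^ (k - i) * b ^ k" by(simp add: g(2) mult_ac)
    qed
    finally have "c * a' ^ k = (SUM i<=k. of_nat (k choose i) * g i * (- h) ^ (k - i)) * b ^ k" .
    moreover have "of_nat j : monoid_ring S" for j by(induction j) (use ring_subring in \<open>auto intro: subring_0 subring_1 subring_add\<close>)
    ultimately show ?thesis using g(1) hS ring_subring by(intro bexI[of _ "SUM i<=k. of_nat (k choose i) * g i * (- h) ^ (k - i)"])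
      (auto intro!: subring_sum subring_mult subring_power subring_uminus)
   qed
   note ai = this
   have "EX r:monoid_ring S. a' = r * b"
   proof(cases "a' = 0")
    case True
    thus ?thesis using subring_0[OF ring_subring] by(intro bexI[of _ 0]) auto
   next
    case False
    then obtain m' where m': "is_lead m' a'" using lead_exists by blast
    have hb: "is_lead m (h * b)"
    proof -
     have "lookup a m ~= 0" "lookup b n ~= 0" using m n by(auto simp: is_lead_def in_keys_iff)
     hence "is_lead s h" by(simp add: is_lead_def h_def)
     thus ?thesis using is_lead_times[OF _ n, of s h] s(2) by(simp add: add.commute)
    qed
    have "lookup (h * b) m = lookup a m"
    proof -
     have "lookup (h * b) m = (SUM t:keys b. if s + t = m then lookup h s * lookup b t else 0)"
     proof -
      have kh: "keys h = {s}" using m n by(auto simp: h_def is_lead_def in_keys_iff split: if_splits)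
      show ?thesis unfolding lookup_times kh by simp
     qed
     also have "... = (SUM t:keys b. if t = n then lookup h s * lookup b n else 0)" by(intro sum.cong refl) (auto simp: s(2) add.commute)
     also have "... = lookup h s * lookup b n" using n by(simp add: is_lead_def)
     also have "... = lookup a m" using n by(simp add: h_def is_lead_def in_keys_iff)
     finally show ?thesis .
    qed
    hence "m ~: keys a'" by(simp add: a'_def in_keys_iff lookup_minus)
    moreover have "m' : keys a Un keys (h * b)" using m' by(auto simp: is_lead_def a'_def in_keys_iff lookup_minus)
    ultimately have "grlex m' m" using m' m(1) hb by(auto simp: is_lead_def)
    hence "{v. grlex v m'} \<subset> {v. grlex v m}" using grlex_trans grlex_irrefl by blast
    hence "card {v. grlex v m'} < N" using m(2) psubset_card_mono[OF finite_grlex] by blast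
    thus ?thesis using less.IH[OF _ a'S ai] m' by blast
   qed
   then obtain r where "r : monoid_ring S" "a' = r * b" by blast
   hence "a = (r + h) * b" by(simp add: a'_def algebra_simps)
   thus ?thesis using \<open>r : monoid_ring S\<close> hS subring_add[OF ring_subring] by blast
  qed
 qed
 note * = this
 have "a = 0 | (EX m. is_lead m a & card {v. grlex v m} = card {v. grlex v (SOME m. is_lead m a)})" using lead_exists[of a] by(metis someI_ex)
 thus ?thesis by(rule *[OF a g])
qed

lemma normal_ring: "normal_domain (to_fract ` (monoid_ring S :: ('n, 'k::field) mpoly set))"
proof -
 let ?A = "to_fract ` (monoid_ring S :: ('n, 'k) mpoly set)"
 have A: "is_subring ?A" by(intro to_fract_subring ring_subring)
 have "z : ?A" if z: "z : frac_field ?A" "integral_over ?A z" for z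
 proof -
  obtain a b where ab: "a : monoid_ring S" "b : monoid_ring S" "b ~= 0" "z = to_fract a / to_fract b" using z(1) by(auto simp: frac_field_def)
  obtain c' where c': "c' : ?A" "c' ~= 0" "!!k. c' * z ^ k : ?A" using integral_almost_integral[OF A z] by blast
  then obtain c where c: "c : monoid_ring S" "c' = to_fract c" "c ~= 0" by auto
  have "EX g:monoid_ring S. c * a ^ k = g * b ^ k" for k
  proof -
   obtain g where g: "g : monoid_ring S" "to_fract c * z ^ k = to_fract g" using c'(3)[of k] c(2) by auto
   have "to_fract c * to_fract a ^ k = to_fract g * to_fract b ^ k" using g(2) ab(3,4) by(simp add: power_divide field_simps)
   hence "to_fract (c * a ^ k) = to_fract (g * b ^ k)" by(simp add: to_fract_power)
   thus ?thesis using g(1) by(metis to_fract_eq_iff)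
  qed
  then obtain r where r: "r : monoid_ring S" "a = r * b" using almost_integral_in_ring[OF ab(2,3) c(1,3) ab(1)] by blast
  hence "z = to_fract r" using ab by simp
  thus ?thesis using r(1) by blast
 qed
 thus ?thesis using domain_ring_on[OF A] by(simp add: normal_domain_def)
qed

text \<open>The splitting extracts the exponents congruent to a fixed exponent \<open>mu\<close> of \<open>c\<close> modulo a
 power of the characteristic that exceeds all exponents occurring in \<open>c\<close>.\<close>

lemma frobenius_split_ring: assumes p: "CHAR('k::field) > 0" shows "frobenius_split (monoid_ring S :: ('n, 'k) mpoly set)"
 unfolding frobenius_split_def
proof(intro ballI impI)
 fix c :: "('n, 'k) mpoly" assume c: "c : monoid_ring S" "c ~= 0"
 have pr: "Factorial_Ring.prime CHAR('k)" using p prime_CHAR_semidom by blast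
 obtain mu where mu: "mu : keys c" using c(2) by(metis equals0I keys_eq_empty poly_mapping_eqI lookup_zero not_in_keys_iff_lookup_eq_zero)
 have muS: "mu : S" using c mu by(auto simp: monoid_ring_def)
 \<comment> \<open>The first summand bounds the functionals at \<open>mu\<close>, which makes
   quotients exist in \<open>S\<close>; the second bounds the degrees in \<open>c\<close>, so that
   \<open>mu\<close> is the only exponent of \<open>c\<close> of the form
   \<open>mu + nscale q ta\<close>.\<close>
 define N where "N = nat (Max (insert 0 ((%ph. ph mu) ` L))) + (SUM \<nu>:keys c. esize \<nu>)"
 have N1: "ph mu <= int N" if "ph : L" for ph
 proof -
  have "ph mu <= Max (insert 0 ((%ph. ph mu) ` L))" using finite_L that by(intro Max_ge) auto
  moreover have "Max (insert 0 ((%ph. ph mu) ` L)) <= int N" unfolding N_def by linarith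
  ultimately show ?thesis by linarith
 qed
 have N2: "esize \<nu> <= N" if "\<nu> : keys c" for \<nu> using member_le_sum[OF that, of esize] by(simp add: N_def)
 have "EX Ph. splits (monoid_ring S) e c Ph"
  if e: "e >= N" for e
 proof -
  define q where "q = CHAR('k) ^ e"
  have "N < 2 ^ e" using e less_exp[of e] by linarith
  also have "2 ^ e <= q" unfolding q_def using pr by(intro power_mono) (auto simp: prime_ge_2_nat)
  finally have Nq: "N < q" .
  obtain ka :: "'k => 'k" where ka: "!!x y. ka (x + y) = ka x + ka y" "!!x y. ka (x ^ q * y) = x * ka y"
   "ka (lookup c mu) = 1" using frobenius_functional[OF p, of "lookup c mu" e] mu unfolding q_def in_keys_iff by blast
  have ka0: "ka 0 = 0" using additive_0[of ka] ka(1) by blast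
  define h where "h t x = (if EX ta:S. t = mu + nscale q ta then single (SOME ta. ta : S & t = mu + nscale q ta) (ka x) else 0)" for t x
  have hI: "h t x = single ta (ka x)" if "ta : S" "t = mu + nscale q ta" for t x ta
  proof -
   have "(SOME ta. ta : S & t = mu + nscale q ta) = ta" using that Nq by(intro some_equality) (auto dest: nscale_inject[rotated])
   thus ?thesis using that by(auto simp: h_def)
  qed
  have h0: "h t x = 0" if "!!ta. ta : S ==> t ~= mu + nscale q ta" for t x using that by(auto simp: h_def)
  have hz: "h t 0 = 0" for t by(simp add: h_def ka0)
  have ha: "h t (a + b) = h t a + h t b" for t a b by(simp add: h_def ka(1) single_add)
  let ?Ph = "lin_ext h"
  have add: "?Ph (f + g) = ?Ph f + ?Ph g" for f g by(rule lin_ext_add[OF hz ha])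
  have single: "?Ph (single t x) = h t x" for t x by(rule lin_ext_single[of h t, OF hz])
  have "h t x : monoid_ring S" for t x using hI[of _ t x] h0[of t x] single_in_monoid_ring subring_0[OF ring_subring] by metis
  hence mem: "?Ph f : monoid_ring S" for f unfolding lin_ext_def by(intro subring_sum[OF ring_subring])
  \<comment> \<open>If \<open>nscale q s + \<nu> = mu + nscale q ta'\<close>, a functional with a
    larger value at \<open>s\<close> than at \<open>ta'\<close> would need
    \<open>q <= ph mu\<close>. As \<open>q\<close> exceeds \<open>N\<close>, saturation makes
    \<open>ta' - s\<close> an element of \<open>S\<close>.\<close>
  have sp: "h (nscale q s + \<nu>) (x ^ q * y) = single s x * h \<nu> y" if s: "s : S" and \<nu>: "\<nu> : S" for s \<nu> x y
  proof(cases "EX ta:S. nscale q s + \<nu> = mu + nscale q ta")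
   case True
   then obtain ta' where ta': "ta' : S" "nscale q s + \<nu> = mu + nscale q ta'" by blast
   have "ph s <= ph ta'" if ph: "ph : L" for ph
   proof(rule ccontr)
    assume "~ ph s <= ph ta'"
    hence "int q * 1 <= int q * (ph s - ph ta')" by(intro mult_left_mono) auto
    moreover have "ph (nscale q s + \<nu>) = ph (mu + nscale q ta')" using ta'(2) by simp
    hence "int q * (ph s - ph ta') = ph mu - ph \<nu>" by(simp add: L_add[OF ph] L_nscale[OF ph] algebra_simps)
    ultimately show False using N1[OF ph] Nq L_nonneg[OF ph \<nu>] by simp
   qed
   then obtain ta where ta: "ta : S" "ta' = s + ta" using saturated[OF ta'(1) s] by blast
   have "nscale q s + \<nu> = nscale q s + (mu + nscale q ta)" using ta'(2) by(simp add: ta(2) nscale_add add_ac)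
   hence "\<nu> = mu + nscale q ta" by simp
   thus ?thesis using hI[OF ta(1), of \<nu> y] hI[OF ta'(1,2), of "x ^ q * y"] ta(2) by(simp add: ka(2) mult_single)
  next
   case False
   have "\<nu> ~= mu + nscale q ta" if "ta : S" for ta
   proof
    assume "\<nu> = mu + nscale q ta"
    hence "nscale q s + \<nu> = mu + nscale q (s + ta)" by(simp add: nscale_add add_ac)
    thus False using False S_add[OF s that] by blast
   qed
   thus ?thesis using False h0 by simp
  qed
  have lin: "?Ph (g ^ q * f) = g * ?Ph f" if f: "f : monoid_ring S" and g: "g : monoid_ring S" for f g
  proof -
   let ?F = "keys f" and ?G = "keys g"
   have "g ^ q = (SUM s:?G. single s (lookup g s)) ^ q" by(simp add: sum_single_lookup)
   also have "... = (SUM s:?G. single s (lookup g s) ^ q)"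
    unfolding q_def by(rule freshmans_dream_sum') (use pr in \<open>simp_all add: CHAR_poly_mapping\<close>)
   finally have gq: "g ^ q = (SUM s:?G. single (nscale q s) (lookup g s ^ q))" by(simp add: single_power)
   have "g ^ q * f = (SUM s:?G. SUM \<nu>:?F. single (nscale q s + \<nu>) (lookup g s ^ q * lookup f \<nu>))"
    unfolding gq by(subst (1) sum_single_lookup[of f, symmetric]) (simp add: sum_product mult_single)
   hence "?Ph (g ^ q * f) = (SUM s:?G. SUM \<nu>:?F. h (nscale q s + \<nu>) (lookup g s ^ q * lookup f \<nu>))"
    by(simp add: additive_sum[of ?Ph, OF add] single)
   also have "... = (SUM s:?G. SUM \<nu>:?F. single s (lookup g s) * h \<nu> (lookup f \<nu>))"
    using f g by(intro sum.cong refl sp) (auto simp: monoid_ring_def)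
   also have "... = g * ?Ph f" by(subst (3) sum_single_lookup[of g, symmetric]) (simp add: sum_product lin_ext_def)
   finally show ?thesis .
  qed
  have "?Ph c = 1"
  proof -
   have "h \<nu> (lookup c \<nu>) = (if \<nu> = mu then 1 else 0)" if \<nu>: "\<nu> : keys c" for \<nu>
   proof(cases "\<nu> = mu")
    case True
    thus ?thesis using hI[OF S_0, of mu "lookup c mu"] ka(3) by(simp add: poly_mapping_eqI)
   next
    case False
    have "\<nu> ~= mu + nscale q ta" for ta
    proof
     assume eq: "\<nu> = mu + nscale q ta"
     have "esize \<nu> >= q * esize ta" by(simp add: eq esize_add esize_nscale)
     hence "q * esize ta < q" using N2[OF \<nu>] Nq by linarith
     hence "ta = 0" by(simp add: esize_eq_0_iff)
     hence "nscale q ta = 0" by(intro poly_mapping_eqI) simp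
     thus False using eq False by simp
    qed
    thus ?thesis using h0 False by simp
   qed
   hence "?Ph c = (SUM \<nu>:keys c. if \<nu> = mu then 1 else 0)" unfolding lin_ext_def by(intro sum.cong) auto
   thus ?thesis using mu by simp
  qed
  thus ?thesis using add mem lin by(intro exI[of _ ?Ph]) (auto simp: splits_def CHAR_poly_mapping q_def)
 qed
 thus "EX N. ALL e>=N. EX Ph. splits (monoid_ring S) e c Ph" by blast
qed

end

subsection \<open>Faces\<close>

context normal_monoid
begin

text \<open>For \<open>w\<close> in \<open>S\<close> the functionals outside \<open>supp w\<close>
  vanish at \<open>w\<close> and cut out the smallest face of the cone through \<open>w\<close>.
  Faces are represented by these sets, larger sets being larger faces.\<close>

definition supp :: "'n mon => ('n mon => int) set" where
 "supp w = {ph\<in>L. ph w > 0}"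

lemma supp_add: "a : S ==> b : S ==> supp (a + b) = supp a Un supp b"
 using L_nonneg[of _ a] L_nonneg[of _ b] L_add by(auto simp: supp_def) (smt (verit))+

lemma supp_0 [simp]: "supp 0 = {}" by(auto simp: supp_def L_0)

lemma supp_nscale: "k > 0 ==> supp (nscale k a) = supp a" by(auto simp: supp_def L_nscale zero_less_mult_iff)

lemma supp_empty: "supp a = {} ==> a = 0"
proof(rule poly_mapping_eqI)
 fix i assume "supp a = {}"
 hence "~ int (lookup a i) > 0" using L_coord[of i] by(auto simp: supp_def)
 thus "lookup a i = lookup 0 i" by simp
qed

text \<open>In the ring: a power of the monomial of \<open>a\<close> is divisible by the monomial of
  \<open>b\<close> once the face of \<open>a\<close> contains that of \<open>b\<close>.\<close>

lemma nscale_dominates: assumes a: "a : S" and b: "b : S" and sub: "supp b <= supp a" shows "EX k. EX c:S. nscale k a = b + c"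
proof -
 define k where "k = nat (Max (insert 0 ((%ph. ph b) ` L)))"
 have "ph b <= ph (nscale k a)" if ph: "ph : L" for ph
 proof(cases "ph b > 0")
  case True
  have "ph b <= Max (insert 0 ((%ph. ph b) ` L))" using finite_L ph by(intro Max_ge) auto
  hence "ph b <= int k" unfolding k_def by linarith
  moreover have "ph a >= 1" using sub True ph by(auto simp: supp_def)
  hence "int k * 1 <= int k * ph a" by(intro mult_left_mono) auto
  ultimately show ?thesis by(simp add: L_nscale[OF ph])
 next
  case False
  thus ?thesis using L_nonneg[OF ph S_nscale[OF a, of k]] by simp
 qed
 thus ?thesis using saturated[OF S_nscale[OF a] b] by blast
qed

definition faces where "faces = supp ` S"

lemma finite_faces: "finite faces" by(rule finite_subset[of _ "Pow L"]) (use finite_L in \<open>auto simp: faces_def supp_def\<close>)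

lemma faces_finite: "Z : faces ==> finite Z" using finite_L by(auto simp: faces_def supp_def)

lemma faces_empty: "{} : faces" using S_0 supp_0 unfolding faces_def by(metis image_eqI)

lemma faces_Un: "Z : faces ==> Z' : faces ==> Z Un Z' : faces" unfolding faces_def using supp_add S_add by(auto simp: image_iff) metis

definition face_chain :: "nat => (nat => ('n mon => int) set) => bool" where
 "face_chain n c \<longleftrightarrow> (ALL i<=n. c i : faces) & (ALL i<n. c i \<subset> c (Suc i))"

text \<open>With longest chains a strict inclusion always raises the height, so different faces of
  equal height are never nested.\<close>

definition height where "height Z = Max {n. EX c. face_chain n c & c n = Z}"

lemma face_chain_card: "face_chain n c ==> i <= n ==> i <= card (c i)"
proof(induction i)
 case (Suc i)
 hence "c i \<subset> c (Suc i)" "finite (c (Suc i))" by(auto simp: face_chain_def faces_finite)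
 hence "card (c i) < card (c (Suc i))" by(rule psubset_card_mono[rotated])
 thus ?case using Suc by simp
qed simp

lemma finite_chain_lengths: "finite {n. EX c. face_chain n c & c n = Z}"
proof(rule finite_subset[of _ "{..card Z}"])
 show "{n. EX c. face_chain n c & c n = Z} <= {..card Z}" using face_chain_card by fastforce
qed simp

lemma height_ge: "face_chain n c ==> n <= height (c n)" unfolding height_def by(rule Max_ge[OF finite_chain_lengths]) auto

lemma height_chain: assumes "Z : faces" obtains c where "face_chain (height Z) c" "c (height Z) = Z"
proof -
 have "face_chain 0 (%_. Z)" using assms by(simp add: face_chain_def)
 hence "{n. EX c. face_chain n c & c n = Z} ~= {}" by auto
 hence "height Z : {n. EX c. face_chain n c & c n = Z}" unfolding height_def by(rule Max_in[OF finite_chain_lengths])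
 thus ?thesis using that by blast
qed

lemma height_less: assumes Z: "Z' : faces" "Z : faces" "Z' \<subset> Z" shows "height Z' < height Z"
proof -
 obtain c where c: "face_chain (height Z') c" "c (height Z') = Z'" using height_chain[OF Z(1)] by blast
 let ?n = "height Z'"
 define c' where "c' i = (if i <= ?n then c i else Z)" for i
 have "face_chain (Suc ?n) c'" using c Z unfolding face_chain_def c'_def by(auto simp: le_Suc_eq less_Suc_eq)
 hence "Suc ?n <= height (c' (Suc ?n))" by(rule height_ge)
 thus ?thesis by(simp add: c'_def)
qed

lemma height_empty: "height {} = 0"
proof -
 obtain c where c: "face_chain (height {}) c" "c (height {}) = {}" using height_chain[OF faces_empty] by blast
 thus ?thesis using face_chain_card[OF c(1), of "height {}"] by simp
qed

definition top_face where "top_face = \<Union>faces"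

lemma top_face: "top_face : faces"
proof -
 have "\<Union>\<G> : faces" if "finite \<G>" "\<G> <= faces" for \<G>
  using that by(induction \<G> rule: finite_induct) (auto intro: faces_empty faces_Un)
 thus ?thesis using finite_faces unfolding top_face_def by blast
qed

lemma face_le_top: "Z : faces ==> Z <= top_face" unfolding top_face_def by blast

definition fdim where "fdim = height top_face"

lemma height_le_fdim: "Z : faces ==> height Z <= fdim"
 using height_less[OF _ top_face, of Z] face_le_top[of Z] unfolding fdim_def by(metis less_imp_le order_refl psubsetI)

text \<open>A longest chain up to the top face cannot skip a height: the position in the chain
  bounds the height from below, and strict descent from the top bounds it from above.\<close>

lemma flag_exists:
 obtains c where "!!i. i <= fdim ==> c i : faces" "!!i. i < fdim ==> c i \<subset> c (Suc i)"
  "!!i. i <= fdim ==> height (c i) = i" "c fdim = top_face"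
proof -
 obtain c where c: "face_chain fdim c" "c fdim = top_face" using height_chain[OF top_face] unfolding fdim_def by blast
 have f: "c i : faces" if "i <= fdim" for i using c that by(simp add: face_chain_def)
 have ss: "c i \<subset> c (Suc i)" if "i < fdim" for i using c that by(simp add: face_chain_def)
 have ge: "i <= height (c i)" if "i <= fdim" for i using c(1) that by(intro height_ge) (simp add: face_chain_def)
 have le: "height (c (fdim - j)) <= fdim - j" if "j <= fdim" for j using that
 proof(induction j)
  case 0
  thus ?case using c(2) by(simp add: fdim_def)
 next
  case (Suc j)
  have "height (c (fdim - Suc j)) < height (c (Suc (fdim - Suc j)))" using Suc.prems by(intro height_less f ss) auto
  moreover have "Suc (fdim - Suc j) = fdim - j" using Suc.prems by simp
  ultimately show ?case using Suc by simp
 qed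
 have "height (c i) = i" if "i <= fdim" for i using ge[OF that] le[of "fdim - i"] that by simp
 thus ?thesis using that f ss c(2) by blast
qed

subsection \<open>Parameters attached to the faces\<close>

definition face_rep0 where "face_rep0 Z = (SOME s. s : S & supp s = Z)"

text \<open>A common multiple of the degrees of the representatives; scaling each of them to this
  degree makes all parameters homogeneous of the same degree.\<close>

definition pdeg where "pdeg = (\<Prod>Z\<in>faces - {{}}. esize (face_rep0 Z))"

definition face_rep where "face_rep Z = nscale (pdeg div esize (face_rep0 Z)) (face_rep0 Z)"

lemma face_rep0: "Z : faces ==> face_rep0 Z : S & supp (face_rep0 Z) = Z" unfolding face_rep0_def by(rule someI_ex) (auto simp: faces_def)

lemma pdeg_pos: "pdeg > 0"
proof -
 have "esize (face_rep0 Z) ~= 0" if "Z : faces - {{}}" for Z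
 proof
  assume "esize (face_rep0 Z) = 0"
  hence "face_rep0 Z = 0" by(simp add: esize_eq_0_iff)
  thus False using face_rep0[of Z] that by auto
 qed
 thus ?thesis unfolding pdeg_def by(intro prod_pos) blast
qed

lemma face_rep: assumes "Z : faces" "Z ~= {}" shows "face_rep Z : S" "supp (face_rep Z) = Z" "esize (face_rep Z) = pdeg"
proof -
 have dvd: "esize (face_rep0 Z) dvd pdeg" unfolding pdeg_def using finite_faces assms by(intro dvd_prodI) auto
 show "face_rep Z : S" unfolding face_rep_def using face_rep0[OF assms(1)] by(intro S_nscale) auto
 have "pdeg div esize (face_rep0 Z) > 0" using dvd pdeg_pos by(metis dvd_div_eq_0_iff gr0I not_gr0)
 thus "supp (face_rep Z) = Z" unfolding face_rep_def using face_rep0[OF assms(1)] by(simp add: supp_nscale)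
 show "esize (face_rep Z) = pdeg" unfolding face_rep_def esize_nscale using dvd by simp
qed

text \<open>The coefficients 0 and 1 are integers, so the same formula gives the parameters in every
  characteristic and \<open>int_map\<close> preserves them.\<close>

definition theta :: "nat => ('n, 'k::comm_ring_1) mpoly" where
 "theta i = (SUM Z:{Z\<in>faces. height Z = i}. single (face_rep Z) 1)"

definition thetas :: "('n, 'k::comm_ring_1) mpoly list" where
 "thetas = map theta [1..<Suc fdim]"

lemma length_thetas [simp]: "length thetas = fdim" by(simp add: thetas_def)

lemma face_of_height: "Z : faces ==> height Z = i ==> i > 0 ==> Z ~= {}" using height_empty by auto

lemma theta_in_ring: "i > 0 ==> theta i : monoid_ring S" unfolding theta_def
 by(intro subring_sum[OF ring_subring] single_in_monoid_ring) (use face_rep(1) face_of_height in blast)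

lemma thetas_in_ring: "set thetas <= monoid_ring S" by(auto simp: thetas_def theta_in_ring)

lemma lookup_theta: assumes i: "i > 0" and Z: "Z : faces" "height Z = i" shows "lookup (theta i :: ('n, 'k::comm_ring_1) mpoly) (face_rep Z) = 1"
proof -
 have "lookup (theta i :: ('n, 'k) mpoly) (face_rep Z)
   = (SUM Z':{Z\<in>faces. height Z = i}. if Z' = Z then 1 else 0)" unfolding theta_def lookup_sum
 proof(intro sum.cong refl)
  fix Z' assume Z': "Z' : {Z\<in>faces. height Z = i}"
  have "face_rep Z' = face_rep Z ==> Z' = Z"
   using face_rep(2)[of Z] face_rep(2)[of Z'] Z Z' i face_of_height by(metis (mono_tags, lifting) mem_Collect_eq)
  thus "lookup (single (face_rep Z') 1) (face_rep Z) = (if Z' = Z then 1 else (0::'k))" by(auto simp: lookup_single when_def)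
 qed
 thus ?thesis using Z finite_faces by simp
qed

lemma keys_theta: assumes "i > 0" "t : keys (theta i :: ('n, 'k::comm_ring_1) mpoly)" shows "EX Z:faces. height Z = i & t = face_rep Z"
proof(rule ccontr)
 assume n: "~ ?thesis"
 have "lookup (theta i :: ('n, 'k) mpoly) t = 0" unfolding theta_def lookup_sum using n by(intro sum.neutral) (auto simp: lookup_single when_def)
 thus False using assms(2) by(simp add: in_keys_iff)
qed

definition face_prime :: "('n mon => int) set => ('n, 'k::field) mpoly set" where
 "face_prime Z = {f\<in>monoid_ring S. ALL t:keys f. ~ supp t <= Z}"

text \<open>Dropping the terms off the face \<open>Z\<close> is a retraction onto the monoid ring of
  the face. Modulo the ideal, \<open>f * g\<close> equals \<open>r f * r g\<close>, all of whose
  terms lie on the face. If this product is in the ideal it is zero, and the polynomial ring is a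
  domain.\<close>

lemma face_prime_prime: "is_prime (monoid_ring S) (face_prime Z :: ('n, 'k::field) mpoly set)" unfolding is_prime_def
proof(intro conjI ballI impI)
 let ?A = "monoid_ring S :: ('n, 'k) mpoly set" and ?P = "face_prime Z :: ('n, 'k) mpoly set"
 have kS: "t : S" if "f : ?A" "t : keys f" for f t using that by(auto simp: monoid_ring_def)
 show I: "is_ideal ?A ?P" unfolding is_ideal_def
 proof(intro conjI ballI)
  show "?P <= ?A" by(auto simp: face_prime_def)
  show "0 : ?P" using subring_0[OF ring_subring] by(simp add: face_prime_def)
  fix f g assume "f : ?P" "g : ?P"
  thus "f + g : ?P" using keys_add[of f g] subring_add[OF ring_subring, of f g] by(auto simp: face_prime_def)
 next
  fix f g assume f: "f : ?A" and g: "g : ?P"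
  have "~ supp t <= Z" if t: "t : keys (f * g)" for t
  proof -
   obtain u v where uv: "t = u + v" "u : keys f" "v : keys g" using subsetD[OF keys_mult t] by blast
   hence "supp t = supp u Un supp v" using f g kS by(auto simp: face_prime_def intro!: supp_add)
   thus ?thesis using uv g by(auto simp: face_prime_def)
  qed
  thus "f * g : ?P" using f g subring_mult[OF ring_subring, of f g] by(auto simp: face_prime_def)
 qed
 show "1 ~: ?P" by(auto simp: face_prime_def)
 fix f g assume fg: "f : ?A" "g : ?A" "f * g : ?P"
 define r where "r f = (SUM t:{t\<in>keys f. supp t <= Z}. single t (lookup f t))" for f :: "('n, 'k) mpoly"
 have lr: "lookup (r f) t = (if supp t <= Z then lookup f t else 0)" for f t by(auto simp: r_def lookup_sum lookup_single when_def in_keys_iff)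
 have kr: "keys (r f) = {t\<in>keys f. supp t <= Z}" for f by(auto simp: in_keys_iff lr split: if_splits)
 have rA: "r f : ?A" if "f : ?A" for f using that by(auto simp: monoid_ring_def kr)
 have rP: "f - r f : ?P" if "f : ?A" for f
  using that subring_diff[OF ring_subring that rA[OF that]] by(auto simp: face_prime_def in_keys_iff lookup_minus lr)
 have "f * g - r f * r g = g * (f - r f) + r f * (g - r g)" by(simp add: algebra_simps)
 hence "f * g - r f * r g : ?P" using fg(1,2) by(simp only:) (intro ideal_add[OF I] ideal_mult[OF I] rP rA)
 hence "f * g - (f * g - r f * r g) : ?P" by(rule ideal_diff[OF ring_subring I fg(3)])
 moreover have "f * g - (f * g - r f * r g) = r f * r g" by simp
 ultimately have rr: "r f * r g : ?P" by(simp only:)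
 have "r f * r g = 0"
 proof(rule ccontr)
  assume "r f * r g ~= 0"
  then obtain t where t: "t : keys (r f * r g)" by(metis equals0I keys_eq_empty poly_mapping_eqI lookup_zero not_in_keys_iff_lookup_eq_zero)
  then obtain u v where uv: "t = u + v" "u : keys (r f)" "v : keys (r g)" using subsetD[OF keys_mult t] by blast
  hence "supp t = supp u Un supp v" using fg kS by(auto simp: kr intro!: supp_add)
  hence "supp t <= Z" using uv by(auto simp: kr)
  thus False using rr t by(auto simp: face_prime_def)
 qed
 hence "r f = 0 | r g = 0" by simp
 thus "f : ?P | g : ?P" using rP[OF fg(1)] rP[OF fg(2)] by auto
qed

definition scalars :: "('n, 'k::comm_ring_1) mpoly set" where
 "scalars = range (single 0)"

lemma scalars_subring: "is_subring scalars" unfolding is_subring_def scalars_def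
proof(intro conjI ballI)
 show "1 : range (single 0)" by(rule image_eqI[of _ _ 1]) auto
qed (auto simp: mult_single simp flip: single_diff)

lemma scalars_in_ring: "scalars <= monoid_ring S" by(auto simp: scalars_def intro!: single_in_monoid_ring S_0)

text \<open>Along a flag of faces the primes \<open>face_prime (c j)\<close> decrease. All faces in
  \<open>theta (Suc j)\<close> are too high to lie in \<open>c j\<close>, while
  \<open>c (Suc j)\<close> is among them, so each parameter lies in one prime of the chain and
  outside the next.\<close>

lemma thetas_indep: "indep scalars {0} (rev (thetas :: ('n, 'k::field) mpoly list))"
proof -
 obtain c where c: "!!i. i <= fdim ==> c i : faces" "!!i. i < fdim ==> c i \<subset> c (Suc i)"
  "!!i. i <= fdim ==> height (c i) = i" "c fdim = top_face" using flag_exists by blast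
 have "indep scalars (face_prime (c j)) (rev (map theta [1..<Suc j] :: ('n, 'k) mpoly list))" if "j <= fdim" for j using that
 proof(induction j)
  case 0
  show ?case unfolding indep_def
  proof(intro allI impI ballI)
   fix E d ks assume h: "(ALL ks. d ks : scalars) & (SUM ks:box (length (rev (map theta [1..<Suc 0]) :: ('n, 'k) mpoly list)) E.
    d ks * mono_eval (rev (map theta [1..<Suc 0]) :: ('n, 'k) mpoly list) ks) : face_prime (c 0)"
    and "ks : box (length (rev (map theta [1..<Suc 0]) :: ('n, 'k) mpoly list)) E"
   hence ks: "ks = []" by simp
   obtain a where a: "d [] = single 0 a" using h by(auto simp: scalars_def)
   have "single 0 a : face_prime (c 0)" using h by(simp add: a)
   hence "a = 0" by(auto simp: face_prime_def split: if_splits)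
   thus "d ks = 0" by(simp add: ks a)
  qed
 next
  case (Suc j)
  let ?P = "face_prime (c (Suc j)) :: ('n, 'k) mpoly set" and ?Q = "face_prime (c j) :: ('n, 'k) mpoly set"
  have j: "j < fdim" "Suc j <= fdim" using Suc.prems by auto
  have "indep scalars ?P (theta (Suc j) # rev (map theta [1..<Suc j]))"
  proof(rule indep_Cons_chain[OF ring_subring scalars_in_ring face_prime_prime face_prime_prime])
   show "?P <= ?Q" using c(2)[OF j(1)] by(auto simp: face_prime_def)
   show "theta (Suc j) : ?Q"
   proof -
    have "~ supp t <= c j" if t: "t : keys (theta (Suc j) :: ('n, 'k) mpoly)" for t
    proof
     assume sub: "supp t <= c j"
     obtain Z where Z: "Z : faces" "height Z = Suc j" "t = face_rep Z" using keys_theta[OF _ t] by auto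
     hence "Z <= c j" using sub face_rep(2)[OF Z(1)] face_of_height[OF Z(1,2)] by simp
     hence "height Z <= height (c j)" using height_less[OF Z(1) c(1)[of j]] j by(metis less_imp_le order_refl psubsetI)
     thus False using Z c(3)[of j] j by simp
    qed
    thus ?thesis using theta_in_ring[of "Suc j"] by(auto simp: face_prime_def)
   qed
   show "theta (Suc j) ~: ?P"
   proof
    assume "theta (Suc j) : ?P"
    moreover have "face_rep (c (Suc j)) : keys (theta (Suc j) :: ('n, 'k) mpoly)"
     using lookup_theta[of "Suc j" "c (Suc j)", where 'k = 'k] c j by(simp add: in_keys_iff)
    moreover have "supp (face_rep (c (Suc j))) = c (Suc j)" using c(1,3)[OF j(2)] face_of_height[of "c (Suc j)" "Suc j"] by(intro face_rep(2)) auto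
    ultimately show False by(auto simp: face_prime_def)
   qed
   show "set (rev (map theta [1..<Suc j])) <= (monoid_ring S :: ('n, 'k) mpoly set)" by(auto simp: theta_in_ring)
   show "indep scalars ?Q (rev (map theta [1..<Suc j]))" using Suc by simp
  qed
  thus ?case by simp
 qed
 from this[of fdim] have "indep scalars (face_prime top_face) (rev (thetas :: ('n, 'k) mpoly list))" using c(4) by(simp add: thetas_def)
 thus ?thesis using ideal_0[OF prime_ideal[OF face_prime_prime]] by(elim indep_antimono) auto
qed

end

subsection \<open>Regular sequences\<close>

lemma radical_ideal: assumes A: "is_subring A" and J: "is_ideal A J" shows "is_ideal A {f\<in>A. EX k. f ^ k : J}" unfolding is_ideal_def
proof(intro conjI ballI)
 show "0 : {f\<in>A. EX k. f ^ k : J}" using subring_0[OF A] ideal_0[OF J] by(auto intro!: exI[of _ 1])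
 fix f g assume "f : {f\<in>A. EX k. f ^ k : J}" "g : {f\<in>A. EX k. f ^ k : J}"
 then obtain k l where h: "f : A" "g : A" "f ^ k : J" "g ^ l : J" by blast
 have nat: "of_nat j : A" for j by(induction j) (use A in \<open>auto intro: subring_0 subring_1 subring_add\<close>)
 have "(f + g) ^ (k + l) = (SUM i<=k + l. of_nat (k + l choose i) * f ^ i * g ^ (k + l - i))" by(rule binomial_ring)
 also have "... : J"
 proof(rule ideal_sum[OF J])
  fix i
  let ?c = "of_nat (k + l choose i)"
  show "?c * f ^ i * g ^ (k + l - i) : J"
  proof(cases "k <= i")
   case True
   hence "f ^ i = f ^ (i - k) * f ^ k" by(simp flip: power_add)
   hence "?c * f ^ i * g ^ (k + l - i) = (?c * f ^ (i - k) * g ^ (k + l - i)) * f ^ k" by(simp add: mult_ac)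
   moreover have "?c * f ^ (i - k) * g ^ (k + l - i) : A" using h nat A by(intro subring_mult subring_power)
   ultimately show ?thesis using ideal_mult[OF J _ h(3)] by simp
  next
   case False
   hence "k + l - i = (k - i) + l" by simp
   hence "g ^ (k + l - i) = g ^ (k - i) * g ^ l" by(simp only: power_add)
   hence "?c * f ^ i * g ^ (k + l - i) = (?c * f ^ i * g ^ (k - i)) * g ^ l" by(simp add: mult_ac)
   moreover have "?c * f ^ i * g ^ (k - i) : A" using h nat A by(intro subring_mult subring_power)
   ultimately show ?thesis using ideal_mult[OF J _ h(4)] by simp
  qed
 qed
 finally show "f + g : {f\<in>A. EX k. f ^ k : J}" using h A by(auto intro: subring_add)
next
 fix a f assume "a : A" "f : {f\<in>A. EX k. f ^ k : J}"
 thus "a * f : {f\<in>A. EX k. f ^ k : J}" using A by(auto simp: power_mult_distrib intro: subring_mult subring_power ideal_mult[OF J])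
qed auto

definition regular_on :: "'a::comm_ring_1 set => 'a list => bool" where
 "regular_on A xs \<longleftrightarrow> (ALL j<length xs. ALL z:A. xs ! j * z : ideal_gen A (set (take j xs)) -->
   z : ideal_gen A (set (take j xs)))"

text \<open>Multiplication by \<open>y ^ q\<close> only shifts coefficients, so it is injective
  modulo any ideal extended from \<open>R\<close>.\<close>

lemma regular_on_adjoin1: assumes R: "is_subring R" and y: "transcendental R y" and xs: "set xs <= R" "regular_on R xs"
 shows "regular_on (adjoin1 R y) (xs @ [y ^ q])" unfolding regular_on_def
proof(intro allI impI ballI)
 let ?B = "adjoin1 R y"
 fix j z assume j: "j < length (xs @ [y ^ q])" and z: "z : ?B" and m: "(xs @ [y ^ q]) ! j * z : ideal_gen ?B (set (take j (xs @ [y ^ q])))"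
 let ?T = "set (take j xs)"
 have TR: "?T <= R" using xs(1) set_take_subset[of j xs] by blast
 have tk: "set (take j (xs @ [y ^ q])) = ?T" using j by simp
 have I: "is_ideal R (ideal_gen R ?T)" by(rule ideal_gen_ideal[OF R TR])
 have mem: "poly f y : ideal_gen ?B ?T \<longleftrightarrow> f : polys_over (ideal_gen R ?T)" if f: "f : polys_over R" for f
 proof -
  have "polys_over (ideal_gen R ?T) <= polys_over R" using I by(intro polys_over_mono) (auto simp: is_ideal_def)
  thus ?thesis unfolding ideal_gen_extend[OF R TR] using transcendental_eq[OF R y f] by auto
 qed
 obtain f where f: "f : polys_over R" "z = poly f y" using z by(auto simp: adjoin1_def)
 have "f : polys_over (ideal_gen R ?T)"
 proof(cases "j < length xs")
  case True
  hence xj: "xs ! j : R" using xs(1) by auto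
  have "Polynomial.smult (xs ! j) f : polys_over R" using f(1) xj by(auto simp: polys_over_def intro: subring_mult[OF R])
  moreover have "poly (Polynomial.smult (xs ! j) f) y : ideal_gen ?B ?T" using m tk True f(2) by(simp add: nth_append)
  ultimately have "Polynomial.smult (xs ! j) f : polys_over (ideal_gen R ?T)" using mem by blast
  thus ?thesis using xs(2) True f(1) by(auto simp: polys_over_def regular_on_def)
 next
  case False
  hence jl: "j = length xs" using j by simp
  have "Polynomial.monom 1 q * f : polys_over R" using f(1) subring_0[OF R] subring_1[OF R] by(intro polys_over_mult[OF R] polys_over_monom)
  moreover have "poly (Polynomial.monom 1 q * f) y : ideal_gen ?B ?T" using m tk jl f(2) by(simp add: poly_monom)
  ultimately have "Polynomial.monom 1 q * f : polys_over (ideal_gen R ?T)" using mem by blast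
  hence "coeff (Polynomial.monom 1 q * f) (q + i) : ideal_gen R ?T" for i by(rule polys_over_coeff)
  thus ?thesis by(simp add: coeff_monom_mult polys_over_def)
 qed
 thus "z : ideal_gen ?B (set (take j (xs @ [y ^ q])))" unfolding tk f(2) using mem[OF f(1)] by blast
qed

lemma regular_on_powers: assumes K: "is_subring K" shows "indep K {0} as ==> regular_on (adjoins K as) (map (%x. x ^ q) (rev as))"
proof(induction as)
 case (Cons a as)
 have R: "is_subring (adjoins K as)" by(rule adjoins_subring[OF K])
 have "set (map (%x. x ^ q) (rev as)) <= adjoins K as" using adjoins_generators[OF K, of as] by(auto intro: subring_power[OF R])
 thus ?case using regular_on_adjoin1[OF R indep_Cons(2)[OF K Cons.prems], of "map (%x. x ^ q) (rev as)" q]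
   Cons.IH[OF indep_Cons(1)[OF K Cons.prems]] by simp
qed (simp add: regular_on_def)

lemma adjoins_cong: "is_subring K ==> set as = set bs ==> adjoins K as = adjoins K bs"
 using adjoins_least[of "adjoins K as" K bs] adjoins_least[of "adjoins K bs" K as]
  adjoins_subring[of K] adjoins_superset[of K] adjoins_generators[of K as] adjoins_generators[of K bs] by blast

text \<open>Linear independence modulo all parameters lifts to linear independence over the ring
 generated by the parameters, one parameter at a time.\<close>

lemma free_over_adjoins: assumes A: "is_subring A" and K: "is_subring K" "K <= A" and W: "finite W" "!!w. w : W ==> x w : A"
 shows "set as <= A ==> T <= A ==>
  (!!j z. j < length as ==> z : A ==> as ! j * z : ideal_gen A (T Un set (take j as)) ==> z : ideal_gen A (T Un set (take j as))) ==>
  (!!k. (!!w. k w : K) ==> (SUM w:W. k w * x w) : ideal_gen A (T Un set as) ==> ALL w:W. k w = 0) ==>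
  (!!w. c w : adjoins K as) ==> (SUM w:W. c w * x w) : ideal_gen A T ==> ALL w:W. c w = 0"
proof(induction as arbitrary: T c)
 case Nil
 thus ?case by simp
next
 case (Cons a as)
 let ?R = "adjoins K as" let ?J = "ideal_gen A T" let ?J' = "ideal_gen A (insert a T)"
 have aA: "a : A" using Cons.prems(1) by simp
 have R: "is_subring ?R" by(rule adjoins_subring[OF K(1)])
 have RA: "?R <= A" using Cons.prems(1) by(intro adjoins_least[OF A K(2)]) auto
 have J': "is_ideal A ?J'" using aA Cons.prems(2) by(intro ideal_gen_ideal[OF A]) auto
 have JJ': "?J <= ?J'" by(rule ideal_gen_mono) auto
 have aJ': "a : ?J'" using ideal_gen_superset[of "insert a T" A] by auto
 have IH: "ALL w:W. c w = 0" if "!!w. c w : ?R" "(SUM w:W. c w * x w) : ?J'" for c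
 proof(rule Cons.IH[of "insert a T" c])
  show "set as <= A" "insert a T <= A" using Cons.prems(1,2) by auto
  fix j z assume "j < length as" "z : A" "as ! j * z : ideal_gen A (insert a T Un set (take j as))"
  thus "z : ideal_gen A (insert a T Un set (take j as))" using Cons.prems(3)[of "Suc j" z] by(simp add: insert_commute Un_insert_right)
 next
  fix k assume "!!w. k w : K" "(SUM w:W. k w * x w) : ideal_gen A (insert a T Un set as)"
  moreover have "insert a T Un set as = T Un set (a # as)" by auto
  ultimately show "ALL w:W. k w = 0" using Cons.prems(4)[of k] by metis
 qed (use that in auto)
 have "EX p. p : polys_over ?R & c w = poly p a" for w using Cons.prems(5)[of w] unfolding adjoins.simps adjoin1_def by blast
 then obtain p where p: "!!w. p w : polys_over ?R" "!!w. c w = poly (p w) a" by metis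
 \<comment> \<open>The coefficients are polynomials in \<open>a\<close>. Modulo \<open>a\<close>
   their constant terms vanish by the induction hypothesis; then \<open>a\<close> is cancelled by
   regularity and the degree drops.\<close>
 have "ALL w:W. p w = 0" if "!!w. p w : polys_over ?R" "(SUM w:W. poly (p w) a * x w) : ?J" "!!w. w : W ==> p w = 0 | degree (p w) < d" for p d
  using that
 proof(induction d arbitrary: p)
  case 0
  thus ?case by simp
 next
  case (Suc d)
  define r where "r w = coeff (p w) 0" for w
  define s where "s w = (SUM i<degree (p w). Polynomial.monom (coeff (p w) (Suc i)) i)" for w
  have sc: "coeff (s w) i = coeff (p w) (Suc i)" for w i
  proof(cases "i < degree (p w)")
   case False
   thus ?thesis by(simp add: s_def coeff_sum coeff_eq_0)
  qed (simp add: s_def coeff_sum)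
  have ps: "p w = pCons (r w) (s w)" for w by(rule poly_eqI) (auto simp: coeff_pCons sc r_def split: nat.split)
  have rR: "r w : ?R" for w using Suc.prems(1) by(simp add: r_def polys_over_def)
  have sR: "s w : polys_over ?R" for w using Suc.prems(1) by(simp add: sc polys_over_def)
  have sA: "poly (s w) a : A" for w using sR[of w] RA aA by(intro subring_poly[OF A]) (auto simp: polys_over_def)
  have sumA: "(SUM w:W. poly (s w) a * x w) : A" by(intro subring_sum[OF A] subring_mult[OF A] sA W(2))
  have eq: "(SUM w:W. poly (p w) a * x w) = (SUM w:W. r w * x w) + a * (SUM w:W. poly (s w) a * x w)"
   by(simp add: ps algebra_simps sum.distrib sum_distrib_left)
  have "(SUM w:W. poly (p w) a * x w) : ?J'" using Suc.prems(2) JJ' by blast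
  hence "(SUM w:W. poly (p w) a * x w) - (SUM w:W. poly (s w) a * x w) * a : ?J'" by(rule ideal_diff[OF A J' _ ideal_mult[OF J' sumA aJ']])
  hence "(SUM w:W. r w * x w) : ?J'" unfolding eq by(simp add: mult.commute)
  hence r0: "ALL w:W. r w = 0" using IH[of r] rR by blast
  hence "a * (SUM w:W. poly (s w) a * x w) : ?J" using Suc.prems(2) unfolding eq by simp
  hence "(SUM w:W. poly (s w) a * x w) : ?J" using Cons.prems(3)[of 0] sumA by simp
  moreover have "s w = 0 | degree (s w) < d" if w: "w : W" for w using Suc.prems(3)[OF w] ps[of w] by(cases "s w = 0") (auto simp: )
  ultimately have "ALL w:W. s w = 0" using Suc.IH[of s] sR by blast
  thus ?case using r0 ps by simp
 qed
 from this[of p "Max (insert 0 ((%w. degree (p w)) ` W)) + 1"]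
 have "ALL w:W. p w = 0" using p Cons.prems(6) W(1) by(auto simp: less_Suc_eq_le)
 thus ?case using p(2) by simp
qed

locale normal_affine_monoid = normal_monoid S L
 for S :: "('n::{finite, linorder} mon) set" and L +
 fixes G :: "'n mon set" assumes finite_G: "finite G" and G_sub: "G <= S" and G_gen: "s : S ==> s ~= 0 ==> EX g:G. EX t:S. g ~= 0 & s = g + t"
begin

definition theta_ideal :: "('n, 'k::comm_ring_1) mpoly set" where
 "theta_ideal = ideal_gen (monoid_ring S) (set thetas)"

lemma theta_ideal: "is_ideal (monoid_ring S) (theta_ideal :: ('n, 'k::comm_ring_1) mpoly set)"
 unfolding theta_ideal_def by(rule ideal_gen_ideal[OF ring_subring thetas_in_ring])

lemma theta_in_ideal: "i > 0 ==> i <= fdim ==> theta i : theta_ideal"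
proof -
 assume "i > 0" "i <= fdim"
 hence "theta i : set thetas" unfolding thetas_def set_map by(intro imageI) auto
 thus ?thesis using ideal_gen_superset[of "set thetas" "monoid_ring S"] unfolding theta_ideal_def by blast
qed

text \<open>Multiplying \<open>\<theta>\<^sub>i\<close> by the monomial of one face of height \<open>i\<close> leaves its square plus monomials
 supported on larger faces, so all monomials are nilpotent modulo the parameters.\<close>

lemma monomial_nilpotent: assumes "w : S" "w ~= 0" shows "EX k. (single w 1 :: ('n, 'k::field) mpoly) ^ k : theta_ideal" using assms
proof(induction "fdim - height (supp w)" arbitrary: w rule: less_induct)
 case less
 let ?A = "monoid_ring S :: ('n, 'k) mpoly set"
 let ?J = "theta_ideal :: ('n, 'k) mpoly set"
 define Rad where "Rad = {f\<in>?A. EX k. f ^ k : ?J}"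
 have Rad: "is_ideal ?A Rad" unfolding Rad_def by(rule radical_ideal[OF ring_subring theta_ideal])
 have JR: "?J <= Rad" using theta_ideal[where 'k = 'k] unfolding Rad_def is_ideal_def by(auto intro!: exI[of _ 1])
 let ?Z = "supp w" let ?i = "height (supp w)"
 have Z: "?Z : faces" "?Z ~= {}" using less.prems supp_empty by(auto simp: faces_def)
 have "{} \<subset> ?Z" using Z(2) by blast
 hence i: "?i > 0" using height_less[OF faces_empty Z(1)] by simp
 have iN: "?i <= fdim" by(rule height_le_fdim[OF Z(1)])
 note b = face_rep[OF Z]
 let ?M = "{Z'\<in>faces. height Z' = ?i}"
 \<comment> \<open>Two different faces of equal height are not nested, so their union is a larger
   face and the induction hypothesis applies.\<close>
 have big: "single (face_rep ?Z + face_rep Z') 1 : Rad" if Z': "Z' : ?M - {?Z}" for Z'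
 proof -
  have Z'n: "Z' ~= {}" using face_of_height[of Z' ?i] Z' i by auto
  note b' = face_rep[of Z', OF _ Z'n]
  have S: "face_rep ?Z + face_rep Z' : S" using b b' Z' by(intro S_add) auto
  have su: "supp (face_rep ?Z + face_rep Z') = ?Z Un Z'" using b b' Z' by(subst supp_add) auto
  have "~ Z' \<subset> ?Z" using height_less[of Z' ?Z] Z Z' by auto
  hence "?Z \<subset> ?Z Un Z'" using Z' by blast
  hence "?i < height (?Z Un Z')" using Z Z' by(intro height_less faces_Un) auto
  moreover have "height (?Z Un Z') <= fdim" using Z Z' by(intro height_le_fdim faces_Un) auto
  ultimately have "EX k. (single (face_rep ?Z + face_rep Z') 1 :: ('n, 'k) mpoly) ^ k : ?J"
   using su Z by(intro less.hyps S) (auto dest!: arg_cong[of _ 0 supp])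
  thus ?thesis using S unfolding Rad_def by(auto intro: single_in_monoid_ring)
 qed
 have fin: "finite ?M" using finite_faces by simp
 have "single (face_rep ?Z) 1 * theta ?i
   = (SUM Z':?M. single (face_rep ?Z + face_rep Z') (1::'k))" unfolding theta_def sum_distrib_left by(simp add: mult_single)
 also have "... = single (face_rep ?Z + face_rep ?Z) 1
   + (SUM Z':?M - {?Z}. single (face_rep ?Z + face_rep Z') 1)" using Z by(intro sum.remove fin) auto
 finally have eq: "single (face_rep ?Z + face_rep ?Z) 1 = single (face_rep ?Z) 1 * theta ?i
   - (SUM Z':?M - {?Z}. single (face_rep ?Z + face_rep Z') (1::'k))" by simp
 have "single (face_rep ?Z) 1 * theta ?i : Rad" using JR theta_in_ideal[OF i iN] b(1) by(intro ideal_mult[OF Rad] single_in_monoid_ring) auto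
 hence sq: "single (face_rep ?Z + face_rep ?Z) 1 : Rad" unfolding eq using big by(intro ideal_diff[OF ring_subring Rad] ideal_sum[OF Rad]) auto
 have bb: "face_rep ?Z + face_rep ?Z : S" using b by(intro S_add)
 have "supp (face_rep ?Z + face_rep ?Z) <= ?Z" using b by(subst supp_add) auto
 then obtain k c where kc: "c : S" "nscale k w = face_rep ?Z + face_rep ?Z + c" using nscale_dominates[OF less.prems(1) bb] by blast
 have "(single w 1 :: ('n, 'k) mpoly) ^ k = single c 1 * single (face_rep ?Z + face_rep ?Z) 1" by(simp add: single_power kc(2) mult_single add_ac)
 also have "... : Rad" by(intro ideal_mult[OF Rad] single_in_monoid_ring kc sq)
 finally obtain l where "((single w 1 :: ('n, 'k) mpoly) ^ k) ^ l : ?J" by(auto simp: Rad_def)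
 thus ?case by(auto simp flip: power_mult)
qed

lemma S_combination: assumes "s : S" shows "EX n. s = (SUM g:G. nscale (n g) g)" using assms
proof(induction "esize s" arbitrary: s rule: less_induct)
 case less
 show ?case
 proof(cases "s = 0")
  case True
  thus ?thesis by(intro exI[of _ "%_. 0"]) simp
 next
  case False
  then obtain g t where gt: "g : G" "t : S" "g ~= 0" "s = g + t" using G_gen less.prems by blast
  have "esize t < esize s" using gt esize_eq_0_iff[of g] by(simp add: esize_add)
  then obtain n where n: "t = (SUM g:G. nscale (n g) g)" using less.hyps gt(2) by blast
  have "s = (SUM h:G. nscale ((n(g := Suc (n g))) h) h)"
  proof -
   have "(SUM h:G. nscale ((n(g := Suc (n g))) h) h) = nscale (Suc (n g)) g + (SUM h:G - {g}. nscale (n h) h)"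
    using finite_G gt(1) by(subst sum.remove[of _ g]) (auto intro!: sum.cong)
   also have "... = g + (SUM h:G. nscale (n h) h)" using finite_G gt(1) by(subst sum.remove[of G g]) (auto simp: nscale_Suc add_ac)
   finally show ?thesis using n gt(4) by simp
  qed
  thus ?thesis by blast
 qed
qed

text \<open>Written in the generators, a monomial of large degree uses some generator at least as
  often as its nilpotency order.\<close>

lemma large_monomials_in_ideal:
 "EX E. ALL w:S. esize w >= E --> (single w 1 :: ('n, 'k::field) mpoly) : theta_ideal"
proof -
 let ?J = "theta_ideal :: ('n, 'k) mpoly set"
 have "ALL g. EX k. g : G & g ~= 0 --> (single g 1 :: ('n, 'k) mpoly) ^ k : ?J" using monomial_nilpotent G_sub by blast
 then obtain k where k: "!!g. g : G ==> g ~= 0 ==> (single g 1 :: ('n, 'k) mpoly) ^ k g : ?J" by metis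
 have "single w 1 : ?J" if w: "w : S" "esize w >= (SUM g:G. k g * esize g) + 1" for w
 proof -
  obtain n where n: "w = (SUM g:G. nscale (n g) g)" using S_combination[OF w(1)] by blast
  have es: "esize (SUM g:Y. f g) = (SUM g:Y. esize (f g))" for Y and f :: "_ => 'n mon"
   by(induction Y rule: infinite_finite_induct) (auto simp: esize_add)
  have "EX g:G. k g * esize g < n g * esize g"
  proof(rule ccontr)
   assume "~ ?thesis"
   hence "(SUM g:G. n g * esize g) <= (SUM g:G. k g * esize g)" by(intro sum_mono) (auto simp: not_less)
   thus False using w(2) by(simp add: n es esize_nscale)
  qed
  then obtain g where g: "g : G" "k g * esize g < n g * esize g" by blast
  hence g0: "g ~= 0" and kn: "k g <= n g" by auto
  define r where "r = nscale (n g - k g) g + (SUM h:G - {g}. nscale (n h) h)"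
  have "nscale (n g) g = nscale (k g) g + nscale (n g - k g) g" using kn by(intro poly_mapping_eqI) (simp add: lookup_add flip: distrib_right)
  hence wr: "w = r + nscale (k g) g" unfolding n r_def using finite_G g(1) by(subst sum.remove[of _ g]) (auto simp: add_ac)
  have "r : S" unfolding r_def using G_sub g(1) by(intro S_add S_sum S_nscale) auto
  hence "single r 1 * (single g 1 :: ('n, 'k) mpoly) ^ k g : ?J" by(intro ideal_mult[OF theta_ideal] single_in_monoid_ring k g g0)
  thus ?thesis by(simp add: single_power mult_single wr)
 qed
 thus ?thesis by blast
qed

section \<open>Homogeneous components and the graded Nakayama lemma\<close>

definition proj :: "nat => ('n, 'k::comm_ring_1) mpoly => ('n, 'k) mpoly" where
 "proj d = lin_ext (%t a. if esize t = d then single t a else 0)"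

lemma proj_add: "proj d (f + g) = proj d f + proj d g" unfolding proj_def by(rule lin_ext_add) (auto simp: single_add)

lemma proj_sum: "proj d (sum f Y) = (SUM y:Y. proj d (f y))" by(rule additive_sum) (rule proj_add)

lemma proj_single: "proj d (single t a) = (if esize t = d then single t a else 0)" unfolding proj_def by(subst lin_ext_single) auto

lemma proj_eq_sum: "proj d f = (SUM t:keys f. if esize t = d then single t (lookup f t) else 0)" by(simp add: proj_def lin_ext_def)

lemma keys_proj: "keys (proj d f) <= {t\<in>keys f. esize t = d}"
proof
 fix t assume t: "t : keys (proj d f)"
 show "t : {t\<in>keys f. esize t = d}"
 proof(rule ccontr)
  assume n: "~ ?thesis"
  have "lookup (proj d f) t = 0" unfolding proj_eq_sum lookup_sum using n by(intro sum.neutral) (auto simp: lookup_single when_def)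
  thus False using t by(simp add: in_keys_iff)
 qed
qed

lemma proj_homogeneous: "(!!t. t : keys f ==> esize t = e) ==> proj d f = (if e = d then f else 0)"
proof -
 assume h: "!!t. t : keys f ==> esize t = e"
 have "proj d f = (SUM t:keys f. if e = d then single t (lookup f t) else 0)" unfolding proj_eq_sum using h by(intro sum.cong) auto
 thus ?thesis by(simp add: sum_single_lookup)
qed

lemma thetas_esize: "th : set thetas ==> t : keys (th :: ('n, 'k::comm_ring_1) mpoly) ==> esize t = pdeg"
proof -
 assume th: "th : set thetas" and t: "t : keys th"
 obtain i where i: "i : set [1..<Suc fdim]" "th = theta i" using th unfolding thetas_def set_map by blast
 hence i: "i > 0" "th = theta i" by auto
 obtain Z where "Z : faces" "height Z = i" "t = face_rep Z" using keys_theta[OF i(1), of t] t i(2) by auto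
 thus ?thesis using face_rep(3)[of Z] face_of_height[of Z i] i(1) by auto
qed

lemma proj_times_theta:
 fixes c th :: "('n, 'k::comm_ring_1) mpoly" assumes "th : set thetas" shows "proj d (c * th) = (if pdeg <= d then proj (d - pdeg) c * th else 0)"
proof -
 have "proj d (c * th) = (SUM s:keys c. proj d (single s (lookup c s) * th))"
  by(subst (1) sum_single_lookup[of c, symmetric]) (simp add: sum_distrib_right proj_sum)
 also have "... = (SUM s:keys c. if esize s + pdeg = d then single s (lookup c s) * th else 0)"
 proof(intro sum.cong refl proj_homogeneous)
  fix s t assume t: "t : keys (single s (lookup c s) * th)"
  obtain u v where "t = u + v" "u : keys (single s (lookup c s))" "v : keys th" using subsetD[OF keys_mult t] by blast
  thus "esize t = esize s + pdeg" using thetas_esize[OF assms] by(auto simp: esize_add split: if_splits)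
 qed
 also have "... = (if pdeg <= d then proj (d - pdeg) c * th else 0)" by(auto simp: proj_eq_sum sum_distrib_right intro!: sum.cong sum.neutral)
 finally show ?thesis .
qed

definition module_span :: "'n mon set => ('n, 'k::comm_ring_1) mpoly set" where
 "module_span W = {SUM w:W. c w * single w 1 | c. ALL w. c w : adjoins scalars thetas}"

lemma param_subring: "is_subring (adjoins scalars thetas)" by(rule adjoins_subring[OF scalars_subring])

lemma param_sub_ring: "adjoins scalars thetas <= monoid_ring S" by(rule adjoins_least[OF ring_subring scalars_in_ring thetas_in_ring])

lemma module_spanI: "(!!w. c w : adjoins scalars thetas) ==> (SUM w:W. c w * single w 1) : module_span W" unfolding module_span_def by blast

lemma module_span_add: "f : module_span W ==> g : module_span W ==> f + g : module_span W"
proof -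
 assume "f : module_span W" "g : module_span W"
 then obtain c d where h: "ALL w. c w : adjoins scalars thetas" "f = (SUM w:W. c w * single w 1)"
  "ALL w. d w : adjoins scalars thetas" "g = (SUM w:W. d w * single w 1)" by(auto simp: module_span_def)
 have "f + g = (SUM w:W. (c w + d w) * single w 1)" by(simp add: h distrib_right sum.distrib)
 thus ?thesis using h subring_add[OF param_subring] by(auto intro!: module_spanI)
qed

lemma module_span_0: "0 : module_span W" using module_spanI[of "%_. 0" W] subring_0[OF param_subring] by simp

lemma module_span_sum: "(!!x. x : Y ==> f x : module_span W) ==> sum f Y : module_span W"
 by(induction Y rule: infinite_finite_induct) (auto intro: module_span_0 module_span_add)

lemma module_span_mult: "a : adjoins scalars thetas ==> f : module_span W ==> a * f : module_span W"
proof -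
 assume a: "a : adjoins scalars thetas" and "f : module_span W"
 then obtain c where h: "ALL w. c w : adjoins scalars thetas" "f = (SUM w:W. c w * single w 1)" by(auto simp: module_span_def)
 have "a * f = (SUM w:W. (a * c w) * single w 1)" by(simp add: h sum_distrib_left mult.assoc)
 thus ?thesis using h a subring_mult[OF param_subring] by(auto intro!: module_spanI)
qed

lemma single_0_in_param: "single 0 a : adjoins scalars thetas" using adjoins_superset[OF scalars_subring, of thetas] by(auto simp: scalars_def)

lemma module_span_generator: "finite W ==> w : W ==> single w (1::'k::comm_ring_1) : module_span W"
proof -
 assume W: "finite W" "w : W"
 have "(SUM v:W. (if v = w then 1 else 0) * single v 1) = single w (1::'k)" using W by(simp add: if_distrib[of "%t. t * _"] cong: if_cong)
 moreover have "(if v = w then 1 else 0 :: ('n, 'k) mpoly) : adjoins scalars thetas" for v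
  using subring_0[OF param_subring] subring_1[OF param_subring] by auto
 ultimately show ?thesis using module_spanI[of "%v. if v = w then 1 else (0 :: ('n, 'k) mpoly)" W] by simp
qed

text \<open>Graded Nakayama: in the component of degree \<open>esize s\<close> the coefficients of
  the parameters have degree lower by \<open>pdeg\<close>, which is positive, and are spanned by
  induction.\<close>

lemma module_span_all: assumes W: "finite W" and span: "!!s. s : S ==> EX k. single s (1::'k::comm_ring_1) - (SUM w:W. single w (k w)) : theta_ideal"
 shows "(monoid_ring S :: ('n, 'k) mpoly set) <= module_span W"
proof -
 have single: "single s (1::'k) : module_span W" if "s : S" for s using that
 proof(induction "esize s" arbitrary: s rule: less_induct)
  case less
  obtain k where k: "single s (1::'k) - (SUM w:W. single w (k w)) : theta_ideal" using span[OF less.prems] by blast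
  then obtain c where c: "!!y. c y : monoid_ring S"
   "single s (1::'k) - (SUM w:W. single w (k w)) = (SUM th:set thetas. c th * th)"
   using ideal_gen_finite[OF ring_subring thetas_in_ring, of "single s (1::'k) - (SUM w:W. single w (k w))"] unfolding theta_ideal_def by auto
  hence "single s (1::'k) = (SUM w:W. single w (k w)) + (SUM th:set thetas. c th * th)" by(simp add: algebra_simps)
  hence "proj (esize s) (single s (1::'k)) = proj (esize s) ((SUM w:W. single w (k w)) + (SUM th:set thetas. c th * th))" by simp
  hence eq: "single s (1::'k) = (SUM w:W. if esize w = esize s then single w (k w) else 0)
    + (SUM th:set thetas. if pdeg <= esize s then proj (esize s - pdeg) (c th) * th else 0)"
   by(simp add: proj_single proj_add proj_sum proj_times_theta cong: sum.cong)
  have "(if esize w = esize s then single w (k w) else 0) : module_span W" if "w : W" for w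
   using module_span_mult[OF single_0_in_param module_span_generator[OF W that], of "k w"] by(auto simp: mult_single intro: module_span_0)
  moreover have "(if pdeg <= esize s then proj (esize s - pdeg) (c th) * th else 0) : module_span W" if th: "th : set thetas" for th
  proof(cases "pdeg <= esize s")
   case True
   have "proj (esize s - pdeg) (c th) : module_span W"
   proof -
    let ?f = "proj (esize s - pdeg) (c th)"
    have "single t (lookup ?f t) : module_span W" if t: "t : keys ?f" for t
    proof -
     have "t : S" "esize t < esize s" using subsetD[OF keys_proj t] c(1)[of th] pdeg_pos True by(auto simp: monoid_ring_def)
     hence "single t (1::'k) : module_span W" using less.hyps by blast
     thus ?thesis using module_span_mult[OF single_0_in_param, of _ W "lookup ?f t"] by(fastforce simp: mult_single)
    qed
    hence "(SUM t:keys ?f. single t (lookup ?f t)) : module_span W" by(rule module_span_sum)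
    thus ?thesis by(simp only: sum_single_lookup)
   qed
   moreover have "th : adjoins scalars thetas" using th adjoins_generators[OF scalars_subring] by blast
   ultimately show ?thesis using True by(simp add: mult.commute[of _ th] module_span_mult)
  qed (simp add: module_span_0)
  ultimately show ?case by(subst eq) (intro module_span_add module_span_sum)
 qed
 show ?thesis
 proof
  fix f :: "('n, 'k) mpoly" assume f: "f : monoid_ring S"
  have "single 0 (lookup f t) * single t 1 : module_span W" if "t : keys f" for t
   using f that by(intro module_span_mult single_0_in_param single) (auto simp: monoid_ring_def)
  hence "(SUM t:keys f. single t (lookup f t)) : module_span W" by(intro module_span_sum) (simp add: mult_single)
  thus "f : module_span W" by(simp only: sum_single_lookup)
 qed
qed

end

section \<open>Monomial bases and colon capturing\<close>

lemma maximal_subset: assumes "finite V" "P {}"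
 obtains W where "W <= V" "P W" "!!v. v : V ==> v ~: W ==> ~ P (insert v W)"
proof -
 have "finite {W. W <= V & P W}" by(rule finite_subset[of _ "Pow V"]) (use assms(1) in auto)
 moreover have "{W. W <= V & P W} ~= {}" using assms(2) by auto
 ultimately have "EX W:{W. W <= V & P W}. ALL W':{W. W <= V & P W}. W <= W' --> W = W'" by(rule finite_has_maximal)
 then obtain W where "W <= V" "P W" "ALL W':{W. W <= V & P W}. W <= W' --> W = W'" by blast
 thus ?thesis using that[of W] by blast
qed

lemma regular_onD:
 "regular_on A xs ==> j < length xs ==> z : A ==> xs ! j * z : ideal_gen A (set (take j xs)) ==>
  z : ideal_gen A (set (take j xs))" by(auto simp: regular_on_def)

context normal_affine_monoid
begin

definition independent_mod :: "('n, 'k::comm_ring_1) mpoly set => ('n, 'k) mpoly set => 'n mon set => bool" where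
 "independent_mod C J W \<longleftrightarrow> (ALL c. (ALL w. c w : C) & (SUM w:W. c w * single w 1) : J --> (ALL w:W. c w = 0))"

lemma dependent_insert: assumes C: "is_subring C" and W: "finite W" "v ~: W" "independent_mod C J W" "~ independent_mod C J (insert v W)"
 shows "EX c. (ALL w. c w : C) & c v ~= 0 & c v * single v 1 + (SUM w:W. c w * single w 1) : J"
proof -
 obtain c where c: "ALL w. c w : C" "(SUM w:insert v W. c w * single w 1) : J" "EX w:insert v W. c w ~= 0"
  using W(4) unfolding independent_mod_def by blast
 have eq: "(SUM w:insert v W. c w * single w 1) = c v * single v 1 + (SUM w:W. c w * single w 1)" using W(1,2) by simp
 have "c v ~= 0"
 proof
  assume "c v = 0"
  hence "(SUM w:W. c w * single w 1) : J" using c(2) eq by simp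
  hence "ALL w:W. c w = 0" using W(3) c(1) unfolding independent_mod_def by blast
  thus False using c(3) \<open>c v = 0\<close> by auto
 qed
 thus ?thesis using c eq by auto
qed

text \<open>Monomials of large degree lie in the ideal of the parameters, so a maximal independent
  set among the finitely many others spans the quotient; the graded Nakayama lemma lifts this to the
  ring.\<close>

lemma monomial_basis_exists:
 "EX W. finite W & W <= S & independent_mod (scalars :: ('n, 'k::field) mpoly set) theta_ideal W &
   (monoid_ring S :: ('n, 'k) mpoly set) <= module_span W"
proof -
 let ?J = "theta_ideal :: ('n, 'k) mpoly set"
 obtain E where E: "!!w. w : S ==> esize w >= E ==> (single w 1 :: ('n, 'k) mpoly) : ?J" using large_monomials_in_ideal[where 'k = 'k] by blast
 define V where "V = {w\<in>S. esize w < E}"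
 have "finite V" by(rule finite_subset[OF _ finite_esize_le[of E]]) (auto simp: V_def)
 moreover have "independent_mod scalars ?J {}" by(simp add: independent_mod_def)
 ultimately obtain W where W: "W <= V" "independent_mod scalars ?J W"
  "!!v. v : V ==> v ~: W ==> ~ independent_mod scalars ?J (insert v W)" using maximal_subset[of V "independent_mod scalars ?J"] by blast
 have fW: "finite W" using W(1) \<open>finite V\<close> finite_subset by blast
 have "EX k. single s (1::'k) - (SUM w:W. single w (k w)) : ?J" if s: "s : S" for s
 proof -
  have "s : V | esize s >= E" using s by(auto simp: V_def)
  then consider "esize s >= E" | "s : W" | "s : V" "s ~: W" by blast
  thus ?thesis
  proof cases
   case 1
   thus ?thesis using E[OF s] by(intro exI[of _ "%_. 0"]) simp
  next
   case 2
   have "single w (if w = s then 1 else 0) = (if w = s then single s (1::'k) else 0)" for w by simp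
   hence "(SUM w:W. single w (if w = s then 1 else 0)) = single s (1::'k)" using fW 2 by simp
   thus ?thesis using ideal_0[OF theta_ideal[where 'k = 'k]] by(intro exI[of _ "%w. if w = s then 1 else 0"]) simp
  next
   case 3
   obtain c where c: "ALL w. c w : scalars" "c s ~= 0" "c s * single s 1 + (SUM w:W. c w * single w 1) : ?J"
    using dependent_insert[OF scalars_subring fW 3(2) W(2) W(3)[OF 3]] by blast
   hence "ALL w. EX a. c w = single 0 a" by(auto simp: scalars_def image_iff)
   then obtain a where a: "!!w. c w = single 0 (a w)" by metis
   have as: "a s ~= 0" using c(2) a by auto
   have "single 0 (inverse (a s)) * (c s * single s 1 + (SUM w:W. c w * single w 1)) : ?J"
    by(intro ideal_mult[OF theta_ideal _ c(3)] single_in_monoid_ring S_0)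
   also have "single 0 (inverse (a s)) * (c s * single s 1 + (SUM w:W. c w * single w 1))
    = single s 1 - (SUM w:W. single w (- inverse (a s) * a w))"
    using as by(simp add: a distrib_left sum_distrib_left mult_single single_uminus sum_negf)
   finally show ?thesis by(rule exI[of _ "%w. - inverse (a s) * a w"])
  qed
 qed
 hence "(monoid_ring S :: ('n, 'k) mpoly set) <= module_span W" by(rule module_span_all[OF fW])
 thus ?thesis using fW W(1,2) by(intro exI[of _ W]) (auto simp: V_def)
qed

text \<open>Colon capturing. Some multiple of the ring lies in a free module over the polynomial ring in
 the parameters, where the powers of the parameters form a regular sequence; the multiplier is
 removed by a Frobenius splitting.\<close>

lemma thetas_regular: assumes p: "CHAR('k::field) > 0" shows "regular_on (monoid_ring S) (thetas :: ('n, 'k) mpoly list)" unfolding regular_on_def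
proof(intro allI impI ballI)
 let ?A = "monoid_ring S :: ('n, 'k) mpoly set"
 let ?th = "thetas :: ('n, 'k) mpoly list"
 let ?C = "adjoins scalars ?th"
 fix j z assume j: "j < length ?th" and z: "z : ?A" and zj: "?th ! j * z : ideal_gen ?A (set (take j ?th))"
 have C: "is_subring ?C" by(rule param_subring)
 have CA: "?C <= ?A" by(rule param_sub_ring)
 have pr: "Factorial_Ring.prime CHAR('k)" using p prime_CHAR_semidom by blast
 obtain W where W: "finite W" "W <= S" "?A <= module_span W" using monomial_basis_exists[where 'k = 'k] by blast
 have "independent_mod ?C {0} {}" by(simp add: independent_mod_def)
 then obtain V where V: "V <= W" "independent_mod ?C {0} V" "!!v. v : W ==> v ~: V ==> ~ independent_mod ?C {0} (insert v V)"
  using maximal_subset[OF W(1), of "independent_mod ?C {0}"] by blast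
 have fV: "finite V" using V(1) W(1) finite_subset by blast
 have "EX d. w : W --> d : ?C & d ~= 0 & d * single w 1 : module_span V" for w
 proof(cases "w : V | w ~: W")
  case True
  thus ?thesis using subring_1[OF C] module_span_generator[OF fV, of w] by(intro exI[of _ 1]) auto
 next
  case False
  then obtain c where c: "ALL w. c w : ?C" "c w ~= 0" "c w * single w 1 + (SUM v:V. c v * single v 1) : {0}"
   using dependent_insert[OF C fV _ V(2) V(3)[of w]] by blast
  have "c w * single w 1 = (SUM v:V. (- c v) * single v 1)" using c(3) by(simp add: sum_negf eq_neg_iff_add_eq_0)
  moreover have "... : module_span V" using c(1) by(intro module_spanI subring_uminus[OF C]) auto
  ultimately show ?thesis using c(1,2) by auto
 qed
 then obtain d where d: "!!w. w : W ==> d w : ?C" "!!w. w : W ==> d w ~= 0" "!!w. w : W ==> d w * single w 1 : module_span V" by metis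
 \<comment> \<open>Every monomial of \<open>W\<close> has a nonzero multiple in the free module on
   \<open>V\<close>; the product of the multipliers carries the whole ring into it.\<close>
 define D where "D = (\<Prod>w\<in>W. d w)"
 have DC: "D : ?C" unfolding D_def using d(1) by(intro subring_prod[OF C])
 have D0: "D ~= 0" unfolding D_def using d(2) W(1) by simp
 have DW: "D * single w 1 : module_span V" if w: "w : W" for w
 proof -
  have "D = (\<Prod>w\<in>W - {w}. d w) * d w" unfolding D_def using W(1) w by(simp add: prod.remove[of W w] mult.commute)
  hence eq: "D * single w 1 = (\<Prod>w\<in>W - {w}. d w) * (d w * single w 1)" by(simp only: mult.assoc)
  have "(\<Prod>w\<in>W - {w}. d w) : ?C" using d(1) by(intro subring_prod[OF C]) auto
  thus ?thesis unfolding eq by(rule module_span_mult[OF _ d(3)[OF w]])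
 qed
 have DA: "D * f : module_span V" if f: "f : ?A" for f
 proof -
  obtain c where c: "ALL w. c w : ?C" "f = (SUM w:W. c w * single w 1)" using W(3) f by(auto simp: module_span_def)
  have eq: "D * f = (SUM w:W. c w * (D * single w 1))" by(simp add: c(2) sum_distrib_left mult_ac)
  have "c w * (D * single w 1) : module_span V" if "w : W" for w using c(1) by(intro module_span_mult DW that) auto
  thus ?thesis unfolding eq by(rule module_span_sum)
 qed
 have DinA: "D : ?A" using DC CA by blast
 have "EX N. ALL e>=N. EX Ph. splits ?A e D Ph" using frobenius_split_ring[OF p, unfolded frobenius_split_def] DinA D0 by blast
 then obtain e Ph where Ph: "ALL f:?A. ALL g:?A. Ph (f + g) = Ph f + Ph g" "ALL f:?A. Ph f : ?A"
   "ALL f:?A. ALL g:?A. Ph (g ^ (CHAR(('n, 'k) mpoly) ^ e) * f) = g * Ph f" "Ph D = 1" unfolding splits_def by blast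
 define q where "q = CHAR('k) ^ e"
 have Phq: "Ph (g ^ q * f) = g * Ph f" if "f : ?A" "g : ?A" for f g using Ph(3) that by(simp add: CHAR_poly_mapping q_def)
 let ?T = "set (take j ?th)"
 have TA: "?T <= ?A" using thetas_in_ring set_take_subset[of j ?th] by blast
 have TC: "?T <= ?C" using adjoins_generators[OF scalars_subring, of ?th] set_take_subset[of j ?th] by blast
 obtain a where a: "!!t. a t : ?A" "?th ! j * z = (SUM t:?T. a t * t)" using zj ideal_gen_finite[OF ring_subring TA, of "?th ! j * z"] by auto
 \<comment> \<open>The \<open>q\<close>-th power of the relation, multiplied by \<open>D\<close>,
   can be compared coefficient by coefficient in the free module, over whose ring of scalars the
   powers of the parameters are regular.\<close>
 have "(?th ! j * z) ^ q = (SUM t:?T. (a t * t) ^ q)"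
  unfolding a(2) q_def by(rule freshmans_dream_sum') (use pr in \<open>simp_all add: CHAR_poly_mapping\<close>)
 hence powq: "?th ! j ^ q * z ^ q = (SUM t:?T. a t ^ q * t ^ q)" by(simp add: power_mult_distrib)
 have zq: "z ^ q : ?A" "!!t. a t ^ q : ?A" using z a(1) by(auto intro: subring_power[OF ring_subring])
 obtain u where u: "ALL v. u v : ?C" "D * z ^ q = (SUM v:V. u v * single v 1)" using DA[OF zq(1)] by(auto simp: module_span_def)
 have "EX b. (ALL v. b v : ?C) & D * a t ^ q = (SUM v:V. b v * single v 1)" for t using DA[OF zq(2)[of t]] unfolding module_span_def by blast
 hence "EX b. ALL t. (ALL v. b t v : ?C) & D * a t ^ q = (SUM v:V. b t v * single v 1)" by(intro choice allI)
 then obtain b where b: "!!t v. b t v : ?C" "!!t. D * a t ^ q = (SUM v:V. b t v * single v 1)" by blast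
 have thC: "?th ! j : ?C" using adjoins_generators[OF scalars_subring, of ?th] j by auto
 have "(SUM v:V. (?th ! j ^ q * u v) * single v 1) = ?th ! j ^ q * (D * z ^ q)" unfolding u(2) by(simp add: sum_distrib_left mult_ac)
 also have "... = (SUM t:?T. (D * a t ^ q) * t ^ q)" using powq by(simp add: mult.left_commute[of _ D] sum_distrib_left mult_ac)
 also have "... = (SUM t:?T. SUM v:V. (b t v * t ^ q) * single v 1)" unfolding b(2) by(simp add: sum_distrib_left sum_distrib_right mult_ac)
 also have "... = (SUM v:V. (SUM t:?T. b t v * t ^ q) * single v 1)" by(subst sum.swap) (simp add: sum_distrib_right)
 finally have "(SUM v:V. (?th ! j ^ q * u v - (SUM t:?T. b t v * t ^ q)) * single v 1) : {0}" by(simp add: left_diff_distrib sum_subtractf)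
 moreover have "?th ! j ^ q * u v - (SUM t:?T. b t v * t ^ q) : ?C" for v
  using u(1) b(1) thC TC by(intro subring_diff[OF C] subring_sum[OF C] subring_mult[OF C] subring_power[OF C]) auto
 ultimately have rel: "ALL v:V. ?th ! j ^ q * u v - (SUM t:?T. b t v * t ^ q) = 0"
  using V(2)[unfolded independent_mod_def, rule_format, of "%v. ?th ! j ^ q * u v - (SUM t:?T. b t v * t ^ q)"] by blast
 have reg: "regular_on ?C (map (%x. x ^ q) ?th)" using regular_on_powers[OF scalars_subring thetas_indep[where 'k = 'k], of q]
  by(simp add: adjoins_cong[OF scalars_subring, of "rev ?th" ?th])
 let ?Tq = "set (take j (map (%x. x ^ q) ?th))"
 have Tq: "?Tq = (%x. x ^ q) ` ?T" by(simp add: take_map)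
 have TqC: "?Tq <= ?C" unfolding Tq using TC by(auto intro: subring_power[OF C])
 have uT: "u v : ideal_gen ?C ?Tq" if v: "v : V" for v
 proof -
  have IC: "is_ideal ?C (ideal_gen ?C ?Tq)" by(rule ideal_gen_ideal[OF C TqC])
  have "?th ! j ^ q * u v = (SUM t:?T. b t v * t ^ q)" using rel v by simp
  also have "... : ideal_gen ?C ?Tq" using b(1) ideal_gen_superset[of ?Tq ?C] by(intro ideal_sum[OF IC] ideal_mult[OF IC]) (auto simp: Tq)
  finally have "map (%x. x ^ q) ?th ! j * u v : ideal_gen ?C ?Tq" using j by simp
  thus ?thesis using regular_onD[OF reg, of j "u v"] j u(1) by simp
 qed
 have TqA: "?Tq <= ?A" using TqC CA by blast
 have IA: "is_ideal ?A (ideal_gen ?A ?Tq)" by(rule ideal_gen_ideal[OF ring_subring TqA])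
 have sub: "ideal_gen ?C ?Tq <= ideal_gen ?A ?Tq" using ideal_contract[OF IA C CA] TqC ideal_gen_superset[of ?Tq ?A]
   ideal_gen_minimal[of ?C "ideal_gen ?A ?Tq Int ?C" ?Tq] by blast
 have "D * z ^ q : ideal_gen ?A ?Tq" unfolding u(2)
  using uT sub V(1) W(2) by(intro ideal_sum[OF IA] ideal_mult_right[OF IA] single_in_monoid_ring) auto
 then obtain y where y: "!!s. y s : ?A" "D * z ^ q = (SUM s:?Tq. y s * s)" using ideal_gen_finite[OF ring_subring TqA, of "D * z ^ q"] by auto
 \<comment> \<open>The splitting removes \<open>D\<close> and turns the \<open>q\<close>-th powers
   of the parameters back into the parameters.\<close>
 have "z = Ph (z ^ q * D)" using Phq[OF DinA z] Ph(4) by simp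
 also have "z ^ q * D = (SUM s:?Tq. y s * s)" using y(2) by(simp add: mult.commute)
 also have "Ph (SUM s:?Tq. y s * s) = (SUM s:?Tq. Ph (y s * s))"
  using y(1) TqA by(intro additive_on_sum[OF ring_subring Ph(1)] subring_mult[OF ring_subring]) auto
 also have "... : ideal_gen ?A ?T"
 proof(rule ideal_sum[OF ideal_gen_ideal[OF ring_subring TA]])
  fix s assume "s : ?Tq"
  then obtain t where t: "t : ?T" "s = t ^ q" unfolding Tq by blast
  have "Ph (y s * s) = Ph (t ^ q * y s)" by(simp add: t(2) mult.commute)
  also have "... = t * Ph (y s)" using Phq[OF y(1), of t s] t(1) TA by blast
  finally show "Ph (y s * s) : ideal_gen ?A ?T" using t(1) ideal_gen_superset[of ?T ?A] Ph(2) y(1)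
   by(auto intro!: ideal_mult_right[OF ideal_gen_ideal[OF ring_subring TA]])
 qed
 finally show "z : ideal_gen ?A ?T" .
qed

text \<open>Regularity of the parameters lifts the independence of a monomial basis modulo them to
  independence over the ring they generate.\<close>

lemma free_basis_char_p: assumes p: "CHAR('k::field) > 0"
 shows "EX W. finite W & W <= S & independent_mod (adjoins scalars (thetas :: ('n, 'k) mpoly list)) {0} W &
   (monoid_ring S :: ('n, 'k) mpoly set) <= module_span W"
proof -
 let ?A = "monoid_ring S :: ('n, 'k) mpoly set"
 let ?th = "thetas :: ('n, 'k) mpoly list"
 obtain W where W: "finite W" "W <= S" "independent_mod (scalars :: ('n, 'k) mpoly set) theta_ideal W" "?A <= module_span W"
  using monomial_basis_exists[where 'k = 'k] by blast
 have "independent_mod (adjoins scalars ?th) {0} W" unfolding independent_mod_def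
 proof(intro allI impI)
  fix c assume c: "(ALL w. c w : adjoins scalars ?th) & (SUM w:W. c w * single w 1) : {0}"
  show "ALL w:W. c w = 0"
  proof(rule free_over_adjoins[OF ring_subring scalars_subring scalars_in_ring W(1), of "%w. single w 1" ?th "{}" c])
   show "set ?th <= ?A" by(rule thetas_in_ring)
   show "single w 1 : ?A" if "w : W" for w using that W(2) by(intro single_in_monoid_ring) auto
   show "z : ideal_gen ?A ({} Un set (take j ?th))"
    if "j < length ?th" "z : ?A" "?th ! j * z : ideal_gen ?A ({} Un set (take j ?th))" for j z
    using regular_onD[OF thetas_regular[OF p] that(1,2)] that(3) by simp
   show "ALL w:W. k w = 0" if "!!w. k w : scalars" "(SUM w:W. k w * single w 1) : ideal_gen ?A ({} Un set ?th)" for k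
    using W(3) that unfolding independent_mod_def theta_ideal_def by simp
   show "(SUM w:W. c w * single w 1) : ideal_gen ?A {}"
   proof -
    have "ideal_gen ?A {} = {0}" by(rule ideal_gen_empty[OF ring_subring])
    thus ?thesis using c by blast
   qed
  qed (use c in auto)
 qed
 thus ?thesis using W by blast
qed

end

text \<open>Gaussian elimination: the pivots are nonzero in some field, hence nonzero integers.\<close>

lemma injective_char_0:
 fixes N :: "'x => 'y => int" and c :: "'x => 'k::field" assumes char: "CHAR('k) = 0" and "finite Y"
  and "!!d :: 'x => 'b::field. (!!y. (SUM x:Y. d x * of_int (N x y)) = 0) ==> ALL x:Y. d x = 0" and "!!y. (SUM x:Y. c x * of_int (N x y)) = 0"
 shows "ALL x:Y. c x = 0" using assms(2-)
proof(induction Y arbitrary: N c rule: finite_induct)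
 case (insert x0 Y)
 \<comment> \<open>Otherwise the unit vector at \<open>x0\<close> would be a relation over
   \<open>'b\<close>.\<close>
 have "EX y. (of_int (N x0 y) :: 'b) ~= 0"
 proof(rule ccontr)
  assume n: "~ ?thesis"
  let ?d = "%x. if x = x0 then 1 else (0::'b)"
  have "(SUM x:insert x0 Y. ?d x * of_int (N x y)) = 0" for y using n insert.hyps by(auto intro!: sum.neutral)
  hence "?d x0 = 0" using insert.prems(1)[of ?d] by blast
  thus False by simp
 qed
 then obtain y0 where y0: "(of_int (N x0 y0) :: 'b) ~= 0" by blast
 \<comment> \<open>Elimination without division, so the new matrix is again integral and can be read
   in both fields.\<close>
 define N' where "N' x y = N x0 y0 * N x y - N x y0 * N x0 y" for x y
 have "ALL x:Y. c x = 0"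
 proof(rule insert.IH[of N' c])
  fix d :: "'x => 'b" assume d: "!!y. (SUM x:Y. d x * of_int (N' x y)) = 0"
  let ?p = "of_int (N x0 y0) :: 'b"
  let ?s = "SUM x:Y. d x * of_int (N x y0)"
  let ?d = "%x. if x = x0 then - ?s else ?p * d x"
  have "(SUM x:insert x0 Y. ?d x * of_int (N x y)) = 0" for y
  proof -
   have "(SUM x:Y. ?d x * of_int (N x y)) = (SUM x:Y. ?p * d x * of_int (N x y))" using insert.hyps by(intro sum.cong) auto
   hence "(SUM x:insert x0 Y. ?d x * of_int (N x y)) = - ?s * of_int (N x0 y) + (SUM x:Y. ?p * d x * of_int (N x y))" using insert.hyps by simp
   also have "... = (SUM x:Y. d x * of_int (N' x y))" by(simp add: N'_def right_diff_distrib sum_subtractf sum_distrib_left sum_distrib_right mult_ac)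
   finally show ?thesis using d by simp
  qed
  hence all: "ALL x:insert x0 Y. ?d x = 0" by(rule insert.prems(1))
  show "ALL x:Y. d x = 0"
  proof
   fix x assume x: "x : Y"
   hence "?d x = 0" "x ~= x0" using all insert.hyps by auto
   thus "d x = 0" using y0 by simp
  qed
 next
  fix y
  have e: "(SUM x:Y. c x * of_int (N x y)) = - (c x0 * of_int (N x0 y))" for y using insert.prems(2)[of y] insert.hyps by(simp add: add_eq_0_iff2)
  have "(SUM x:Y. c x * of_int (N' x y)) = of_int (N x0 y0) * (SUM x:Y. c x * of_int (N x y)) - (SUM x:Y. c x * of_int (N x y0)) * of_int (N x0 y)"
   by(simp add: N'_def right_diff_distrib sum_subtractf sum_distrib_left sum_distrib_right mult_ac)
  also have "... = 0" unfolding e by(simp add: mult_ac)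
  finally show "(SUM x:Y. c x * of_int (N' x y)) = 0" .
 qed
 moreover have "N x0 y0 ~= 0" using y0 by auto
 hence "(of_int (N x0 y0) :: 'k) ~= 0" using char by(simp add: of_int_eq_0_iff_char_dvd)
 hence "c x0 = 0" using insert.prems(2)[of y0] insert.hyps calculation by simp
 ultimately show ?case by simp
qed simp

context normal_affine_monoid
begin

section \<open>Transfer of the basis from two elements to characteristic zero\<close>

definition int_map :: "('n, int) mpoly => ('n, 'k::comm_ring_1) mpoly" where
 "int_map = lin_ext (%t a. single t (of_int a))"

lemma int_map_add: "int_map (f + g) = int_map f + int_map g" unfolding int_map_def by(rule lin_ext_add) (auto simp: single_add)

lemma int_map_sum: "int_map (sum f Y) = (SUM y:Y. int_map (f y))" by(rule additive_sum) (rule int_map_add)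

lemma int_map_single: "int_map (single t a) = single t (of_int a)" unfolding int_map_def by(subst lin_ext_single) auto

lemma lookup_int_map: "lookup (int_map f) t = of_int (lookup f t)"
 by(auto simp: int_map_def lin_ext_def lookup_sum lookup_single when_def in_keys_iff)

lemma int_map_mult: "int_map (f * g) = int_map f * int_map g"
proof -
 have "f * g = (SUM s:keys f. SUM t:keys g.
   single (s + t) (lookup f s * lookup g t))" by(subst (1) sum_single_lookup[of f, symmetric], subst (1) sum_single_lookup[of g, symmetric])
   (simp add: sum_product mult_single)
 thus ?thesis by(simp add: int_map_sum int_map_single) (simp add: int_map_def lin_ext_def sum_product mult_single)
qed

lemma int_map_power: "int_map (f ^ k) = int_map f ^ k" by(induction k) (auto simp: int_map_mult int_map_single simp flip: single_one)

lemma int_map_theta: "int_map (theta i) = theta i" by(simp add: theta_def int_map_sum int_map_single)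

lemma int_map_mono_eval: "int_map (mono_eval as ks) = mono_eval (map int_map as) ks"
 by(induction as ks rule: mono_eval.induct) (auto simp: int_map_mult int_map_power int_map_single simp flip: single_one)

lemma int_map_thetas: "map int_map thetas = thetas" by(simp add: thetas_def int_map_theta)

definition basis_elem :: "'n mon \<times> nat list => ('n, 'k::comm_ring_1) mpoly" where
 "basis_elem x = mono_eval (rev thetas) (snd x) * single (fst x) 1"

lemma int_map_basis_elem: "int_map (basis_elem x) = basis_elem x"
 by(simp add: basis_elem_def int_map_mult int_map_mono_eval int_map_thetas int_map_single rev_map[symmetric])

lemma basis_elem_in_ring: "fst x : S ==> basis_elem x : monoid_ring S"
 unfolding basis_elem_def by(intro subring_mult[OF ring_subring] mono_eval_in[OF ring_subring] single_in_monoid_ring)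
  (use thetas_in_ring in auto)

lemma keys_basis_elem: assumes "length (snd x) = fdim" "t : keys (basis_elem x :: ('n, 'k::comm_ring_1) mpoly)"
 shows "esize t = esize (fst x) + pdeg * sum_list (snd x)"
proof -
 have pw: "esize t = pdeg * k" if "th : set thetas" "t : keys (th ^ k)" for th :: "('n, 'k) mpoly" and k t using that(2)
 proof(induction k arbitrary: t)
  case (Suc k)
  obtain u v where uv: "t = u + v" "u : keys th" "v : keys (th ^ k)" using subsetD[OF keys_mult, of t th "th ^ k"] Suc.prems by auto
  thus ?case using Suc.IH thetas_esize[OF that(1)] by(simp add: esize_add)
 qed (simp split: if_splits)
 have me: "esize t = pdeg * sum_list ks" if "set as <= set thetas" "length ks = length as" "t : keys (mono_eval as ks)"
  for as :: "('n, 'k) mpoly list" and ks t using that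
 proof(induction as ks arbitrary: t rule: mono_eval.induct)
  case (1 a as k ks)
  obtain u v where uv: "t = u + v" "u : keys (a ^ k)" "v : keys (mono_eval as ks)"
   using subsetD[OF keys_mult, of t "a ^ k" "mono_eval as ks"] 1(4) by auto
  thus ?case using 1 pw[of a u k] by(simp add: esize_add distrib_left)
 qed (auto split: if_splits)
 obtain u v where uv: "t = u + v" "u : keys (mono_eval (rev thetas) (snd x) :: ('n, 'k) mpoly)"
  "v : keys (single (fst x) (1::'k))" using subsetD[OF keys_mult assms(2)[unfolded basis_elem_def]] by blast
 have "esize u = pdeg * sum_list (snd x)" using uv(2) assms(1) by(intro me[of "rev thetas"]) auto
 moreover have "v = fst x" using uv(3) by(auto split: if_splits)
 ultimately show ?thesis using uv(1) by(simp add: esize_add)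
qed

lemma param_family: assumes "finite W" "ALL w. c w : adjoins scalars (thetas :: ('n, 'k::field) mpoly list)"
 obtains E d where "!!w. w : W ==> c w = (SUM ks:box fdim E. single 0 (d (w, ks)) * mono_eval (rev thetas) ks)"
proof -
 have "c w : adjoins scalars (rev thetas)" for w
  using assms(2) adjoins_cong[OF scalars_subring, of "thetas :: ('n, 'k) mpoly list" "rev thetas"] by simp
 then obtain E where E: "ALL w:W. c w : spanned scalars (rev thetas) E"
  using adjoins_uniform_spanned[OF scalars_subring assms(1), of c "rev thetas"] by blast
 have "EX d. w : W --> c w = (SUM ks:box fdim E. single 0 (d ks) * mono_eval (rev thetas) ks)" for w
 proof(cases "w : W")
  case True
  then obtain k where k: "ALL ks. k ks : scalars" "c w = (SUM ks:box fdim E. k ks * mono_eval (rev thetas) ks)" using E unfolding spanned_def by auto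
  hence "ALL ks. EX a. k ks = single 0 a" by(auto simp: scalars_def image_iff)
  then obtain a where "!!ks. k ks = single 0 (a ks)" by metis
  thus ?thesis using k(2) by auto
 qed simp
 then obtain d where "!!w. w : W ==> c w = (SUM ks:box fdim E. single 0 (d w ks) * mono_eval (rev thetas) ks)" by metis
 thus thesis by(intro that[of "%x. d (fst x) (snd x)" E]) simp
qed

lemma sum_basis_elem: "(SUM x:W \<times> box fdim E. single 0 (d x) * basis_elem x)
 = (SUM w:W. (SUM ks:box fdim E. single 0 (d (w, ks) :: 'k::field) * mono_eval (rev thetas) ks) * single w 1)"
 by(simp add: sum_distrib_right mult.assoc basis_elem_def sum.cartesian_product')

text \<open>Since the parameters are algebraically independent, a coefficient from the ring they
  generate vanishes iff all its scalars do. Freeness becomes linear independence of a family defined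
  over the integers.\<close>

lemma free_iff_basis_elems: assumes W: "finite W"
 shows "independent_mod (adjoins scalars (thetas :: ('n, 'k::field) mpoly list)) {0} W \<longleftrightarrow>
  (ALL E d. (SUM x:W \<times> box fdim E. single 0 (d x) * (basis_elem x :: ('n, 'k) mpoly)) = 0 --> (ALL x:W \<times> box fdim E. d x = 0))"
  (is "?L \<longleftrightarrow> ?R")
proof(intro iffI allI impI ballI)
 fix E d x assume L: ?L and z: "(SUM x:W \<times> box fdim E. single 0 (d x) * (basis_elem x :: ('n, 'k) mpoly)) = 0" and "x : W \<times> box fdim E"
 then obtain w ks where x: "x = (w, ks)" "w : W" "ks : box fdim E" by blast
 let ?c = "%w. SUM ks:box fdim E. single 0 (d (w, ks)) * mono_eval (rev thetas) ks :: ('n, 'k) mpoly"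
 have "(SUM w:W. ?c w * single w 1) : {0}" using z unfolding sum_basis_elem by simp
 moreover have "?c w : adjoins scalars thetas" for w using adjoins_generators[OF scalars_subring, of "thetas :: ('n, 'k) mpoly list"]
  by(intro subring_sum[OF param_subring] subring_mult[OF param_subring] single_0_in_param mono_eval_in[OF param_subring]) auto
 ultimately have "?c w = 0" using L[unfolded independent_mod_def, rule_format, of ?c] x(2) by blast
 hence "single 0 (d (w, ks)) = (0 :: ('n, 'k) mpoly)"
  using x by(intro indepD[OF thetas_indep, of "%ks. single 0 (d (w, ks))" E]) (auto simp: scalars_def)
 thus "d x = 0" using x(1) by(metis lookup_single_eq lookup_zero)
next
 assume R: ?R
 show ?L unfolding independent_mod_def
 proof(intro allI impI)
  fix c assume c: "(ALL w. c w : adjoins scalars (thetas :: ('n, 'k) mpoly list)) & (SUM w:W. c w * single w 1) : {0}"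
  obtain E d where d: "!!w. w : W ==> c w = (SUM ks:box fdim E. single 0 (d (w, ks)) * mono_eval (rev thetas) ks)"
   using param_family[OF W c[THEN conjunct1]] by blast
  hence "(SUM x:W \<times> box fdim E. single 0 (d x) * (basis_elem x :: ('n, 'k) mpoly)) = 0"
   unfolding sum_basis_elem using c[THEN conjunct2] by(simp cong: sum.cong)
  hence "ALL x:W \<times> box fdim E. d x = 0" using R by blast
  thus "ALL w:W. c w = 0" using d by(auto intro!: sum.neutral)
 qed
qed

lemma in_module_span_basis: assumes "finite W" "f : module_span W"
 shows "EX E d. f = (SUM x:W \<times> box fdim E. single 0 (d x :: 'k::field) * basis_elem x)"
proof -
 obtain c where c: "ALL w. c w : adjoins scalars (thetas :: ('n, 'k) mpoly list)" "f = (SUM w:W. c w * single w 1)"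
  using assms(2) by(auto simp: module_span_def)
 obtain E d where "!!w. w : W ==> c w = (SUM ks:box fdim E. single 0 (d (w, ks)) * mono_eval (rev thetas) ks)"
  using param_family[OF assms(1) c(1)] by blast
 hence "f = (SUM x:W \<times> box fdim E. single 0 (d x) * basis_elem x)" unfolding c(2) sum_basis_elem by(intro sum.cong) auto
 thus ?thesis by blast
qed

lemma basis_elem_in_span: "finite W ==> fst x : W ==> single 0 a * (basis_elem x :: ('n, 'k::comm_ring_1) mpoly) : module_span W"
proof -
 assume W: "finite W" "fst x : W"
 have "mono_eval (rev thetas) (snd x) : adjoins scalars (thetas :: ('n, 'k) mpoly list)"
  using adjoins_generators[OF scalars_subring, of "thetas :: ('n, 'k) mpoly list"] by(intro mono_eval_in[OF param_subring]) auto
 thus ?thesis unfolding basis_elem_def by(intro module_span_mult module_span_generator W single_0_in_param)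
qed

lemma vector_space_mpoly: "vector_space (%a f :: ('v, 'b::field) mpoly. single 0 a * f)"
 by unfold_locales (simp_all add: algebra_simps single_add mult_single flip: mult.assoc)

lemma (in vector_space) independent_image: assumes "finite Y" and free: "!!c. (SUM x:Y. scale (c x) (f x)) = 0 ==> ALL x:Y. c x = 0"
 shows "inj_on f Y & independent (f ` Y)"
proof
 show inj: "inj_on f Y"
 proof(rule inj_onI, rule ccontr)
  fix x y assume h: "x : Y" "y : Y" "f x = f y" "x ~= y"
  let ?c = "%z. if z = x then 1 else if z = y then - 1 else 0"
  have "(SUM z:Y. scale (?c z) (f z)) = (SUM z:{x, y}. scale (?c z) (f z))" using h assms(1) by(intro sum.mono_neutral_right) auto
  hence "(SUM z:Y. scale (?c z) (f z)) = 0" using h by simp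
  from free[OF this] show False using h(1) by auto
 qed
 show "independent (f ` Y)"
 proof(rule independent_if_scalars_zero)
  fix u v assume "(SUM x:f ` Y. scale (u x) x) = 0" "v : f ` Y"
  thus "u v = 0" using free[of "u \<circ> f"] by(auto simp: sum.reindex[OF inj])
 qed (use assms in simp)
qed

text \<open>Over the field with two elements the products \<open>x\<^sup>w \<theta>\<^sup>k\<close> form a basis. They are defined
 over the integers, so they stay independent in characteristic zero, where they span each graded
 piece because of its dimension.\<close>

lemma free_basis_char_0: assumes char: "CHAR('k::field) = 0"
 shows "EX W. finite W & W <= S & independent_mod (adjoins scalars (thetas :: ('n, 'k) mpoly list)) {0} W &
   (monoid_ring S :: ('n, 'k) mpoly set) <= module_span W"
proof -
 have "CHAR(bit) > 0" unfolding CHAR_pos_iff by(rule exI[of _ 2]) simp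
 then obtain W where W: "finite W" "W <= S" "independent_mod (adjoins scalars (thetas :: ('n, bit) mpoly list)) {0} W"
  "(monoid_ring S :: ('n, bit) mpoly set) <= module_span W" using free_basis_char_p[where 'k = bit] by blast
 define N where "N x y = lookup (basis_elem x :: ('n, int) mpoly) y" for x y
 have lookup: "lookup (basis_elem x :: ('n, 'b::comm_ring_1) mpoly) y = of_int (N x y)" for x y
  unfolding N_def by(subst int_map_basis_elem[symmetric]) (rule lookup_int_map)
 have lookup_c: "lookup (single 0 a * f) y = a * lookup f y" for a :: "'b::comm_ring_1" and f :: "('n, 'b) mpoly" and y
  by(auto simp: lookup_times in_keys_iff)
 have bitfree: "ALL x:W \<times> box fdim E. d x = 0"
  if "!!y. (SUM x:W \<times> box fdim E. d x * of_int (N x y)) = 0" for E and d :: "_ => bit"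
 proof -
  have "(SUM x:W \<times> box fdim E. single 0 (d x) * (basis_elem x :: ('n, bit) mpoly)) = 0"
   by(rule poly_mapping_eqI) (simp only: lookup_sum lookup_c lookup that lookup_zero)
  thus ?thesis using W(3)[unfolded free_iff_basis_elems[OF W(1)]] by blast
 qed
 have kfree: "ALL x:W \<times> box fdim E. c x = 0"
  if "(SUM x:W \<times> box fdim E. single 0 (c x) * (basis_elem x :: ('n, 'k) mpoly)) = 0" for E c
 proof(rule injective_char_0[OF char])
  show "finite (W \<times> box fdim E)" using W(1) by simp
  show "ALL x:W \<times> box fdim E. d x = 0" if "!!y. (SUM x:W \<times> box fdim E. d x * of_int (N x y)) = 0" for d :: "_ => bit"
   using that by(rule bitfree)
  fix y
  have "0 = lookup (SUM x:W \<times> box fdim E. single 0 (c x) * (basis_elem x :: ('n, 'k) mpoly)) y" using that by simp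
  thus "(SUM x:W \<times> box fdim E. c x * of_int (N x y)) = 0" by(simp add: lookup_sum lookup_c lookup)
 qed
 interpret b: vector_space "%a f :: ('n, bit) mpoly. single 0 a * f" by(rule vector_space_mpoly)
 interpret k: vector_space "%a f :: ('n, 'k) mpoly. single 0 a * f" by(rule vector_space_mpoly)
 have single: "single s (1::'k) : module_span W" if s: "s : S" for s
 proof -
  define d where "d = esize s"
  let ?e = "%x. esize (fst x) + pdeg * sum_list (snd x)"
  let ?b = "%t. single t (1::bit)" and ?k = "%t. single t (1::'k)"
  let ?B = "basis_elem :: _ => ('n, bit) mpoly" and ?K = "basis_elem :: _ => ('n, 'k) mpoly"
  \<comment> \<open>The products of degree \<open>d\<close>. Exponents up to \<open>d\<close>
    suffice, as every parameter has positive degree.\<close>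
  define Y where "Y = {x\<in>W \<times> box fdim d. ?e x = d}"
  define T where "T = {t\<in>S. esize t = d}"
  have fY: "finite Y" using W(1) by(auto simp: Y_def)
  have fT: "finite T" by(rule finite_subset[OF _ finite_esize_le[of d]]) (auto simp: T_def)
  have "?b ` T <= b.span (?B ` Y)"
  proof safe
   fix t assume "t : T"
   hence t: "t : S" "esize t = d" by(auto simp: T_def)
   hence "?b t : module_span W" using W(4) single_in_monoid_ring by blast
   then obtain E a where Ea: "?b t = (SUM x:W \<times> box fdim E. single 0 (a x) * basis_elem x)" using in_module_span_basis[OF W(1)] by blast
   have "proj d (single 0 (a x) * ?B x) : b.span (?B ` Y)" if x: "x : W \<times> box fdim E" for x
   proof -
    have "proj d (single 0 (a x) * ?B x) = (if ?e x = d then single 0 (a x) * ?B x else 0)"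
     using x by(intro proj_homogeneous keys_basis_elem[where 'k = bit]) (auto simp: box_def in_keys_iff lookup_c)
    moreover have "x : Y" if "?e x = d"
    proof -
     have "k <= d" if k: "k : set (snd x)" for k
      using member_le_sum_list[OF k] pdeg_pos \<open>?e x = d\<close> mult_le_mono1[of 1 pdeg "sum_list (snd x)"] by linarith
     thus ?thesis using that x by(auto simp: Y_def box_def)
    qed
    ultimately show ?thesis by(auto intro: b.span_scale b.span_base b.span_zero)
   qed
   hence "proj d (?b t) : b.span (?B ` Y)" unfolding Ea proj_sum by(rule b.span_sum)
   thus "?b t : b.span (?B ` Y)" using t by(simp add: proj_single)
  qed
  moreover have bT: "inj_on ?b T & b.independent (?b ` T)"
  proof(rule b.independent_image[OF fT], intro ballI)
   fix c t assume z: "(SUM x:T. single 0 (c x) * ?b x) = 0" and t: "t : T"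
   have "c t = lookup (SUM x:T. single 0 (c x) * ?b x) t" using t fT by(simp add: mult_single lookup_sum lookup_single when_def)
   thus "c t = 0" using z by simp
  qed
  ultimately have "card (?b ` T) <= card (?B ` Y)" using fY b.independent_span_bound by blast
  hence "card T <= card Y" using card_image_le[OF fY, of ?B] bT by(simp add: card_image)
  have K: "inj_on ?K Y & k.independent (?K ` Y)"
  proof(rule k.independent_image[OF fY])
   fix c assume "(SUM x:Y. single 0 (c x) * ?K x) = 0"
   hence "(SUM x:W \<times> box fdim d. single 0 (if x : Y then c x else 0) * ?K x) = 0"
    using W(1) by(subst sum.mono_neutral_cong_right[where S = Y]) (auto simp: Y_def)
   hence "ALL x:W \<times> box fdim d. (if x : Y then c x else 0) = 0" by(rule kfree)
   moreover have "Y <= W \<times> box fdim d" by(auto simp: Y_def)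
   ultimately show "ALL x:Y. c x = 0" by(metis subsetD)
  qed
  have sub: "?K ` Y <= k.span (?k ` T)"
  proof safe
   fix x assume x: "x : Y"
   have "t : T" if "t : keys (?K x)" for t
    using that x subsetD[OF W(2), of "fst x"] keys_basis_elem[of x t, where 'k = 'k] basis_elem_in_ring[of x, where 'a = 'k] by(auto simp: T_def Y_def box_def monoid_ring_def)
   hence "(SUM t:keys (?K x). single 0 (lookup (?K x) t) * ?k t) : k.span (?k ` T)" by(intro k.span_sum k.span_scale k.span_base) auto
   thus "?K x : k.span (?k ` T)" by(simp add: mult_single sum_single_lookup)
  qed
  \<comment> \<open>\<open>Y\<close> has at least as many members as there are monomials of degree
    \<open>d\<close>, so an independent family indexed by it leaves no room for a further
    independent vector.\<close>
  have "?k s : k.span (?K ` Y)"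
  proof(rule ccontr)
   assume n: "?k s ~: k.span (?K ` Y)"
   have "insert (?k s) (?K ` Y) <= k.span (?k ` T)" using sub s by(auto simp: T_def d_def intro: k.span_base)
   moreover have "card (insert (?k s) (?K ` Y)) = Suc (card Y)"
    using n k.span_base[of "?k s" "?K ` Y"] fY by(subst card_insert_disjoint) (auto simp: card_image[OF K[THEN conjunct1]])
   moreover have "k.independent (insert (?k s) (?K ` Y))" using k.independent_insertI[OF n] K by blast
   ultimately have "Suc (card Y) <= card (?k ` T)" using k.independent_span_bound[of "?k ` T"] fT by fastforce
   thus False using \<open>card T <= card Y\<close> card_image_le[OF fT, of ?k] by linarith
  qed
  moreover have "k.span (?K ` Y) <= module_span W" using basis_elem_in_span[OF W(1), of _ 1]
   by(intro k.span_minimal k.subspaceI module_span_0 module_span_add module_span_mult single_0_in_param) (auto simp: Y_def)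
  ultimately show ?thesis by blast
 qed
 have "(monoid_ring S :: ('n, 'k) mpoly set) <= module_span W"
 proof
  fix f :: "('n, 'k) mpoly" assume f: "f : monoid_ring S"
  have "single 0 (lookup f t) * single t 1 : module_span W" if "t : keys f" for t
   using f that by(intro module_span_mult single_0_in_param single) (auto simp: monoid_ring_def)
  hence "(SUM t:keys f. single t (lookup f t)) : module_span W" by(intro module_span_sum) (simp add: mult_single)
  thus "f : module_span W" by(simp only: sum_single_lookup)
 qed
 moreover have "independent_mod (adjoins scalars (thetas :: ('n, 'k) mpoly list)) {0} W"
  unfolding free_iff_basis_elems[OF W(1)] by(intro allI impI kfree)
 ultimately show ?thesis by(intro exI[of _ W] conjI W)
qed

end

section \<open>Passage to the fraction field\<close>

lemma to_fract_mono_eval: "to_fract (mono_eval as ks) = mono_eval (map to_fract as) ks"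
 by(induction as ks rule: mono_eval.induct) (auto simp: to_fract_power)

lemma to_fract_spanned: "to_fract ` spanned K as E = spanned (to_fract ` K) (map to_fract as) E"
proof
 show "to_fract ` spanned K as E <= spanned (to_fract ` K) (map to_fract as) E"
 proof
  fix z assume "z : to_fract ` spanned K as E"
  then obtain c where c: "ALL ks. c ks : K" "z = to_fract (lincomb c as E)" by(auto simp: spanned_def)
  have "z = (SUM ks:box (length (map to_fract as)) E. to_fract (c ks) * mono_eval (map to_fract as) ks)" by(simp add: c(2) to_fract_mono_eval)
  also have "... : spanned (to_fract ` K) (map to_fract as) E" using c(1) by(intro spannedI) auto
  finally show "z : spanned (to_fract ` K) (map to_fract as) E" .
 qed
 show "spanned (to_fract ` K) (map to_fract as) E <= to_fract ` spanned K as E"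
 proof
  fix z assume "z : spanned (to_fract ` K) (map to_fract as) E"
  then obtain c where c: "ALL ks. c ks : to_fract ` K" "z = (SUM ks:box (length as) E. c ks * mono_eval (map to_fract as) ks)"
   by(auto simp: spanned_def)
  hence "ALL ks. EX d. d : K & c ks = to_fract d" by blast
  then obtain d where d: "!!ks. d ks : K" "!!ks. c ks = to_fract (d ks)" by metis
  have z: "z = to_fract (lincomb d as E)" by(simp add: c(2) d(2) to_fract_mono_eval)
  show "z : to_fract ` spanned K as E" unfolding z using d(1) by(intro imageI spannedI) auto
 qed
qed

lemma to_fract_adjoins: assumes "is_subring K" shows "to_fract ` adjoins K as = adjoins (to_fract ` K) (map to_fract as)"
 unfolding adjoins_eq_spanned[OF assms] adjoins_eq_spanned[OF to_fract_subring[OF assms]] image_UN to_fract_spanned ..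

lemma to_fract_indep: assumes "indep K {0} as" shows "indep (to_fract ` K) {0} (map to_fract as)" unfolding indep_def
proof(intro allI impI ballI)
 fix E c ks assume h: "(ALL ks. c ks : to_fract ` K) & lincomb c (map to_fract as) E : {0}" and ks: "ks : box (length (map to_fract as)) E"
 hence "ALL ks. EX d. d : K & c ks = to_fract d" by blast
 then obtain d where d: "!!ks. d ks : K" "!!ks. c ks = to_fract (d ks)" by metis
 have "to_fract (lincomb d as E) = 0" using h by(simp add: d(2) to_fract_mono_eval)
 hence "lincomb d as E : {0}" by(simp only: to_fract_eq_0_iff singleton_iff)
 hence "d ks = 0" using ks by(intro indepD[OF assms, of d E]) (auto simp: d)
 thus "c ks = 0" by(simp add: d(2))
qed

definition ground_field :: "('n::{finite, linorder}, 'k::field) mfrac set" where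
 "ground_field = to_fract ` range (single 0)"

lemma ground_field_subfield: "is_subfield (ground_field :: ('n::{finite, linorder}, 'k::field) mfrac set)" unfolding is_subfield_def
proof(intro conjI ballI)
 have "is_subring (range (single 0) :: ('n, 'k) mpoly set)" unfolding is_subring_def
 proof(intro conjI ballI)
  show "1 : (range (single 0) :: ('n, 'k) mpoly set)" by(rule image_eqI[of _ _ 1]) auto
 qed (auto simp: mult_single simp flip: single_diff)
 thus "is_subring (ground_field :: ('n, 'k) mfrac set)" unfolding ground_field_def by(rule to_fract_subring)
 fix z :: "('n, 'k) mfrac" assume "z : ground_field"
 then obtain a where a: "z = to_fract (single 0 a)" by(auto simp: ground_field_def)
 have "inverse z = to_fract (single 0 (inverse a))"
 proof(cases "a = 0")
  case False
  have "z * to_fract (single 0 (inverse a)) = 1" using False by(simp add: a mult_single flip: to_fract_mult)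
  thus ?thesis by(rule inverse_unique)
 qed (simp add: a)
 thus "inverse z : ground_field" by(auto simp: ground_field_def)
qed

context normal_affine_monoid
begin

lemma ring_generated: assumes "set gl = (%g. single g 1) ` G" shows "(monoid_ring S :: ('n, 'k::field) mpoly set) = adjoins scalars gl"
proof
 have A: "is_subring (adjoins scalars gl)" by(rule adjoins_subring[OF scalars_subring])
 have "set gl <= monoid_ring S" using assms G_sub by(auto intro!: single_in_monoid_ring)
 thus "adjoins scalars gl <= monoid_ring S" by(rule adjoins_least[OF ring_subring scalars_in_ring])
 have single: "single s 1 : adjoins scalars gl" if "s : S" for s using that
 proof(induction "esize s" arbitrary: s rule: less_induct)
  case less
  show ?case
  proof(cases "s = 0")
   case True
   thus ?thesis using subring_1[OF A] by simp
  next
   case False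
   then obtain g t where gt: "g : G" "t : S" "g ~= 0" "s = g + t" using G_gen less.prems by blast
   have "esize t < esize s" using gt esize_eq_0_iff[of g] by(simp add: esize_add)
   hence "single t 1 : adjoins scalars gl" using less.hyps gt(2) by blast
   moreover have "single g 1 : adjoins scalars gl" using adjoins_generators[OF scalars_subring, of gl] assms gt(1) by blast
   ultimately have "single g 1 * single t 1 : adjoins scalars gl" by(intro subring_mult[OF A])
   thus ?thesis by(simp add: mult_single gt(4))
  qed
 qed
 show "monoid_ring S <= adjoins scalars gl"
 proof
  fix f :: "('n, 'k) mpoly" assume f: "f : monoid_ring S"
  have "single 0 (lookup f t) * single t 1 : adjoins scalars gl" if "t : keys f" for t using f that adjoins_superset[OF scalars_subring, of gl]
   by(intro subring_mult[OF A] single) (auto simp: monoid_ring_def scalars_def)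
  hence "(SUM t:keys f. single t (lookup f t)) : adjoins scalars gl" by(intro subring_sum[OF A]) (simp add: mult_single)
  thus "f : adjoins scalars gl" by(simp only: sum_single_lookup)
 qed
qed

lemma noetherian_ring: "noetherian (to_fract ` (monoid_ring S :: ('n, 'k::field) mpoly set))"
proof -
 obtain gl :: "('n, 'k) mpoly list" where gl: "set gl = (%g. single g 1) ` G" using finite_list[of "(%g. single g 1) ` G"] finite_G by blast
 have "to_fract ` (monoid_ring S :: ('n, 'k) mpoly set) = adjoins ground_field (map to_fract gl)"
  unfolding ring_generated[OF gl] to_fract_adjoins[OF scalars_subring] by(simp add: ground_field_def scalars_def)
 thus ?thesis using noetherian_adjoins[OF noetherian_subfield[OF ground_field_subfield]] by simp
qed

lemma F_rational_ring: assumes "CHAR('k::field) > 0" shows "F_rational (to_fract ` (monoid_ring S :: ('n, 'k) mpoly set))"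
 by(rule F_rational_if_split[OF noetherian_ring frobenius_split_to_fract[OF ring_subring frobenius_split_ring[OF assms]]])
  (use assms in \<open>simp add: CHAR_fract CHAR_poly_mapping\<close>)

lemma cohen_macaulay_ring: "cohen_macaulay (to_fract ` (monoid_ring S :: ('n, 'k::field) mpoly set))"
proof -
 let ?A = "monoid_ring S :: ('n, 'k) mpoly set"
 let ?th = "thetas :: ('n, 'k) mpoly list"
 obtain W where W: "finite W" "W <= S" "independent_mod (adjoins scalars ?th) {0} W" "?A <= module_span W"

 proof(cases "CHAR('k) = 0")
  case True
  thus ?thesis using that free_basis_char_0[OF True] by(elim exE conjE)
 next
  case False
  hence "CHAR('k) > 0" by simp
  from free_basis_char_p[OF this] show ?thesis using that by(elim exE conjE)
 qed
 let ?x = "%w. to_fract (single w (1::'k))"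
 have inj: "inj_on ?x W"
 proof(rule inj_onI)
  fix v w :: "'n mon" assume "?x v = ?x w"
  hence "keys (single v (1::'k)) = keys (single w (1::'k))" by simp
  thus "v = w" by simp
 qed
 have gf: "ground_field = to_fract ` (scalars :: ('n, 'k) mpoly set)" by(simp add: ground_field_def scalars_def)
 have C: "adjoins ground_field (map to_fract (rev ?th)) = to_fract ` adjoins scalars ?th" unfolding gf to_fract_adjoins[OF scalars_subring, symmetric]
  using adjoins_cong[OF scalars_subring, of "rev ?th" ?th] by simp
 show ?thesis
 proof(rule cohen_macaulay_free[where K = ground_field and ths = "map to_fract (rev ?th)" and W = "?x ` W"])
  show "is_subfield (ground_field :: ('n, 'k) mfrac set)" by(rule ground_field_subfield)
  show "noetherian (to_fract ` ?A)" by(rule noetherian_ring)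
  show "indep ground_field {0} (map to_fract (rev ?th))" unfolding gf by(rule to_fract_indep[OF thetas_indep])
  show "adjoins ground_field (map to_fract (rev ?th)) <= to_fract ` ?A" unfolding C using param_sub_ring by(rule image_mono)
  show "finite (?x ` W)" using W(1) by simp
  show "?x ` W <= to_fract ` ?A" using W(2) by(auto intro!: imageI single_in_monoid_ring)
  show "EX c. (ALL w. c w : adjoins ground_field (map to_fract (rev ?th))) & a = (SUM w:?x ` W. c w * w)"
   if "a : to_fract ` ?A" for a
  proof -
   from that obtain f where f: "a = to_fract f" "f : ?A" by blast
   then obtain c where c: "ALL w. c w : adjoins scalars ?th" "f = (SUM w:W. c w * single w 1)" using W(4) by(auto simp: module_span_def)
   let ?c = "%z. to_fract (c (the_inv_into W ?x z)) :: ('n, 'k) mfrac"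
   have "a = (SUM w:?x ` W. ?c w * w)" unfolding f(1) c(2) sum.reindex[OF inj] comp_def by(simp add: the_inv_into_f_f[OF inj])
   moreover have "ALL w. ?c w : to_fract ` adjoins scalars ?th" using c(1) by blast
   ultimately show ?thesis unfolding C by(intro exI[of _ ?c] conjI)
  qed
  fix c assume c: "!!w. c w : adjoins ground_field (map to_fract (rev ?th))" "(SUM w:?x ` W. c w * w) = 0"
  hence "ALL w. EX d. d : adjoins scalars ?th & c (?x w) = to_fract d" unfolding C by blast
  then obtain d where d: "!!w. d w : adjoins scalars ?th" "!!w. c (?x w) = to_fract (d w)" by metis
  have "to_fract (SUM w:W. d w * single w 1) = 0" using c(2) inj by(simp add: sum.reindex d(2))
  hence "(SUM w:W. d w * single w 1) : {0}" by(simp only: to_fract_eq_0_iff singleton_iff)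
  hence "ALL w:W. d w = 0" using W(3)[unfolded independent_mod_def, rule_format, of d] d(1) by blast
  thus "ALL w:?x ` W. c w = 0" by(auto simp: d(2))
 qed
qed

end

section \<open>Exponents of a principal strongly shifted ideal\<close>

definition pm :: "('n::finite => 'b::zero) => ('n \<Rightarrow>\<^sub>0 'b)" where "pm = Abs_poly_mapping"

lemma lookup_pm [simp]: "lookup (pm w) = w" by(simp add: pm_def)

lemma pm_lookup [simp]: "pm (lookup w) = w" by(rule poly_mapping_eqI) simp

abbreviation (input) enumerates :: "(nat => 'n::finite) => bool" where
 "enumerates e \<equiv> bij_betw e {..<CARD('n)} UNIV"

definition sorts :: "(nat => 'n::finite) => ('n => nat) => bool" where
 "sorts e w \<longleftrightarrow> enumerates e & (ALL i j. i <= j & j < CARD('n) --> w (e j) <= w (e i))"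

lemma sorts_exists: "EX e. sorts e (w :: 'a::finite => nat)"
proof -
 obtain xs :: "'a list" where xs: "set xs = UNIV" "distinct xs" using List.finite_distinct_list[OF finite] by blast
 let ?ys = "rev (sort_key w xs)"
 have ys: "set ?ys = UNIV" "distinct ?ys" using xs by auto
 hence len: "length ?ys = CARD('a)" using distinct_card[of ?ys] by simp
 have "bij_betw ((!) ?ys) {..<CARD('a)} UNIV" using ys len by(metis bij_betw_nth)
 moreover have "w (?ys ! j) <= w (?ys ! i)" if "i <= j" "j < CARD('a)" for i j
 proof -
  have "sorted (map w (sort_key w xs))" by simp
  hence "sorted (rev (map w ?ys))" by(simp only: rev_map rev_rev_ident)
  thus ?thesis using that len by(simp add: sorted_rev_iff_nth_mono)
 qed
 ultimately show ?thesis unfolding sorts_def by(intro exI[of _ "(!) ?ys"] conjI allI impI) auto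
qed

definition pre :: "('n => nat) => (nat => 'n) => nat => nat" where
 "pre w e k = (SUM j<k. w (e j))"

lemma pre_0 [simp]: "pre w e 0 = 0" and pre_Suc: "pre w e (Suc k) = pre w e k + w (e k)" by(simp_all add: pre_def)

lemma pre_card: "enumerates e ==> pre w e CARD('n) = sum w (UNIV :: 'n::finite set)" unfolding pre_def by(rule sum.reindex_bij_betw)

lemma pre_eq_sum: assumes "bij_betw e {..<CARD('n)} (UNIV :: 'n::finite set)" "k <= CARD('n)"
 shows "pre w e k = sum w (e ` {..<k})" "card (e ` {..<k}) = k"
proof -
 have "inj_on e {..<k}" using assms unfolding bij_betw_def by(auto intro: inj_on_subset)
 thus "pre w e k = sum w (e ` {..<k})" "card (e ` {..<k}) = k" by(simp_all add: pre_def sum.reindex card_image)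
qed

lemma move_lookup: assumes "v + unit_exp j = w + unit_exp i" shows "lookup v x + (if x = j then 1 else 0) = lookup w x + (if x = i then 1 else 0)"
 using arg_cong[OF assms, of "%u. lookup u x"] by(simp add: lookup_add lookup_single when_def eq_commute split: if_splits)

lemma move_sum: assumes v: "v + unit_exp j = w + unit_exp (i :: 'n::finite)"
 shows "sum (lookup v) T + (if j : T then 1 else 0) = sum (lookup w) T + (if i : T then 1 else 0)"
proof -
 have "(SUM x:T. lookup v x + (if x = j then 1 else 0)) = (SUM x:T. lookup w x + (if x = i then 1 else 0))"
  by(rule sum.cong[OF refl move_lookup[OF v]])
 thus ?thesis by(simp add: sum.distrib)
qed

lemma move_pre: assumes e: "bij_betw e {..<CARD('n)} (UNIV :: 'n::finite set)" and ij: "i < CARD('n)" "j < CARD('n)" "k <= CARD('n)"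
  and v: "v + unit_exp (e j) = w + unit_exp (e i)"
 shows "pre (lookup v) e k + (if j < k then 1 else 0) = pre (lookup w) e k + (if i < k then 1 else 0)"
proof -
 have "e x : e ` {..<k} \<longleftrightarrow> x < k" if "x < CARD('n)" for x
  using inj_on_image_mem_iff[of e "{..<CARD('n)}" x "{..<k}"] e that ij(3) by(simp add: bij_betw_def)
 thus ?thesis using move_sum[OF v, of "e ` {..<k}"] ij by(simp add: pre_eq_sum[OF e])
qed

lemma sum_le_initial:
 fixes a :: "nat => nat" assumes a: "!!i j. i <= j ==> j < n ==> a j <= a i" and "finite T" "T <= {..<n}" shows "sum a T <= sum a {..<card T}"
 using assms(2,3)
proof(induction T rule: finite_linorder_max_induct)
 case (insert b A)
 have "A <= {..<b}" using insert.hyps by auto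
 hence "card A <= b" using card_mono[of "{..<b}" A] by simp
 moreover have "b ~: A" "b < n" using insert by auto
 ultimately show ?case using insert a[of "card A" b] by(simp add: lessThan_Suc)
qed simp

lemma surj_image: assumes "e ` A = UNIV" shows "T = e ` {j\<in>A. e j : T}"
proof
 show "T <= e ` {j\<in>A. e j : T}"
 proof
  fix x assume "x : T"
  moreover obtain j where "j : A" "x = e j" using assms by(metis UNIV_I imageE)
  ultimately show "x : e ` {j\<in>A. e j : T}" by blast
 qed
qed auto

lemma image_set_eq: assumes "bij_betw e {..<CARD('n)} (UNIV :: 'n::finite set)"
 obtains T' where "T' <= {..<CARD('n)}" "T = e ` T'" "inj_on e T'" "card T' = card T"
proof -
 let ?T = "{j\<in>{..<CARD('n)}. e j : T}"
 have "T = e ` ?T" using assms unfolding bij_betw_def by(intro surj_image) simp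
 moreover have inj: "inj_on e ?T" using assms unfolding bij_betw_def by(auto intro: inj_on_subset)
 ultimately have "card ?T = card T" using card_image by metis
 thus ?thesis using \<open>T = e ` ?T\<close> inj that[of ?T] by auto
qed

lemma sum_le_pre: assumes e: "sorts e w" shows "sum w T <= pre w e (card T)"
proof -
 have "bij_betw e {..<CARD('a)} UNIV" using e by(simp add: sorts_def)
 then obtain T' where T': "T' <= {..<CARD('a)}" "T = e ` T'" "inj_on e T'" "card T' = card T" by(rule image_set_eq)
 have "sum w T = (SUM j:T'. w (e j))" by(simp add: T'(2) sum.reindex[OF T'(3)])
 also have "... <= (SUM j<card T'. w (e j))" using e T'(1) finite_subset[OF T'(1)] by(intro sum_le_initial) (auto simp: sorts_def)
 finally show ?thesis by(simp add: T'(4) pre_def)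
qed

lemma downset_nat:
 fixes A :: "nat set" assumes "finite A" "!!i j. j : A ==> i <= j ==> i : A" shows "A = {..<card A}"
proof -
 define m where "m = (LEAST m. m ~: A)"
 have m: "m ~: A" unfolding m_def by(rule LeastI_ex) (rule ex_new_if_finite[OF infinite_UNIV_nat assms(1)])
 have "i : A" if "i < m" for i using not_less_Least[OF that[unfolded m_def]] by blast
 moreover have "i < m" if "i : A" for i using assms(2)[OF that, of m] m by force
 ultimately have "A = {..<m}" by auto
 thus ?thesis by simp
qed

lemma upper_set_initial:
 fixes c :: "'n::finite => nat" assumes e: "sorts e c" shows "{i. v <= c i} = e ` {..<card {i. v <= c i}}" "card {i. v <= c i} <= CARD('n)"
proof -
 let ?A = "{j\<in>{..<CARD('n)}. v <= c (e j)}"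
 have b: "enumerates e" using e by(simp add: sorts_def)
 have "?A = {..<card ?A}" using e by(intro downset_nat) (auto simp: sorts_def intro: order_trans)
 moreover have U: "{i. v <= c i} = e ` ?A" using b surj_image[of e "{..<CARD('n)}" "{i. v <= c i}"] unfolding bij_betw_def by simp
 moreover have "inj_on e ?A" using b unfolding bij_betw_def by(auto intro: inj_on_subset)
 hence "card ?A = card {i. v <= c i}" unfolding U by(simp only: card_image)
 ultimately show "{i. v <= c i} = e ` {..<card {i. v <= c i}}" by metis
 show "card {i. v <= c i} <= CARD('n)" by(intro card_mono) auto
qed

lemma sum_upper_set:
 fixes c :: "'n::finite => nat" assumes e: "sorts e c" shows "sum s {i. v <= c i} = pre s e (card {i. v <= c i})"
 using upper_set_initial[OF e, of v] pre_eq_sum(1)[of e "card {i. v <= c i}" s] e by(simp add: sorts_def)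

text \<open>Increasing \<open>m\<close> by one shifts the sum: the term \<open>m div d\<close> is
  replaced by \<open>(m + d) div d\<close>, which is larger by one.\<close>

lemma hermite_identity: "d > 0 ==> (SUM k<d. (m + k) div d) = (m::nat)"
proof(induction m)
 case (Suc m)
 have "(SUM k<d. (Suc m + k) div d) + m div d = (SUM k<Suc d. (m + k) div d)" by(subst sum.lessThan_Suc_shift) simp
 also have "... = m + (m + d) div d" using Suc by simp
 finally show ?case using Suc.prems by simp
qed simp

text \<open>Cuts the sequence \<open>w (e 0), w (e 1), \<dots>\<close> into \<open>d\<close> parts of almost equal size; the prefix sums
 of the part \<open>k\<close> are \<open>\<lfloor>(W + k) / d\<rfloor>\<close>, where \<open>W\<close> is the corresponding prefix sum of \<open>w\<close>.\<close>

definition piece :: "('n::finite => nat) => (nat => 'n) => nat => nat => 'n => nat" where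
 "piece w e d k i = (let j = the_inv_into {..<CARD('n)} e i in
   (pre w e (Suc j) + k) div d - (pre w e j + k) div d)"

context
 fixes w :: "'n::finite => nat" and e :: "nat => 'n" and d :: nat assumes e: "enumerates e" and d: "d > 0"
begin

lemma piece_e: "j < CARD('n) ==> piece w e d k (e j) = (pre w e (Suc j) + k) div d - (pre w e j + k) div d"
 using e by(simp add: piece_def bij_betw_def the_inv_into_f_f)

lemma e_surj: obtains j where "j < CARD('n)" "i = e j" using e unfolding bij_betw_def by(metis UNIV_I imageE lessThan_iff)

lemma pre_piece: "k < d ==> j <= CARD('n) ==> pre (piece w e d k) e j = (pre w e j + k) div d"
proof(induction j)
 case (Suc j)
 have "(pre w e j + k) div d <= (pre w e (Suc j) + k) div d" by(intro div_le_mono) (simp add: pre_Suc)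
 thus ?case using Suc by(simp add: pre_Suc[of "piece w e d k"] piece_e)
qed simp

lemma piece_cases: "piece w e d k i = w i div d | piece w e d k i = Suc (w i div d)"
proof -
 obtain j where j: "j < CARD('n)" "i = e j" by(rule e_surj)
 let ?a = "pre w e j + k"
 have "(?a + w (e j)) div d = ?a div d + w (e j) div d + (?a mod d + w (e j) mod d) div d" by(rule div_add1_eq)
 moreover have "(?a mod d + w (e j) mod d) div d <= 1"
 proof -
  have "?a mod d < d" "w (e j) mod d < d" using d by auto
  hence "?a mod d + w (e j) mod d < 2 * d" by linarith
  thus ?thesis using d by(simp add: less_mult_imp_div_less flip: less_Suc_eq_le)
 qed
 ultimately show ?thesis using j by(simp add: piece_e pre_Suc algebra_simps) linarith
qed

lemma sum_piece: "(SUM k<d. piece w e d k i) = w i"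
proof -
 obtain j where j: "j < CARD('n)" "i = e j" by(rule e_surj)
 have "(SUM k<d. piece w e d k i) = (SUM k<d. (pre w e (Suc j) + k) div d) - (SUM k<d. (pre w e j + k) div d)"
  using j by(simp add: piece_e) (intro sum_subtractf_nat div_le_mono, simp add: pre_Suc)
 thus ?thesis using j by(simp add: hermite_identity[OF d] pre_Suc)
qed

end

locale borel_generator =
 fixes lam :: "'n::{finite, linorder} mon" assumes lam_nonzero: "lam ~= 0"
begin

definition D where "D = esize lam"

definition lam_order :: "nat => 'n" where "lam_order = (SOME e. sorts e (lookup lam))"

definition lam_seq :: "nat => nat" where
 "lam_seq j = (if j < CARD('n) then lookup lam (lam_order j) else 0)"

text \<open>The rank function of a symmetric polymatroid. It is concave because
  \<open>lam_seq\<close> is decreasing, which makes \<open>rk (card T)\<close> submodular in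
  \<open>T\<close>.\<close>

definition rk :: "nat => nat" where "rk k = (SUM j<k. lam_seq j)"

definition G :: "'n mon set" where
 "G = {w. esize w = D & (ALL T. sum (lookup w) T <= rk (card T))}"

definition S :: "'n mon set" where
 "S = {w. EX d. esize w = D * d & (ALL T. sum (lookup w) T <= d * rk (card T))}"

lemma D_pos: "D > 0" using lam_nonzero esize_eq_0_iff[of lam] by(simp add: D_def del: neq0_conv add: neq0_conv[symmetric])

lemma lam_order: "sorts lam_order (lookup lam)" unfolding lam_order_def by(rule someI_ex[OF sorts_exists])

lemma lam_seq_antimono: "i <= j ==> lam_seq j <= lam_seq i" using lam_order by(auto simp: lam_seq_def sorts_def)

lemma rk_0 [simp]: "rk 0 = 0" and rk_Suc: "rk (Suc k) = rk k + lam_seq k" by(simp_all add: rk_def)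

lemma rk_eq_pre: "k <= CARD('n) ==> rk k = pre (lookup lam) lam_order k" unfolding rk_def pre_def by(intro sum.cong) (auto simp: lam_seq_def)

lemma rk_card: "rk CARD('n) = D" using lam_order by(simp add: rk_eq_pre pre_card sorts_def D_def esize_def)

lemma card_le: "card (T :: 'n set) <= CARD('n)" by(intro card_mono) auto

lemma lam_in_G: "lam : G" using sum_le_pre[OF lam_order] by(simp add: G_def D_def rk_eq_pre card_le)

lemma rk_ge: "u <= t ==> (!!j. j < t ==> v <= lam_seq j) ==> rk u + (t - u) * v <= rk t"
proof(induction t rule: dec_induct)
 case (step t)
 hence "v <= lam_seq t" "rk u + (t - u) * v <= rk t" by auto
 thus ?case using step.hyps by(simp add: rk_Suc Suc_diff_le)
qed simp

lemma rk_le: "t <= u ==> (!!j. t <= j ==> lam_seq j <= v) ==> rk u <= rk t + (u - t) * v"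
proof(induction u rule: dec_induct)
 case (step u)
 hence "lam_seq u <= v" "rk u <= rk t + (u - t) * v" by auto
 thus ?case using step.hyps by(simp add: rk_Suc Suc_diff_le)
qed simp

text \<open>Choose \<open>v\<close> so that \<open>card T\<close> lies between the sizes of two
  consecutive level sets of \<open>c\<close>, and compare \<open>T\<close> with one of them. The
  sums change in a controlled way: \<open>s\<close> is at most \<open>v + 1\<close> outside the
  smaller level set and at least \<open>v + 1\<close> inside, and the same holds with
  \<open>v\<close> for the larger one.\<close>

lemma rk_bound:
 fixes c s :: "'n => nat" assumes s: "!!i. s i = c i | s i = Suc (c i)" and up: "!!v. sum s {i. v <= c i} <= rk (card {i. v <= c i})"
 shows "sum s T <= rk (card T)"
proof(cases "T = {}")
 case False
 let ?U = "%v. {i. v <= c i}"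
 have "EX v. card T <= card (?U v) & card (?U (Suc v)) < card T"
 proof -
  let ?m = "Suc (Max (range c))"
  have "c i < ?m" for i using Max_ge[of "range c" "c i"] by(simp add: less_Suc_eq_le)
  hence "?U ?m = {}" by(metis (mono_tags, lifting) empty_Collect_eq not_le)
  moreover have "card T > 0" using False by(simp add: card_gt_0_iff)
  ultimately have "card (?U ?m) < card T" by(metis card.empty)
  moreover have "~ card (?U 0) < card T" using card_le[of T] by simp
  ultimately show ?thesis using ex_least_nat_less[of "%v. card (?U v) < card T" ?m] by(auto simp: not_less)
 qed
 then obtain v where v: "card T <= card (?U v)" "card (?U (Suc v)) <= card T" by(blast intro: less_imp_le)
 let ?A = "?U (Suc v)" and ?B = "?U v"
 have split: "sum g Y + sum g (Z - Y) = sum g Z + sum g (Y - Z)" for g :: "'n => nat" and Y Z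
  using sum.union_disjoint[of Y "Z - Y" g] sum.union_disjoint[of Z "Y - Z" g] by(simp add: Un_commute)
 have card_split: "card Y + card (Z - Y) = card Z + card (Y - Z)" for Y Z :: "'n set" using split[of "%_. 1"] by simp
 \<comment> \<open>If the parts of \<open>lam\<close> before position \<open>card T\<close> all
   exceed \<open>v\<close>, the bound for the smaller level set extends up to the size of
   \<open>T\<close>; otherwise the parts from there on are at most \<open>v\<close>, and the bound
   for the larger level set is cut down.\<close>
 show ?thesis
 proof(cases "ALL j<card T. Suc v <= lam_seq j")
  case True
  have "s i <= Suc v" if "i : T - ?A" for i using s[of i] that by auto
  hence "sum s (T - ?A) <= card (T - ?A) * Suc v" using sum_bounded_above[of "T - ?A" s "Suc v"] by simp
  moreover have "Suc v <= s i" if "i : ?A - T" for i using s[of i] that by auto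
  hence "card (?A - T) * Suc v <= sum s (?A - T)" using sum_bounded_below[of "?A - T" "Suc v" s] by simp
  ultimately have "sum s T + (card (?A - T) * Suc v) <= sum s ?A + card (T - ?A) * Suc v" using split[of s T ?A] by linarith
  moreover have eq: "card (T - ?A) = (card T - card ?A) + card (?A - T)" using card_split[of T ?A] v(2) by linarith
  ultimately have "sum s T <= sum s ?A + (card T - card ?A) * Suc v" unfolding eq add_mult_distrib by linarith
  also have "... <= rk (card ?A) + (card T - card ?A) * Suc v" using up by simp
  also have "... <= rk (card T)" using True v(2) by(intro rk_ge) auto
  finally show ?thesis .
 next
  case False
  then obtain j where "j < card T" "lam_seq j <= v" by(auto simp: not_le less_Suc_eq_le)
  hence le: "lam_seq i <= v" if "card T <= i" for i using lam_seq_antimono[of j i] that by linarith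
  have "s i <= v" if "i : T - ?B" for i using s[of i] that by auto
  hence "sum s (T - ?B) <= card (T - ?B) * v" using sum_bounded_above[of "T - ?B" s v] by simp
  moreover have "v <= s i" if "i : ?B - T" for i using s[of i] that by auto
  hence "card (?B - T) * v <= sum s (?B - T)" using sum_bounded_below[of "?B - T" v s] by simp
  ultimately have "sum s T + (card (?B - T) * v) <= sum s ?B + card (T - ?B) * v" using split[of s T ?B] by linarith
  moreover have eq: "card (?B - T) = (card ?B - card T) + card (T - ?B)" using card_split[of T ?B] v(1) by linarith
  ultimately have "sum s T + (card ?B - card T) * v <= sum s ?B" unfolding eq add_mult_distrib by linarith
  also have "... <= rk (card ?B)" by(rule up)
  also have "... <= rk (card T) + (card ?B - card T) * v" using le v(1) by(intro rk_le) auto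
  finally show ?thesis by simp
 qed
qed simp

text \<open>The entries of a piece are \<open>lookup w i div d\<close> or one more, so only level
  sets matter. These are initial segments of \<open>e\<close>, where the piece has the sum
  \<open>(W + k) div d\<close> for a prefix sum \<open>W\<close> of \<open>w\<close> that is at most
  \<open>d\<close> times the rank; \<open>k < d\<close> does the rest.\<close>

lemma piece_in_G: assumes w: "esize w = D * d" "!!T. sum (lookup w) T <= d * rk (card T)" and e: "sorts e (lookup w)" and k: "k < d"
 shows "pm (piece (lookup w) e d k) : G"
proof -
 let ?p = "piece (lookup w) e d k" and ?c = "%i. lookup w i div d"
 have b: "enumerates e" using e by(simp add: sorts_def)
 have d: "d > 0" using k by simp
 have c: "sorts e ?c" using e by(simp add: sorts_def div_le_mono)
 have "sum ?p T <= rk (card T)" for T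
 proof(rule rk_bound[of ?p ?c])
  show "?p i = ?c i | ?p i = Suc (?c i)" for i by(rule piece_cases[OF b d])
  fix v
  let ?u = "card {i. v <= ?c i}"
  have u: "?u <= CARD('n)" by(rule card_le)
  have "pre (lookup w) e ?u <= d * rk ?u" using w(2) pre_eq_sum[OF b u] by metis
  hence "(pre (lookup w) e ?u + k) div d <= (k + d * rk ?u) div d" by(intro div_le_mono) simp
  also have "... = rk ?u" using k by simp
  finally show "sum ?p {i. v <= ?c i} <= rk ?u" using sum_upper_set[OF c, of ?p v] pre_piece[OF b d k u, of "lookup w"] by simp
 qed
 moreover have "esize (pm ?p) = D" using pre_card[OF b, of ?p] pre_piece[OF b d k le_refl, of "lookup w"] pre_card[OF b, of "lookup w"] w(1) k
  by(simp add: esize_def)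
 ultimately show ?thesis by(simp add: G_def)
qed

lemma sum_pieces: assumes "sorts e (lookup w)" "d > 0" shows "w = (SUM k<d. pm (piece (lookup w) e d k))"
 using sum_piece[of e d "lookup w"] assms by(intro poly_mapping_eqI) (simp add: lookup_sum sorts_def)

text \<open>A sum can grow only for \<open>T\<close> containing \<open>i\<close> but not
  \<open>j\<close>; there it is bounded by the sum of \<open>w\<close> over \<open>T\<close> with
  \<open>i\<close> replaced by \<open>j\<close>.\<close>

lemma exchange_in_G: assumes w: "w : G" and ij: "lookup w i < lookup w j" and v: "v + unit_exp j = w + unit_exp i" shows "v : G"
proof -
 have neq: "i ~= j" using ij by auto
 note sums = move_sum[OF v]
 have "esize v = D" using sums[of UNIV] w by(simp add: G_def esize_def)
 moreover have "sum (lookup v) T <= rk (card T)" for T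
 proof(cases "i : T & j ~: T")
  case True
  let ?T = "insert j (T - {i})"
  have "card ?T = card T" using True by(simp add: card_insert_if) (metis Suc_pred card_gt_0_iff empty_iff finite)
  moreover have "sum (lookup w) T = lookup w i + sum (lookup w) (T - {i})" using True by(simp add: sum.remove)
  moreover have "sum (lookup w) ?T = lookup w j + sum (lookup w) (T - {i})" using True by simp
  moreover have "sum (lookup w) ?T <= rk (card ?T)" using w by(simp only: G_def mem_Collect_eq)
  ultimately show ?thesis using sums[of T] True ij by simp
 next
  case False
  hence "sum (lookup v) T <= sum (lookup w) T" using sums[of T] by(auto split: if_splits)
  also have "... <= rk (card T)" using w by(simp add: G_def)
  finally show ?thesis .
 qed
 ultimately show ?thesis by(simp add: G_def)
qed

lemma permute_in_G: assumes w: "w : G" and p: "bij p" shows "pm (lookup w \<circ> p) : G"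
proof -
 have inj: "inj_on p T" for T using p by(auto simp: bij_def intro: inj_on_subset)
 have s: "sum (lookup w \<circ> p) T = sum (lookup w) (p ` T)" for T by(simp add: sum.reindex[OF inj])
 have "card (p ` T) = card T" for T using inj by(rule card_image)
 hence "sum (lookup w \<circ> p) T <= rk (card T)" for T using w unfolding s G_def by(metis (mono_tags, lifting) mem_Collect_eq)
 moreover have "p ` UNIV = UNIV" using p by(simp add: bij_def)
 ultimately show ?thesis using w s[of UNIV] by(simp add: G_def esize_def)
qed

text \<open>Permute \<open>lam\<close> so that its parts follow the order of \<open>w\<close>: its
  prefix sums then dominate those of \<open>w\<close>. As in Muirhead's argument, moving a unit from
  the first entry that is too large to the point where the prefix sums meet again keeps the
  domination and lowers the total of the prefix sums.\<close>

lemma G_reachable: assumes C1: "lam : C" and C2: "!!v p. v : C ==> bij p ==> pm (lookup v \<circ> p) : C"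
  and C3: "!!v u i j. v : C ==> lookup v i < lookup v j ==> u + unit_exp j = v + unit_exp i ==> u : C" and w: "w : G" shows "w : C"
proof -
 obtain e where e: "sorts e (lookup w)" using sorts_exists by blast
 have b: "enumerates e" using e by(simp add: sorts_def)
 define p where "p = lam_order \<circ> the_inv_into {..<CARD('n)} e"
 have bl: "enumerates lam_order" using lam_order by(simp add: sorts_def)
 have p: "bij p" unfolding p_def using bij_betw_trans[OF bij_betw_the_inv_into[OF b] bl] by simp
 have pe: "p (e j) = lam_order j" if "j < CARD('n)" for j using that b by(simp add: p_def bij_betw_def the_inv_into_f_f)
 define P where "P v \<longleftrightarrow> v : C & esize v = D & (ALL k<=CARD('n). pre (lookup w) e k <= pre (lookup v) e k)" for v
 have "P (pm (lookup lam \<circ> p))"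
 proof -
  have pr: "pre (lookup lam \<circ> p) e k = rk k" if "k <= CARD('n)" for k
   using that unfolding rk_eq_pre[OF that] pre_def by(intro sum.cong) (auto simp: pe)
  have "pre (lookup w) e k <= rk k" if "k <= CARD('n)" for k
   using w pre_eq_sum[OF b that] unfolding G_def by(metis (mono_tags, lifting) mem_Collect_eq)
  moreover have "esize (pm (lookup lam \<circ> p)) = D" using pr[OF le_refl] pre_card[OF b, of "lookup lam \<circ> p"] by(simp add: esize_def rk_card)
  ultimately show ?thesis using C2[OF C1 p] by(simp add: P_def pr)
 qed
 moreover have "w : C" if "P v" for v using that
 proof(induction "SUM k<=CARD('n). pre (lookup v) e k" arbitrary: v rule: less_induct)
  case less
  note v = less.prems[unfolded P_def]
  show ?case
  proof(cases "v = w")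
   case False
   have "EX i<CARD('n). lookup v (e i) ~= lookup w (e i)"
   proof(rule ccontr)
    assume "~ ?thesis"
    hence "lookup v i = lookup w i" for i using b unfolding bij_betw_def by(metis UNIV_I imageE lessThan_iff)
    thus False using False poly_mapping_eqI by blast
   qed
   then obtain i where i: "i < CARD('n)" "lookup v (e i) ~= lookup w (e i)" "!!j. j < i ==> lookup v (e j) = lookup w (e j)"
    using exists_least_iff[of "%i. i < CARD('n) & lookup v (e i) ~= lookup w (e i)"] by(metis less_trans)
   have "pre (lookup v) e i = pre (lookup w) e i" unfolding pre_def using i(3) by(intro sum.cong) auto
   moreover have "pre (lookup w) e (Suc i) <= pre (lookup v) e (Suc i)" using v i(1) by(simp add: Suc_le_eq)
   ultimately have gt: "pre (lookup w) e (Suc i) < pre (lookup v) e (Suc i)" "lookup w (e i) < lookup v (e i)" using i(2) by(auto simp: pre_Suc)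
   have end_eq: "pre (lookup v) e CARD('n) = pre (lookup w) e CARD('n)" using v w by(simp add: pre_card[OF b] G_def esize_def)
   let ?P = "%k. k > i & k < CARD('n) & pre (lookup v) e (Suc k) = pre (lookup w) e (Suc k)"
   have "EX k. ?P k"
   proof -
    have s: "Suc (CARD('n) - 1) = CARD('n)" by simp
    have "i ~= CARD('n) - 1"
    proof
     assume "i = CARD('n) - 1"
     thus False using gt(1) end_eq s by simp
    qed
    thus ?thesis using i(1) end_eq s by(intro exI[of _ "CARD('n) - 1"]) auto
   qed
   \<comment> \<open>Up to \<open>j\<close> the prefix sums of \<open>v\<close> stay strictly above
     those of \<open>w\<close>, so lowering them by one there is harmless.\<close>
   then obtain j where P: "?P j" "ALL m<j. ~ ?P m" using exists_least_iff[of ?P] by blast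
   hence j: "i < j" "j < CARD('n)" "pre (lookup v) e (Suc j) = pre (lookup w) e (Suc j)" by auto
   have least: "pre (lookup v) e (Suc k) ~= pre (lookup w) e (Suc k)" if "i < k" "k < j" for k using P that less_trans[of k j "CARD('n)"] by blast
   have between: "pre (lookup w) e k < pre (lookup v) e k" if "i < k" "k <= j" for k
   proof -
    from that obtain k' where k': "k = Suc k'" by(cases k) auto
    have "pre (lookup v) e k ~= pre (lookup w) e k" using gt(1) least[of k'] that unfolding k' by(cases "k' = i") auto
    moreover have "pre (lookup w) e k <= pre (lookup v) e k" using v that j(2) by simp
    ultimately show ?thesis by simp
   qed
   \<comment> \<open>This chain of inequalities makes the move an allowed shift from a larger to a
     smaller entry.\<close>
   have "lookup v (e j) < lookup w (e j)" using between[of j] j(1,3) by(simp add: pre_Suc)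
   also have "... <= lookup w (e i)" using e j(1,2) by(simp add: sorts_def)
   also note gt(2)
   finally have lt: "lookup v (e j) < lookup v (e i)" .
   have neq: "e i ~= e j" using lt by auto
   define u where "u = pm (%x. if x = e i then lookup v x - 1 else if x = e j then lookup v x + 1 else lookup v x)"
   have u: "u + unit_exp (e i) = v + unit_exp (e j)" using neq lt by(intro poly_mapping_eqI) (auto simp: u_def lookup_add lookup_single when_def)
   have uC: "u : C" by(rule C3[OF _ lt u]) (use v in simp)
   have pu: "pre (lookup u) e k + (if i < k then 1 else 0) = pre (lookup v) e k + (if j < k then 1 else 0)" if "k <= CARD('n)" for k
    by(rule move_pre[OF b j(2) i(1) that u])
   have "esize u = D" using pu[OF le_refl] v i(1) j(2) by(simp add: pre_card[OF b] esize_def)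
   moreover have "pre (lookup w) e k <= pre (lookup u) e k" if "k <= CARD('n)" for k
    using pu[OF that] between[of k] v that j(1) by(cases "i < k"; cases "j < k") auto
   ultimately have "P u" using uC by(simp add: P_def)
   moreover have "(SUM k<=CARD('n). pre (lookup u) e k) < (SUM k<=CARD('n). pre (lookup v) e k)"
   proof(rule sum_strict_mono_ex1)
    show "ALL k:{..CARD('n)}. pre (lookup u) e k <= pre (lookup v) e k"
    proof
     fix k assume "k : {..CARD('n)}"
     thus "pre (lookup u) e k <= pre (lookup v) e k" using pu[of k] j(1) by(auto split: if_splits)
    qed
    show "EX k:{..CARD('n)}. pre (lookup u) e k < pre (lookup v) e k" using pu[of "Suc i"] i(1) j(1) by(intro bexI[of _ "Suc i"]) auto
   qed simp
   ultimately show ?thesis by(intro less.hyps)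
  qed (use v in simp)
 qed
 ultimately show ?thesis by blast
qed

end

section \<open>Identification of the ideal and of its minimal generators\<close>

lemma ring_on_UNIV: "ring_on UNIV = ring_of_type_algebra" by(simp add: ring_on_def ring_of_type_algebra_def)

lemma type_ring_sel [simp]:
 "monoid.mult ring_of_type_algebra = ((*) :: 'a::comm_ring_1 => _)" "monoid.one ring_of_type_algebra = (1 :: 'a)"
 "carrier ring_of_type_algebra = (UNIV :: 'a set)" "ring.zero ring_of_type_algebra = (0 :: 'a)"
 "ring.add ring_of_type_algebra = ((+) :: 'a => _)" by(simp_all add: ring_of_type_algebra_def)

lemma a_inv_type: "\<ominus>\<^bsub>ring_of_type_algebra\<^esub> x = - (x :: 'a::comm_ring_1)"
proof -
 interpret cring "ring_on (UNIV :: 'a set)" by(rule cring_ring_on[OF subring_UNIV])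
 show ?thesis using minus_equality[of "- x" x] by(simp add: ring_on_UNIV)
qed

lemma generate_ring_subring: "is_subring (generate_ring ring_of_type_algebra (Y :: 'a::comm_ring_1 set))" unfolding is_subring_def
proof(intro conjI ballI)
 let ?R = "generate_ring ring_of_type_algebra Y"
 show "1 : ?R" using generate_ring.one[of ring_of_type_algebra Y] by simp
 fix x y assume "x : ?R" "y : ?R"
 thus "x * y : ?R" "x - y : ?R" using generate_ring.eng_mult[of x ring_of_type_algebra Y y] generate_ring.a_inv[of y ring_of_type_algebra Y]
   generate_ring.eng_add[of x ring_of_type_algebra Y "- y"] by(simp_all add: a_inv_type)
qed

lemma generate_ring_least: assumes "is_subring A" "Y <= A" shows "generate_ring ring_of_type_algebra (Y :: 'a::comm_ring_1 set) <= A"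
proof
 fix x assume "x : generate_ring ring_of_type_algebra Y"
 thus "x : A" by induction (use assms in \<open>auto simp: a_inv_type intro: subring_intros\<close>)
qed

lemma generate_ring_superset: "Y <= generate_ring ring_of_type_algebra Y" by(auto intro: generate_ring.incl)

lemma adjoin_eq_adjoins: assumes "is_subring A" shows "adjoin A (set ys) = adjoins A ys" unfolding adjoin_def
proof
 show "generate_ring ring_of_type_algebra (A Un set ys) <= adjoins A ys" using adjoins_superset[OF assms] adjoins_generators[OF assms]
  by(intro generate_ring_least adjoins_subring assms) blast
 show "adjoins A ys <= generate_ring ring_of_type_algebra (A Un set ys)"
  using generate_ring_superset[of "A Un set ys"] by(intro adjoins_least generate_ring_subring) blast+
qed

lemma lookup_map_key: "inj f ==> lookup (Poly_Mapping.map_key f p) x = lookup p (f x)" by(simp add: Poly_Mapping.map_key.rep_eq)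

lemma map_key_bij: "bij p ==> Poly_Mapping.map_key p t = pm (lookup t \<circ> p)" by(rule poly_mapping_eqI) (simp add: lookup_map_key bij_is_inj)

lemma lookup_permute_vars: assumes p: "bij p" shows "lookup (permute_vars p f) t = lookup f (pm (lookup t \<circ> p))"
proof -
 have "inj (Poly_Mapping.map_key p :: 'a mon => _)"
 proof(rule injI)
  fix s t :: "'a mon" assume h: "Poly_Mapping.map_key p s = Poly_Mapping.map_key p t"
  show "s = t"
  proof(rule poly_mapping_eqI)
   fix i
   have "lookup s (p (inv_into UNIV p i)) = lookup t (p (inv_into UNIV p i))"
    using arg_cong[OF h, of "%u. lookup u (inv_into UNIV p i)"] p by(simp add: lookup_map_key bij_is_inj)
   thus "lookup s i = lookup t i" using p by(simp add: bij_is_surj surj_f_inv_f)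
  qed
 qed
 thus ?thesis unfolding permute_vars_def by(simp add: lookup_map_key map_key_bij[OF p])
qed

lemma pm_comp_inv: "bij p ==> pm (lookup (pm (lookup t \<circ> inv_into UNIV p)) \<circ> p) = t" "bij p ==> pm (lookup (pm (lookup t \<circ> p)) \<circ> inv_into UNIV p) = t"
 by(auto simp: comp_def bij_is_inj bij_is_surj surj_f_inv_f)

lemma permute_vars_inverse: assumes "bij (p :: 'n::finite => 'n)" shows "permute_vars p (permute_vars (inv_into UNIV p) f) = f"
 by(intro poly_mapping_eqI)
  (simp only: lookup_permute_vars[OF assms] lookup_permute_vars[OF bij_imp_bij_inv[OF assms]] pm_comp_inv[OF assms])

lemma permute_vars_monom:
 assumes "bij p" shows "permute_vars (inv_into UNIV p) (monom_of t) = (monom_of (pm (lookup t \<circ> p)) :: ('n::finite, 'k::comm_ring_1) mpoly)"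
proof(rule poly_mapping_eqI)
 fix u
 have "t = pm (lookup u \<circ> inv_into UNIV p) \<longleftrightarrow> pm (lookup t \<circ> p) = u" using pm_comp_inv[OF assms] by metis
 thus "lookup (permute_vars (inv_into UNIV p) (monom_of t)) u = lookup (monom_of (pm (lookup t \<circ> p)) :: ('n, 'k) mpoly) u"
  by(simp add: lookup_permute_vars[OF bij_imp_bij_inv[OF assms]] monom_of_def lookup_single when_def)
qed

lemma sss_sum_keys: "f = (SUM t:keys f. single 0 (lookup f t) * monom_of t)" by(simp add: monom_of_def mult_single sum_single_lookup)

lemma monomial_ideal_imp: "monomial_ideal J ==> is_ideal UNIV J"
 by(auto simp: monomial_ideal_def genideal_ring_on[OF subring_UNIV] ideal_gen_ideal[OF subring_UNIV] simp flip: ring_on_UNIV)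

text \<open>Partitions increase along the variables while \<open>sorts\<close> lists exponents in
  decreasing order; the two are matched by a numbering that reverses the order.\<close>

lemma antimono_rank: "EX r. bij_betw r (UNIV :: 'n::{finite, linorder} set) {..<CARD('n)} & (ALL x y. x <= y --> r y <= r x)"
proof(intro exI conjI allI impI)
 let ?r = "%x :: 'n. card {y. x < y}"
 have lt: "?r y < ?r x" if "x < y" for x y using that by(intro psubset_card_mono) auto
 have "inj ?r"
 proof(rule injI)
  fix x y assume "?r x = ?r y"
  thus "x = y" using lt[of x y] lt[of y x] by(cases x y rule: linorder_cases) auto
 qed
 moreover have "?r x < CARD('n)" for x by(rule psubset_card_mono) auto
 hence "?r ` UNIV <= {..<CARD('n)}" by blast
 moreover have "card (?r ` UNIV) = CARD('n)" using \<open>inj ?r\<close> by(rule card_image)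
 ultimately show "bij_betw ?r UNIV {..<CARD('n)}" unfolding bij_betw_def by(simp add: card_subset_eq)
 fix x y :: 'n assume "x <= y"
 thus "?r y <= ?r x" using lt[of x y] by(cases "x = y") (auto simp only: order.order_iff_strict)
qed

text \<open>The defining condition speaks of partitions. A permutation sorts \<open>v\<close> into
  one, the shift is made there, and the inverse permutation carries it back.\<close>

lemma sss_exchange: assumes J: "symmetric_strongly_shifted (J :: ('n::{finite, linorder}, 'k::comm_ring_1) mpoly set)"
  and v: "monom_of v : J" and ij: "lookup v i < lookup v j" and u: "u + unit_exp j = v + unit_exp i" shows "monom_of u : J"
proof -
 have perm: "monom_of (pm (lookup t \<circ> p)) : J" if "monom_of t : J" "bij p" for t p
 proof -
  have "permute_vars (inv_into UNIV p) ` J = J"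
   using J bij_imp_bij_inv[OF that(2)] unfolding symmetric_strongly_shifted_def symmetric_fixed_def by blast
  thus ?thesis using that(1) permute_vars_monom[OF that(2), of t] by(metis image_eqI)
 qed
 obtain e where e: "sorts e (lookup v)" using sorts_exists by blast
 obtain r where r: "bij_betw r (UNIV :: 'n set) {..<CARD('n)}" "!!x y. x <= y ==> r y <= r x" using antimono_rank by blast
 define q where "q = e \<circ> r"
 have q: "bij q" unfolding q_def using e by(intro bij_betw_trans[OF r(1)]) (simp add: sorts_def)
 let ?w = "pm (lookup v \<circ> q)" and ?i = "inv_into UNIV q i" and ?j = "inv_into UNIV q j"
 have lw: "lookup ?w ?i = lookup v i" "lookup ?w ?j = lookup v j" using q by(simp_all add: bij_is_surj surj_f_inv_f)
 have mono: "mono (lookup ?w)"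
 proof(rule monoI)
  fix x y :: 'n assume "x <= y"
  hence "r y <= r x" "r x < CARD('n)" using r unfolding bij_betw_def by auto
  thus "lookup ?w x <= lookup ?w y" using e by(simp add: sorts_def q_def)
 qed
 hence "?i < ?j" using lw ij by(metis linorder_not_less monoD)
 moreover have "?w : ideal_partitions J" using mono perm[OF v q] by(simp add: ideal_partitions_def partitions_def)
 ultimately have "monom_of (?w + unit_exp ?i - unit_exp ?j) : J" using J ij unfolding symmetric_strongly_shifted_def by(metis lw)
 hence "monom_of (pm (lookup (?w + unit_exp ?i - unit_exp ?j) \<circ> inv_into UNIV q)) : J" by(rule perm) (rule bij_imp_bij_inv[OF q])
 moreover have "pm (lookup (?w + unit_exp ?i - unit_exp ?j) \<circ> inv_into UNIV q) = u"
 proof(rule poly_mapping_eqI)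
  fix x
  have "?i = inv_into UNIV q x \<longleftrightarrow> i = x" "?j = inv_into UNIV q x \<longleftrightarrow> j = x"
   using q by(metis bij_is_surj surj_f_inv_f)+
  thus "lookup (pm (lookup (?w + unit_exp ?i - unit_exp ?j) \<circ> inv_into UNIV q)) x = lookup u x" using q arg_cong[OF u, of "%u. lookup u x"]
   by(simp add: lookup_minus lookup_add lookup_single when_def bij_is_surj surj_f_inv_f split: if_splits)
 qed
 ultimately show ?thesis by simp
qed

context borel_generator
begin

text \<open>The ideal generated by the monomials of \<open>G\<close>, described through the terms of
  its elements so that membership of a monomial can be read off.\<close>

definition up :: "('n, 'k::field) mpoly set" where
 "up = {f. ALL t:keys f. EX g:G. EX u. t = g + u}"

lemma monom_in_up: "(monom_of t :: ('n, 'k::field) mpoly) : up \<longleftrightarrow> (EX g:G. EX u. t = g + u)" by(simp add: up_def monom_of_def)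

lemma G_in_up: "g : G ==> (monom_of g :: ('n, 'k::field) mpoly) : up" unfolding monom_in_up by(intro bexI[of _ g] exI[of _ 0]) simp_all

lemma up_ideal: "is_ideal UNIV (up :: ('n, 'k::field) mpoly set)" unfolding is_ideal_def
proof(intro conjI ballI)
 fix f g :: "('n, 'k) mpoly" assume "f : up" "g : up"
 thus "f + g : up" using Poly_Mapping.keys_add[of f g] unfolding up_def by blast
next
 fix a f :: "('n, 'k) mpoly" assume f: "f : up"
 have "EX g:G. EX u. t = g + u" if t: "t : keys (a * f)" for t
 proof -
  obtain s v where s: "v : keys f" "t = s + v" using t keys_mult[of a f] by blast
  then obtain g u where "g : G" "v = g + u" using f unfolding up_def by blast
  thus ?thesis using s(2) by(intro bexI[of _ g] exI[of _ "s + u"]) (simp_all add: ac_simps)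
 qed
 thus "a * f : up" by(simp add: up_def)
qed (auto simp: up_def)

lemma up_least: assumes J: "is_ideal UNIV (J :: ('n, 'k::field) mpoly set)" and G: "monom_of ` G <= J" shows "up <= J"
proof
 fix f :: "('n, 'k) mpoly" assume f: "f : up"
 have "single 0 (lookup f t) * monom_of t : J" if "t : keys f" for t
 proof -
  obtain g u where g: "g : G" "t = u + g" using f \<open>t : keys f\<close> by(fastforce simp: up_def add.commute)
  have "monom_of u * monom_of g : J" using ideal_mult[OF J] G g(1) by blast
  hence "monom_of t : J" by(simp add: g(2) monom_of_def mult_single)
  thus ?thesis using ideal_mult[OF J] by blast
 qed
 thus "f : J" by(subst sss_sum_keys) (rule ideal_sum[OF J])
qed

lemma up_sss: "symmetric_strongly_shifted (up :: ('n, 'k::field) mpoly set)" unfolding symmetric_strongly_shifted_def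
proof(intro conjI ballI allI impI)
 have "(monom_of ` G :: ('n, 'k) mpoly set) <= up" using G_in_up by blast
 hence "up = ideal_gen UNIV (monom_of ` G :: ('n, 'k) mpoly set)"
  using up_least[OF ideal_gen_ideal[OF subring_UNIV subset_UNIV] ideal_gen_superset] ideal_gen_minimal[OF up_ideal] by blast
 thus "monomial_ideal (up :: ('n, 'k) mpoly set)"
  unfolding monomial_ideal_def by(auto simp: genideal_ring_on[OF subring_UNIV] simp flip: ring_on_UNIV)
 have perm: "permute_vars p f : up" if p: "bij p" and f: "f : up" for p and f :: "('n, 'k) mpoly" unfolding up_def
 proof(intro CollectI ballI)
  fix t assume "t : keys (permute_vars p f)"
  hence "pm (lookup t \<circ> p) : keys f" by(simp add: in_keys_iff lookup_permute_vars[OF p])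
  then obtain g u where g: "g : G" "pm (lookup t \<circ> p) = g + u" using f by(auto simp: up_def)
  have "t = pm (lookup (pm (lookup t \<circ> p)) \<circ> inv_into UNIV p)" by(simp only: pm_comp_inv[OF p])
  also have "... = pm (lookup g \<circ> inv_into UNIV p) + pm (lookup u \<circ> inv_into UNIV p)"
   unfolding g(2) by(rule poly_mapping_eqI) (simp add: lookup_add)
  finally show "EX g:G. EX u. t = g + u" using permute_in_G[OF g(1) bij_imp_bij_inv[OF p]] by blast
 qed
 show "symmetric_fixed (up :: ('n, 'k) mpoly set)" unfolding symmetric_fixed_def
 proof(intro allI impI equalityI subsetI)
  fix p :: "'n => 'n" and f :: "('n, 'k) mpoly" assume p: "bij p" "f : up"
  hence "f = permute_vars p (permute_vars (inv_into UNIV p) f)" by(simp add: permute_vars_inverse)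
  thus "f : permute_vars p ` up" using perm[OF bij_imp_bij_inv[OF p(1)] p(2)] by(rule image_eqI)
 qed (auto intro: perm)
 fix w :: "'n mon" and i j
 assume w: "w : ideal_partitions (up :: ('n, 'k) mpoly set)" and ij: "i < j & lookup w i < lookup w j"
 then obtain g u where g: "g : G" "w = g + u" by(auto simp: ideal_partitions_def monom_in_up)
 show "(monom_of (w + unit_exp i - unit_exp j) :: ('n, 'k) mpoly) : up"
 \<comment> \<open>If the cofactor \<open>u\<close> contains the variable \<open>j\<close>, the
   shift is made in \<open>u\<close>. Otherwise the exponents at \<open>i\<close> and
   \<open>j\<close> compare in \<open>g\<close> as they do in \<open>w\<close>, and the shift is an
   exchange inside \<open>G\<close>.\<close>
 proof(cases "lookup u j = 0")
  case True
  have lt: "lookup g i < lookup g j" using ij True by(simp add: g(2) lookup_add)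
  let ?v = "g + unit_exp i - unit_exp j"
  have "?v + unit_exp j = g + unit_exp i" using lt by(intro poly_mapping_eqI) (auto simp: lookup_add lookup_minus lookup_single when_def)
  hence "?v : G" by(rule exchange_in_G[OF g(1) lt])
  moreover have "w + unit_exp i - unit_exp j = ?v + u"
   using True lt by(intro poly_mapping_eqI) (auto simp: g(2) lookup_add lookup_minus lookup_single when_def)
  ultimately show ?thesis unfolding monom_in_up by blast
 next
  case False
  hence "w + unit_exp i - unit_exp j = g + (u + unit_exp i - unit_exp j)"
   by(intro poly_mapping_eqI) (auto simp: g(2) lookup_add lookup_minus lookup_single when_def)
  thus ?thesis using g(1) unfolding monom_in_up by blast
 qed
qed

text \<open>For minimality, \<open>G_reachable\<close> is applied to the exponents of the monomials
  in an arbitrary competitor \<open>J\<close>.\<close>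

lemma Sss_eq_up: "Sss {lam} = (up :: ('n, 'k::field) mpoly set)" unfolding Sss_def
proof(intro equalityI Inter_lower Inter_greatest)
 have "monom_of lam : (up :: ('n, 'k) mpoly set)" by(rule G_in_up[OF lam_in_G])
 thus "up : {J. symmetric_strongly_shifted J & (monom_of ` {lam} :: ('n, 'k) mpoly set) <= J}" using up_sss by blast
 fix J :: "('n, 'k) mpoly set" assume "J : {J. symmetric_strongly_shifted J & monom_of ` {lam} <= J}"
 hence J: "symmetric_strongly_shifted J" "monom_of lam : J" by auto
 have "w : {v. (monom_of v :: ('n, 'k) mpoly) : J}" if "w : G" for w
 proof(rule G_reachable[OF _ _ _ that])
  show "pm (lookup v \<circ> p) : {v. (monom_of v :: ('n, 'k) mpoly) : J}" if "v : {v. (monom_of v :: ('n, 'k) mpoly) : J}" "bij p" for v p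
  proof -
   have "permute_vars (inv_into UNIV p) ` J = J"
    using J(1) bij_imp_bij_inv[OF \<open>bij p\<close>] unfolding symmetric_strongly_shifted_def symmetric_fixed_def by blast
   thus ?thesis using that permute_vars_monom[OF \<open>bij p\<close>, of v, where 'k = 'k] by(metis image_eqI mem_Collect_eq)
  qed
 qed (use J sss_exchange[OF J(1)] in blast)+
 thus "up <= J" using J(1) by(intro up_least monomial_ideal_imp) (auto simp: symmetric_strongly_shifted_def)
qed

lemma min_gens_up: "min_gens (up :: ('n, 'k::field) mpoly set) = G"
proof(intro equalityI subsetI)
 fix w assume w: "w : min_gens (up :: ('n, 'k) mpoly set)"
 then obtain g u where g: "g : G" "w = g + u" by(auto simp: min_gens_def monom_in_up)
 have "(monom_of g :: ('n, 'k) mpoly) : up" by(rule G_in_up[OF g(1)])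
 moreover have "(monom_of w :: ('n, 'k) mpoly) = monom_of g * monom_of u" by(simp add: g(2) monom_of_def mult_single)
 ultimately have "g = w" using w by(auto simp: min_gens_def)
 thus "w : G" using g(1) by simp
next
 fix g assume g: "g : G"
 have "v = g" if v: "(monom_of v :: ('n, 'k) mpoly) : up" "(monom_of v :: ('n, 'k) mpoly) dvd monom_of g" for v
 proof -
  obtain h where h: "(monom_of g :: ('n, 'k) mpoly) = monom_of v * h" using v(2) by(elim dvdE)
  have "g : keys (monom_of g :: ('n, 'k) mpoly)" by(simp add: monom_of_def)
  then obtain t where t: "g = v + t" unfolding h using keys_mult[of "monom_of v" h] by(auto simp: monom_of_def)
  obtain g' u where "g' : G" "v = g' + u" using v(1) by(auto simp: monom_in_up)
  hence "esize t = 0" using g t by(auto simp: G_def esize_add)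
  thus ?thesis using t by(simp add: esize_eq_0_iff)
 qed
 thus "g : min_gens (up :: ('n, 'k) mpoly set)" using G_in_up[OF g] by(auto simp: min_gens_def)
qed

lemma S_zero: "0 : S" and S_plus: "s : S ==> t : S ==> s + t : S"
proof -
 show "0 : S" unfolding S_def by(intro CollectI exI[of _ 0]) simp
 assume "s : S" "t : S"
 then obtain d d' where "esize s = D * d" "esize t = D * d'" "!!T. sum (lookup s) T <= d * rk (card T)"
  "!!T. sum (lookup t) T <= d' * rk (card T)" by(auto simp: S_def)
 thus "s + t : S" unfolding S_def
  by(intro CollectI exI[of _ "d + d'"]) (auto simp: esize_add lookup_add sum.distrib distrib_left distrib_right intro!: add_mono)
qed

lemma G_sub_S: "G <= S" unfolding G_def S_def by(auto intro: exI[of _ 1])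

lemma finite_gens: "finite G" by(rule finite_subset[OF _ finite_esize_le[of D]]) (auto simp: G_def)

lemma sum_closed: "(!!k. k : A ==> f k : S) ==> sum f A : S" by(induction A rule: infinite_finite_induct) (auto simp: S_zero S_plus)

text \<open>The facet inequalities of the cone over the base polytope, multiplied by
  \<open>D\<close> so that the dilation factor, the degree over \<open>D\<close>, involves no
  division.\<close>

definition L :: "('n mon => int) set" where
 "L = range (%i w. int (lookup w i)) Un
   range (%T w. int (esize w * rk (card T)) - int (D * sum (lookup w) T))"

lemma in_S_iff: "w : S \<longleftrightarrow> D dvd esize w & (ALL T. D * sum (lookup w) T <= esize w * rk (card T))"
 using D_pos by(auto simp: S_def dvd_def mult.assoc)

text \<open>Divisibility of the degree by \<open>D\<close> is not expressed by \<open>L\<close>, but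
  it passes to differences, which gives saturation. A generator is split off by cutting
  \<open>s\<close> into \<open>d\<close> pieces: one piece is the generator and the sum of the
  others stays in \<open>S\<close>.\<close>

sublocale normal_affine_monoid S L G
proof
 show "finite L" by(simp add: L_def)
 show "ph (a + b) = ph a + ph b" if "ph : L" for ph a b using that by(auto simp: L_def lookup_add esize_add sum.distrib algebra_simps)
 show "ph s >= 0" if "ph : L" "s : S" for ph s
 proof -
  have "int (D * sum (lookup s) T) <= int (esize s * rk (card T))" for T using that(2) unfolding in_S_iff by(simp only: zle_int)
  thus ?thesis using that(1) by(auto simp: L_def)
 qed
 show "(%w. int (lookup w i)) : L" for i by(simp add: L_def)
 show "0 : S" by(rule S_zero)
 show "s + t : S" if "s : S" "t : S" for s t using that by(rule S_plus)
 show "EX c:S. a = b + c" if a: "a : S" and b: "b : S" and le: "!!ph. ph : L ==> ph b <= ph a" for a b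
 proof -
  have co: "int (lookup b i) <= int (lookup a i)" for i using le[of "%w. int (lookup w i)"] by(auto simp: L_def)
  hence ab: "a = b + (a - b)" by(intro poly_mapping_eqI) (simp add: lookup_add lookup_minus)
  have e: "esize a = esize b + esize (a - b)" using arg_cong[OF ab, of esize] by(simp add: esize_add)
  have s: "sum (lookup a) T = sum (lookup b) T + sum (lookup (a - b)) T" for T
   using arg_cong[OF ab, of "%w. sum (lookup w) T"] by(simp add: lookup_add sum.distrib)
  have "D * sum (lookup (a - b)) T <= esize (a - b) * rk (card T)" for T
  proof -
   have "int (esize b * rk (card T)) - int (D * sum (lookup b) T) <= int (esize a * rk (card T)) - int (D * sum (lookup a) T)"
    by(rule le[of "%w. int (esize w * rk (card T)) - int (D * sum (lookup w) T)"]) (simp add: L_def)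
   hence "int (D * sum (lookup (a - b)) T) <= int (esize (a - b) * rk (card T))" unfolding e s by(simp add: algebra_simps)
   thus ?thesis by(simp only: zle_int)
  qed
  moreover have "D dvd esize (a - b)" using a b e unfolding in_S_iff by(metis dvd_add_right_iff)
  ultimately show ?thesis using ab by(intro bexI[of _ "a - b"]) (simp_all add: in_S_iff)
 qed
 show "finite G" by(rule finite_gens)
 show "G <= S" by(rule G_sub_S)
 show "EX g:G. EX t:S. g ~= 0 & s = g + t" if s: "s : S" "s ~= 0" for s
 proof -
  obtain d where d: "esize s = D * d" "!!T. sum (lookup s) T <= d * rk (card T)" using s(1) by(auto simp: S_def)
  hence "d > 0" using s(2) by(metis esize_eq_0_iff gr0I mult_0_right)
  obtain e where e: "sorts e (lookup s)" using sorts_exists by blast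
  let ?g = "%k. pm (piece (lookup s) e d k)"
  have g: "?g k : G" if "k < d" for k by(rule piece_in_G[OF d e that])
  obtain d' where d': "d = Suc d'" using \<open>d > 0\<close> by(cases d) auto
  have "(SUM k:{..<d'}. ?g (Suc k)) : S"
  proof(rule sum_closed)
   show "?g (Suc k) : S" if "k : {..<d'}" for k using g[of "Suc k"] that G_sub_S d' by auto
  qed
  moreover have "s = ?g 0 + (SUM k:{..<d'}. ?g (Suc k))" by(subst sum_pieces[OF e \<open>d > 0\<close>]) (simp only: d' sum.lessThan_Suc_shift)
  moreover have "?g 0 ~= 0" using g[OF \<open>d > 0\<close>] D_pos by(auto simp: G_def)
  ultimately show ?thesis using g[OF \<open>d > 0\<close>] by blast
 qed
qed

lemma toric_ring_up: "toric_ring (up :: ('n, 'k::field) mpoly set) = monoid_ring S"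
proof -
 obtain gl :: "('n, 'k) mpoly list" where gl: "set gl = (%g. single g 1) ` G" using finite_list[of "(%g. single g 1) ` G"] finite_G by blast
 have m: "monom_of ` G = set gl" unfolding gl by(simp add: monom_of_def)
 have "range const_of = (scalars :: ('n, 'k) mpoly set)" unfolding scalars_def by(simp add: const_of_def)
 thus ?thesis unfolding toric_ring_def min_gens_up m ring_generated[OF gl] adjoin_eq_adjoins[OF scalars_subring, symmetric] by simp
qed

end

section \<open>Symmetric exchange relations\<close>

lemma single_prod: "(\<Prod>m\<in>A. single (f m) (1::'k::comm_ring_1)) = single (SUM m:A. f m) 1"
 by(induction A rule: infinite_finite_induct) (auto simp: mult_single)

lemma nscale_unit: "nscale q (unit_exp m) = single m q" by(rule poly_mapping_eqI) (simp add: lookup_single when_def)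

lemma lin_ext_mult:
 fixes f g :: "'a::comm_monoid_add \<Rightarrow>\<^sub>0 'k::comm_ring_1" and h :: "'a => 'k => 'b::comm_ring_1"
 assumes h0: "!!t. h t 0 = 0" and ha: "!!t a b. h t (a + b) = h t a + h t b" and hm: "!!s t a b. h (s + t) (a * b) = h s a * h t b"
 shows "lin_ext h (f * g) = lin_ext h f * lin_ext h g"
proof -
 have "lin_ext h (f * g) = lin_ext h ((SUM s:keys f. single s (lookup f s)) * (SUM t:keys g. single t (lookup g t)))" by(simp only: sum_single_lookup)
 also have "... = lin_ext h (SUM s:keys f. SUM t:keys g. single (s + t) (lookup f s * lookup g t))" by(simp add: sum_product mult_single)
 also have "... = (SUM s:keys f. SUM t:keys g. h s (lookup f s) * h t (lookup g t))"
  using lin_ext_add[of h, OF h0 ha] by(simp add: additive_sum[of "lin_ext h"] lin_ext_single[of h, OF h0] hm)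
 finally show ?thesis by(simp add: lin_ext_def sum_product)
qed

lemma sum_two:
 fixes g :: "nat => 'b::comm_monoid_add" assumes "a < d" "b < d" "a ~= b" shows "(SUM k<d. g k) = g a + g b + (SUM k:{..<d}-{a, b}. g k)"
proof -
 have "{..<d} = insert a (insert b ({..<d}-{a, b}))" using assms by auto
 thus ?thesis using assms(3) by(metis (no_types, lifting) Diff_iff add.assoc finite.insertI finite_Diff finite_lessThan insertCI insertE sum.insert)
qed

lemma square_balance:
 fixes p q p' q' :: nat assumes p: "p' + 1 = p" and q: "q' = q + 1" and "q < p"
 shows "p'^2 + q'^2 <= p^2 + q^2" "q + 2 <= p ==> p'^2 + q'^2 < p^2 + q^2"
proof -
 obtain x where x: "p' = q + x" using assms by(metis Suc_eq_plus1 less_Suc_eq_le le_Suc_ex)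
 show "p'^2 + q'^2 <= p^2 + q^2" by(simp add: p[symmetric] q x power2_eq_square algebra_simps)
 assume "q + 2 <= p"
 thus "p'^2 + q'^2 < p^2 + q^2" using x p by(simp add: p[symmetric] q power2_eq_square algebra_simps)
qed

lemma square_unbalance:
 fixes p q p' q' :: nat assumes "p' + q' = p + q" "q < q'" "p <= q" shows "p^2 + q^2 < p'^2 + q'^2"
proof -
 obtain l where l: "q' = q + l" "l > 0" using assms(2) by(metis less_imp_add_positive)
 obtain z where z: "q = p' + l + z" using assms l by(metis add.assoc add.commute add_right_cancel le_Suc_ex)
 have "p = p' + l" using assms(1) l(1) by linarith
 thus ?thesis using l(2) by(simp add: l(1) z power2_eq_square algebra_simps)
qed

text \<open>From position \<open>k\<close> on the entries are at least \<open>b k\<close>, and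
  before it at least \<open>b k - 1\<close>, with the matching bounds from above; so the sum
  determines the sequence. Applied to prefix sums this recognises the canonical
  factorization.\<close>

lemma balanced_division:
 fixes b :: "nat => nat" assumes mono: "!!i j. i <= j ==> j < d ==> b i <= b j" and le: "!!i j. i < d ==> j < d ==> b i <= b j + 1" and k: "k < d"
 shows "b k = ((SUM i<d. b i) + k) div d"
proof -
 let ?W = "SUM i<d. b i"
 have count: "(SUM i<d. v + (if k <= i then 1 else 0)) = d * v + (d - k)" "(SUM i<d. v + (if k < i then 1 else 0)) = d * v + (d - Suc k)" for v
 proof -
  have "{i\<in>{..<d}. k <= i} = {k..<d}" "{i\<in>{..<d}. k < i} = {Suc k..<d}" by auto
  thus "(SUM i<d. v + (if k <= i then 1 else 0)) = d * v + (d - k)" "(SUM i<d. v + (if k < i then 1 else 0)) = d * v + (d - Suc k)"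
   by(simp_all add: sum.distrib flip: sum.inter_filter)
 qed
 have "d * b k <= ?W + k"
 proof(cases "b k = 0")
  case False
  then obtain v where v: "b k = Suc v" using not0_implies_Suc by blast
  have "(SUM i<d. v + (if k <= i then 1 else 0)) <= ?W" using mono[of k] le[OF k] by(intro sum_mono) (auto simp: v)
  thus ?thesis using k by(simp add: count v)
 qed simp
 moreover have "?W <= (SUM i<d. b k + (if k < i then 1 else 0))" using mono[of _ k] le[of _ k] k by(intro sum_mono) auto
 hence "?W + k < d * Suc (b k)" using k by(simp add: count)
 ultimately show ?thesis by(metis div_nat_eqI mult.commute)
qed

text \<open>Here \<open>x\<close> is the last index before \<open>j\<close>, and
  \<open>Suc y\<close> the first one after it, at which \<open>u\<close> does not exceed
  \<open>v\<close>.\<close>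

lemma excursion:
 fixes u v :: "nat => nat" assumes j: "v j < u j" "j <= n" and ends: "u 0 <= v 0" "u n <= v n"
 obtains x y where "x < j" "j <= y" "y < n" "u x <= v x" "u (Suc y) <= v (Suc y)" "!!k. x < k ==> k <= y ==> v k < u k"
proof -
 define x where "x = Max {k. k < j & u k <= v k}"
 define z where "z = (LEAST k. j <= k & u k <= v k)"
 have fin: "finite {k. k < j & u k <= v k}" by simp
 have "0 < j" using j(1) ends(1) by(cases j) auto
 hence "{k. k < j & u k <= v k} ~= {}" using ends(1) by blast
 hence x: "x < j" "u x <= v x" using Max_in[OF fin] unfolding x_def by blast+
 have x2: "v k < u k" if "x < k" "k < j" for k using Max_ge[OF fin, of k] that unfolding x_def[symmetric] by force
 have z: "j <= z" "u z <= v z" using LeastI[of "%k. j <= k & u k <= v k" n] j(2) ends(2) unfolding z_def by blast+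
 have z2: "v k < u k" if "j <= k" "k < z" for k using not_less_Least[OF that(2)[unfolded z_def]] that(1) by(simp add: not_le)
 have "z <= n" unfolding z_def by(rule Least_le) (use j(2) ends(2) in simp)
 moreover obtain y where y: "z = Suc y" using z j(1) by(cases z) auto
 moreover have "j ~= z" using z(2) j(1) by auto
 ultimately show ?thesis using x z x2 z2 that[of x y] by(metis Suc_leI Suc_le_lessD less_Suc_eq_le linorder_le_less_linear nat_less_le)
qed

context borel_generator
begin

lemma rk_submodular:
 "rk (card (A Un B)) + rk (card (A Int B)) <= rk (card A) + rk (card (B :: 'n set))"
proof -
 have conc: "rk (a + x + y) + rk a <= rk (a + x) + rk (a + y)" for a x y
 proof(induction y)
  case (Suc y)
  thus ?case using lam_seq_antimono[of "a + y" "a + x + y"] by(simp add: rk_Suc)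
 qed simp
 have "card A = card (A Int B) + card (A - B)" "card B = card (A Int B) + card (B - A)"
  using card_Int_Diff[of A B] card_Int_Diff[of B A] by(simp_all add: Int_commute)
 moreover have "card (A Un B) = card A + card (B - A)" by(subst card_Un_disjoint[symmetric]) (auto intro: arg_cong[where f = card])
 ultimately show ?thesis using conc[of "card (A Int B)" "card (A - B)" "card (B - A)"] by simp
qed

lemma G_leI: "w : G ==> sum (lookup w) T <= rk (card T)" by(simp add: G_def)

lemma move_in_G: assumes r: "r : G" and v: "v + unit_exp i = r + unit_exp j" and slack: "!!T. j : T ==> i ~: T ==> sum (lookup r) T < rk (card T)"
 shows "v : G"
proof -
 have "sum (lookup v) T <= rk (card T)" for T using move_sum[OF v, of T] slack[of T] G_leI[OF r, of T] by(auto split: if_splits)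
 moreover have "esize v = D" using move_sum[OF v, of UNIV] r by(simp add: G_def esize_def)
 ultimately show ?thesis by(simp add: G_def)
qed

text \<open>Uncrossing: submodularity of the bound leaves no slack at the union and the intersection
  of two tight sets.\<close>

lemma tight_Un_Int: assumes r: "r : G" and "sum (lookup r) A = rk (card A)" "sum (lookup r) B = rk (card B)"
 shows "sum (lookup r) (A Un B) = rk (card (A Un B))" "sum (lookup r) (A Int B) = rk (card (A Int B))"
 using assms(2,3) rk_submodular[of A B] sum.union_inter[of A B "lookup r"] G_leI[OF r, of "A Un B"] G_leI[OF r, of "A Int B"] by simp_all

text \<open>The elements of \<open>G\<close> are the integer points of a base polytope, which is M-convex.\<close>

lemma simultaneous_exchange: assumes r: "r : G" and s: "s : G" and i: "lookup s i < lookup r i"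
 obtains j where "lookup r j < lookup s j"
  "!!v. v + unit_exp i = r + unit_exp j ==> v : G" "!!v. v + unit_exp j = s + unit_exp i ==> v : G"
proof -
 \<comment> \<open>The sets that can block an exchange: tight sets of \<open>s\<close> containing
   \<open>i\<close> and tight sets of \<open>r\<close> avoiding it. By uncrossing there are a least
   \<open>A\<close> and a greatest \<open>Z\<close>, and a variable in \<open>A - Z\<close> is
   blocked by none of them.\<close>
 let ?A = "%T. i : T & sum (lookup s) T = rk (card T)" and ?Z = "%T. i ~: T & sum (lookup r) T = rk (card T)"
 have "?A UNIV" using s by(simp add: G_def esize_def rk_card)
 then obtain A where A: "?A A" "!!T. ?A T ==> card A <= card T" using ex_has_least_nat[of ?A UNIV card] by blast
 have Amin: "A <= T" if "?A T" for T
 proof -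
  have "?A (A Int T)" using tight_Un_Int(2)[OF s, of A T] A(1) that by simp
  hence "A Int T = A" using A(2) by(intro card_seteq) auto
  thus ?thesis by blast
 qed
 have "?Z {}" by simp
 then obtain Z where Z: "?Z Z" "!!T. ?Z T ==> card T <= card Z"
  using ex_has_greatest_nat[of ?Z "{}" card "Suc CARD('n)"] card_le by(auto simp: less_Suc_eq_le)
 have Zmax: "T <= Z" if "?Z T" for T
 proof -
  have "?Z (Z Un T)" using tight_Un_Int(1)[OF r, of Z T] Z(1) that by simp
  hence "Z = Z Un T" using Z(2) by(intro card_seteq) auto
  thus ?thesis by blast
 qed
 \<comment> \<open>Were \<open>s\<close> at most \<open>r\<close> throughout \<open>A - Z\<close>,
   with strict inequality at \<open>i\<close>, the tight sums would contradict submodularity at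
   \<open>A\<close> and \<open>Z\<close>.\<close>
 have "EX j:A - Z. lookup r j < lookup s j"
 proof(rule ccontr)
  assume "~ ?thesis"
  hence ge: "!!j. j : A - Z ==> lookup s j <= lookup r j" by force
  have "sum (lookup s) (A - Z) < sum (lookup r) (A - Z)" using ge i A(1) Z(1) by(intro sum_strict_mono_ex1) auto
  moreover have "sum (lookup r) (A Un Z) = sum (lookup r) Z + sum (lookup r) (A - Z)"
   by(subst sum.union_disjoint[symmetric]) (auto intro: sum.cong simp: Un_commute)
  moreover have "sum (lookup s) A = sum (lookup s) (A Int Z) + sum (lookup s) (A - Z)" by(rule sum.Int_Diff) simp
  ultimately show False using rk_submodular[of A Z] G_leI[OF r, of "A Un Z"] G_leI[OF s, of "A Int Z"] A(1) Z(1) by linarith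
 qed
 then obtain j where j: "j : A" "j ~: Z" "lookup r j < lookup s j" by blast
 show ?thesis
 proof(rule that[OF j(3)])
  show "v : G" if v: "v + unit_exp i = r + unit_exp j" for v using Zmax G_leI[OF r] j(2) by(intro move_in_G[OF r v]) (metis in_mono nat_less_le)
  show "v : G" if v: "v + unit_exp j = s + unit_exp i" for v using Amin G_leI[OF s] j(1) by(intro move_in_G[OF s v]) (metis in_mono nat_less_le)
 qed
qed

section \<open>The toric map and the ideal of exchange relations\<close>

definition toric_monomials :: "('n mon \<Rightarrow>\<^sub>0 nat) set" where
 "toric_monomials = {t. keys t <= G}"

definition expo :: "('n mon \<Rightarrow>\<^sub>0 nat) => 'n mon" where
 "expo = lin_ext (%m k. nscale k m)"

lemma expo_add: "expo (s + t) = expo s + expo t"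
 unfolding expo_def by(rule lin_ext_add) (auto intro!: poly_mapping_eqI simp: lookup_add algebra_simps)

lemma expo_unit: "expo (unit_exp m) = m" unfolding expo_def by(subst lin_ext_single) (auto intro!: poly_mapping_eqI)

lemma expo_0: "expo 0 = 0" by(simp add: expo_def lin_ext_def)

lemma expo_sum: "expo (SUM x:A. f x) = (SUM x:A. expo (f x))" by(induction A rule: infinite_finite_induct) (auto simp: expo_0 expo_add)

lemma toric_map_eq: "(toric_map f :: ('n, 'k::field) mpoly) = lin_ext (%t c. single (expo t) c) f" unfolding toric_map_def lin_ext_def expo_def
 by(simp add: monom_of_def const_of_def single_power single_prod mult_single)

lemma toric_map_add: "(toric_map (f + g) :: ('n, 'k::field) mpoly) = toric_map f + toric_map g"
 unfolding toric_map_eq by(rule lin_ext_add) (auto simp: single_add)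

lemma toric_map_single: "(toric_map (single t c) :: ('n, 'k::field) mpoly) = single (expo t) c" unfolding toric_map_eq by(rule lin_ext_single) simp


lemma toric_map_mult: "(toric_map (f * g) :: ('n, 'k::field) mpoly) = toric_map f * toric_map g"
 unfolding toric_map_eq by(rule lin_ext_mult) (auto simp: single_add mult_single expo_add)

lemma toric_monomials_subring: "is_subring (monoid_ring toric_monomials :: ('n mon, 'k::field) mpoly set)"
proof(rule monoid_ring_subring)
 show "s + t : toric_monomials" if "s : toric_monomials" "t : toric_monomials" for s t
  using that Poly_Mapping.keys_add[of s t] unfolding toric_monomials_def by blast
qed (simp add: toric_monomials_def)

lemma toric_poly_ring_up: "toric_poly_ring (up :: ('n, 'k::field) mpoly set) = ring_on (monoid_ring toric_monomials)"
proof -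
 let ?R = "monoid_ring toric_monomials :: ('n mon, 'k) mpoly set" and ?Q = "adjoin (range const_of) (T_var ` G) :: ('n mon, 'k) mpoly set"
 have Q: "is_subring ?Q" unfolding adjoin_def by(rule generate_ring_subring)
 have sup: "range const_of Un T_var ` G <= ?Q" unfolding adjoin_def by(rule generate_ring_superset)
 have "?Q <= ?R" unfolding adjoin_def by(rule generate_ring_least[OF toric_monomials_subring])
   (auto simp: const_of_def T_var_def monom_of_def toric_monomials_def intro!: single_in_monoid_ring)
 moreover have "?R <= ?Q"
 proof
  fix f assume f: "f : ?R"
  have "single t (lookup f t) : ?Q" if t: "t : keys f" for t
  proof -
   have "keys t <= G" using f t by(auto simp: monoid_ring_def toric_monomials_def)
   hence "const_of (lookup f t) * (\<Prod>m\<in>keys t. T_var m ^ lookup t m) : ?Q"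
    using sup by(intro subring_mult[OF Q] subring_prod[OF Q] subring_power[OF Q]) auto
   moreover have "const_of (lookup f t) * (\<Prod>m\<in>keys t. T_var m ^ lookup t m) = single t (lookup f t)"
    by(simp add: T_var_def monom_of_def const_of_def single_power nscale_unit[simplified] single_prod mult_single sum_single_lookup)
   ultimately show ?thesis by simp
  qed
  hence "(SUM t:keys f. single t (lookup f t)) : ?Q" by(intro subring_sum[OF Q])
  thus "f : ?Q" by(simp only: sum_single_lookup)
 qed
 ultimately show ?thesis by(simp add: toric_poly_ring_def min_gens_up)
qed

definition exchange_ideal :: "('n mon, 'k::field) mpoly set" where
 "exchange_ideal = ideal_gen (monoid_ring toric_monomials) (symmetric_exchange_relations (up :: ('n, 'k) mpoly set))"

lemma T_var_mult: "T_var r * T_var s = single (unit_exp r + unit_exp s) 1" by(simp add: T_var_def monom_of_def mult_single)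

lemma relation_in_kernel: assumes f: "f : symmetric_exchange_relations (up :: ('n, 'k::field) mpoly set)"
 shows "f : monoid_ring toric_monomials" "(toric_map f :: ('n, 'k) mpoly) = 0"
proof -
 obtain r s t w i j where h: "f = T_var r * T_var s - T_var t * T_var w" "{r, s, t, w} <= G"
  "t + unit_exp i = r + unit_exp j" "w + unit_exp j = s + unit_exp i" using f unfolding symmetric_exchange_relations_def min_gens_up by blast
 have "(t + w) + (unit_exp i + unit_exp j) = (t + unit_exp i) + (w + unit_exp j)" by(simp only: ac_simps)
 also have "... = (r + s) + (unit_exp i + unit_exp j)" unfolding h(3,4) by(simp only: ac_simps)
 finally have "t + w = r + s" by simp
 hence "toric_map (T_var r * T_var s) = (toric_map (T_var t * T_var w) :: ('n, 'k) mpoly)"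
  by(simp only: T_var_mult toric_map_single expo_add expo_unit)
 moreover have "toric_map f + toric_map (T_var t * T_var w) = (toric_map (T_var r * T_var s) :: ('n, 'k) mpoly)"
  by(simp add: h(1) flip: toric_map_add)
 ultimately show "(toric_map f :: ('n, 'k) mpoly) = 0" by simp
 have "T_var m : monoid_ring toric_monomials" if "m : G" for m
  using that unfolding T_var_def monom_of_def by(intro single_in_monoid_ring) (simp add: toric_monomials_def)
 thus "f : monoid_ring toric_monomials" unfolding h(1) using h(2)
  by(intro subring_diff[OF toric_monomials_subring] subring_mult[OF toric_monomials_subring]) auto
qed

lemma exchange_ideal: "is_ideal (monoid_ring toric_monomials) (exchange_ideal :: ('n mon, 'k::field) mpoly set)"
 unfolding exchange_ideal_def using relation_in_kernel by(intro ideal_gen_ideal[OF toric_monomials_subring]) blast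

lemma exchange_ideal_sub: "exchange_ideal <= {f : monoid_ring toric_monomials. (toric_map f :: ('n, 'k::field) mpoly) = 0}"
 unfolding exchange_ideal_def
proof(rule ideal_gen_minimal)
 show "is_ideal (monoid_ring toric_monomials) {f : monoid_ring toric_monomials. (toric_map f :: ('n, 'k) mpoly) = 0}"
  using toric_monomials_subring[where 'k = 'k] by(auto simp: is_ideal_def toric_map_add toric_map_mult toric_map_def[of 0] intro: subring_intros)
qed (use relation_in_kernel in blast)

text \<open>Congruence of two monomials modulo the exchange relations; the type argument fixes the
  coefficient field, which the exponents do not show.\<close>

definition linked :: "'k::field itself => ('n mon \<Rightarrow>\<^sub>0 nat) => ('n mon \<Rightarrow>\<^sub>0 nat) => bool" where
 "linked k s t \<longleftrightarrow> single s 1 - single t (1::'k) : exchange_ideal"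

lemma linked_trans: "linked k s t ==> linked k t u ==> linked k s u" unfolding linked_def using ideal_add[OF exchange_ideal] by fastforce

lemma linked_refl: "linked k t t" unfolding linked_def using ideal_0[OF exchange_ideal] by simp

lemma linked_sym: "linked k s t ==> linked k t s" unfolding linked_def using ideal_uminus[OF toric_monomials_subring exchange_ideal] by fastforce

end

section \<open>Moving factorizations to the canonical one\<close>

locale factorization = borel_generator lam for lam :: "'n::{finite, linorder} mon" +
 fixes w :: "'n mon" and d :: nat and e :: "nat => 'n" assumes e: "sorts e (lookup w)"
begin

definition factors :: "(nat => 'n mon) => bool" where
 "factors m \<longleftrightarrow> (ALL k<d. m k : G) & (SUM k<d. m k) = w"

definition tmon :: "(nat => 'n mon) => 'n mon \<Rightarrow>\<^sub>0 nat" where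
 "tmon m = (SUM k<d. unit_exp (m k))"

definition area :: "'n mon => nat" where "area v = (SUM j<=CARD('n). pre (lookup v) e j)"

text \<open>The three measures are compared lexicographically: \<open>m1\<close> falls until the
  exponents of any two factors differ by at most one, \<open>m2\<close> until the same holds for
  prefix sums, and \<open>m3\<close> until the factors are ordered consistently. \<open>m3\<close>
  subtracts a sum of squares, which is to grow, from a fixed bound; by \<open>area_sum\<close> the
  subtraction is not truncated for factorizations of \<open>w\<close>.\<close>

definition m1 where "m1 m = (SUM k<d. SUM i:UNIV. (lookup (m k) i)^2)" for m
definition m2 where "m2 m = (SUM k<d. SUM j<=CARD('n). (pre (lookup (m k)) e j)^2)" for m
definition m3 where "m3 m = (SUM j<=CARD('n). pre (lookup w) e j)^2 - (SUM k<d. (area (m k))^2)" for m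

lemma e_bij: "enumerates e" using e by(simp add: sorts_def)

context
 fixes m :: "nat => 'n mon" and a b :: nat and i j :: 'n and r' s' assumes m: "factors m" and ab: "a < d" "b < d" "a ~= b"
  and i: "lookup (m b) i < lookup (m a) i" and j: "lookup (m a) j < lookup (m b) j"
  and r': "r' : G" "r' + unit_exp i = m a + unit_exp j" and s': "s' : G" "s' + unit_exp j = m b + unit_exp i"
begin

lemma exchange_factors: "factors (m(a := r', b := s'))"
proof -
 have "r' + s' + (unit_exp i + unit_exp j) = (r' + unit_exp i) + (s' + unit_exp j)" by(simp only: ac_simps)
 also have "... = m a + m b + (unit_exp i + unit_exp j)" unfolding r'(2) s'(2) by(simp only: ac_simps)
 finally have "r' + s' = m a + m b" by simp
 moreover have "(SUM k:{..<d} - {a, b}. (m(a := r', b := s')) k) = (SUM k:{..<d} - {a, b}. m k)" by(intro sum.cong) auto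
 ultimately show ?thesis using m r' s' ab unfolding factors_def sum_two[OF ab] by auto
qed

text \<open>An exchange relation multiplied by the monomial of the factors that are not
  involved.\<close>

lemma exchange_linked: "linked (k :: 'k::field itself) (tmon m) (tmon (m(a := r', b := s')))"
proof -
 let ?t = "SUM k:{..<d} - {a, b}. unit_exp (m k)"
 have t: "(SUM k:{..<d} - {a, b}. unit_exp ((m(a := r', b := s')) k)) = ?t" by(intro sum.cong) auto
 have "T_var (m a) * T_var (m b) - T_var r' * T_var s' : symmetric_exchange_relations (up :: ('n, 'k) mpoly set)"
  using m ab i j r' s' unfolding symmetric_exchange_relations_def min_gens_up factors_def by blast
 hence "T_var (m a) * T_var (m b) - T_var r' * T_var s' : (exchange_ideal :: ('n mon, 'k) mpoly set)"
  unfolding exchange_ideal_def using ideal_gen_superset by blast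
 moreover have "single ?t 1 : (monoid_ring toric_monomials :: ('n mon, 'k) mpoly set)"
 proof(rule single_in_monoid_ring)
  have "x : toric_monomials ==> y : toric_monomials ==> x + y : toric_monomials" for x y
   using Poly_Mapping.keys_add[of x y] unfolding toric_monomials_def by blast
  hence "ALL k:A. m k : G ==> (SUM k:A. unit_exp (m k)) : toric_monomials" for A
   by(induction A rule: infinite_finite_induct) (auto simp: toric_monomials_def)
  thus "?t : toric_monomials" using m by(simp add: factors_def)
 qed
 ultimately have "single ?t 1 * (T_var (m a) * T_var (m b) - T_var r' * T_var s') : (exchange_ideal :: ('n mon, 'k) mpoly set)"
  by(rule ideal_mult[OF exchange_ideal, rotated])
 thus ?thesis unfolding linked_def tmon_def sum_two[OF ab] t using ab(3) by(simp add: T_var_mult right_diff_distrib mult_single ac_simps)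
qed

lemma exchange_sum: "(SUM k<d. F ((m(a := r', b := s')) k)) + (F (m a) + F (m b)) = (SUM k<d. F (m k)) + (F r' + (F s' :: nat))"
proof -
 have "(SUM k:{..<d} - {a, b}. F ((m(a := r', b := s')) k)) = (SUM k:{..<d} - {a, b}. F (m k))" by(intro sum.cong) auto
 thus ?thesis using ab(3) unfolding sum_two[OF ab] by simp
qed

lemma exchange_m1: "m1 (m(a := r', b := s')) <= m1 m" and exchange_m1_less: "lookup (m b) i + 2 <= lookup (m a) i ==> m1 (m(a := r', b := s')) < m1 m"
proof -
 have ij: "i ~= j" using i j by auto
 have le: "(lookup r' x)^2 + (lookup s' x)^2 <= (lookup (m a) x)^2 + (lookup (m b) x)^2" for x
  using move_lookup[OF r'(2), of x] move_lookup[OF s'(2), of x] ij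
   square_balance(1)[OF _ _ i, of "lookup r' i" "lookup s' i"] square_balance(1)[OF _ _ j, of "lookup s' j" "lookup r' j"]
  by(cases "x = i"; cases "x = j") auto
 have "(SUM x:UNIV. (lookup r' x)^2) + (SUM x:UNIV. (lookup s' x)^2) <= (SUM x:UNIV. (lookup (m a) x)^2) + (SUM x:UNIV. (lookup (m b) x)^2)"
  unfolding sum.distrib[symmetric] by(rule sum_mono) (rule le)
 thus "m1 (m(a := r', b := s')) <= m1 m" using exchange_sum[of "%v. SUM x:UNIV. (lookup v x)^2"] unfolding m1_def by linarith
 assume "lookup (m b) i + 2 <= lookup (m a) i"
 hence "(lookup r' i)^2 + (lookup s' i)^2 < (lookup (m a) i)^2 + (lookup (m b) i)^2"
  using move_lookup[OF r'(2), of i] move_lookup[OF s'(2), of i] square_balance(2)[OF _ _ i, of "lookup r' i" "lookup s' i"] ij by auto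
 hence "(SUM x:UNIV. (lookup r' x)^2) + (SUM x:UNIV. (lookup s' x)^2) < (SUM x:UNIV. (lookup (m a) x)^2) + (SUM x:UNIV. (lookup (m b) x)^2)"
  unfolding sum.distrib[symmetric] using le by(intro sum_strict_mono_ex1) auto
 thus "m1 (m(a := r', b := s')) < m1 m" using exchange_sum[of "%v. SUM x:UNIV. (lookup v x)^2"] unfolding m1_def by linarith
qed

end

lemma area_sum:
 assumes "factors m" shows "(SUM k<d. pre (lookup (m k)) e j) = pre (lookup w) e j" "(SUM k<d. (area (m k))^2) <= (SUM j<=CARD('n). pre (lookup w) e j)^2"
proof -
 have "pre (lookup (SUM k<d. m k)) e j = (SUM k<d. pre (lookup (m k)) e j)" for j unfolding pre_def lookup_sum by(rule sum.swap)
 thus eq: "(SUM k<d. pre (lookup (m k)) e j) = pre (lookup w) e j" for j using assms by(simp add: factors_def)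
 have "(SUM k<d. area (m k)) = (SUM j<=CARD('n). pre (lookup w) e j)" unfolding area_def by(subst sum.swap) (simp add: eq)
 moreover have "(SUM k:A. (f k)^2) <= (SUM k:A. f k)^2" for A and f :: "nat => nat"
  by(induction A rule: infinite_finite_induct) (auto simp: power2_sum)
 ultimately show "(SUM k<d. (area (m k))^2) <= (SUM j<=CARD('n). pre (lookup w) e j)^2" by metis
qed

definition flat :: "(nat => 'n mon) => bool" where
 "flat m \<longleftrightarrow> (ALL a<d. ALL b<d. ALL i. lookup (m a) i <= lookup (m b) i + 1)"

text \<open>The least value among the factors is the integer part of the average of
  \<open>lookup w i\<close> over the \<open>d\<close> factors.\<close>

lemma flat_values: assumes m: "factors m" "flat m" and a: "a < d" shows "lookup (m a) i = lookup w i div d | lookup (m a) i = Suc (lookup w i div d)"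
proof -
 obtain b where b: "b < d" "!!k. k < d ==> lookup (m b) i <= lookup (m k) i" using ex_has_least_nat[of "%k. k < d" a "%k. lookup (m k) i"] a by blast
 have le: "lookup (m k) i <= lookup (m b) i + 1" if "k < d" for k using m(2) that b(1) by(auto simp: flat_def)
 have w: "(SUM k<d. lookup (m k) i) = lookup w i" using m(1) by(auto simp: factors_def simp flip: lookup_sum)
 have "(SUM k<d. lookup (m b) i) <= (SUM k<d. lookup (m k) i)" by(intro sum_mono) (use b in simp)
 moreover have "(SUM k<d. lookup (m k) i) < (SUM k<d. lookup (m b) i + 1)" using le b(1) by(intro sum_strict_mono_ex1) (auto intro!: bexI[of _ b])
 ultimately have "lookup w i div d = lookup (m b) i" by(intro div_nat_eqI) (simp_all add: w mult.commute)
 thus ?thesis using le[OF a] b(2)[OF a] by linarith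
qed

lemma pre_total: "factors m ==> k < d ==> pre (lookup (m k)) e CARD('n) = D" by(auto simp: pre_card[OF e_bij] factors_def G_def esize_def)

lemma move_back: "0 < lookup v i ==> (v + unit_exp j - unit_exp i) + unit_exp i = v + unit_exp j"
 by(rule poly_mapping_eqI) (auto simp: lookup_add lookup_minus lookup_single when_def)

text \<open>\<open>rk_bound\<close> asks for level sets of \<open>lookup w x div d\<close> only;
  these are initial segments of \<open>e\<close>, where the sum of \<open>u\<close> is a prefix sum
  bounded by that of some member of \<open>G\<close>.\<close>

lemma move_in_G_if_flat: assumes v: "v : G" and u: "u + unit_exp i = v + unit_exp j"
  and c: "!!x. lookup u x = lookup w x div d | lookup u x = Suc (lookup w x div d)"
  and p: "!!k. k <= CARD('n) ==> EX s:G. pre (lookup u) e k <= pre (lookup s) e k" shows "u : G"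
proof -
 have ce: "sorts e (%x. lookup w x div d)" using e by(simp add: sorts_def div_le_mono)
 have "sum (lookup u) T <= rk (card T)" for T
 proof(rule rk_bound[OF c])
  fix v let ?U = "{i. v <= lookup w i div d}"
  obtain s where s: "s : G" "pre (lookup u) e (card ?U) <= pre (lookup s) e (card ?U)" using p[OF card_le] by blast
  thus "sum (lookup u) ?U <= rk (card ?U)" using G_leI[OF s(1), of ?U] by(simp add: sum_upper_set[OF ce])
 qed
 moreover have "esize u = D" using move_sum[OF u, of UNIV] v by(simp add: G_def esize_def)
 ultimately show ?thesis by(simp add: G_def)
qed

text \<open>On a stretch where the prefix sums of factor \<open>a\<close> exceed those of factor
  \<open>b\<close>, exchanging the variables at its ends lowers the former and raises the latter by
  one. Flatness keeps both new factors in \<open>G\<close>. A gap of 2 makes \<open>m2\<close> fall;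
  if the area of \<open>a\<close> is not the larger one, the areas spread and \<open>m3\<close>
  falls.\<close>

lemma excursion_move:
 assumes m: "factors m" "flat m" and ab: "a < d" "b < d" and k0: "k0 <= CARD('n)" "pre (lookup (m b)) e k0 < pre (lookup (m a)) e k0"
 obtains m' where "factors m'" "linked (k :: 'k::field itself) (tmon m) (tmon m')" "m1 m' <= m1 m" "m2 m' <= m2 m"
  "pre (lookup (m b)) e k0 + 2 <= pre (lookup (m a)) e k0 ==> m2 m' < m2 m" "area (m a) <= area (m b) ==> m3 m' < m3 m"
proof -
 let ?u = "pre (lookup (m a)) e" and ?v = "pre (lookup (m b)) e"
 have neq: "a ~= b" using k0(2) by auto
 have G: "m a : G" "m b : G" using m(1) ab by(auto simp: factors_def)
 obtain x y where xy: "x < k0" "k0 <= y" "y < CARD('n)" "?u x <= ?v x" "?u (Suc y) <= ?v (Suc y)" "!!k. x < k ==> k <= y ==> ?v k < ?u k"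
  using excursion[of ?v k0 ?u "CARD('n)"] k0 pre_total[OF m(1)] ab by auto
 have x: "x < CARD('n)" "x < y" using xy by auto
 have i: "lookup (m b) (e x) < lookup (m a) (e x)" using xy(4) xy(6)[of "Suc x"] x by(simp add: pre_Suc)
 have j: "lookup (m a) (e y) < lookup (m b) (e y)" using xy(5) xy(6)[of y] x by(simp add: pre_Suc)
 define r' where "r' = m a + unit_exp (e y) - unit_exp (e x)"
 define s' where "s' = m b + unit_exp (e x) - unit_exp (e y)"
 have r': "r' + unit_exp (e x) = m a + unit_exp (e y)" unfolding r'_def using i by(intro move_back) simp
 have s': "s' + unit_exp (e y) = m b + unit_exp (e x)" unfolding s'_def using j by(intro move_back) simp
 have pr: "pre (lookup r') e k + (if x < k & k <= y then 1 else 0) = ?u k" "pre (lookup s') e k = ?v k + (if x < k & k <= y then 1 else 0)" if "k <= CARD('n)" for k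
  using move_pre[OF e_bij xy(3) x(1) that r'] move_pre[OF e_bij x(1) xy(3) that s'] x(2) by(auto split: if_splits)
 note fl = flat_values[OF m ab(1)] flat_values[OF m ab(2)]
 have rG: "r' : G"
 proof(rule move_in_G_if_flat[OF G(1) r'])
  show "lookup r' z = lookup w z div d | lookup r' z = Suc (lookup w z div d)" for z
   using move_lookup[OF r', of z] fl[of z] i j by(auto split: if_splits)
  show "EX s:G. pre (lookup r') e k <= pre (lookup s) e k" if "k <= CARD('n)" for k using pr(1)[OF that] G(1) by(intro bexI[of _ "m a"]) auto
 qed
 have sG: "s' : G"
 proof(rule move_in_G_if_flat[OF G(2) s'])
  show "lookup s' z = lookup w z div d | lookup s' z = Suc (lookup w z div d)" for z
   using move_lookup[OF s', of z] fl[of z] i j by(auto split: if_splits)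
  show "EX s:G. pre (lookup s') e k <= pre (lookup s) e k" if "k <= CARD('n)" for k
   using pr(2)[OF that] G xy(6)[of k] by(cases "x < k & k <= y") (auto intro: bexI[of _ "m a"] bexI[of _ "m b"])
 qed
 note ex = m(1) ab neq i j rG r' sG s'
 let ?m = "m(a := r', b := s')"
 have sq: "(pre (lookup r') e k)^2 + (pre (lookup s') e k)^2 <= (?u k)^2 + (?v k)^2" if "k <= CARD('n)" for k
  using square_balance(1)[of "pre (lookup r') e k" "?u k" "pre (lookup s') e k" "?v k"] pr[OF that] xy(6)[of k] by(cases "x < k & k <= y") auto
 let ?F = "%v. SUM j<=CARD('n). (pre (lookup v) e j)^2"
 have "?F r' + ?F s' <= ?F (m a) + ?F (m b)" unfolding sum.distrib[symmetric] by(rule sum_mono) (use sq in simp)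
 hence le2: "m2 ?m <= m2 m" using exchange_sum[OF ex, of ?F] unfolding m2_def by linarith
 have lt2: "m2 ?m < m2 m" if "?v k0 + 2 <= ?u k0"
 proof -
  have "(pre (lookup r') e k0)^2 + (pre (lookup s') e k0)^2 < (?u k0)^2 + (?v k0)^2"
   using square_balance(2)[of "pre (lookup r') e k0" "?u k0" "pre (lookup s') e k0" "?v k0"] pr[OF k0(1)] xy(1,2) that by simp
  hence "?F r' + ?F s' < ?F (m a) + ?F (m b)" unfolding sum.distrib[symmetric] using sq k0(1) by(intro sum_strict_mono_ex1) auto
  thus ?thesis using exchange_sum[OF ex, of ?F] unfolding m2_def by linarith
 qed
 have lt3: "m3 ?m < m3 m" if A: "area (m a) <= area (m b)"
 proof -
  have "area r' + area s' = area (m a) + area (m b)" unfolding area_def sum.distrib[symmetric]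
  proof(rule sum.cong[OF refl])
   fix k assume "k : {..CARD('n)}"
   thus "pre (lookup r') e k + pre (lookup s') e k = ?u k + ?v k" using pr[of k] by auto
  qed
  moreover have "area (m b) < area s'" unfolding area_def using pr(2) xy(1,2) k0(1) by(intro sum_strict_mono_ex1) (auto intro!: bexI[of _ k0])
  ultimately have "(area (m a))^2 + (area (m b))^2 < (area r')^2 + (area s')^2" using A by(rule square_unbalance)
  hence "(SUM k<d. (area (m k))^2) < (SUM k<d. (area (?m k))^2)" using exchange_sum[OF ex, of "%v. (area v)^2"] by linarith
  thus ?thesis using area_sum(2)[OF exchange_factors[OF ex]] unfolding m3_def by linarith
 qed
 show ?thesis by(rule that[OF exchange_factors[OF ex] exchange_linked[OF ex] exchange_m1[OF ex] le2 lt2 lt3])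
qed

text \<open>After sorting by area all prefix sums increase along the factors simultaneously and
  differ by at most one, so \<open>balanced_division\<close> determines each of them.\<close>

lemma sorted_factors: assumes m: "factors m"
  and close: "!!a b k. a < d ==> b < d ==> k <= CARD('n) ==> pre (lookup (m a)) e k <= pre (lookup (m b)) e k + 1"
  and ordered: "!!a b k. a < d ==> b < d ==> k <= CARD('n) ==> area (m a) <= area (m b) ==> pre (lookup (m a)) e k <= pre (lookup (m b)) e k"
 shows "tmon m = tmon (%k. pm (piece (lookup w) e d k))"
proof -
 let ?xs = "sort_key (%k. area (m k)) [0..<d]"
 define s where "s k = ?xs ! k" for k
 have bij: "bij_betw s {..<d} {..<d}" unfolding s_def by(rule bij_betw_nth) auto
 have sd: "s k < d" if "k < d" for k using bij that unfolding bij_betw_def by blast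
 have mono: "area (m (s i)) <= area (m (s j))" if "i <= j" "j < d" for i j
  using sorted_nth_mono[OF sorted_sort_key[of "%k. area (m k)" "[0..<d]"], of i j] that by(simp add: s_def)
 have pre: "pre (lookup (m (s k))) e j = (pre (lookup w) e j + k) div d" if "k < d" "j <= CARD('n)" for k j
 proof -
  have "pre (lookup (m (s k))) e j = ((SUM i<d. pre (lookup (m (s i))) e j) + k) div d"
   by(rule balanced_division) (use that sd mono close ordered in auto)
  also have "(SUM i<d. pre (lookup (m (s i))) e j) = (SUM i<d. pre (lookup (m i)) e j)" by(rule sum.reindex_bij_betw[OF bij])
  finally show ?thesis by(simp add: area_sum(1)[OF m])
 qed
 have eq: "m (s k) = pm (piece (lookup w) e d k)" if k: "k < d" for k
 proof(rule poly_mapping_eqI)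
  fix i
  have d: "d > 0" using k by simp
  obtain j where j: "j < CARD('n)" "i = e j" by(rule e_surj[OF e_bij d])
  thus "lookup (m (s k)) i = lookup (pm (piece (lookup w) e d k)) i"
   using pre[OF k, of j] pre[OF k, of "Suc j"] pre_Suc[of "lookup (m (s k))" e j] by(simp add: piece_e[OF e_bij d])
 qed
 have "tmon m = (SUM k<d. unit_exp (m (s k)))" unfolding tmon_def by(rule sum.reindex_bij_betw[OF bij, symmetric])
 thus ?thesis unfolding tmon_def by(simp add: eq)
qed

text \<open>If a factorization is not flat, a simultaneous exchange lowers \<open>m1\<close>; if it
  is flat, an excursion move lowers \<open>m2\<close> or \<open>m3\<close> unless the factorization
  is canonical up to the order of its factors.\<close>

lemma linked_canonical: assumes "factors m" shows "linked (k :: 'k::field itself) (tmon m) (tmon (%k. pm (piece (lookup w) e d k)))" using assms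
proof(induction m rule: wf_induct[OF wf_measures[of "[m1, m2, m3]"]])
 case (1 m)
 note IH = 1(1)[rule_format] and m = 1(2)
 have step: ?case if "factors m'" "linked k (tmon m) (tmon m')" "(m', m) : measures [m1, m2, m3]" for m'
  using linked_trans[OF that(2) IH[OF that(3,1)]] .
 show ?case
 proof(cases "flat m")
  case False
  then obtain a b i where ab': "a < d" "b < d" "~ lookup (m a) i <= lookup (m b) i + 1" unfolding flat_def by blast
  hence ab: "a < d" "b < d" "lookup (m b) i + 2 <= lookup (m a) i" by auto
  hence neq: "a ~= b" and i: "lookup (m b) i < lookup (m a) i" by auto
  have G: "m a : G" "m b : G" using m ab by(auto simp: factors_def)
  obtain j where j: "lookup (m a) j < lookup (m b) j"
   "!!v. v + unit_exp i = m a + unit_exp j ==> v : G" "!!v. v + unit_exp j = m b + unit_exp i ==> v : G" using simultaneous_exchange[OF G i] by blast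
  have r': "(m a + unit_exp j - unit_exp i) + unit_exp i = m a + unit_exp j" and s': "(m b + unit_exp i - unit_exp j) + unit_exp j = m b + unit_exp i"
   by(rule move_back, use i j(1) in simp)+
  note ex = m ab(1,2) neq i j(1) j(2)[OF r'] r' j(3)[OF s'] s'
  show ?thesis by(rule step[OF exchange_factors[OF ex] exchange_linked[OF ex]]) (use exchange_m1_less[OF ex ab(3)] in simp)
 next
  case flat: True
  show ?thesis
  proof(cases "EX a b k. a < d & b < d & k <= CARD('n) & pre (lookup (m b)) e k + 2 <= pre (lookup (m a)) e k")
   case True
   then obtain a b k0 where h: "a < d" "b < d" "k0 <= CARD('n)" "pre (lookup (m b)) e k0 + 2 <= pre (lookup (m a)) e k0" by blast
   hence "pre (lookup (m b)) e k0 < pre (lookup (m a)) e k0" by simp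
   from excursion_move[OF m flat h(1-3) this, of k] obtain m' where "factors m'" "linked k (tmon m) (tmon m')" "m1 m' <= m1 m" "m2 m' < m2 m"
    using h(4) by metis
   thus ?thesis by(intro step[of m']) (auto simp: le_less)
  next
   case close: False
   show ?thesis
   proof(cases "EX a b k. a < d & b < d & k <= CARD('n) & area (m a) <= area (m b) & pre (lookup (m b)) e k < pre (lookup (m a)) e k")
    case True
    then obtain a b k0 where h: "a < d" "b < d" "k0 <= CARD('n)" "pre (lookup (m b)) e k0 < pre (lookup (m a)) e k0" "area (m a) <= area (m b)" by blast
    from excursion_move[OF m flat h(1-4), of k] obtain m' where "factors m'" "linked k (tmon m) (tmon m')" "m1 m' <= m1 m" "m2 m' <= m2 m" "m3 m' < m3 m"
     using h(5) by metis
    thus ?thesis by(intro step[of m']) (auto simp: le_less)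
   next
    case False
    have "tmon m = tmon (%k. pm (piece (lookup w) e d k))"
    proof(rule sorted_factors[OF m])
     show "pre (lookup (m a)) e k <= pre (lookup (m b)) e k + 1" if "a < d" "b < d" "k <= CARD('n)" for a b k
     proof(rule ccontr)
      assume "~ ?thesis"
      hence "pre (lookup (m b)) e k + 2 <= pre (lookup (m a)) e k" by simp
      thus False using close that by blast
     qed
     show "pre (lookup (m a)) e k <= pre (lookup (m b)) e k" if "a < d" "b < d" "k <= CARD('n)" "area (m a) <= area (m b)" for a b k
     proof(rule ccontr)
      assume "~ ?thesis"
      hence "pre (lookup (m b)) e k < pre (lookup (m a)) e k" by simp
      thus False using False that by blast
     qed
    qed
    thus ?thesis using linked_refl by simp
   qed
  qed
 qed
qed

end

context borel_generator
begin

lemma toric_monomial_list: assumes t: "keys t <= G" shows "EX xs. set xs <= G & t = sum_list (map unit_exp xs)"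
proof -
 define P where "P t \<longleftrightarrow> (EX xs. set xs <= G & t = sum_list (map unit_exp xs))" for t
 have add: "P (s + t)" if "P s" "P t" for s t
 proof -
  from that obtain xs ys where "set xs <= G" "s = sum_list (map unit_exp xs)" "set ys <= G" "t = sum_list (map unit_exp ys)" unfolding P_def by blast
  thus ?thesis unfolding P_def by(intro exI[of _ "xs @ ys"]) auto
 qed
 have zero: "P 0" unfolding P_def by(intro exI[of _ "[]"]) simp
 have single: "P (single m q)" if "m : G" for m q
 proof(induction q)
  case (Suc q)
  have "P (unit_exp m)" using that unfolding P_def by(intro exI[of _ "[m]"]) simp
  hence "P (unit_exp m + single m q)" using Suc by(rule add)
  thus ?case by(simp flip: single_add)
 qed (simp add: zero)
 have "A <= G ==> P (SUM m:A. single m (lookup t m))" for A by(induction A rule: infinite_finite_induct) (auto simp: zero intro!: add single)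
 from this[OF t] have "P t" by(simp only: sum_single_lookup)
 thus ?thesis by(simp only: P_def)
qed

text \<open>The number of factors is fixed by the degree, so two products with equal exponent reach
  the same canonical factorization.\<close>

lemma linked_if_expo_eq: assumes st: "s : toric_monomials" "t : toric_monomials" and eq: "expo s = expo t" shows "linked (k :: 'k::field itself) s t"
proof -
 let ?w = "expo s"
 obtain e where e: "sorts e (lookup ?w)" using sorts_exists by blast
 have list: "linked k u (SUM k<d. unit_exp (pm (piece (lookup ?w) e d k)))"
  if u: "u : toric_monomials" "expo u = ?w" and d: "d = esize ?w div D" for u d
 proof -
  obtain xs where xs: "set xs <= G" "u = sum_list (map unit_exp xs)" using toric_monomial_list u(1) unfolding toric_monomials_def by blast
  have us: "u = (SUM k<length xs. unit_exp (xs ! k))" by(simp add: xs(2) sum_list_sum_nth lessThan_atLeast0)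
  have ws: "?w = (SUM k<length xs. xs ! k)" unfolding u(2)[symmetric] us expo_sum expo_unit ..
  have "esize ?w = (SUM k<length xs. esize (xs ! k))" unfolding ws esize_def lookup_sum by(rule sum.swap)
  also have "... = (SUM k<length xs. D)" using xs(1) by(intro sum.cong) (auto simp: G_def dest!: nth_mem)
  finally have "d = length xs" using D_pos by(simp add: d)
  interpret factorization lam ?w d e by unfold_locales (rule e)
  have "factors ((!) xs)" unfolding factors_def using xs(1) ws[symmetric] nth_mem by(auto simp only: \<open>d = length xs\<close>)
  hence "linked k (tmon ((!) xs)) (tmon (%k. pm (piece (lookup ?w) e d k)))" by(rule linked_canonical)
  thus ?thesis unfolding tmon_def us by(simp only: \<open>d = length xs\<close>)
 qed
 show ?thesis using list[OF st(1) refl refl] list[OF st(2) eq[symmetric] refl] by(blast intro: linked_trans linked_sym)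
qed

text \<open>Each term of an element of the kernel is replaced by a representative with the same
  image, which changes it by an element of the exchange ideal. The coefficients collected at a
  representative add up to a coefficient of the image and so vanish.\<close>

lemma toric_ideal_up:
 "toric_ideal (up :: ('n, 'k::field) mpoly set) =
   Idl\<^bsub>toric_poly_ring (up :: ('n, 'k) mpoly set)\<^esub> (symmetric_exchange_relations (up :: ('n, 'k) mpoly set))"
proof -
 let ?Q = "monoid_ring toric_monomials :: ('n mon, 'k) mpoly set"
 have "f : exchange_ideal" if f: "f : ?Q" "(toric_map f :: ('n, 'k) mpoly) = 0" for f
 proof -
  have fm: "t : toric_monomials" if "t : keys f" for t using f(1) that by(auto simp: monoid_ring_def)
  define rep where "rep u = (SOME t. t : keys f & expo t = u)" for u
  have rep: "rep (expo t) : keys f" "expo (rep (expo t)) = expo t" if "t : keys f" for t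
   unfolding rep_def using someI[of "%t'. t' : keys f & expo t' = expo t" t] that by auto
  have diff: "single 0 (lookup f t) * (single t 1 - single (rep (expo t)) 1) : exchange_ideal" if t: "t : keys f" for t
  proof(rule ideal_mult[OF exchange_ideal])
   show "single 0 (lookup f t) : ?Q" by(rule single_in_monoid_ring) (simp add: toric_monomials_def)
   show "single t 1 - single (rep (expo t)) (1::'k) : exchange_ideal"
    using linked_if_expo_eq[OF fm[OF t] fm[OF rep(1)[OF t]] rep(2)[OF t, symmetric], of "TYPE('k)"] by(simp add: linked_def)
  qed
  have zero: "(SUM t:keys f. single (rep (expo t)) (lookup f t)) = 0"
  proof -
   have "(SUM t:keys f. single (rep (expo t)) (lookup f t)) = lin_ext (%u c. single (rep u) c) (SUM t:keys f. single (expo t) (lookup f t))"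
    by(subst additive_sum[of "lin_ext (%u c. single (rep u) c)"]) (auto simp: lin_ext_single single_add intro!: lin_ext_add)
   also have "(SUM t:keys f. single (expo t) (lookup f t)) = toric_map f" by(simp add: toric_map_eq lin_ext_def)
   finally show ?thesis by(simp add: f(2) lin_ext_def)
  qed
  have "(SUM t:keys f. single 0 (lookup f t) * (single t 1 - single (rep (expo t)) 1)) = (SUM t:keys f. single t (lookup f t)) - (SUM t:keys f. single (rep (expo t)) (lookup f t))"
   by(simp add: right_diff_distrib mult_single sum_subtractf)
  also have "... = f" by(simp add: zero sum_single_lookup)
  finally show ?thesis using ideal_sum[OF exchange_ideal diff, of "keys f" "%t. t"] by simp
 qed
 hence "toric_ideal (up :: ('n, 'k) mpoly set) = exchange_ideal"
  using exchange_ideal_sub[where 'k = 'k] unfolding toric_ideal_def toric_poly_ring_up by auto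
 thus ?thesis unfolding toric_poly_ring_up genideal_ring_on[OF toric_monomials_subring] exchange_ideal_def .
qed

lemma exchange_relations_quadratic: assumes "f : symmetric_exchange_relations (up :: ('n, 'k::field) mpoly set)" shows "quadratic_form f"
proof -
 obtain r s t w where f: "f = T_var r * T_var s - T_var t * T_var w" using assms unfolding symmetric_exchange_relations_def by blast
 have "(SUM v:keys (unit_exp a + unit_exp b). lookup (unit_exp a + unit_exp b) v) = 2" for a b :: "'n mon"
 proof -
  have "(SUM v:keys (unit_exp a + unit_exp b). lookup (unit_exp a + unit_exp b) v) = (SUM v:{a, b}. lookup (unit_exp a + unit_exp b) v)"
   by(rule sum.mono_neutral_left) (auto simp: in_keys_iff lookup_add lookup_single when_def split: if_splits)
  thus ?thesis by(cases "a = b") (auto simp: lookup_add lookup_single)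
 qed
 moreover have "keys f <= {unit_exp r + unit_exp s, unit_exp t + unit_exp w}"
  unfolding f T_var_mult using keys_diff[of "single (unit_exp r + unit_exp s) 1" "single (unit_exp t + unit_exp w) 1"] by auto
 ultimately show ?thesis unfolding quadratic_form_def by auto
qed

end

section \<open>Exactness of relative cochain complexes\<close>

definition incid :: "nat => nat set => 'k::comm_ring_1" where
 "incid i sg = (-1) ^ card {j\<in>sg. j < i}"

lemma cech_coboundary_incid: "cech_coboundary c sg = (SUM i:sg. incid i sg * c (sg - {i}))" by(simp add: cech_coboundary_def incid_def)

lemma incid_square: "incid i sg * incid i sg = 1" by(simp add: incid_def flip: power_mult_distrib)

lemma incid_insert: assumes "finite sg" "i ~: sg" shows "incid j (insert i sg) = (if i < j then - incid j sg else incid j sg)"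
proof -
 have "{x\<in>insert i sg. x < j} = (if i < j then insert i {x\<in>sg. x < j} else {x\<in>sg. x < j})" by auto
 thus ?thesis using assms by(simp add: incid_def)
qed

lemma incid_swap: assumes "finite sg" "i : sg" "j : sg" "i ~= j"
 shows "incid i sg * incid j (sg - {i}) = - (incid j sg * incid i (sg - {j}) :: 'k::comm_ring_1)"
proof -
 have "(incid j sg :: 'k) = (if i < j then - incid j (sg - {i}) else incid j (sg - {i}))"
  "(incid i sg :: 'k) = (if j < i then - incid i (sg - {j}) else incid i (sg - {j}))"
  using assms incid_insert[of "sg - {i}" i j] incid_insert[of "sg - {j}" j i] by(simp_all add: insert_absorb)
 thus ?thesis using assms(4) by(cases i j rule: linorder_cases) auto
qed

lemma sign_rotate:
 fixes p q w z :: "'k::comm_ring_1" assumes h: "q * w = - (p * z)" and "p * p = 1" "w * w = 1" shows "z * w = - (p * q)"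
proof -
 have "p * q * (w * w) = p * (q * w) * w" by(simp only: mult.assoc)
 also have "... = - ((p * p) * (z * w))" unfolding h by(simp add: mult.assoc)
 finally show ?thesis by(simp add: assms)
qed

text \<open>The double sum is antisymmetric in the two removed indices and thus equals its own
  negative; 2 is nonzero in characteristic zero.\<close>

lemma coboundary_coboundary:
 fixes c :: "nat set => 'k::field" assumes char: "CHAR('k) = 0" and sg: "finite sg" shows "cech_coboundary (cech_coboundary c) sg = 0"
proof -
 define T where "T i j = (if i = j then 0 else incid i sg * incid j (sg - {i}) * c (sg - {i} - {j}))" for i j
 have eq: "cech_coboundary (cech_coboundary c) sg = (SUM i:sg. SUM j:sg. T i j)" unfolding cech_coboundary_incid
 proof(rule sum.cong[OF refl])
  fix i assume "i : sg"
  have "(SUM j:sg - {i}. incid i sg * (incid j (sg - {i}) * c (sg - {i} - {j}))) = (SUM j:sg. T i j)"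
   using sg by(intro sum.mono_neutral_cong_left) (auto simp: T_def mult.assoc)
  thus "incid i sg * (SUM j:sg - {i}. incid j (sg - {i}) * c (sg - {i} - {j})) = (SUM j:sg. T i j)" by(simp add: sum_distrib_left)
 qed
 have "(SUM i:sg. SUM j:sg. T i j) = (SUM i:sg. SUM j:sg. - T j i)"
 proof(rule sum.cong[OF refl], rule sum.cong[OF refl])
  fix i j assume "i : sg" "j : sg"
  have d: "sg - {i} - {j} = sg - {j} - {i}" by auto
  show "T i j = - T j i"
  proof(cases "i = j")
   case False
   show ?thesis unfolding T_def d incid_swap[OF sg \<open>i : sg\<close> \<open>j : sg\<close> False] using False by simp
  qed (simp add: T_def)
 qed
 also have "... = - (SUM i:sg. SUM j:sg. T j i)" by(simp only: sum_negf)
 also have "(SUM i:sg. SUM j:sg. T j i) = (SUM i:sg. SUM j:sg. T i j)" by(rule sum.swap)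
 finally have "(SUM i:sg. SUM j:sg. T i j) + (SUM i:sg. SUM j:sg. T i j) = 0" unfolding eq_neg_iff_add_eq_0 .
 moreover have "of_nat 2 * x = x + x" for x :: 'k by(metis mult_2 of_nat_numeral)
 ultimately have "of_nat 2 * (SUM i:sg. SUM j:sg. T i j) = 0" by metis
 moreover have "of_nat 2 ~= (0::'k)" unfolding of_nat_eq_0_iff_char_dvd by(simp add: char)
 ultimately show ?thesis unfolding eq by(metis mult_eq_0_iff)
qed

text \<open>Exactness of the augmented cochain complex of the full simplex on \<open>\<Omega>\<close> relative to a family \<open>\<K>\<close>
 of simplices. Cochains are not homogeneous, and they also have a value at the empty simplex.\<close>

definition exact_off :: "'k::field itself => nat set => nat set set => bool" where
 "exact_off _ \<Omega> \<K> \<longleftrightarrow> (ALL c :: nat set => 'k. (ALL sg:\<K>. c sg = 0) & (ALL sg<=\<Omega>. cech_coboundary c sg = 0) -->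
   (EX b. (ALL sg:\<K>. b sg = 0) & (ALL sg<=\<Omega>. c sg = cech_coboundary b sg)))"

text \<open>Inserting \<open>v\<close> is a contracting homotopy, as for a cone with apex
  \<open>v\<close>; closure of \<K> under it keeps the cochains relative.\<close>

lemma exact_off_cone: assumes \<Omega>: "finite \<Omega>" "v : \<Omega>" and cone: "!!sg. sg : \<K> ==> insert v sg : \<K>"
 shows "exact_off TYPE('k::field) \<Omega> \<K>" unfolding exact_off_def
proof(intro allI impI)
 fix c :: "nat set => 'k" assume c: "(ALL sg:\<K>. c sg = 0) & (ALL sg<=\<Omega>. cech_coboundary c sg = 0)"
 define b where "b ta = (if v : ta then 0 else incid v ta * c (insert v ta))" for ta
 have "c sg = cech_coboundary b sg" if "sg <= \<Omega>" for sg
 proof -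
  have f: "finite sg" using that \<Omega>(1) by(rule finite_subset)
  show ?thesis
  proof(cases "v : sg")
   case True
   have "cech_coboundary b sg = (SUM i:{v}. incid i sg * b (sg - {i}))"
    unfolding cech_coboundary_incid using True f by(intro sum.mono_neutral_right) (auto simp: b_def)
   also have "incid v sg = (incid v (sg - {v}) :: 'k)" using incid_insert[of "sg - {v}" v v] f True by(simp add: insert_absorb)
   hence "(SUM i:{v}. incid i sg * b (sg - {i})) = c sg"
    using True incid_square[of v "sg - {v}", where 'a = 'k] by(simp add: b_def insert_absorb flip: mult.assoc)
   finally show ?thesis by simp
  next
   case False
   have neg: "incid i sg * b (sg - {i}) = - (incid v sg * (incid i (insert v sg) * c (insert v sg - {i})))" if i: "i : sg" for i
   proof -
    have "i ~= v" using i False by auto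
    have "incid i (insert v sg) * incid v (insert v sg - {i}) = - (incid v (insert v sg) * incid i (insert v sg - {v}) :: 'k)"
     using incid_swap[of "insert v sg" i v] f i \<open>i ~= v\<close> by simp
    hence "incid i (insert v sg) * incid v (sg - {i}) = - (incid v sg * incid i sg :: 'k)"
     using incid_insert[of "sg - {i}" v v, where 'a = 'k] incid_insert[of sg v v, where 'a = 'k] f False \<open>i ~= v\<close>
     by(simp add: insert_Diff_if)
    hence "incid i sg * incid v (sg - {i}) = - (incid v sg * incid i (insert v sg) :: 'k)" by(rule sign_rotate[OF _ incid_square incid_square])
    moreover have b: "b (sg - {i}) = incid v (sg - {i}) * c (insert v sg - {i})" using False \<open>i ~= v\<close> by(simp add: b_def insert_Diff_if)
    ultimately show ?thesis unfolding b mult.assoc[symmetric] by simp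
   qed
   have "cech_coboundary c (insert v sg) = 0" using c that \<Omega>(2) by simp
   hence "incid v sg * c sg + (SUM i:sg. incid i (insert v sg) * c (insert v sg - {i})) = 0"
    using f False incid_insert[OF f False, of v, where 'a = 'k] by(simp add: cech_coboundary_incid)
   hence "- (SUM i:sg. incid i (insert v sg) * c (insert v sg - {i})) = incid v sg * c sg" by(simp add: eq_neg_iff_add_eq_0 neg_eq_iff_add_eq_0 add.commute)
   moreover have "cech_coboundary b sg = incid v sg * - (SUM i:sg. incid i (insert v sg) * c (insert v sg - {i}))"
    by(simp add: cech_coboundary_incid neg sum_negf flip: sum_distrib_left)
   ultimately have "cech_coboundary b sg = incid v sg * (incid v sg * c sg)" by simp
   thus ?thesis using incid_square[of v sg, where 'a = 'k] by(simp flip: mult.assoc)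
  qed
 qed
 moreover have "ALL ta:\<K>. b ta = 0" using c cone by(simp add: b_def)
 ultimately show "EX b. (ALL sg:\<K>. b sg = 0) & (ALL sg<=\<Omega>. c sg = cech_coboundary b sg)" by blast
qed

text \<open>A Mayer-Vietoris argument: a primitive relative to \<K> is a cocycle on the overlap, and
  subtracting the coboundary of a primitive found there makes it vanish on the simplex that is glued
  in.\<close>

lemma exact_off_glue: assumes char: "CHAR('k::field) = 0" and \<Omega>: "finite \<Omega>" and down: "!!sg i. sg : \<K> ==> sg - {i} : \<K>"
  and 1: "exact_off TYPE('k) \<Omega> \<K>" and 2: "exact_off TYPE('k) (\<Omega> Int \<Omega>') \<K>"
 shows "exact_off TYPE('k) \<Omega> (\<K> Un Pow \<Omega>')" unfolding exact_off_def
proof(intro allI impI)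
 fix c :: "nat set => 'k" assume c: "(ALL sg:\<K> Un Pow \<Omega>'. c sg = 0) & (ALL sg<=\<Omega>. cech_coboundary c sg = 0)"
 hence "(ALL sg:\<K>. c sg = 0) & (ALL sg<=\<Omega>. cech_coboundary c sg = 0)" by simp
 from 1[unfolded exact_off_def, THEN spec, THEN mp, OF this]
 obtain b where b: "ALL sg:\<K>. b sg = 0" "ALL sg<=\<Omega>. c sg = cech_coboundary b sg" by(elim exE conjE)
 have "cech_coboundary b sg = 0" if "sg <= \<Omega> Int \<Omega>'" for sg
 proof -
  have "sg <= \<Omega>" "sg : \<K> Un Pow \<Omega>'" using that by auto
  thus ?thesis using b(2) c by metis
 qed
 hence "(ALL sg:\<K>. b sg = 0) & (ALL sg<=\<Omega> Int \<Omega>'. cech_coboundary b sg = 0)" using b(1) by simp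
 from 2[unfolded exact_off_def, THEN spec, THEN mp, OF this]
 obtain e where e: "ALL sg:\<K>. e sg = 0" "ALL sg<=\<Omega> Int \<Omega>'. b sg = cech_coboundary e sg" by(elim exE conjE)
 let ?b = "%sg. if sg <= \<Omega> then b sg - cech_coboundary e sg else 0"
 have "?b sg = 0" if "sg : \<K> Un Pow \<Omega>'" for sg using that
 proof
  assume "sg : \<K>"
  thus ?thesis using b(1) e(1) down by(simp add: cech_coboundary_incid)
 qed (use e(2) in auto)
 moreover have "c sg = cech_coboundary ?b sg" if "sg <= \<Omega>" for sg
 proof -
  have "cech_coboundary ?b sg = (SUM i:sg. incid i sg * (b (sg - {i}) - cech_coboundary e (sg - {i})))"
   unfolding cech_coboundary_incid[of ?b] using that by(intro sum.cong) auto
  also have "... = cech_coboundary b sg - cech_coboundary (cech_coboundary e) sg"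
   by(simp add: cech_coboundary_incid[of b] cech_coboundary_incid[of "cech_coboundary e"] right_diff_distrib sum_subtractf)
  finally show ?thesis using coboundary_coboundary[OF char finite_subset[OF that \<Omega>]] b(2) that by simp
 qed
 ultimately show "EX b. (ALL sg:\<K> Un Pow \<Omega>'. b sg = 0) & (ALL sg<=\<Omega>. c sg = cech_coboundary b sg)" by(intro exI[of _ ?b]) blast
qed

definition flags :: "(nat => 'n set set) => nat => 'n set set => nat set" where
 "flags V r C = {i. i < r & C <= V i}"

text \<open>A union of full simplices, one for each \<open>Y\<close> in \<T>, on the charts whose
  flag contains \<open>Y\<close>.\<close>

definition share :: "(nat => 'n set set) => nat => 'n set set => nat set set" where
 "share V r \<T> = {sg. EX Y:\<T>. sg <= flags V r {Y}}"

context
 fixes V :: "nat => 'n::finite set set" and r :: nat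
 assumes complete: "!!C. chain_subset C ==> EX i<r. C <= V i" and chain: "!!i. i < r ==> chain_subset (V i)"
begin

text \<open>Adjoining \<open>Y\<close> glues in one simplex, whose overlap is the same problem for
  flags that also contain \<open>Y\<close>; when \<open>Y\<close> does not form a chain with
  \<open>C\<close>, that overlap is empty.\<close>

lemma exact_off_insert: assumes char: "CHAR('k::field) = 0" and 1: "exact_off TYPE('k) (flags V r C) (share V r \<T>)" and ne: "\<T> ~= {}"
  and 2: "chain_subset (insert Y C) ==> exact_off TYPE('k) (flags V r (insert Y C)) (share V r \<T>)"
 shows "exact_off TYPE('k) (flags V r C) (share V r (insert Y \<T>))"
proof -
 have "flags V r C Int flags V r {Y} = flags V r (insert Y C)" by(auto simp: flags_def)
 moreover have "exact_off TYPE('k) (flags V r (insert Y C)) (share V r \<T>)"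
 proof(cases "chain_subset (insert Y C)")
  case False
  hence "flags V r (insert Y C) = {}" using chain by(auto simp: flags_def chain_subset_def)
  moreover have "{} : share V r \<T>" using ne by(auto simp: share_def)
  ultimately show ?thesis by(auto simp: exact_off_def cech_coboundary_def intro!: exI[of _ "%_. 0"])
 qed (rule 2)
 ultimately have "exact_off TYPE('k) (flags V r C) (share V r \<T> Un Pow (flags V r {Y}))"
  by(intro exact_off_glue[OF char _ _ 1]) (auto simp: share_def flags_def)
 moreover have "share V r (insert Y \<T>) = share V r \<T> Un Pow (flags V r {Y})" by(auto simp: share_def)
 ultimately show ?thesis by simp
qed

text \<open>The members of \<T> other than \<open>M\<close> are removed one at a time, and in each
  overlap \<open>M\<close> remains comparable with everything compatible. When only \<open>M\<close>
  is left, any flag through \<open>M\<close> and \<open>C\<close> is a cone point.\<close>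

lemma exact_off_apex: assumes char: "CHAR('k::field) = 0" and M: "M : \<T>" "chain_subset (insert M C)"
  and comp: "!!Y. Y : \<T> ==> chain_subset (insert Y C) ==> Y <= M | M <= Y" shows "exact_off TYPE('k) (flags V r C) (share V r \<T>)" using M comp
proof(induction "card \<T>" arbitrary: \<T> C rule: less_induct)
 case less
 show ?case
 proof(cases "\<T> = {M}")
  case True
  obtain v where v: "v < r" "insert M C <= V v" using complete[OF less.prems(2)] by blast
  show ?thesis unfolding True by(rule exact_off_cone[of _ v]) (use v in \<open>auto simp: flags_def share_def\<close>)
 next
  case False
  then obtain Y where Y: "Y : \<T>" "Y ~= M" using less.prems(1) by blast
  let ?T = "\<T> - {Y}"
  have lt: "card ?T < card \<T>" using Y(1) by(intro psubset_card_mono) auto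
  have MT: "M : ?T" using less.prems(1) Y(2) by auto
  have "exact_off TYPE('k) (flags V r C) (share V r (insert Y ?T))"
  proof(rule exact_off_insert[OF char])
   show "exact_off TYPE('k) (flags V r C) (share V r ?T)" using lt MT less.prems by(intro less.hyps) auto
   show "?T ~= {}" using MT by blast
   assume ch: "chain_subset (insert Y C)"
   show "exact_off TYPE('k) (flags V r (insert Y C)) (share V r ?T)"
   proof(rule less.hyps[OF lt MT])
    show "chain_subset (insert M (insert Y C))" using ch less.prems(2) less.prems(3)[OF Y(1) ch] by(auto simp: chain_subset_def)
    show "Z <= M | M <= Z" if "Z : ?T" "chain_subset (insert Z (insert Y C))" for Z using that less.prems(3)[of Z] by(auto simp: chain_subset_def)
   qed
  qed
  thus ?thesis using Y(1) by(simp add: insert_absorb)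
 qed
qed

text \<open>The poset contraction that passes from \<open>Y\<close> to \<open>Y Int M\<close> and on
  to \<open>M\<close>. A minimal \<open>Y\<close> not below \<open>M\<close> is removed; in its
  overlap every compatible set is comparable with \<open>Y Int M\<close>, because the smaller ones
  lie below \<open>M\<close> by minimality.\<close>

lemma exact_off_meet: assumes char: "CHAR('k::field) = 0" and M: "M : \<T>" "!!Y. Y : \<T> ==> Y Int M : \<T>"
 shows "exact_off TYPE('k) {..<r} (share V r \<T>)" using M
proof(induction "card {Y\<in>\<T>. ~ Y <= M}" arbitrary: \<T> rule: less_induct)
 case less
 have all: "{..<r} = flags V r {}" by(auto simp: flags_def)
 show ?case
 proof(cases "{Y\<in>\<T>. ~ Y <= M} = {}")
  case True
  thus ?thesis unfolding all using less.prems(1) by(intro exact_off_apex[OF char, of M]) (auto simp: chain_subset_def)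
 next
  case False
  then obtain Y where "Y : {Y\<in>\<T>. ~ Y <= M}" and min: "ALL Z:{Y\<in>\<T>. ~ Y <= M}. Z <= Y --> Z = Y"
   using finite_has_minimal[of "{Y\<in>\<T>. ~ Y <= M}"] by auto
  hence Y: "Y : \<T>" "~ Y <= M" by auto
  let ?T = "\<T> - {Y}"
  have MT: "M : ?T" and meet: "Z Int M : ?T" if "Z : \<T>" for Z using less.prems(1) less.prems(2)[OF that] Y(2) by auto
  have "exact_off TYPE('k) (flags V r {}) (share V r (insert Y ?T))"
  proof(rule exact_off_insert[OF char])
   show "exact_off TYPE('k) (flags V r {}) (share V r ?T)" unfolding all[symmetric]
   proof(rule less.hyps)
    show "card {Z\<in>?T. ~ Z <= M} < card {Y\<in>\<T>. ~ Y <= M}" using Y by(intro psubset_card_mono) auto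
   qed (use MT meet Y(1) in auto)
   show "?T ~= {}" using MT[OF Y(1)] by blast
   show "exact_off TYPE('k) (flags V r {Y}) (share V r ?T)"
   proof(rule exact_off_apex[OF char meet[OF Y(1)]])
    show "chain_subset (insert (Y Int M) {Y})" by(auto simp: chain_subset_def)
    show "Z <= Y Int M | Y Int M <= Z" if "Z : ?T" "chain_subset (insert Z {Y})" for Z using that min by(auto simp: chain_subset_def)
   qed
  qed
  thus ?thesis unfolding all using Y(1) by(simp add: insert_absorb)
 qed
qed

end

section \<open>Valuation rings and their centers\<close>

lemma is_subring_if: "subring V ring_of_type_algebra ==> is_subring (V :: 'a::comm_ring_1 set)"
proof -
 assume V: "subring V ring_of_type_algebra"
 interpret cring "ring_on (UNIV :: 'a set)" by(rule cring_ring_on[OF subring_UNIV])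
 note E = subringE[unfolded ring_on_UNIV, OF V]
 have "1 : V" using E(3) by simp
 moreover have "x - y : V" "x * y : V" if "x : V" "y : V" for x y using E(7)[OF that(1) E(5)[OF that(2)]] E(6)[OF that] by(simp_all add: a_inv_type)
 ultimately show ?thesis by(simp add: is_subring_def)
qed

lemma frac_field_subring: assumes A: "is_subring (A :: 'f::field set)" shows "is_subring (frac_field A)" unfolding is_subring_def
proof(intro conjI ballI)
 show "1 : frac_field A" using subring_1[OF A] unfolding frac_field_def by(intro CollectI exI[of _ 1]) simp
 fix x y assume "x : frac_field A" "y : frac_field A"
 then obtain a b c d where h: "x = a / b" "y = c / d" "a : A" "b : A" "c : A" "d : A" "b ~= 0" "d ~= 0" unfolding frac_field_def by blast
 hence "x - y = (a * d - c * b) / (b * d)" "x * y = (a * c) / (b * d)" "b * d ~= 0" by(simp_all add: field_simps)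
 moreover have "a * d - c * b : A" "a * c : A" "b * d : A" using h(3-6) by(auto intro: subring_diff[OF A] subring_mult[OF A])
 ultimately show "x - y : frac_field A" "x * y : frac_field A" unfolding frac_field_def by blast+
qed

lemma nonunits_field:
 "is_subring A ==> nonunits (ring_on (A :: 'f::field set)) = {x\<in>A. x = 0 | inverse x ~: A}"
proof -
 assume A: "is_subring A"
 have "(EX y:A. x * y = 1) \<longleftrightarrow> x ~= 0 & inverse x : A" for x by(metis mult_zero_left right_inverse zero_neq_one inverse_unique)
 thus ?thesis unfolding nonunits_def Units_ring_on[OF A] by auto
qed

context
 fixes V F :: "'f::field set" assumes V: "valuation_ring_of F V" and F: "is_subring F" "!!x. x : F ==> inverse x : F"
begin

lemma V_subring: "is_subring V" and V_sub: "V <= F" and V_or: "x : F ==> x : V | inverse x : V"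
 using V is_subring_if by(auto simp: valuation_ring_of_def)

lemma nonunits_V: "nonunits (ring_on V) = {x\<in>V. x = 0 | inverse x ~: V}" by(rule nonunits_field[OF V_subring])

text \<open>For a sum of nonzero elements, one of the two quotients of the summands lies in
  \<open>V\<close>, so the sum is a multiple of one of them.\<close>

lemma nonunits_ideal: "is_ideal V (nonunits (ring_on V))" unfolding is_ideal_def
proof(intro conjI ballI)
 note R = V_subring
 have mult: "a * x : nonunits (ring_on V)" if a: "a : V" and x: "x : nonunits (ring_on V)" for a x
 proof -
  have "inverse x : V" if "a ~= 0" "inverse (a * x) : V"
  proof -
   have "inverse x = a * inverse (a * x)" using that(1) by(cases "x = 0") (simp_all add: field_simps)
   thus ?thesis using subring_mult[OF R a that(2)] by(simp only:)
  qed
  thus ?thesis using a x subring_mult[OF R, of a x] by(auto simp: nonunits_V)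
 qed
 show "0 : nonunits (ring_on V)" using subring_0[OF R] by(simp add: nonunits_V)
 show "a * x : nonunits (ring_on V)" if "a : V" "x : nonunits (ring_on V)" for a x using that by(rule mult)
 fix x y assume x: "x : nonunits (ring_on V)" and y: "y : nonunits (ring_on V)"
 hence xy: "x : F" "y : F" using V_sub by(auto simp: nonunits_V)
 show "x + y : nonunits (ring_on V)"
 proof(cases "x = 0 | y = 0")
  case False
  have "x * inverse y : V | inverse (x * inverse y) : V" by(intro V_or subring_mult[OF F(1)] xy F(2))
  moreover have "x + y = (1 + x * inverse y) * y" "x + y = (1 + inverse (x * inverse y)) * x" using False by(simp_all add: field_simps)
  ultimately show ?thesis using mult[OF subring_add[OF R subring_1[OF R]]] x y by metis
 qed (use x y in auto)
qed (auto simp: nonunits_V)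

context
 fixes B assumes B: "is_subring B" "B <= V"
begin

definition center where "center = B Int nonunits (ring_on V)"

lemma center_prime: "is_prime B center" unfolding is_prime_def
proof(intro conjI ballI impI)
 show "is_ideal B center" using nonunits_ideal B ideal_0[OF nonunits_ideal] subring_0[OF B(1)] subring_add[OF B(1)] subring_mult[OF B(1)]
  unfolding is_ideal_def center_def by auto
 show "1 ~: center" by(simp add: center_def nonunits_V subring_1[OF V_subring])
 fix a b assume "a : B" "b : B" "a * b : center"
 thus "a : center | b : center" using B subring_mult[OF V_subring, of "inverse a" "inverse b"] by(auto simp: center_def nonunits_V)
qed

lemma localize_center: "localize B center = sat B center B" "is_subring (localize B center)"
 using localize_eq_sat[OF B(1) center_prime] sat_subring[OF B(1) center_prime] by auto

lemma inverse_in_localize: "b : B ==> inverse b : V ==> inverse b : localize B center"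
proof(cases "b = 0")
 case False
 assume "b : B" "inverse b : V"
 thus ?thesis using sat_unit[OF B(1) center_prime, of b] False unfolding localize_center(1) by(auto simp: center_def nonunits_V)
qed (use localize_center(2) subring_0 in auto)

lemma localize_sub: "B <= localize B center" unfolding localize_center(1) by(rule sat_superset[OF B(1) center_prime])

lemma localize_center_sub: "localize B center <= V"
 using B(2) subring_mult[OF V_subring] by(fastforce simp: localize_def center_def nonunits_V divide_inverse)

lemma dominates_center: "dominates V (localize B center)" unfolding dominates_def
proof(intro conjI localize_center_sub subsetI)
 fix z assume z: "z : nonunits (ring_on (localize B center))"
 hence "z : localize B center" by(simp add: nonunits_field[OF localize_center(2)])
 then obtain a s where as: "z = a / s" "a : B" "s : B" "s ~: center" by(auto simp: localize_def)
 have "inverse z ~: V" if "z ~= 0"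
 proof
  assume "inverse z : V"
  have "s ~= 0" using that as(1) by auto
  hence "inverse a : V" using as(3,4) B(2) \<open>inverse z : V\<close> subring_mult[OF V_subring, of "inverse z" "inverse s"]
   by(auto simp: as(1) center_def nonunits_V field_simps)
  hence "s * inverse a : localize B center" using as localize_sub inverse_in_localize[OF as(2)] by(intro subring_mult[OF localize_center(2)]) auto
  thus False using z that by(simp add: nonunits_field[OF localize_center(2)] as(1) divide_inverse mult.commute)
 qed
 thus "z : nonunits (ring_on V)" using \<open>z : localize B center\<close> localize_center_sub by(auto simp: nonunits_V)
qed

end

text \<open>Elements of \<open>B\<close> outside \<open>P\<close> are inverted in the local ring and
  so in \<open>V\<close>, while those inside \<open>P\<close> must stay nonunits of
  \<open>V\<close>; hence \<open>P\<close> is the center.\<close>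

lemma dominated_unique: assumes B: "is_subring B" and P: "is_prime B P" and dom: "dominates V (localize B P)"
 shows "B <= V" "localize B P = localize B (center B)"
proof -
 have loc: "localize B P = sat B P B" by(rule localize_eq_sat[OF B P])
 show BV: "B <= V" using dom sat_superset[OF B P, of B] unfolding loc dominates_def by blast
 have "P = center B"
 proof(intro equalityI subsetI)
  fix p assume p: "p : P"
  have "p : nonunits (ring_on (sat B P B))" unfolding nonunits_sat[OF B P] using p sat_superset[OF B P, of P] by blast
  thus "p : center B" unfolding center_def[OF B BV] using dom p P unfolding loc dominates_def by(auto simp: is_prime_def is_ideal_def)
 next
  fix p assume p: "p : center B"
  show "p : P"
  proof(rule ccontr)
   assume "p ~: P"
   hence "inverse p : V" using sat_unit[OF B P, of p] p dom unfolding loc dominates_def center_def[OF B BV] by blast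
   moreover have "p ~= 0" using \<open>p ~: P\<close> P by(auto simp: is_prime_def is_ideal_def)
   ultimately show False using p by(simp add: center_def[OF B BV] nonunits_V)
  qed
 qed
 thus "localize B P = localize B (center B)" by simp
qed

text \<open>A denominator of \<open>B'\<close> is a unit of \<open>V\<close>, and an element of a
  dominated local ring that is a unit of \<open>V\<close> is already a unit there.\<close>

lemma localize_center_mono: assumes B: "is_subring B" "B <= V" and B': "is_subring B'" "B' <= V" and sub: "B' <= localize B (center B)"
 shows "localize B' (center B') <= localize B (center B)"
proof
 let ?Q = "localize B (center B)"
 have Q: "is_subring ?Q" by(rule localize_center(2)[OF B])
 fix z assume "z : localize B' (center B')"
 then obtain a s where as: "z = a / s" "a : B'" "s : B'" "s ~: center B'" by(auto simp: localize_def)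
 have "inverse s : V" "s ~= 0" using as(3,4) B'(2) by(auto simp: center_def[OF B'] nonunits_V)
 hence "inverse s : ?Q" using dominates_center[OF B] as(3) sub unfolding dominates_def nonunits_field[OF Q] nonunits_V by auto
 thus "z : ?Q" using as sub by(auto simp: divide_inverse intro!: subring_mult[OF Q])
qed

end

section \<open>A toric resolution\<close>

definition xvar :: "'n => ('n::{finite, linorder}, 'k::field) mfrac" where
 "xvar i = to_fract (single (unit_exp i) 1)"

definition lmon :: "('n \<Rightarrow>\<^sub>0 int) => ('n::{finite, linorder}, 'k::field) mfrac" where
 "lmon u = (\<Prod>i\<in>UNIV. xvar i powi lookup u i)"

definition emb :: "('n::finite mon) => ('n \<Rightarrow>\<^sub>0 int)" where
 "emb w = pm (%i. int (lookup w i))"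

definition isc :: "int => ('n::finite \<Rightarrow>\<^sub>0 int) => ('n \<Rightarrow>\<^sub>0 int)" where
 "isc c u = pm (%i. c * lookup u i)"

lemma lookup_emb [simp]: "lookup (emb w) i = int (lookup w i)" and lookup_isc [simp]: "lookup (isc c u) i = c * lookup u i"
 by(simp_all add: emb_def isc_def)

lemma xvar_nonzero: "xvar i ~= (0 :: ('n::{finite, linorder}, 'k::field) mfrac)"
proof -
 have "single (unit_exp i) (1::'k) ~= 0" by(auto dest: arg_cong[where f = keys])
 thus ?thesis by(simp add: xvar_def)
qed

lemma prod_power_int: "(\<Prod>i\<in>A. f i :: 'a::field) powi c = (\<Prod>i\<in>A. f i powi c)"
 by(induction A rule: infinite_finite_induct) (auto simp: power_int_mult_distrib)

lemma lmon_0 [simp]: "lmon 0 = 1" and lmon_add: "lmon (u + v) = lmon u * lmon v" and lmon_nonzero: "lmon u ~= 0"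
 by(simp_all add: lmon_def lookup_add power_int_add xvar_nonzero prod.distrib)

lemma lmon_isc: "lmon (isc c u) = lmon u powi c" by(simp add: lmon_def prod_power_int mult.commute[of c] power_int_mult)

lemma lmon_diff: "lmon (u - v) = (lmon u / lmon v :: ('n::{finite, linorder}, 'k::field) mfrac)"
 unfolding nonzero_eq_divide_eq[OF lmon_nonzero] by(simp flip: lmon_add)

lemma lmon_sum: "lmon (SUM x:A. f x) = (\<Prod>x\<in>A. lmon (f x))" by(induction A rule: infinite_finite_induct) (auto simp: lmon_add)

lemma to_fract_prod: "to_fract (\<Prod>x\<in>A. f x) = (\<Prod>x\<in>A. to_fract (f x))" by(induction A rule: infinite_finite_induct) auto

lemma lmon_emb: "(lmon (emb w) :: ('n::{finite, linorder}, 'k::field) mfrac) = to_fract (single w 1)"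
proof -
 have "(SUM i:UNIV. single i (lookup w i)) = w" by(rule poly_mapping_eqI) (simp add: lookup_sum lookup_single when_def)
 hence "single w (1::'k) = (\<Prod>i\<in>UNIV. single (single i (lookup w i)) 1)" by(simp add: single_prod)
 thus ?thesis by(simp add: lmon_def xvar_def to_fract_prod single_power nscale_unit[simplified] flip: to_fract_power)
qed

definition ev :: "(('n \<Rightarrow>\<^sub>0 int) \<Rightarrow>\<^sub>0 'k) => ('n::{finite, linorder}, 'k::field) mfrac" where
 "ev = lin_ext (%u c. to_fract (single 0 c) * lmon u)"

lemma ev_add: "ev (f + g) = ev f + ev g" and ev_single: "ev (single u c) = to_fract (single 0 c) * lmon u" and ev_mult: "ev (f * g) = ev f * ev g"
 unfolding ev_def by(rule lin_ext_add lin_ext_single lin_ext_mult; simp add: single_add algebra_simps lmon_add mult_single flip: to_fract_mult)+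

lemma ev_0 [simp]: "ev 0 = 0" by(simp add: ev_def lin_ext_def)

lemma ev_sum: "ev (sum f A) = (SUM x:A. ev (f x))" by(rule additive_sum[of ev]) (rule ev_add)

lemma ev_uminus: "ev (- f) = - ev f" using ev_add[of f "- f"] by(simp add: eq_neg_iff_add_eq_0 add.commute)

text \<open>A monomial with exponent \<open>N\<close> clears all negative exponents; what remains is
  an ordinary polynomial with the same coefficients. Elements of \<open>lspan\<close> therefore have
  well-defined terms.\<close>

lemma ev_inject: assumes "ev f = ev g" shows "f = g"
proof -
 have zero: "f = 0" if z: "ev f = 0" for f :: "('n::{finite, linorder} \<Rightarrow>\<^sub>0 int) \<Rightarrow>\<^sub>0 'k::field"
 proof -
  define N :: "'n mon" where "N = pm (%i. SUM u:keys f. nat \<bar>lookup u i\<bar>)"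
  define t where "t u = pm (%i. nat (lookup u i + int (lookup N i)))" for u
  have t: "emb (t u) = u + emb N" if "u : keys f" for u
  proof(rule poly_mapping_eqI)
   fix i
   have "nat \<bar>lookup u i\<bar> <= lookup N i" using member_le_sum[of u "keys f" "%u. nat \<bar>lookup u i\<bar>"] that by(simp add: N_def)
   thus "lookup (emb (t u)) i = lookup (u + emb N) i" by(simp add: t_def lookup_add)
  qed
  have inj: "u = v" if "u : keys f" "v : keys f" "t u = t v" for u v using t[OF that(1)] t[OF that(2)] unfolding that(3) by(metis add_right_cancel)
  have "to_fract (SUM u:keys f. single (t u) (lookup f u)) = (SUM u:keys f. to_fract (single 0 (lookup f u)) * lmon (emb (t u)))"
   by(simp add: lmon_emb mult_single flip: to_fract_mult)
  also have "... = ev f * lmon (emb N)" by(simp add: t lmon_add ev_def lin_ext_def sum_distrib_right mult.assoc)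
  finally have s: "(SUM u:keys f. single (t u) (lookup f u)) = 0" unfolding z mult_zero_left to_fract_eq_0_iff .
  have "lookup f u = 0" if u: "u : keys f" for u
  proof -
   have "lookup (SUM u:keys f. single (t u) (lookup f u)) (t u) = (SUM v:keys f. if v = u then lookup f u else 0)" unfolding lookup_sum
   proof(rule sum.cong[OF refl])
    fix v assume "v : keys f"
    thus "lookup (single (t v) (lookup f v)) (t u) = (if v = u then lookup f u else 0)" using inj[OF _ u, of v] by(auto simp: lookup_single when_def)
   qed
   thus ?thesis using s u by simp
  qed
  thus "f = 0" by(intro poly_mapping_eqI) (metis in_keys_iff lookup_zero)
 qed
 have "ev (f - g) = 0" using ev_add[of f "- g"] assms by(simp add: ev_uminus)
 thus ?thesis using zero by fastforce
qed

definition lspan :: "('n \<Rightarrow>\<^sub>0 int) set => ('n::{finite, linorder}, 'k::field) mfrac set" where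
 "lspan U = ev ` {f. keys f <= U}"

lemma ground_field_eq: "ground_field = range (%c. to_fract (single 0 c))" by(auto simp: ground_field_def)

lemma lmon_in_lspan: "u : U ==> (lmon u :: ('n::{finite, linorder}, 'k::field) mfrac) : lspan U"
 unfolding lspan_def using ev_single[of u "1::'k"] by(intro image_eqI[of _ _ "single u 1"]) auto

lemma ground_sub_lspan: "0 : U ==> ground_field <= lspan U"
 unfolding lspan_def ground_field_eq by(auto simp: ev_single intro!: image_eqI[of _ ev "single 0 _"] split: if_splits)

lemma lspan_subring: assumes "0 : U" "!!u v. u : U ==> v : U ==> u + v : U"
 shows "is_subring (lspan U :: ('n::{finite, linorder}, 'k::field) mfrac set)" unfolding is_subring_def
proof(intro conjI ballI)
 show "1 : lspan U" using lmon_in_lspan[OF assms(1)] by simp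
 fix x y :: "('n, 'k) mfrac" assume "x : lspan U" "y : lspan U"
 then obtain f g where f: "x = ev f" "keys f <= U" "y = ev g" "keys g <= U" by(auto simp: lspan_def)
 have "x - y = ev (f - g)" using ev_add[of f "- g"] by(simp add: f ev_uminus)
 moreover have "keys (f - g) <= U" using f keys_diff[of f g] by auto
 ultimately show "x - y : lspan U" by(auto simp: lspan_def)
 have "keys (f * g) <= U" using f assms(2) keys_mult[of f g] by blast
 thus "x * y : lspan U" by(auto simp: lspan_def f simp flip: ev_mult)
qed

lemma lspan_least: assumes R: "is_subring R" "ground_field <= (R :: ('n::{finite, linorder}, 'k::field) mfrac set)" and U: "!!u. u : U ==> lmon u : R"
 shows "lspan U <= R"
proof
 fix z :: "('n, 'k) mfrac" assume "z : lspan U"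
 then obtain f where f: "z = ev f" "keys f <= U" by(auto simp: lspan_def)
 have "(SUM u:keys f. to_fract (single 0 (lookup f u)) * lmon u) : R"
  using f(2) R(2) by(intro subring_sum[OF R(1)] subring_mult[OF R(1)] U) (auto simp: ground_field_eq)
 thus "z : R" by(simp add: f(1) ev_def lin_ext_def)
qed

text \<open>All Laurent polynomials representing \<open>z\<close> agree by \<open>ev_inject\<close>,
  so the exponents of one of them lie in every \<open>U i\<close>.\<close>

lemma lspan_Inter:
 assumes "I ~= {}" "!!i. i : I ==> (z :: ('n::{finite, linorder}, 'k::field) mfrac) : lspan (U i)" shows "z : lspan (\<Inter>i\<in>I. U i)"
proof -
 obtain i0 where i0: "i0 : I" using assms(1) by blast
 then obtain f where f: "z = ev f" using assms(2) by(auto simp: lspan_def)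
 have "keys f <= U i" if i: "i : I" for i
 proof -
  obtain g where "z = ev g" "keys g <= U i" using assms(2)[OF i] by(auto simp: lspan_def)
  thus ?thesis using ev_inject[of f g] f by simp
 qed
 thus ?thesis using f by(auto simp: lspan_def)
qed

lemma mono_eval_prod: "length ks = length as ==> mono_eval as ks = (\<Prod>j<length as. (as ! j) ^ (ks ! j))"
proof(induction as ks rule: mono_eval.induct)
 case (1 a as k ks)
 thus ?case by(simp add: prod.lessThan_Suc_shift del: prod.lessThan_Suc)
qed auto

lemma indep_lmon: assumes inj: "!!E. inj_on (%ks. SUM j<length vs. isc (int (ks ! j)) (vs ! j)) (box (length vs) E)"
 shows "indep ground_field {0} (map lmon vs :: ('n::{finite, linorder}, 'k::field) mfrac list)" unfolding indep_def
proof(intro allI impI ballI)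
 let ?l = "%ks. SUM j<length vs. isc (int (ks ! j)) (vs ! j)"
 fix E ks0 and c :: "nat list => ('n, 'k) mfrac" assume h: "(ALL ks. c ks : ground_field) & lincomb c (map lmon vs) E : {0}"
  and ks0: "ks0 : box (length (map lmon vs)) E"
 hence "ALL ks. EX d. c ks = to_fract (single 0 d)" by(auto simp: ground_field_eq)
 then obtain d where d: "!!ks. c ks = to_fract (single 0 (d ks))" by metis
 let ?b = "box (length vs) E"
 have "ev (SUM ks:?b. single (?l ks) (d ks)) = (SUM ks:?b. c ks * mono_eval (map lmon vs) ks)" unfolding ev_sum
  by(intro sum.cong) (auto simp: ev_single d box_def mono_eval_prod lmon_sum lmon_isc)
 hence "(SUM ks:?b. single (?l ks) (d ks)) = 0" using h ev_inject[of "SUM ks:?b. single (?l ks) (d ks)" 0] by simp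
 moreover have "lookup (SUM ks:?b. single (?l ks) (d ks)) (?l ks0) = (SUM ks:?b. if ks = ks0 then d ks0 else 0)"
  unfolding lookup_sum using ks0 inj_onD[OF inj] by(intro sum.cong) (auto simp: lookup_single when_def)
 ultimately show "c ks0 = 0" using ks0 by(simp add: d)
qed

lemma adjoin_eq_adjoins_over: assumes K: "is_subring K" "K <= A" and A: "A <= adjoins K ys" shows "adjoin A (set ys) = adjoins K ys"
 unfolding adjoin_def
proof
 show "generate_ring ring_of_type_algebra (A Un set ys) <= adjoins K ys"
  using A adjoins_generators[OF K(1)] by(intro generate_ring_least adjoins_subring K) blast
 show "adjoins K ys <= generate_ring ring_of_type_algebra (A Un set ys)"
  using generate_ring_superset[of "A Un set ys"] K(2) by(intro adjoins_least generate_ring_subring) blast+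
qed

lemma regular_model_if: assumes K: "is_subfield K" and B: "!!i. i < r ==> EX ys. B i = adjoins K ys & indep K {0} ys" shows "regular_model r B"
 unfolding regular_model_def
proof(intro allI impI ballI)
 fix i Q assume i: "i < r" and Q: "Q : local_rings (B i)"
 obtain ys where ys: "B i = adjoins K ys" "indep K {0} ys" using B[OF i] by blast
 have S: "is_subring (adjoins K ys)" using K by(intro adjoins_subring) (simp add: is_subfield_def)
 then obtain P where P: "is_prime (adjoins K ys) P" "Q = localize (adjoins K ys) P"
  using Q primeideal_ring_on[OF S] by(auto simp: local_rings_def ys(1))
 show "regular_local (ring_on Q)" unfolding P(2) localize_eq_sat[OF S P(1)] by(rule regular_local_polynomial[OF K ys(2) P(1)])
qed

lemma frac_field_inverse: assumes A: "is_subring (A :: 'f::field set)" and "x : frac_field A" shows "inverse x : frac_field A"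
proof -
 obtain a b where ab: "x = a / b" "a : A" "b : A" "b ~= 0" using \<open>x : frac_field A\<close> by(auto simp: frac_field_def)
 show ?thesis
 proof(cases "a = 0")
  case True
  thus ?thesis using subring_0[OF frac_field_subring[OF A]] by(simp add: ab)
 next
  case False
  thus ?thesis using ab unfolding frac_field_def by(intro CollectI exI[of _ b] exI[of _ a]) simp
 qed
qed

text \<open>A chart inside \<open>V\<close> provides a dominated local ring, its localization at the
  center. If two charts lie in \<open>V\<close>, \<open>glue\<close> puts each into the local ring
  of the other, so the two local rings coincide.\<close>

lemma proper_model_if: assumes A: "is_subring (A :: 'f::field set)" and B: "!!i. i < r ==> is_subring (B i)" "!!i. i < r ==> B i <= frac_field A"
  and fin: "!!i. i < r ==> EX S. finite S & B i = adjoin A S" and ex: "!!V. valuation_ring_of (frac_field A) V ==> A <= V ==> EX i<r. B i <= V"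
  and glue: "!!V i j. valuation_ring_of (frac_field A) V ==> A <= V ==> i < r ==> j < r ==> B i <= V ==> B j <= V ==>
    B j <= localize (B i) (center V (B i))" shows "proper_birational_model A r B" unfolding proper_birational_model_def
proof(intro conjI allI impI)
 fix V assume "valuation_ring_of (frac_field A) V & A <= V"
 hence V: "valuation_ring_of (frac_field A) V" "A <= V" by auto
 note F = frac_field_subring[OF A] frac_field_inverse[OF A]
 obtain i where i: "i < r" "B i <= V" using ex[OF V] by blast
 let ?Q = "%i. localize (B i) (center V (B i))"
 show "EX! Q. Q : (\<Union>i<r. local_rings (B i)) & dominates V Q"
 proof(rule ex1I[of _ "?Q i"])
  have "?Q i : local_rings (B i)" unfolding local_rings_def primeideal_ring_on[OF B(1)[OF i(1)]]
   using center_prime[OF V(1) F B(1)[OF i(1)] i(2)] by blast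
  thus "?Q i : (\<Union>i<r. local_rings (B i)) & dominates V (?Q i)" using i(1) dominates_center[OF V(1) F B(1)[OF i(1)] i(2)] by blast
  fix Q assume Q: "Q : (\<Union>i<r. local_rings (B i)) & dominates V Q"
  then obtain j P where j: "j < r" "Q = localize (B j) P" "primeideal P (ring_on (B j))" by(auto simp: local_rings_def)
  hence P: "is_prime (B j) P" using primeideal_ring_on[OF B(1)[OF j(1)]] by blast
  have dom: "dominates V (localize (B j) P)" using Q j(2) by simp
  note u = dominated_unique[OF V(1) F B(1)[OF j(1)] P dom]
  have "?Q j = ?Q i" using localize_center_mono[OF V(1) F B(1)[OF j(1)] u(1) B(1)[OF i(1)] i(2) glue[OF V j(1) i(1) u(1) i(2)]]
    localize_center_mono[OF V(1) F B(1)[OF i(1)] i(2) B(1)[OF j(1)] u(1) glue[OF V i(1) j(1) i(2) u(1)]] by blast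
  thus "Q = ?Q i" using u(2) j(2) by simp
 qed
qed (use B fin in auto)

lemma poly_mapping_eq_if_sums:
 fixes u v :: "'n::finite \<Rightarrow>\<^sub>0 int"
 assumes e: "enumerates e" and eq: "!!k. k <= CARD('n) ==> sum (lookup u) (e ` {..<k}) = sum (lookup v) (e ` {..<k})" shows "u = v"
proof(rule poly_mapping_eqI)
 fix i
 obtain j where j: "j < CARD('n)" "i = e j" using e unfolding bij_betw_def by(metis UNIV_I imageE lessThan_iff)
 have "e j ~: e ` {..<j}" using e j(1) inj_on_image_mem_iff[of e "{..<CARD('n)}" j "{..<j}"] by(auto simp: bij_betw_def)
 hence "sum (lookup x) (e ` {..<Suc j}) = lookup x (e j) + sum (lookup x) (e ` {..<j})" for x :: "'n \<Rightarrow>\<^sub>0 int"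
  by(simp add: lessThan_Suc)
 thus "lookup u i = lookup v i" using eq[of j] eq[of "Suc j"] j by simp
qed

definition segs :: "(nat => 'n::finite) => 'n set set" where
 "segs e = (%k. e ` {..<k}) ` {..CARD('n)}"

lemma segs_cong: "(!!j. j < CARD('n) ==> e j = e' j) ==> segs (e :: nat => 'n::finite) = segs e'" unfolding segs_def by(intro image_cong refl) auto

lemma segs_chain: "chain_subset (segs e)"
proof -
 have "e ` {..<k} <= e ` {..<l} | e ` {..<l} <= e ` {..<k}" for k l by(cases "k <= l") (auto intro!: image_mono)
 thus ?thesis by(auto simp: chain_subset_def segs_def)
qed

text \<open>Order the variables by the number of members of \<open>C\<close> containing them; each
  member of the chain is a level set of this number, hence an initial segment.\<close>

lemma chain_in_segs: assumes C: "chain_subset (C :: 'n::finite set set)" shows "EX e. enumerates e & C <= segs e"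
proof -
 let ?w = "%x. card {Y\<in>C. x : Y}"
 obtain e where e: "sorts e ?w" using sorts_exists by blast
 have "Y : segs e" if Y: "Y : C" for Y
 proof -
  have lt: "?w y < ?w x" if "x : Y" "y ~: Y" for x y
  proof(rule psubset_card_mono)
   show "{Y\<in>C. y : Y} \<subset> {Y\<in>C. x : Y}" using C Y that unfolding chain_subset_def by blast
  qed simp
  have "EX v. Y = {x. v <= ?w x}"
  proof(cases "Y = {}")
   case True
   have "?w x <= card C" for x by(intro card_mono) auto
   thus ?thesis using True by(intro exI[of _ "Suc (card C)"]) (auto simp: not_le less_Suc_eq_le)
  next
   case False
   hence "Min (?w ` Y) : ?w ` Y" by(intro Min_in) auto
   then obtain x where x: "x : Y" "Min (?w ` Y) = ?w x" by blast
   have "?w x <= ?w y" if "y : Y" for y using Min_le[of "?w ` Y" "?w y"] that x(2) by simp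
   hence "Y = {y. ?w x <= ?w y}" using lt[OF x(1)] by(auto simp: not_le[symmetric])
   thus ?thesis by blast
  qed
  then obtain v where v: "Y = {x. v <= ?w x}" by blast
  show ?thesis unfolding segs_def v using upper_set_initial[OF e, of v] by(intro image_eqI) auto
 qed
 thus ?thesis using e by(auto simp: sorts_def)
qed

text \<open>An enumeration is a function on all natural numbers, but matters only below
  \<open>CARD('n)\<close>; lists without repetition provide finitely many representatives.\<close>

lemma all_orders:
 "EX (r::nat) ord. (ALL i<r. bij_betw (ord i) {..<CARD('n)} (UNIV :: 'n::finite set)) &
   (ALL e. enumerates e --> (EX i<r. ALL j<CARD('n). ord i j = e j))"
proof -
 let ?E = "{xs :: 'n list. distinct xs & set xs = UNIV}"
 have "?E <= {xs. set xs <= UNIV & length xs = CARD('n)}" by(auto simp flip: distinct_card)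
 hence "finite ?E" by(rule finite_subset) (rule finite_lists_length_eq, simp)
 then obtain h where h: "bij_betw h {0..<card ?E} ?E" using ex_bij_betw_nat_finite by blast
 have 1: "ALL i<card ?E. bij_betw ((!) (h i)) {..<CARD('n)} UNIV"
 proof(intro allI impI)
  fix i assume "i < card ?E"
  hence "h i : ?E" using h unfolding bij_betw_def by auto
  thus "bij_betw ((!) (h i)) {..<CARD('n)} UNIV" by(intro bij_betw_nth) (auto simp flip: distinct_card)
 qed
 have 2: "ALL e. enumerates e --> (EX i<card ?E. ALL j<CARD('n). h i ! j = e j)"
 proof(intro allI impI)
  fix e :: "nat => 'n" assume e: "enumerates e"
  have "map e [0..<CARD('n)] : ?E" using e by(auto simp: bij_betw_def distinct_map lessThan_atLeast0)
  then obtain i where i: "i < card ?E" "h i = map e [0..<CARD('n)]" using h unfolding bij_betw_def by(metis (no_types, lifting) atLeastLessThan_iff imageE)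
  thus "EX i<card ?E. ALL j<CARD('n). h i ! j = e j" by(intro exI[of _ i]) simp
 qed
 show ?thesis by(intro exI[where x = "card ?E"] exI[where x = "%i. (!) (h i)"] conjI 1 2)
qed

lemma lookup_incid: "lookup (incid i sg * f) u = incid i sg * (lookup f u :: 'k::comm_ring_1)"
 by(cases "even (card {j\<in>sg. j < i})") (simp_all add: incid_def)

lemma ev_incid: "ev (incid i sg * f) = incid i sg * ev f" by(cases "even (card {j\<in>sg. j < i})") (simp_all add: incid_def ev_uminus)

section \<open>Charts of the toric resolution\<close>

context borel_generator
begin

abbreviation isz :: "('n \<Rightarrow>\<^sub>0 int) => int" where "isz u \<equiv> sum (lookup u) UNIV"

text \<open>The polytope inequalities are imposed only for the sets in the family: all sets give the
  toric ring, the initial segments of one order a chart, and common segments an overlap of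
  charts.\<close>

definition cone :: "'n set set => ('n \<Rightarrow>\<^sub>0 int) set" where
 "cone \<V> = {u. int D dvd isz u & 0 <= isz u & (ALL Y:\<V>. int D * sum (lookup u) Y <= isz u * int (rk (card Y)))}"

lemma cone_0: "0 : cone \<V>" and cone_add: "u : cone \<V> ==> v : cone \<V> ==> u + v : cone \<V>"
 by(auto simp: cone_def lookup_add sum.distrib distrib_left distrib_right intro!: add_mono)

lemma lspan_cone_subring: "is_subring (lspan (cone \<V>) :: ('n, 'k::field) mfrac set)" using cone_0 cone_add by(rule lspan_subring)

lemma cone_antimono: "\<V> <= \<W> ==> cone \<W> <= cone \<V>" by(auto simp: cone_def)

lemma lspan_mono: "U <= U' ==> lspan U <= lspan U'" by(auto simp: lspan_def)

definition dom :: "('n, 'k::field) mfrac set" where "dom = to_fract ` monoid_ring S"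

lemma emb_in_cone: "w : S ==> emb w : cone \<V>"
proof -
 assume w: "w : S"
 have s: "sum (lookup (emb w)) T = int (sum (lookup w) T)" for T by simp
 have "int (D * sum (lookup w) Y) <= int (esize w * rk (card Y))" for Y using w unfolding in_S_iff by(simp only: zle_int)
 thus ?thesis using w unfolding cone_def mem_Collect_eq s in_S_iff esize_def by(simp del: of_nat_sum)
qed

lemma dom_eq: "dom = (lspan (cone UNIV) :: ('n, 'k::field) mfrac set)"
proof
 note R = lspan_cone_subring[of UNIV, where 'k = 'k]
 show "dom <= (lspan (cone UNIV) :: ('n, 'k) mfrac set)"
 proof
  fix z :: "('n, 'k) mfrac" assume "z : dom"
  then obtain f where f: "z = to_fract f" "keys f <= S" by(auto simp: dom_def monoid_ring_def)
  have "ev (SUM t:keys f. single (emb t) (lookup f t)) = (SUM t:keys f. to_fract (single 0 (lookup f t) * single t 1))"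
   unfolding ev_sum ev_single lmon_emb by simp
  also have "... = to_fract (SUM t:keys f. single 0 (lookup f t) * single t 1)" by simp
  also have "(SUM t:keys f. single 0 (lookup f t) * single t 1) = f" by(simp add: mult_single sum_single_lookup)
  finally have "z = ev (SUM t:keys f. single (emb t) (lookup f t))" by(simp add: f(1))
  moreover have "keys (SUM t:keys f. single (emb t) (lookup f t)) <= cone UNIV"
   using keys_sum[of "%t. single (emb t) (lookup f t)" "keys f"] f(2) emb_in_cone by(fastforce split: if_splits)
  ultimately show "z : lspan (cone UNIV)" by(auto simp: lspan_def)
 qed
 show "(lspan (cone UNIV) :: ('n, 'k) mfrac set) <= dom"
 proof(rule lspan_least)
  show "is_subring (dom :: ('n, 'k) mfrac set)" unfolding dom_def by(rule to_fract_subring[OF ring_subring])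
  show "ground_field <= (dom :: ('n, 'k) mfrac set)" unfolding ground_field_def dom_def using S_zero by(auto intro!: imageI single_in_monoid_ring)
  fix u assume u: "u : cone UNIV"
  \<comment> \<open>A coordinate is nonnegative by the inequality for its complement, as
    \<open>rk\<close> there is at most \<open>D\<close>.\<close>
  have nn: "0 <= lookup u i" for i
  proof -
   have "rk (CARD('n) - 1) <= D" using rk_ge[of "CARD('n) - 1" "CARD('n)" 0] by(simp add: rk_card)
   hence "isz u * int (rk (CARD('n) - 1)) <= isz u * int D" using u by(intro mult_left_mono) (auto simp: cone_def)
   moreover have "int D * sum (lookup u) (UNIV - {i}) <= isz u * int (rk (CARD('n) - 1))"
    using u by(auto simp: cone_def card_Diff_singleton dest!: spec[of _ "UNIV - {i}"])
   moreover have "isz u = lookup u i + sum (lookup u) (UNIV - {i})" by(simp add: sum.remove)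
   ultimately have "0 <= int D * lookup u i" by(simp add: algebra_simps)
   thus ?thesis using D_pos by(simp add: zero_le_mult_iff)
  qed
  define w where "w = pm (%i. nat (lookup u i))"
  have uw: "u = emb w" by(rule poly_mapping_eqI) (simp add: w_def nn)
  have "w : S" unfolding in_S_iff
  proof
   show "D dvd esize w" using u by(simp add: cone_def uw esize_def flip: of_nat_sum)
   show "ALL T. D * sum (lookup w) T <= esize w * rk (card T)"
   proof
    fix T
    have "int D * sum (lookup u) T <= isz u * int (rk (card T))" using u by(simp add: cone_def)
    hence "int (D * sum (lookup w) T) <= int (esize w * rk (card T))" by(simp add: uw esize_def)
    thus "D * sum (lookup w) T <= esize w * rk (card T)" by(simp only: zle_int)
   qed
  qed
  thus "lmon u : (dom :: ('n, 'k) mfrac set)" unfolding uw lmon_emb dom_def by(intro imageI single_in_monoid_ring)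
 qed
qed

text \<open>The basis dual to \<open>coef\<close>: on the lattice of integer vectors with total
  divisible by \<open>D\<close>, the coordinates are the total over \<open>D\<close> and the slack
  at each proper initial segment. \<open>vec e 0\<close> is \<open>lam\<close> arranged along
  \<open>e\<close>, which has no slack.\<close>

definition vec :: "(nat => 'n) => nat => 'n \<Rightarrow>\<^sub>0 int" where
 "vec e j = (if j = 0 then pm (%i. int (lam_seq (the_inv_into {..<CARD('n)} e i))) else single (e j) 1 - single (e (j - 1)) 1)"

definition chart :: "(nat => 'n) => ('n, 'k::field) mfrac set" where
 "chart e = adjoins ground_field (map lmon (map (vec e) [0..<CARD('n)]))"

context
 fixes e :: "nat => 'n" assumes e: "enumerates e"
begin

lemma e_mem: "j < CARD('n) ==> k <= CARD('n) ==> e j : e ` {..<k} \<longleftrightarrow> j < k"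
 using inj_on_image_mem_iff[of e "{..<CARD('n)}" j "{..<k}"] e by(simp add: bij_betw_def)

lemma e_card: "k <= CARD('n) ==> card (e ` {..<k}) = k" by(rule pre_eq_sum(2)[OF e])

lemma e_all: "e ` {..<CARD('n)} = UNIV" using e by(simp add: bij_betw_def)

lemma sum_unit: "k <= CARD('n) ==> j < CARD('n) ==> sum (lookup (single (e j) (1::int))) (e ` {..<k}) = (if j < k then 1 else 0)"
 using e_mem[of j k] by(simp add: lookup_single when_def sum.delta)

lemma sum_vec: assumes k: "k <= CARD('n)" and j: "j < CARD('n)"
 shows "sum (lookup (vec e j)) (e ` {..<k}) = (if j = 0 then int (rk k) else if j = k then -1 else 0)"
proof(cases "j = 0")
 case True
 have inj: "inj_on e {..<k}" using e k unfolding bij_betw_def by(auto intro: inj_on_subset)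
 have "sum (lookup (vec e j)) (e ` {..<k}) = (SUM i<k. int (lam_seq i))" unfolding sum.reindex[OF inj] using k e
  by(intro sum.cong) (auto simp: True vec_def bij_betw_def the_inv_into_f_f)
 thus ?thesis by(simp add: True rk_def)
next
 case False
 have "sum (lookup (vec e j)) (e ` {..<k}) = sum (lookup (single (e j) (1::int))) (e ` {..<k}) - sum (lookup (single (e (j - 1)) (1::int))) (e ` {..<k})"
  using False by(simp add: vec_def lookup_minus sum_subtractf)
 also have "... = (if j < k then 1 else 0) - (if j - 1 < k then 1 else 0)" unfolding sum_unit[OF k j] sum_unit[OF k less_imp_diff_less[OF j]] ..
 finally show ?thesis using False by auto
qed

lemma sum_combination: assumes k: "k <= CARD('n)"
 shows "sum (lookup (SUM j<CARD('n). isc (c j) (vec e j))) (e ` {..<k}) = c 0 * int (rk k) - (if 0 < k & k < CARD('n) then c k else 0)"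
proof -
 have "sum (lookup (SUM j<CARD('n). isc (c j) (vec e j))) (e ` {..<k}) = (SUM j<CARD('n). c j * sum (lookup (vec e j)) (e ` {..<k}))"
 proof -
  have "sum (lookup (SUM j<CARD('n). isc (c j) (vec e j))) (e ` {..<k}) = (SUM x:e ` {..<k}. SUM j<CARD('n). c j * lookup (vec e j) x)"
   by(rule sum.cong) (simp_all add: lookup_sum)
  thus ?thesis unfolding sum_distrib_left by(simp only: sum.swap[of _ "{..<CARD('n)}"])
 qed
 also have "... = (SUM j<CARD('n). (if j = 0 then c 0 * int (rk k) else 0) - (if j = k & 0 < k then c k else 0))"
  using k by(intro sum.cong) (auto simp: sum_vec)
 also have "... = c 0 * int (rk k) - (if 0 < k & k < CARD('n) then c k else 0)" by(cases "0 < k") (simp_all add: sum_subtractf)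
 finally show ?thesis .
qed

definition coef :: "('n \<Rightarrow>\<^sub>0 int) => nat => int" where
 "coef u j = (if j = 0 then isz u div int D else (isz u div int D) * int (rk j) - sum (lookup u) (e ` {..<j}))"

lemma decomposition: "int D dvd isz u ==> u = (SUM j<CARD('n). isc (coef u j) (vec e j))"
proof(rule poly_mapping_eq_if_sums[OF e])
 assume d: "int D dvd isz u"
 fix k assume k: "k <= CARD('n)"
 show "sum (lookup u) (e ` {..<k}) = sum (lookup (SUM j<CARD('n). isc (coef u j) (vec e j))) (e ` {..<k})"
 proof(cases "0 < k & k < CARD('n)")
  case False
  hence "k = 0 | k = CARD('n)" using k by auto
  thus ?thesis using d by(auto simp: sum_combination[OF k] coef_def e_all rk_card)
 qed (simp add: sum_combination[OF k] coef_def)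
qed

lemma lmon_decomposition: "int D dvd isz u ==> lmon u = (\<Prod>j<CARD('n). lmon (vec e j) powi coef u j)"
 using decomposition[of u] by(metis (no_types, lifting) lmon_isc lmon_sum prod.cong)

lemma coef_nonneg: "u : cone \<V> ==> j = 0 | j < CARD('n) & e ` {..<j} : \<V> ==> 0 <= coef u j"
proof(cases "j = 0")
 case False
 assume "u : cone \<V>" "j = 0 | j < CARD('n) & e ` {..<j} : \<V>"
 hence "int D dvd isz u" "int D * sum (lookup u) (e ` {..<j}) <= isz u * int (rk j)" using False by(auto simp: cone_def e_card)
 hence "int D * sum (lookup u) (e ` {..<j}) <= int D * ((isz u div int D) * int (rk j))" by(metis dvd_mult_div_cancel mult.assoc)
 thus ?thesis using D_pos False by(simp add: coef_def)
qed (auto simp: coef_def cone_def intro: div_int_pos_iff[THEN iffD2])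

lemma vec_in_cone: "j < CARD('n) ==> vec e j : cone (segs e)" using sum_vec[OF le_refl, of j] sum_vec[of _ j] D_pos
 by(auto simp: cone_def segs_def e_all e_card rk_card)

lemma later_minus_earlier_in_cone:
 "p < q ==> q < CARD('n) ==> single (e q) 1 - single (e p) 1 : cone (segs e)"
proof -
 assume pq: "p < q" "q < CARD('n)"
 have s: "sum (lookup (single (e q) 1 - single (e p) 1 :: 'n \<Rightarrow>\<^sub>0 int)) (e ` {..<k}) = (if q < k then 1 else 0) - (if p < k then 1 else 0)"
  if "k <= CARD('n)" for k
 proof -
  have "sum (lookup (single (e q) 1 - single (e p) 1 :: 'n \<Rightarrow>\<^sub>0 int)) (e ` {..<k})
    = sum (lookup (single (e q) (1::int))) (e ` {..<k}) - sum (lookup (single (e p) (1::int))) (e ` {..<k})"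
   unfolding sum_subtractf[symmetric] by(rule sum.cong) (simp_all add: lookup_minus)
  thus ?thesis by(simp only: sum_unit[OF that pq(2)] sum_unit[OF that less_trans[OF pq]])
 qed
 have "isz (single (e q) 1 - single (e p) 1) = 0" using s[OF le_refl] pq by(simp add: e_all)
 thus ?thesis using s pq by(auto simp: cone_def segs_def mult_le_0_iff)
qed

text \<open>In the basis \<open>vec e\<close> the elements of the cone have nonnegative coordinates,
  so the chart is a polynomial ring and a monoid algebra at once.\<close>

lemma chart_eq: "chart e = (lspan (cone (segs e)) :: ('n, 'k::field) mfrac set)"
proof
 have K: "is_subring (ground_field :: ('n, 'k) mfrac set)" using ground_field_subfield unfolding is_subfield_def by blast
 show "chart e <= (lspan (cone (segs e)) :: ('n, 'k) mfrac set)" unfolding chart_def using ground_sub_lspan[OF cone_0] vec_in_cone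
  by(intro adjoins_least lspan_cone_subring) (auto intro: lmon_in_lspan)
 note R = adjoins_subring[OF K, of "map lmon (map (vec e) [0..<CARD('n)])", folded chart_def]
 have gen: "(lmon (vec e j) :: ('n, 'k) mfrac) : chart e" if "j < CARD('n)" for j
  using adjoins_generators[OF K, of "map lmon (map (vec e) [0..<CARD('n)])"] that unfolding chart_def by auto
 show "(lspan (cone (segs e)) :: ('n, 'k) mfrac set) <= chart e"
 proof(rule lspan_least[OF R])
  show "ground_field <= (chart e :: ('n, 'k) mfrac set)" unfolding chart_def by(rule adjoins_superset[OF K])
  fix u assume u: "u : cone (segs e)"
  have "lmon (vec e j) powi coef u j : (chart e :: ('n, 'k) mfrac set)" if "j < CARD('n)" for j
  proof -
   have "0 <= coef u j" using that by(intro coef_nonneg[OF u]) (auto simp: segs_def)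
   thus ?thesis using subring_power[OF R gen[OF that], of "nat (coef u j)"] by(simp add: power_int_def)
  qed
  hence "(\<Prod>j<CARD('n). lmon (vec e j) powi coef u j) : (chart e :: ('n, 'k) mfrac set)" by(intro subring_prod[OF R]) auto
  moreover have "int D dvd isz u" using u by(simp add: cone_def)
  ultimately show "lmon u : (chart e :: ('n, 'k) mfrac set)" by(simp only: lmon_decomposition)
 qed
qed

lemma chart_subring: "is_subring (chart e :: ('n, 'k::field) mfrac set)" unfolding chart_eq by(rule lspan_cone_subring)

lemma dom_sub_chart: "dom <= (chart e :: ('n, 'k::field) mfrac set)" unfolding dom_eq chart_eq by(intro lspan_mono cone_antimono) simp

lemma chart_indep: "indep ground_field {0} (map lmon (map (vec e) [0..<CARD('n)]) :: ('n, 'k::field) mfrac list)"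
proof(rule indep_lmon)
 let ?vs = "map (vec e) [0..<CARD('n)]"
 fix E
 have eq: "(SUM j<length ?vs. isc (int (ks ! j)) (?vs ! j)) = (SUM j<CARD('n). isc (int (ks ! j)) (vec e j))" for ks by(intro sum.cong) auto
 show "inj_on (%ks. SUM j<length ?vs. isc (int (ks ! j)) (?vs ! j)) (box (length ?vs) E)" unfolding eq
 proof(rule inj_onI)
  fix ks ls assume ks: "ks : box (length ?vs) E" and ls: "ls : box (length ?vs) E"
   and h: "(SUM j<CARD('n). isc (int (ks ! j)) (vec e j)) = (SUM j<CARD('n). isc (int (ls ! j)) (vec e j))"
  have s: "int (ks ! 0) * int (rk k) - (if 0 < k & k < CARD('n) then int (ks ! k) else 0)
    = int (ls ! 0) * int (rk k) - (if 0 < k & k < CARD('n) then int (ls ! k) else 0)" if "k <= CARD('n)" for k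
   using arg_cong[OF h, of "%u. sum (lookup u) (e ` {..<k})"] unfolding sum_combination[OF that] .
  have z: "ks ! 0 = ls ! 0" using s[OF le_refl] D_pos by(simp add: rk_card)
  show "ks = ls"
  proof(rule nth_equalityI)
   show "length ks = length ls" using ks ls by(simp add: box_def)
   fix k assume "k < length ks"
   hence "k < CARD('n)" using ks by(simp add: box_def)
   thus "ks ! k = ls ! k" using s[of k] z by(cases "k = 0") auto
  qed
 qed
qed

end

text \<open>Some permutation of \<open>lam\<close> has a smaller exponent at \<open>a\<close> than
  at \<open>b\<close>; it and its shift towards \<open>a\<close> are two generators whose quotient
  is the ratio.\<close>

lemma ratio_in_frac: assumes lam: "lookup lam p ~= lookup lam q" and ab: "a ~= b"
 shows "lmon (single a 1 - single b 1) : frac_field (dom :: ('n, 'k::field) mfrac set)"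
proof -
 have *: ?thesis if pq: "lookup lam p < lookup lam q" for p q
 proof -
  have "p ~= q" using pq by auto
  \<comment> \<open>Two transpositions that together carry \<open>a\<close> to \<open>p\<close> and
    \<open>b\<close> to \<open>q\<close>.\<close>
  let ?t = "Transposition.transpose a p" let ?s = "Transposition.transpose (?t b) q"
  have bij: "bij (?s \<circ> ?t)" by(intro bij_comp bij_transpose)
  have "?t b ~= p" using ab by(metis transpose_apply_first transpose_involutory)
  hence st: "(?s \<circ> ?t) a = p" "(?s \<circ> ?t) b = q" using \<open>p ~= q\<close> by(auto simp: transpose_apply_other)
  let ?g = "pm (lookup lam \<circ> (?s \<circ> ?t))"
  have g: "?g : G" by(rule permute_in_G[OF lam_in_G bij])
  have lt: "lookup ?g a < lookup ?g b" using pq st by(simp only: lookup_pm o_apply[of "lookup lam"])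
  let ?v = "?g + unit_exp a - unit_exp b"
  have v: "?v + unit_exp b = ?g + unit_exp a" using lt by(intro poly_mapping_eqI) (auto simp: lookup_add lookup_minus lookup_single when_def)
  have vG: "?v : G" by(rule exchange_in_G[OF g lt v])
  have "single a 1 - single b 1 = emb ?v - emb ?g"
  proof(rule poly_mapping_eqI)
   fix x
   show "lookup (single a 1 - single b 1) x = lookup (emb ?v - emb ?g) x"
    using move_lookup[OF v, of x] by(simp only: lookup_minus[of "emb _"] lookup_minus[of "single _ (_::int)"] lookup_emb lookup_single when_def) (auto split: if_splits)
  qed
  hence "lmon (single a 1 - single b 1) = (lmon (emb ?v) / lmon (emb ?g) :: ('n, 'k) mfrac)" by(simp only: lmon_diff)
  moreover have "(lmon (emb w) :: ('n, 'k) mfrac) : dom" if "w : G" for w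
   using that G_sub_S unfolding dom_eq by(intro lmon_in_lspan emb_in_cone) blast
  ultimately show ?thesis unfolding frac_field_def using vG g lmon_nonzero by blast
 qed
 show ?thesis using lam * linorder_neqE_nat by blast
qed

text \<open>For a subring \<open>R\<close> this is a preorder on the variables; for a valuation ring
  of a field containing all ratios it is total.\<close>

definition lies_in :: "'n => 'n => ('n, 'k::field) mfrac set => bool" where
 "lies_in a b R \<longleftrightarrow> lmon (single a 1 - single b 1) : R"

lemma lies_in_refl: "is_subring R ==> lies_in a a R" by(simp add: lies_in_def subring_1)

lemma lies_in_trans: "is_subring R ==> lies_in a b R ==> lies_in b c R ==> lies_in a c R"
 unfolding lies_in_def using subring_mult[of R] by(fastforce simp flip: lmon_add)

lemma lies_in_inverse: "lies_in a b (R :: ('n, 'k::field) mfrac set) \<longleftrightarrow> inverse (lmon (single b 1 - single a 1)) : R"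
proof -
 have "lmon (single a 1 - single b 1) = inverse (lmon (single b 1 - single a 1) :: ('n, 'k::field) mfrac)" by(simp add: lmon_diff)
 thus ?thesis by(simp only: lies_in_def)
qed

lemma vec_lies_in: "j ~= 0 ==> lies_in (e j) (e (j - 1)) R \<longleftrightarrow> lmon (vec e j) : R" by(simp add: lies_in_def vec_def)

lemma later_lies_in: assumes "enumerates e" "p < q" "q < CARD('n)" shows "lies_in (e q) (e p) (chart e :: ('n, 'k::field) mfrac set)"
 unfolding lies_in_def chart_eq[OF assms(1)] by(intro lmon_in_lspan later_minus_earlier_in_cone assms)

lemma ground_sub_dom: "ground_field <= (dom :: ('n, 'k::field) mfrac set)" unfolding dom_eq by(rule ground_sub_lspan[OF cone_0])

lemma ground_subring: "is_subring (ground_field :: ('n, 'k::field) mfrac set)" using ground_field_subfield unfolding is_subfield_def by blast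

lemma vec_0_in_dom: assumes e: "enumerates e" shows "(lmon (vec e 0) :: ('n, 'k::field) mfrac) : dom"
proof -
 let ?p = "lam_order \<circ> the_inv_into {..<CARD('n)} e"
 have bl: "enumerates lam_order" using lam_order by(simp add: sorts_def)
 have p: "bij ?p" using bij_betw_trans[OF bij_betw_the_inv_into[OF e] bl] .
 have "the_inv_into {..<CARD('n)} e i < CARD('n)" for i using bij_betw_the_inv_into[OF e] unfolding bij_betw_def by auto
 hence "vec e 0 = emb (pm (lookup lam \<circ> ?p))" by(intro poly_mapping_eqI) (simp add: vec_def lam_seq_def)
 moreover have "pm (lookup lam \<circ> ?p) : S" using permute_in_G[OF lam_in_G p] G_sub_S by blast
 ultimately show ?thesis unfolding dom_eq by(simp only: lmon_in_lspan emb_in_cone)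
qed

lemma chart_least: assumes e: "enumerates e" and R: "is_subring R" "(dom :: ('n, 'k::field) mfrac set) <= R"
  and step: "!!j. 0 < j ==> j < CARD('n) ==> lies_in (e j) (e (j - 1)) R" shows "chart e <= R" unfolding chart_def
proof(rule adjoins_least[OF R(1)])
 show "ground_field <= R" using ground_sub_dom R(2) by blast
 have "lmon (vec e j) : R" if "j < CARD('n)" for j
  using step[OF _ that] vec_lies_in[of j e R] vec_0_in_dom[OF e, where 'k = 'k] R(2) by(cases "j = 0") auto
 thus "set (map lmon (map (vec e) [0..<CARD('n)])) <= R" by auto
qed

text \<open>In the basis of one chart, a coordinate of \<open>u\<close> can be negative only at a
  segment that the charts do not share. It remains to see that there the generator is invertible in
  the generated ring.\<close>

lemma generate_charts: assumes ord: "!!i. i < r ==> enumerates (ord i)" and sg: "sg <= {..<r}" "sg ~= {}"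
 shows "generate_ring ring_of_type_algebra (\<Union>i\<in>sg. chart (ord i)) = (lspan (cone (\<Inter>i\<in>sg. segs (ord i))) :: ('n, 'k::field) mfrac set)"
  (is "?R = _")
proof
 have ord': "enumerates (ord i)" if "i : sg" for i using ord that sg(1) by auto
 have "(chart (ord i) :: ('n, 'k) mfrac set) <= lspan (cone (\<Inter>i\<in>sg. segs (ord i)))" if "i : sg" for i
  unfolding chart_eq[OF ord'[OF that]] using that by(intro lspan_mono cone_antimono) blast
 thus "?R <= lspan (cone (\<Inter>i\<in>sg. segs (ord i)))" by(intro generate_ring_least lspan_cone_subring) blast
 note R = generate_ring_subring[of "\<Union>i\<in>sg. chart (ord i) :: ('n, 'k) mfrac set"]
 have sub: "(chart (ord i) :: ('n, 'k) mfrac set) <= ?R" if "i : sg" for i using that by(intro order_trans[OF UN_upper generate_ring_superset])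
 obtain i where i: "i : sg" using sg(2) by blast
 note e = ord'[OF i]
 let ?e = "ord i"
 have gen: "(lmon (vec ?e j) :: ('n, 'k) mfrac) : ?R" if "j < CARD('n)" for j
  using vec_in_cone[OF e that] sub[OF i] unfolding chart_eq[OF e] by(blast intro: lmon_in_lspan)
 show "lspan (cone (\<Inter>i\<in>sg. segs (ord i))) <= ?R"
 proof(rule lspan_least[OF R])
  show "ground_field <= ?R" using ground_sub_dom dom_sub_chart[OF e] sub[OF i] by blast
  fix u assume u: "u : cone (\<Inter>i\<in>sg. segs (ord i))"
  have "lmon (vec ?e k) powi coef ?e u k : ?R" if k: "k < CARD('n)" for k
  proof(cases "0 <= coef ?e u k")
   case True
   thus ?thesis using subring_power[OF R gen[OF k], of "nat (coef ?e u k)"] by(simp add: power_int_def)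
  next
   case False
   hence k0: "k ~= 0" and nc: "?e ` {..<k} ~: (\<Inter>i\<in>sg. segs (ord i))" using coef_nonneg[OF e u, of k] k by auto
   let ?a = "?e k"
   \<comment> \<open>The variables whose quotient by \<open>?a\<close> is missing from the ring form
     an initial segment of every order involved. This common segment differs from the first
     \<open>k\<close> variables, which are not shared, and omits \<open>?a\<close>; so it omits the
     neighbour \<open>?e (k - 1)\<close> as well, and the generator is invertible.\<close>
   let ?W = "{b. ~ lies_in b ?a ?R}"
   have W: "?W : segs (ord j)" if j: "j : sg" for j
   proof -
    define A where "A = {q\<in>{..<CARD('n)}. ord j q : ?W}"
    have "A = {..<card A}"
    proof(rule downset_nat)
     fix p q assume q: "q : A" and pq: "p <= q"
     have "~ lies_in (ord j p) ?a ?R"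
     proof
      assume p: "lies_in (ord j p) ?a ?R"
      hence "p ~= q" using q by(auto simp: A_def)
      hence "lies_in (ord j q) (ord j p) ?R"
       using later_lies_in[OF ord'[OF j], of p q, where 'k = 'k] pq q[unfolded A_def] sub[OF j] by(auto simp: lies_in_def)
      from lies_in_trans[OF R this p] show False using q by(simp add: A_def)
     qed
     thus "p : A" using pq q by(auto simp: A_def)
    qed (simp add: A_def)
    moreover have "?W = ord j ` A" using ord'[OF j] unfolding bij_betw_def A_def by(intro surj_image) simp
    moreover have "card A <= card {..<CARD('n)}" by(rule card_mono) (auto simp: A_def)
    ultimately show ?thesis unfolding segs_def by(intro image_eqI[of _ _ "card A"]) auto
   qed
   obtain q where q: "q <= CARD('n)" "?W = ?e ` {..<q}" using W[OF i] by(auto simp: segs_def)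
   have "?a ~: ?W" using lies_in_refl[OF R] by simp
   hence "q <= k" using e_mem[OF e k q(1)] q(2) by simp
   moreover have "q ~= k" using W nc q(2) by auto
   ultimately have "?e (k - 1) ~: ?W" using e_mem[OF e less_imp_diff_less[OF k] q(1)] q(2) k0 by simp
   hence "inverse (lmon (vec ?e k)) : ?R" using k0 by(simp add: lies_in_inverse vec_def)
   hence "inverse (lmon (vec ?e k)) ^ nat (- coef ?e u k) : ?R" by(rule subring_power[OF R])
   thus ?thesis using False by(simp add: power_int_def)
  qed
  hence "(\<Prod>j<CARD('n). lmon (vec ?e j) powi coef ?e u j) : ?R" by(intro subring_prod[OF R]) auto
  moreover have "int D dvd isz u" using u by(simp add: cone_def)
  ultimately show "lmon u : ?R" by(simp only: lmon_decomposition[OF e])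
 qed
qed

text \<open>The degree \<open>u\<close> part of the Cech complex is a relative cochain complex: a set of charts does not
 contain the monomial \<open>u\<close> in its coordinate ring iff its orders share an initial segment \<open>Y\<close> of
 positive excess. The excess is supermodular, so its maximum point is the apex of a contraction.\<close>

lemma exact_degree: assumes char: "CHAR('k::field) = 0" and r: "0 < r" and ord: "!!i. i < r ==> enumerates (ord i)"
  and complete: "!!C. chain_subset C ==> EX i<r. C <= segs (ord i)"
  and off: "!!sg. sg <= {..<r} ==> sg ~= {} ==> u ~: cone (\<Inter>i\<in>sg. segs (ord i)) ==> c sg = (0::'k)" and c0: "c {} = 0"
  and cocycle: "!!sg. sg <= {..<r} ==> cech_coboundary c sg = 0"
 shows "EX b. (ALL sg<={..<r}. sg ~= {} --> u ~: cone (\<Inter>i\<in>sg. segs (ord i)) --> b sg = 0) & (ALL sg<={..<r}. c sg = cech_coboundary b sg)"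
proof(cases "int D dvd isz u & 0 <= isz u")
 case False
 hence "u ~: cone (\<Inter>i\<in>sg. segs (ord i))" for sg by(auto simp: cone_def)
 hence "c sg = 0" if "sg <= {..<r}" for sg using off[OF that] c0 by(cases "sg = {}") auto
 thus ?thesis by(intro exI[of _ "%_. 0"]) (simp add: cech_coboundary_incid)
next
 case True
 define V where "V i = segs (ord i)" for i
 define ex where "ex Y = int D * sum (lookup u) Y - isz u * int (rk (card Y))" for Y
 let ?T = "{Y. 0 < ex Y}"
 have ch: "chain_subset (V i)" for i unfolding V_def by(rule segs_chain)
 note cpl = complete[folded V_def]
 have sh: "sg : share V r ?T \<longleftrightarrow> u ~: cone (\<Inter>i\<in>sg. segs (ord i))" if "sg <= {..<r}" for sg
 proof -
  have "sg : share V r ?T \<longleftrightarrow> (EX Y:(\<Inter>i\<in>sg. segs (ord i)). 0 < ex Y)"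
   unfolding share_def flags_def using that by(auto simp: V_def)
  thus ?thesis using True by(auto simp: cone_def ex_def not_le)
 qed
 have super: "ex A + ex B <= ex (A Un B) + ex (A Int B)" for A B
 proof -
  have "sum (lookup u) (A Un B) + sum (lookup u) (A Int B) = sum (lookup u) A + sum (lookup u) B" by(rule sum.union_inter) auto
  hence 1: "int D * sum (lookup u) (A Un B) + int D * sum (lookup u) (A Int B) = int D * sum (lookup u) A + int D * sum (lookup u) B"
   by(metis distrib_left)
  have "int (rk (card (A Un B)) + rk (card (A Int B))) <= int (rk (card A) + rk (card B))" using rk_submodular by(simp only: zle_int)
  hence "isz u * int (rk (card (A Un B)) + rk (card (A Int B))) <= isz u * int (rk (card A) + rk (card B))" using True by(intro mult_left_mono) auto
  thus ?thesis using 1 by(simp add: ex_def distrib_left)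
 qed
 have exact: "exact_off TYPE('k) {..<r} (share V r ?T)"
 proof(cases "?T = {}")
  case True
  show ?thesis unfolding True by(rule exact_off_cone[of _ 0]) (use r in \<open>auto simp: share_def\<close>)
 next
  case False
  have "Max (range ex) : range ex" by(intro Max_in) auto
  then obtain M where "ex M = Max (range ex)" by(metis rangeE)
  hence M: "ex Y <= ex M" for Y by(metis Max_ge finite finite_imageI rangeI)
  obtain B where "0 < ex B" using False by blast
  show ?thesis
  proof(rule exact_off_meet[OF cpl ch char, of M])
   show "M : ?T" using M[of B] \<open>0 < ex B\<close> by simp
   show "Y Int M : ?T" if "Y : ?T" for Y using super[of Y M] M[of "Y Un M"] that by simp
  qed
 qed
 have "(ALL sg:share V r ?T. c sg = 0) & (ALL sg<={..<r}. cech_coboundary c sg = 0)"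
 proof(intro conjI ballI allI impI cocycle)
  fix sg assume sg: "sg : share V r ?T"
  hence "sg <= {..<r}" by(auto simp: share_def flags_def)
  thus "c sg = 0" using off[of sg] sh[of sg] sg c0 by(cases "sg = {}") auto
 qed
 from exact[unfolded exact_off_def, THEN spec, THEN mp, OF this]
 obtain b where b: "ALL sg:share V r ?T. b sg = 0" "ALL sg<={..<r}. c sg = cech_coboundary b sg" by(elim exE conjE)
 show ?thesis using b sh by(intro exI[of _ b]) blast
qed

end

context borel_generator
begin

text \<open>Cochains take values in Laurent polynomials. The coboundary equation is solved for each
  exponent separately by \<open>exact_degree\<close>, and only finitely many exponents
  occur.\<close>

lemma charts_acyclic: assumes char: "CHAR('k::field) = 0" and r: "0 < r" and ord: "!!i. i < r ==> enumerates (ord i)"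
  and complete: "!!C. chain_subset C ==> EX i<r. C <= segs (ord i)" shows "higher_cohomology_vanishes r (%i. chart (ord i) :: ('n, 'k) mfrac set)"
 unfolding higher_cohomology_vanishes_def
proof(intro allI impI)
 fix p and c :: "nat set => ('n, 'k) mfrac"
 let ?Z = "%p. cech_simplices r p" and ?U = "%sg. cone (\<Inter>i\<in>sg. segs (ord i))"
 assume c: "cech_cocycle r (%i. chart (ord i)) (Suc p) c"
 have gen: "generate_ring ring_of_type_algebra (\<Union>i\<in>sg. chart (ord i) :: ('n, 'k) mfrac set) = lspan (?U sg)" if "sg : ?Z q" for sg q
  using that by(intro generate_charts[OF ord]) (auto simp: cech_simplices_def)
 have face: "sg - {i} : ?Z q \<longleftrightarrow> sg : ?Z (Suc q)" if "sg <= {..<r}" "i : sg" for sg i q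
 proof -
  have "card sg = Suc (card (sg - {i}))" using finite_subset[OF that(1)] that(2) by(intro card.remove) auto
  thus ?thesis using that(1) by(auto simp: cech_simplices_def)
 qed
 have "EX f. sg : ?Z (Suc p) --> c sg = ev f & keys f <= ?U sg" for sg
 proof(cases "sg : ?Z (Suc p)")
  case True
  hence "c sg : lspan (?U sg)" using c gen[OF True] by(auto simp: cech_cocycle_def cech_cochain_def)
  thus ?thesis by(auto simp: lspan_def)
 qed simp
 hence "EX f. ALL sg. sg : ?Z (Suc p) --> c sg = ev (f sg) & keys (f sg) <= ?U sg" by(intro choice allI)
 then obtain f where f: "!!sg. sg : ?Z (Suc p) ==> c sg = ev (f sg)" "!!sg. sg : ?Z (Suc p) ==> keys (f sg) <= ?U sg" by blast
 \<comment> \<open>\<open>exact_degree\<close> treats cochains of all dimensions at once, so the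
   given one is extended by zero to the other simplices.\<close>
 define C where "C sg = (if sg : ?Z (Suc p) then f sg else 0)" for sg
 have "EX b. (ALL sg<={..<r}. sg ~= {} --> u ~: ?U sg --> b sg = 0) & (ALL sg<={..<r}. lookup (C sg) u = cech_coboundary b sg)" for u
 proof(rule exact_degree[OF char r ord complete])
  show "lookup (C sg) u = 0" if "u ~: ?U sg" for sg
  proof(cases "sg : ?Z (Suc p)")
   case True
   hence "u ~: keys (f sg)" using f(2)[of sg] that by blast
   thus ?thesis using True by(simp add: C_def in_keys_iff)
  qed (simp add: C_def)
  show "lookup (C {}) u = 0" by(simp add: C_def cech_simplices_def)
  fix sg assume sg: "sg <= {..<r}"
  have "(SUM i:sg. incid i sg * C (sg - {i})) = 0"
  proof(cases "sg : ?Z (Suc (Suc p))")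
   case True
   have "ev (SUM i:sg. incid i sg * C (sg - {i})) = cech_coboundary c sg"
    unfolding cech_coboundary_incid ev_sum ev_incid using f(1) face[OF sg] True by(intro sum.cong) (auto simp: C_def)
   also have "... = 0" using c True by(simp add: cech_cocycle_def)
   finally show ?thesis using ev_inject[of _ 0] by simp
  next
   case False
   thus ?thesis using face[OF sg] by(intro sum.neutral) (auto simp: C_def)
  qed
  from arg_cong[OF this, of "%z. lookup z u"] show "cech_coboundary (%sg. lookup (C sg) u) sg = 0"
   by(simp add: cech_coboundary_incid lookup_sum lookup_incid)
 qed
 hence "EX \<beta>. ALL u. (ALL sg<={..<r}. sg ~= {} --> u ~: ?U sg --> \<beta> u sg = 0) & (ALL sg<={..<r}. lookup (C sg) u = cech_coboundary (\<beta> u) sg)"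
  by(intro choice allI)
 then obtain \<beta> where \<beta>: "!!u sg. sg <= {..<r} ==> sg ~= {} ==> u ~: ?U sg ==> \<beta> u sg = 0"
  "!!u sg. sg <= {..<r} ==> lookup (C sg) u = cech_coboundary (\<beta> u) sg" by(elim exE) metis
 define Y where "Y = (\<Union>sg\<in>Pow {..<r}. keys (C sg))"
 have "finite Y" by(simp add: Y_def)
 define b where "b sg = (SUM u:Y. single u (\<beta> u sg))" for sg
 have lb: "lookup (b sg) u = (if u : Y then \<beta> u sg else 0)" for sg u
  using \<open>finite Y\<close> by(simp add: b_def lookup_sum lookup_single when_def)
 have "cech_cochain r (%i. chart (ord i)) p (%sg. ev (b sg))" unfolding cech_cochain_def
 proof
  fix sg assume sg: "sg : ?Z p"
  hence "sg <= {..<r}" "sg ~= {}" by(auto simp: cech_simplices_def)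
  hence "keys (b sg) <= ?U sg" using \<beta>(1)[of sg] by(auto simp: in_keys_iff lb split: if_splits)
  thus "ev (b sg) : generate_ring ring_of_type_algebra (\<Union>i\<in>sg. chart (ord i))" unfolding gen[OF sg] lspan_def by blast
 qed
 moreover have "c sg = cech_coboundary (%sg. ev (b sg)) sg" if sg: "sg : ?Z (Suc p)" for sg
 proof -
  have s: "sg <= {..<r}" using sg by(simp add: cech_simplices_def)
  have "C sg = (SUM i:sg. incid i sg * b (sg - {i}))"
  proof(rule poly_mapping_eqI)
   fix u
   have "lookup (C sg) u = 0" if "u ~: Y" using that s by(auto simp: Y_def in_keys_iff)
   thus "lookup (C sg) u = lookup (SUM i:sg. incid i sg * b (sg - {i})) u"
    using \<beta>(2)[OF s, of u] by(cases "u : Y") (simp_all add: lookup_sum lookup_incid lb cech_coboundary_incid)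
  qed
  hence "ev (C sg) = (SUM i:sg. incid i sg * ev (b (sg - {i})))" by(simp add: ev_sum ev_incid)
  thus ?thesis using f(1)[OF sg] sg by(simp add: C_def cech_coboundary_incid)
 qed
 ultimately show "EX b. cech_cochain r (%i. chart (ord i)) p b & (ALL sg:?Z (Suc p). c sg = cech_coboundary b sg)"
  by(intro exI[of _ "%sg. ev (b sg)"]) blast
qed

lemma dom_subring: "is_subring (dom :: ('n, 'k::field) mfrac set)" unfolding dom_eq by(rule lspan_cone_subring)

lemma dom_sub_frac: "dom <= frac_field (dom :: ('n, 'k::field) mfrac set)"
proof
 fix x :: "('n, 'k) mfrac" assume "x : dom"
 thus "x : frac_field dom" using subring_1[OF dom_subring] unfolding frac_field_def by(intro CollectI exI[of _ x] exI[of _ 1]) simp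
qed

lemmas dom_fraction_field = frac_field_subring[OF dom_subring] frac_field_inverse[OF dom_subring]

text \<open>The bound for single variables makes every exponent in \<open>G\<close> at most that of
  \<open>lam\<close>, and equal degree leaves \<open>lam\<close> as the only generator.\<close>

lemma constant_dom: assumes const: "!!p q. lookup lam p = lookup lam q"
 shows "dom = adjoins ground_field (map lmon [emb lam] :: ('n, 'k::field) mfrac list)"
proof -
 have "w = lam" if w: "w : G" for w
 proof(rule ccontr)
  have le: "lookup w i <= lookup lam i" for i
  proof -
   have "lookup w i <= rk 1" using G_leI[OF w, of "{i}"] by simp
   also have "rk 1 = lookup lam i" using const[of "lam_order 0" i] by(simp add: rk_def lam_seq_def)
   finally show ?thesis .
  qed
  assume "w ~= lam"
  then obtain i where "lookup w i ~= lookup lam i" using poly_mapping_eqI[of w lam] by blast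
  hence "esize w < esize lam" unfolding esize_def using le by(intro sum_strict_mono_ex1) (auto simp: le_less)
  thus False using w by(simp add: G_def D_def)
 qed
 hence G: "G = {lam}" using lam_in_G by blast
 have "set [single lam (1::'k)] = (%g. single g 1) ` G" by(simp add: G)
 hence "dom = to_fract ` adjoins scalars [single lam (1::'k)]" unfolding dom_def by(simp only: ring_generated)
 also have "... = adjoins ground_field (map lmon [emb lam])"
  unfolding to_fract_adjoins[OF scalars_subring] by(simp only: list.map lmon_emb ground_field_def scalars_def)
 finally show ?thesis .
qed

lemma rational_singularities_constant: assumes const: "!!p q. lookup lam p = lookup lam q"
 shows "EX r B. proper_birational_model dom r B & regular_model r B & (\<Inter>i<r. B i) = (dom :: ('n, 'k::field) mfrac set) &
  higher_cohomology_vanishes r B"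
proof(intro exI[of _ "1::nat"] exI[of _ "%_. dom"] conjI)
 show "proper_birational_model dom 1 (%_. dom :: ('n, 'k) mfrac set)"
 proof(rule proper_model_if[OF dom_subring dom_subring dom_sub_frac])
  have "dom = adjoin (dom :: ('n, 'k) mfrac set) {}" unfolding adjoin_def
   using generate_ring_least[OF dom_subring subset_refl] generate_ring_superset[of dom] by auto
  thus "EX S. finite S & dom = adjoin (dom :: ('n, 'k) mfrac set) S" by blast
 qed (use localize_sub[OF _ dom_fraction_field dom_subring] in auto)
 show "regular_model 1 (%_. dom :: ('n, 'k) mfrac set)"
 proof(rule regular_model_if[OF ground_field_subfield])
  obtain i where i: "lookup lam i ~= 0" using lam_nonzero by(metis poly_mapping_eqI lookup_zero)
  have "indep ground_field {0} (map lmon [emb lam] :: ('n, 'k) mfrac list)"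
  proof(rule indep_lmon)
   fix E
   show "inj_on (%ks. SUM j<length [emb lam]. isc (int (ks ! j)) ([emb lam] ! j)) (box (length [emb lam]) E)"
   proof(rule inj_onI)
    fix ks ls assume ks: "ks : box (length [emb lam]) E" "ls : box (length [emb lam]) E"
     and h: "(SUM j<length [emb lam]. isc (int (ks ! j)) ([emb lam] ! j)) = (SUM j<length [emb lam]. isc (int (ls ! j)) ([emb lam] ! j))"
    from arg_cong[OF h, of "%u. lookup u i"] have "ks ! 0 = ls ! 0" using i by simp
    moreover have "ks = [ks ! 0]" "ls = [ls ! 0]" using ks by(auto simp: box_def length_Suc_conv)
    ultimately show "ks = ls" by metis
   qed
  qed
  thus "EX ys. dom = adjoins ground_field ys & indep ground_field {0} (ys :: ('n, 'k) mfrac list)" using constant_dom[OF const] by blast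
 qed
 show "higher_cohomology_vanishes 1 (%_. dom :: ('n, 'k) mfrac set)"
 proof -
  have "cech_simplices 1 (Suc p) = {}" for p
  proof -
   have le: "card sg <= 1" if "sg <= {..<1::nat}" for sg using card_mono[OF _ that] by simp
   have "card sg ~= Suc (Suc p)" if "sg <= {..<1::nat}" for sg using le[OF that] by linarith
   thus ?thesis unfolding cech_simplices_def by blast
  qed
  thus ?thesis unfolding higher_cohomology_vanishes_def cech_cochain_def
   by(intro allI impI exI[of _ "%_. 0"] conjI ballI subring_0[OF generate_ring_subring]) simp
 qed
qed (simp add: lessThan_Suc)

text \<open>Divisibility in \<open>V\<close> is a total preorder on the variables; counting the
  \<open>c\<close> with \<open>lies_in c a V\<close> turns it into numbers that can be
  sorted.\<close>

lemma chart_in_valuation_ring: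
 assumes pq: "lookup lam p ~= lookup lam q" and V: "valuation_ring_of (frac_field (dom :: ('n, 'k::field) mfrac set)) V" "dom <= V"
 shows "EX e. enumerates e & (ALL j. 0 < j & j < CARD('n) --> lies_in (e j) (e (j - 1)) V)"
proof -
 note R = V_subring[OF V(1) dom_fraction_field]
 let ?w = "%a. card {c. lies_in c a V}"
 obtain e where e: "sorts e ?w" using sorts_exists by blast
 hence b: "enumerates e" by(simp add: sorts_def)
 have "lies_in (e j) (e (j - 1)) V" if j: "0 < j" "j < CARD('n)" for j
 proof(rule ccontr)
  assume n: "~ lies_in (e j) (e (j - 1)) V"
  have neq: "e j ~= e (j - 1)" using b j by(auto simp: bij_betw_def dest: inj_onD)
  have "lies_in (e (j - 1)) (e j) V"
   using V_or[OF V(1) dom_fraction_field ratio_in_frac[OF pq neq]] n unfolding lies_in_inverse[of "e (j - 1)"] by(simp add: lies_in_def)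
  hence "{c. lies_in c (e (j - 1)) V} \<subset> {c. lies_in c (e j) V}" using n lies_in_trans[OF R] lies_in_refl[OF R] by blast
  hence "?w (e (j - 1)) < ?w (e j)" by(intro psubset_card_mono) auto
  moreover have "?w (e j) <= ?w (e (j - 1))" using e j by(simp add: sorts_def)
  ultimately show False by simp
 qed
 thus ?thesis using b by blast
qed

text \<open>A ratio of neighbours in \<open>e'\<close> or its inverse belongs to
  \<open>chart e\<close>. In the second case it is a unit of \<open>V\<close>, hence of the local
  ring at the center.\<close>

lemma charts_glue: assumes V: "valuation_ring_of (frac_field (dom :: ('n, 'k::field) mfrac set)) V"
  and e: "enumerates e" "chart e <= V" and e': "enumerates e'" "chart e' <= V" shows "chart e' <= localize (chart e) (center V (chart e))"
proof(rule chart_least[OF e'(1)])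
 let ?Q = "localize (chart e) (center V (chart e))"
 note ctx = V dom_fraction_field chart_subring[OF e(1)] e(2)
 note sub = localize_sub[OF ctx]
 show "is_subring ?Q" by(rule localize_center(2)[OF ctx])
 show "dom <= ?Q" using sub dom_sub_chart[OF e(1)] by blast
 fix j assume j: "0 < j" "j < CARD('n)"
 let ?a = "e' j" and ?b = "e' (j - 1)"
 have V: "lies_in ?a ?b V" using later_lies_in[OF e'(1), of "j - 1" j, where 'k = 'k] j e'(2) by(auto simp: lies_in_def)
 obtain x y where xy: "x < CARD('n)" "?a = e x" "y < CARD('n)" "?b = e y" using e(1) unfolding bij_betw_def by(metis UNIV_I imageE lessThan_iff)
 have "?a ~= ?b" using e'(1) j by(auto simp: bij_betw_def dest: inj_onD)
 then consider "y < x" | "x < y" using xy by(cases x y rule: linorder_cases) auto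
 thus "lies_in ?a ?b ?Q"
 proof cases
  case 1
  thus ?thesis using later_lies_in[OF e(1) 1 xy(1), where 'k = 'k] sub xy by(auto simp: lies_in_def)
 next
  case 2
  hence "lies_in ?b ?a (chart e :: ('n, 'k) mfrac set)" using later_lies_in[OF e(1) 2 xy(3)] xy by simp
  thus ?thesis using inverse_in_localize[OF ctx, of "lmon (single ?b 1 - single ?a 1)"] V unfolding lies_in_inverse[of ?a] by(simp add: lies_in_def)
 qed
qed

lemma rational_singularities_nonconstant: assumes pq: "lookup lam p ~= lookup lam q" and char: "CHAR('k::field) = 0"
 shows "EX r B. proper_birational_model dom r B & regular_model r B & (\<Inter>i<r. B i) = (dom :: ('n, 'k) mfrac set) &
  higher_cohomology_vanishes r B"
proof -
 obtain r :: nat and ord where ord: "!!i. i < r ==> bij_betw (ord i) {..<CARD('n)} (UNIV :: 'n set)"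
  and all: "!!e. enumerates e ==> EX i<r. ALL j<CARD('n). ord i j = e j" using all_orders by metis
 have complete: "EX i<r. C <= segs (ord i)" if "chain_subset C" for C
 proof -
  obtain e where e: "enumerates e" "C <= segs e" using chain_in_segs[OF \<open>chain_subset C\<close>] by blast
  obtain i where "i < r" "ALL j<CARD('n). ord i j = e j" using all[OF e(1)] by blast
  thus ?thesis using e(2) segs_cong[of "ord i" e] by auto
 qed
 have r: "0 < r" using complete[of "{}"] by(auto simp: chain_subset_def)
 let ?B = "%i. chart (ord i) :: ('n, 'k) mfrac set"
 have "proper_birational_model dom r ?B"
 proof(rule proper_model_if[OF dom_subring chart_subring[OF ord]])
  fix i assume i: "i < r"
  show "?B i <= frac_field dom"
  proof(rule chart_least[OF ord[OF i] dom_fraction_field(1) dom_sub_frac])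
   fix j assume "0 < j" "j < CARD('n)"
   hence "ord i j ~= ord i (j - 1)" using ord[OF i] by(auto simp: bij_betw_def dest: inj_onD)
   thus "lies_in (ord i j) (ord i (j - 1)) (frac_field (dom :: ('n, 'k) mfrac set))" unfolding lies_in_def by(rule ratio_in_frac[OF pq])
  qed
  have "adjoin dom (set (map lmon (map (vec (ord i)) [0..<CARD('n)]))) = ?B i"
   unfolding chart_def by(rule adjoin_eq_adjoins_over[OF ground_subring ground_sub_dom dom_sub_chart[OF ord[OF i], unfolded chart_def]])
  thus "EX S. finite S & ?B i = adjoin dom S" by(metis finite_set)
 next
  fix V assume V: "valuation_ring_of (frac_field (dom :: ('n, 'k) mfrac set)) V" "dom <= V"
  obtain e where e: "enumerates e" "!!j. 0 < j ==> j < CARD('n) ==> lies_in (e j) (e (j - 1)) V" using chart_in_valuation_ring[OF pq V] by blast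
  obtain i where i: "i < r" "ALL j<CARD('n). ord i j = e j" using all[OF e(1)] by blast
  have "?B i <= V"
  proof(rule chart_least[OF ord[OF i(1)] V_subring[OF V(1) dom_fraction_field] V(2)])
   fix j assume j: "0 < j" "j < CARD('n)"
   hence "ord i j = e j" "ord i (j - 1) = e (j - 1)" using i(2) by auto
   thus "lies_in (ord i j) (ord i (j - 1)) V" using e(2)[OF j] by simp
  qed
  thus "EX i<r. ?B i <= V" using i(1) by blast
 next
  show "?B j <= localize (?B i) (center V (?B i))"
   if "valuation_ring_of (frac_field (dom :: ('n, 'k) mfrac set)) V" "i < r" "j < r" "?B i <= V" "?B j <= V" for V i j
   using that ord by(intro charts_glue)
 qed
 moreover have "regular_model r ?B"
  by(rule regular_model_if[OF ground_field_subfield]) (use chart_indep[OF ord] in \<open>auto simp: chart_def\<close>)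
 moreover have "(\<Inter>i<r. ?B i) = dom"
 proof(intro equalityI subsetI)
  fix z assume z: "z : (\<Inter>i<r. ?B i)"
  have "z : lspan (\<Inter>i\<in>{..<r}. cone (segs (ord i)))" by(rule lspan_Inter) (use r z chart_eq[OF ord, where 'k = 'k] in auto)
  moreover have "(\<Inter>i\<in>{..<r}. cone (segs (ord i))) <= cone UNIV"
  proof
   fix u assume u: "u : (\<Inter>i\<in>{..<r}. cone (segs (ord i)))"
   \<comment> \<open>Every set of variables is an initial segment of some order, so the charts
     together impose all inequalities.\<close>
   have "int D * sum (lookup u) Y <= isz u * int (rk (card Y))" for Y
   proof -
    obtain i where "i < r" "Y : segs (ord i)" using complete[of "{Y}"] by(auto simp: chain_subset_def)
    thus ?thesis using u by(auto simp: cone_def)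
   qed
   thus "u : cone UNIV" using u r by(auto simp: cone_def)
  qed
  ultimately show "z : dom" unfolding dom_eq using lspan_mono by blast
 qed (use dom_sub_chart[OF ord, where 'k = 'k] in auto)
 ultimately show ?thesis using charts_acyclic[OF char r ord complete] by blast
qed

lemma rational_singularities_dom: assumes "CHAR('k::field) = 0" shows "rational_singularities (dom :: ('n, 'k) mfrac set)"
 unfolding rational_singularities_def
proof(intro conjI)
 show "domain (ring_on (dom :: ('n, 'k) mfrac set))" by(rule domain_ring_on[OF dom_subring])
 show "noetherian_ring (ring_on (dom :: ('n, 'k) mfrac set))" unfolding dom_def by(rule noetherian_imp[OF noetherian_ring])
 show "EX r B. proper_birational_model dom r B & regular_model r B & (\<Inter>i<r. B i) = (dom :: ('n, 'k) mfrac set) &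
  higher_cohomology_vanishes r B" using rational_singularities_constant rational_singularities_nonconstant[OF _ assms] by blast
qed

lemma toric_domain_up: "toric_domain (up :: ('n, 'k::field) mpoly set) = dom" by(simp add: toric_domain_def toric_ring_up dom_def)

end

theorem theorem4:
 fixes I :: "('n :: {finite, linorder}, 'k :: field) mpoly set"
  and B :: "('n \<Rightarrow>\<^sub>0 nat) set"
 assumes "symmetric_strongly_shifted I"
  and "I \<noteq> UNIV"
  and "is_partition_Borel_generators I B"
  and "card B = 1"
 shows "toric_ideal I = Idl\<^bsub>toric_poly_ring I\<^esub> (symmetric_exchange_relations I) \<and>
  (\<forall>f \<in> (symmetric_exchange_relations I :: ('n \<Rightarrow>\<^sub>0 nat, 'k) mpoly set). quadratic_form f) \<and>
  cohen_macaulay (toric_domain I) \<and>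
  normal_domain (toric_domain I) \<and>
  (CHAR('k) = 0 \<longrightarrow> rational_singularities (toric_domain I)) \<and>
  (CHAR('k) > 0 \<longrightarrow> F_rational (toric_domain I))"
proof -
 obtain lam where lam: "B = {lam}" using assms(4) by(rule card_1_singletonE)
 have I: "I = Sss {lam}" using assms(3) by(simp add: is_partition_Borel_generators_def lam)
 \<comment> \<open>The zero exponent would put 1 into the ideal; the grading by multiples of
   \<open>D\<close> needs a positive degree.\<close>
 have "lam ~= 0"
 proof
  assume "lam = 0"
  have "J = UNIV" if "symmetric_strongly_shifted J" "monom_of lam : J" for J :: "('n, 'k) mpoly set"
  proof -
   have "is_ideal UNIV J" using that(1) by(intro monomial_ideal_imp) (simp add: symmetric_strongly_shifted_def)
   thus ?thesis using that(2) ideal_one_iff[OF _ subring_UNIV, of J] by(simp add: \<open>lam = 0\<close> monom_of_def)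
  qed
  hence "I = UNIV" unfolding I Sss_def by auto
  thus False using assms(2) by blast
 qed
 then interpret borel_generator lam by unfold_locales
 have up: "I = up" unfolding I by(rule Sss_eq_up)
 show ?thesis unfolding up toric_domain_up
  using toric_ideal_up[where 'k = 'k] exchange_relations_quadratic[where 'k = 'k] cohen_macaulay_ring[where 'k = 'k]
   normal_ring[where 'k = 'k] rational_singularities_dom[where 'k = 'k] F_rational_ring[where 'k = 'k] unfolding dom_def by blast
qed

end
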